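(* Let $2\le r\le\infty$ and $s,t\ge0$. Each bidegree in the $E^2$ page of the spectral sequence for the cosimplicial chain complex $\mathcal E(D_{rst})$ is either $0$ or $\mathbb K=\mathbb Z/2$. The nontrivial terms are exactly those in the bidegrees \begin{gather*} \{-s\}\times [2t, \infty), \\ [-2s,-s-1] \times \{2t\}, \end{gather*} and, if $r<\infty$, also those in the bidegrees \begin{gather*} \{-s-r\} \times [2t+2r-2, \infty), \\ \{-2s-r\} \times \{2t+r-1\}, \\ [-2s-2r,-s-r-1] \times \{2t+2r-2\}. \end{gather*}
   Context: **Spectral sequence.** Chain complexes are over $\mathbb K$. For a cosimplicial chain complex $Y$ ($Y^p_q$ = homological degree $q$ of $Y^p$), its conormalization is $CY^p=\operatorname{coker}(\bigoplus_{k=1}^p d^k:\bigoplus_{k=1}^p Y^{p-1}\to Y^p)$, a bicomplex with $CY^p_q$ in bidegree $(-p,q)$, differentials $d_v:CY^p_q\to CY^p_{q-1}$ (from $Y^p$) and $d_h:CY^p_q\to CY^{p+1}_q$ (induced by $d^0$). $(\operatorname{Tot}CY)_m=\prod_p CY^p_{m+p}$, $\partial=d_v+d_h$, filtered by columns: $F^{-s}_m=\prod_{p\ge s}CY^p_{m+p}$. $E^r_{p,q}(Y)$ is the spectral sequence of this filtered complex, with $\mathrm d^r:E^r_{p,q}\to E^r_{p-r,q+r-1}$ ($p$ = filtration degree, $p+q$ = total degree). **Homotopy orbits.** $\pi=\Sigma_2=\{e,\sigma\}$; $W_i=\mathbb K\pi\cdot e_i$ for $i\ge0$, $W_i=0$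 for $i<0$, $d(e_i)=(1+\sigma)e_{i-1}$. $\mathcal E(Y)=W\otimes_\pi(Y\otimes Y)$, formed levelwise. **Bousfield–Kan examples.** $\Delta^p$ is the normalized simplicial $\mathbb K$-chains on the standard $p$-simplex (basis in degree $k$: ordered injections $[k]\hookrightarrow[p]$); $\operatorname{sk}_j$ is brutal truncation (keep degrees $\le j$; $\operatorname{sk}_\infty$ is the identity). $D^p_{rss}=\operatorname{coker}(\operatorname{sk}_{s-1}\Delta^p\hookrightarrow\operatorname{sk}_{s+r-1}\Delta^p)$, with cosimplicial structure induced from $\Delta^\bullet$; $D_{rst}=\Sigma^{t-s}D_{rss}$ where $(\Sigma C)_{q+1}=C_q$. Intervals denote integer intervals, possibly empty. *)

theory Defs
  imports
    "HOL-Algebra.Module"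
    "HOL-Algebra.AbelCoset"
    "HOL-Library.Poly_Mapping"
    "HOL-Library.Z2"
    "HOL-Library.Extended_Nat"
begin

section \<open>Vector spaces over Z/2\<close>

text \<open>
  Vector spaces are module records of HOL-Algebra over the field \<open>\<bbbK>\<close> with two elements. The ring
  fields \<^const>\<open>mult\<close> and \<^const>\<open>one\<close> of such a record carry no information.
\<close>

definition KK :: "bit ring" (\<open>\<bbbK>\<close>)
  where "\<bbbK> = \<lparr>carrier = UNIV, mult = (*), one = 1, zero = 0, add = (+)\<rparr>"

type_synonym 'a vs = "(bit, 'a) module"

definition KK_vs :: "bit vs"
  where "KK_vs = \<lparr>carrier = UNIV, mult = (*), one = 1, zero = 0, add = (+), smult = (*)\<rparr>"

definition free_vs :: "'b set \<Rightarrow> ('b \<Rightarrow>\<^sub>0 bit) vs"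
  where "free_vs S = \<lparr>carrier = {x. Poly_Mapping.keys x \<subseteq> S}, mult = undefined, one = undefined,
    zero = 0, add = (+), smult = (\<lambda>c. Poly_Mapping.map ((*) c))\<rparr>"

definition lin_ext :: "('b \<Rightarrow> ('c \<Rightarrow>\<^sub>0 bit)) \<Rightarrow> ('b \<Rightarrow>\<^sub>0 bit) \<Rightarrow> ('c \<Rightarrow>\<^sub>0 bit)"
  where "lin_ext g x =
    (\<Sum>b\<in>Poly_Mapping.keys x. Poly_Mapping.map ((*) (Poly_Mapping.lookup x b)) (g b))"

definition sub_vs :: "'a vs \<Rightarrow> 'a set \<Rightarrow> 'a vs"
  where "sub_vs M N = M\<lparr>carrier := N\<rparr>"

definition gen_subspace :: "'a vs \<Rightarrow> 'a set \<Rightarrow> 'a set"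
  where "gen_subspace M R = \<Inter>{N. submodule N \<bbbK> M \<and> R \<subseteq> N}"

definition quot_vs :: "'a vs \<Rightarrow> 'a set \<Rightarrow> 'a set vs"
  where "quot_vs M N = \<lparr>carrier = a_rcosets\<^bsub>M\<^esub> N, mult = undefined, one = undefined,
    zero = N, add = (\<lambda>X Y. X <+>\<^bsub>M\<^esub> Y),
    smult = (\<lambda>c X. \<Union>x\<in>X. N +>\<^bsub>M\<^esub> (c \<odot>\<^bsub>M\<^esub> x))\<rparr>"

text \<open>
  The map into \<open>quot_vs M N\<close> induced by a map \<open>f\<close> into \<open>M\<close>: if \<open>f\<close> is compatible with the two
  subspaces, all cosets in the union coincide.
\<close>

definition quot_map :: "'b vs \<Rightarrow> 'b set \<Rightarrow> ('a \<Rightarrow> 'b) \<Rightarrow> 'a set \<Rightarrow> 'b set"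
  where "quot_map M N f X = (\<Union>x\<in>X. N +>\<^bsub>M\<^esub> f x)"

definition vs_iso :: "'a vs \<Rightarrow> 'b vs \<Rightarrow> bool"  (infix \<open>\<cong>\<^sub>\<bbbK>\<close> 50)
  where "M \<cong>\<^sub>\<bbbK> N \<longleftrightarrow> (\<exists>h \<in> iso (add_monoid M) (add_monoid N).
    \<forall>c. \<forall>x\<in>carrier M. h (c \<odot>\<^bsub>M\<^esub> x) = c \<odot>\<^bsub>N\<^esub> h x)"

definition trivial_vs :: "'a vs \<Rightarrow> bool"
  where "trivial_vs M \<longleftrightarrow> carrier M = {\<zero>\<^bsub>M\<^esub>}"


section \<open>Chain complexes\<close>

text \<open>
  \<open>diff C q\<close> is the differential from degree \<open>q\<close> to degree \<open>q - 1\<close>. In characteristic 2 no signs occur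
  in suspensions, tensor products, symmetry isomorphisms or total complexes.
\<close>

record 'a chain_complex =
  obj :: "int \<Rightarrow> 'a vs"
  diff :: "int \<Rightarrow> 'a \<Rightarrow> 'a"

definition suspend :: "int \<Rightarrow> 'a chain_complex \<Rightarrow> 'a chain_complex"
  where "suspend n C = \<lparr>obj = (\<lambda>q. obj C (q - n)), diff = (\<lambda>q. diff C (q - n))\<rparr>"

text \<open>
  Brutal truncation, indexed by a strict bound so that no index \<open>-1\<close> is needed: for a complex
  vanishing in negative degrees, \<open>sk_below j C\<close> is \<open>sk\<^bsub>j-1\<^esub> C\<close>.
\<close>

definition in_sk_below :: "enat \<Rightarrow> int \<Rightarrow> bool"
  where "in_sk_below j q \<longleftrightarrow> q < 0 \<or> enat (nat q) < j"

definition sk_below :: "enat \<Rightarrow> 'a chain_complex \<Rightarrow> 'a chain_complex"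
  where "sk_below j C =
    \<lparr>obj = (\<lambda>q. if in_sk_below j q then obj C q else sub_vs (obj C q) {\<zero>\<^bsub>obj C q\<^esub>}),
     diff = (\<lambda>q. if in_sk_below j q then diff C q else (\<lambda>_. \<zero>\<^bsub>obj C (q - 1)\<^esub>))\<rparr>"

text \<open>\<open>f\<close> is a chain map from \<open>B\<close> to \<open>C\<close>.\<close>

definition coker_complex ::
    "'b chain_complex \<Rightarrow> 'c chain_complex \<Rightarrow> (int \<Rightarrow> 'b \<Rightarrow> 'c) \<Rightarrow> 'c set chain_complex"
  where "coker_complex B C f =
    \<lparr>obj = (\<lambda>q. quot_vs (obj C q) (f q ` carrier (obj B q))),
     diff = (\<lambda>q. quot_map (obj C (q - 1)) (f (q - 1) ` carrier (obj B (q - 1))) (diff C q))\<rparr>"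


subsection \<open>Tensor products\<close>

text \<open>
  The degree \<open>n\<close> part of \<open>A \<otimes> B\<close> is presented by generators \<open>(i, a, b)\<close>, standing for \<open>a \<otimes> b\<close>
  with \<open>a\<close> of degree \<open>i\<close> and \<open>b\<close> of degree \<open>n - i\<close>, so that the sum over \<open>i\<close> is built in. The set \<open>P\<close>
  consists of pairs \<open>(\<rho>, \<kappa>)\<close> of a right action on \<open>A\<close> and a left action on \<open>B\<close> of one and the same
  operator; they yield the relations \<open>a\<rho> \<otimes> b = a \<otimes> \<kappa>b\<close>. The tensor product over \<open>\<bbbK>\<close> is the case
  of empty \<open>P\<close>, and for the tensor product over a group algebra it suffices to let \<open>P\<close> range over
  generators of the group.
\<close>

type_synonym ('a, 'b) pretensor = "int \<times> 'a \<times> 'b \<Rightarrow>\<^sub>0 bit"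

abbreviation ptens :: "int \<Rightarrow> 'a \<Rightarrow> 'b \<Rightarrow> ('a, 'b) pretensor"
  where "ptens i a b \<equiv> Poly_Mapping.single (i, a, b) 1"

definition tensor_free :: "'a chain_complex \<Rightarrow> 'b chain_complex \<Rightarrow> int \<Rightarrow> ('a, 'b) pretensor vs"
  where "tensor_free A B n =
    free_vs {(i, a, b) | i a b. a \<in> carrier (obj A i) \<and> b \<in> carrier (obj B (n - i))}"

definition tensor_rels ::
    "((int \<Rightarrow> 'a \<Rightarrow> 'a) \<times> (int \<Rightarrow> 'b \<Rightarrow> 'b)) set \<Rightarrow> 'a chain_complex \<Rightarrow> 'b chain_complex \<Rightarrow> int
      \<Rightarrow> ('a, 'b) pretensor set"
  where "tensor_rels P A B n = gen_subspace (tensor_free A B n) (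
    {ptens i (a \<oplus>\<^bsub>obj A i\<^esub> a') b - (ptens i a b + ptens i a' b) | i a a' b.
       a \<in> carrier (obj A i) \<and> a' \<in> carrier (obj A i) \<and> b \<in> carrier (obj B (n - i))} \<union>
    {ptens i a (b \<oplus>\<^bsub>obj B (n - i)\<^esub> b') - (ptens i a b + ptens i a b') | i a b b'.
       a \<in> carrier (obj A i) \<and> b \<in> carrier (obj B (n - i)) \<and> b' \<in> carrier (obj B (n - i))} \<union>
    {ptens i (c \<odot>\<^bsub>obj A i\<^esub> a) b - Poly_Mapping.map ((*) c) (ptens i a b) | i a b c.
       a \<in> carrier (obj A i) \<and> b \<in> carrier (obj B (n - i))} \<union>
    {ptens i a (c \<odot>\<^bsub>obj B (n - i)\<^esub> b) - Poly_Mapping.map ((*) c) (ptens i a b) | i a b c.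
       a \<in> carrier (obj A i) \<and> b \<in> carrier (obj B (n - i))} \<union>
    {ptens i (\<rho> i a) b - ptens i a (\<kappa> (n - i) b) | i a b \<rho> \<kappa>.
       (\<rho>, \<kappa>) \<in> P \<and> a \<in> carrier (obj A i) \<and> b \<in> carrier (obj B (n - i))})"

definition tensor ::
    "((int \<Rightarrow> 'a \<Rightarrow> 'a) \<times> (int \<Rightarrow> 'b \<Rightarrow> 'b)) set \<Rightarrow> 'a chain_complex \<Rightarrow> 'b chain_complex
      \<Rightarrow> ('a, 'b) pretensor set chain_complex"
  where "tensor P A B =
    \<lparr>obj = (\<lambda>n. quot_vs (tensor_free A B n) (tensor_rels P A B n)),
     diff = (\<lambda>n. quot_map (tensor_free A B (n - 1)) (tensor_rels P A B (n - 1))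
       (lin_ext (\<lambda>(i, a, b). ptens (i - 1) (diff A i a) b + ptens i a (diff B (n - i) b))))\<rparr>"

text \<open>\<open>f \<otimes> g\<close> in degree \<open>n\<close>, as a map into \<open>tensor P A B\<close>.\<close>

definition tensor_map ::
    "((int \<Rightarrow> 'a \<Rightarrow> 'a) \<times> (int \<Rightarrow> 'b \<Rightarrow> 'b)) set \<Rightarrow> 'a chain_complex \<Rightarrow> 'b chain_complex
      \<Rightarrow> (int \<Rightarrow> 'c \<Rightarrow> 'a) \<Rightarrow> (int \<Rightarrow> 'd \<Rightarrow> 'b) \<Rightarrow> int
      \<Rightarrow> ('c, 'd) pretensor set \<Rightarrow> ('a, 'b) pretensor set"
  where "tensor_map P A B f g n = quot_map (tensor_free A B n) (tensor_rels P A B n)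
    (lin_ext (\<lambda>(i, a, b). ptens i (f i a) (g (n - i) b)))"

text \<open>The symmetry \<open>a \<otimes> b \<mapsto> b \<otimes> a\<close> of \<open>A \<otimes> A\<close> in degree \<open>n\<close>.\<close>

definition tensor_swap ::
    "'a chain_complex \<Rightarrow> int \<Rightarrow> ('a, 'a) pretensor set \<Rightarrow> ('a, 'a) pretensor set"
  where "tensor_swap A n = quot_map (tensor_free A A n) (tensor_rels {} A A n)
    (lin_ext (\<lambda>(i, a, b). ptens (n - i) b a))"


subsection \<open>Homotopy orbits\<close>

datatype sigma2 = Sig_e | Sig_sigma

fun times_sigma :: "sigma2 \<Rightarrow> sigma2"
  where "times_sigma Sig_e = Sig_sigma" | "times_sigma Sig_sigma = Sig_e"

text \<open>In degree \<open>i \<ge> 0\<close> the basis element \<open>g\<close> stands for \<open>g e\<^sub>i\<close>.\<close>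

definition W_complex :: "(sigma2 \<Rightarrow>\<^sub>0 bit) chain_complex"
  where "W_complex =
    \<lparr>obj = (\<lambda>i. free_vs (if 0 \<le> i then UNIV else {})),
     diff = (\<lambda>i x. if i \<le> 0 then 0
       else lin_ext (\<lambda>g. Poly_Mapping.single g 1 + Poly_Mapping.single (times_sigma g) 1) x)\<rparr>"

definition W_sigma :: "int \<Rightarrow> (sigma2 \<Rightarrow>\<^sub>0 bit) \<Rightarrow> (sigma2 \<Rightarrow>\<^sub>0 bit)"
  where "W_sigma i = lin_ext (\<lambda>g. Poly_Mapping.single (times_sigma g) 1)"

type_synonym 'a orbit = "(sigma2 \<Rightarrow>\<^sub>0 bit, ('a, 'a) pretensor set) pretensor set"

definition horbit :: "'a chain_complex \<Rightarrow> 'a orbit chain_complex"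
  where "horbit C = tensor {(W_sigma, tensor_swap C)} W_complex (tensor {} C C)"

text \<open>The map into \<open>horbit C\<close> induced by a chain map \<open>f\<close> into \<open>C\<close>.\<close>

definition horbit_map :: "'b chain_complex \<Rightarrow> (int \<Rightarrow> 'a \<Rightarrow> 'b) \<Rightarrow> int \<Rightarrow> 'a orbit \<Rightarrow> 'b orbit"
  where "horbit_map C f = tensor_map {(W_sigma, tensor_swap C)} W_complex (tensor {} C C)
    (\<lambda>i w. w) (tensor_map {} C C f f)"


section \<open>Cosimplicial chain complexes\<close>

text \<open>
  \<open>cmap Y m n \<alpha>\<close> is the chain map from \<open>Y\<^sup>m\<close> to \<open>Y\<^sup>n\<close> given by a monotone map
  \<open>\<alpha>\<close> from \<open>{0..m}\<close> to \<open>{0..n}\<close>; its next argument is the homological degree.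
\<close>

record 'a cosimp =
  level :: "nat \<Rightarrow> 'a chain_complex"
  cmap :: "nat \<Rightarrow> nat \<Rightarrow> (nat \<Rightarrow> nat) \<Rightarrow> int \<Rightarrow> 'a \<Rightarrow> 'a"

definition face :: "nat \<Rightarrow> nat \<Rightarrow> nat"
  where "face k i = (if i < k then i else Suc i)"

text \<open>The coface \<open>d\<^sup>k\<close> from \<open>Y\<^sup>p\<^sup>-\<^sup>1\<close> to \<open>Y\<^sup>p\<close>, for \<open>p \<ge> 1\<close>.\<close>

definition coface :: "'a cosimp \<Rightarrow> nat \<Rightarrow> nat \<Rightarrow> int \<Rightarrow> 'a \<Rightarrow> 'a"
  where "coface Y p k = cmap Y (p - 1) p (face k)"

definition cosimp_horbit :: "'a cosimp \<Rightarrow> 'a orbit cosimp"  (\<open>\<E>\<close>)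
  where "\<E> Y = \<lparr>level = (\<lambda>p. horbit (level Y p)),
    cmap = (\<lambda>m n \<alpha>. horbit_map (level Y n) (cmap Y m n \<alpha>))\<rparr>"

definition cosimp_suspend :: "int \<Rightarrow> 'a cosimp \<Rightarrow> 'a cosimp"
  where "cosimp_suspend j Y = \<lparr>level = (\<lambda>p. suspend j (level Y p)),
    cmap = (\<lambda>m n \<alpha> q. cmap Y m n \<alpha> (q - j))\<rparr>"


subsection \<open>The Bousfield-Kan examples\<close>

text \<open>An ordered injection from \<open>{0..k}\<close> to \<open>{0..p}\<close> is encoded by its image.\<close>

definition simplex_complex :: "nat \<Rightarrow> (nat set \<Rightarrow>\<^sub>0 bit) chain_complex"
  where "simplex_complex p =
    \<lparr>obj = (\<lambda>k. free_vs {A. A \<subseteq> {0..p} \<and> A \<noteq> {} \<and> int (card A) = k + 1}),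
     diff = (\<lambda>k x. if k \<le> 0 then 0
       else lin_ext (\<lambda>A. \<Sum>i\<in>A. Poly_Mapping.single (A - {i}) 1) x)\<rparr>"

definition simplex_map :: "(nat \<Rightarrow> nat) \<Rightarrow> (nat set \<Rightarrow>\<^sub>0 bit) \<Rightarrow> (nat set \<Rightarrow>\<^sub>0 bit)"
  where "simplex_map \<alpha> =
    lin_ext (\<lambda>A. if inj_on \<alpha> A then Poly_Mapping.single (\<alpha> ` A) 1 else 0)"

text \<open>\<open>D\<^bsub>rss\<^esub>\<close> and \<open>D\<^bsub>rst\<^esub>\<close>\<close>

definition BK_base :: "enat \<Rightarrow> nat \<Rightarrow> (nat set \<Rightarrow>\<^sub>0 bit) set cosimp"
  where "BK_base r s =
    \<lparr>level = (\<lambda>p. coker_complex (sk_below (enat s) (simplex_complex p))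
                    (sk_below (enat s + r) (simplex_complex p)) (\<lambda>q x. x)),
     cmap = (\<lambda>m n \<alpha> q. quot_map (obj (sk_below (enat s + r) (simplex_complex n)) q)
                    (carrier (obj (sk_below (enat s) (simplex_complex n)) q)) (simplex_map \<alpha>))\<rparr>"

definition BK :: "enat \<Rightarrow> nat \<Rightarrow> nat \<Rightarrow> (nat set \<Rightarrow>\<^sub>0 bit) set cosimp"
  where "BK r s t = cosimp_suspend (int t - int s) (BK_base r s)"


section \<open>The spectral sequence\<close>

subsection \<open>Conormalization and total complex\<close>

definition conorm_image :: "'a cosimp \<Rightarrow> nat \<Rightarrow> int \<Rightarrow> 'a set"
  where "conorm_image Y p q =
    {\<Oplus>\<^bsub>obj (level Y p) q\<^esub>k\<in>{1..p}. coface Y p k q (y k) | y.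
       y \<in> {1..p} \<rightarrow> carrier (obj (level Y (p - 1)) q)}"

definition conorm :: "'a cosimp \<Rightarrow> nat \<Rightarrow> int \<Rightarrow> 'a set vs"
  where "conorm Y p q = quot_vs (obj (level Y p) q) (conorm_image Y p q)"

definition d_vert :: "'a cosimp \<Rightarrow> nat \<Rightarrow> int \<Rightarrow> 'a set \<Rightarrow> 'a set"
  where "d_vert Y p q =
    quot_map (obj (level Y p) (q - 1)) (conorm_image Y p (q - 1)) (diff (level Y p) q)"

definition d_hor :: "'a cosimp \<Rightarrow> nat \<Rightarrow> int \<Rightarrow> 'a set \<Rightarrow> 'a set"
  where "d_hor Y p q =
    quot_map (obj (level Y (p + 1)) q) (conorm_image Y (p + 1) q) (coface Y (p + 1) 0 q)"

definition Tot :: "'a cosimp \<Rightarrow> (nat \<Rightarrow> 'a set) chain_complex"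
  where "Tot Y =
    \<lparr>obj = (\<lambda>m. \<lparr>carrier = {x. \<forall>p. x p \<in> carrier (conorm Y p (m + int p))},
       mult = undefined, one = undefined,
       zero = (\<lambda>p. \<zero>\<^bsub>conorm Y p (m + int p)\<^esub>),
       add = (\<lambda>x y p. x p \<oplus>\<^bsub>conorm Y p (m + int p)\<^esub> y p),
       smult = (\<lambda>c x p. c \<odot>\<^bsub>conorm Y p (m + int p)\<^esub> x p)\<rparr>),
     diff = (\<lambda>m x p. case p of
         0 \<Rightarrow> d_vert Y 0 m (x 0)
       | Suc p' \<Rightarrow> d_vert Y p (m + int p) (x p)
                     \<oplus>\<^bsub>conorm Y p (m - 1 + int p)\<^esub> d_hor Y p' (m + int p') (x p'))\<rparr>"

text \<open>The filtration by columns; \<open>col_filt Y f m\<close> is \<open>F\<^sup>f\<^sub>m\<close>, so that the columns \<open>p \<ge> -f\<close> survive.\<close>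

definition col_filt :: "'a cosimp \<Rightarrow> int \<Rightarrow> int \<Rightarrow> (nat \<Rightarrow> 'a set) set"
  where "col_filt Y f m =
    {x \<in> carrier (obj (Tot Y) m). \<forall>p. int p < - f \<longrightarrow> x p = \<zero>\<^bsub>conorm Y p (m + int p)\<^esub>}"


subsection \<open>Pages\<close>

text \<open>
  For a complex \<open>T\<close> with increasing filtration \<open>F\<close>, where \<open>F p n\<close> is the \<open>p\<close>-th stage in degree \<open>n\<close>,
  \<open>Z\<^sup>r\<^sub>p = {x \<in> F\<^sub>p. dx \<in> F\<^bsub>p-r\<^esub>}\<close> and
  \<open>E\<^sup>r\<^sub>p = Z\<^sup>r\<^sub>p / (Z\<^bsup>r-1\<^esup>\<^bsub>p-1\<^esub> + d Z\<^bsup>r-1\<^esup>\<^bsub>p+r-1\<^esub>)\<close>.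
\<close>

definition approx_cycles ::
    "'a chain_complex \<Rightarrow> (int \<Rightarrow> int \<Rightarrow> 'a set) \<Rightarrow> int \<Rightarrow> int \<Rightarrow> int \<Rightarrow> 'a set"
  where "approx_cycles T F r p n = {x \<in> F p n. diff T n x \<in> F (p - r) (n - 1)}"

definition filtered_page ::
    "'a chain_complex \<Rightarrow> (int \<Rightarrow> int \<Rightarrow> 'a set) \<Rightarrow> nat \<Rightarrow> int \<Rightarrow> int \<Rightarrow> 'a set vs"
  where "filtered_page T F r p q =
    quot_vs (sub_vs (obj T (p + q)) (approx_cycles T F (int r) p (p + q)))
      (approx_cycles T F (int r - 1) (p - 1) (p + q)
        <+>\<^bsub>obj T (p + q)\<^esub>
       diff T (p + q + 1) ` approx_cycles T F (int r - 1) (p + int r - 1) (p + q + 1))"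

definition page :: "'a cosimp \<Rightarrow> nat \<Rightarrow> int \<Rightarrow> int \<Rightarrow> (nat \<Rightarrow> 'a set) set vs"
  where "page Y r p q = filtered_page (Tot Y) (col_filt Y) r p q"

end

theory Submission
  imports Defs "HOL-Library.Function_Algebras"
begin

text \<open>
  The conormalization of \<open>\<E>(D)\<close> in column \<open>p\<close> has as basis the elements \<open>e\<^sub>i \<otimes> A \<otimes> B\<close>, where \<open>A\<close> and
  \<open>B\<close> are faces of the \<open>p\<close>-simplex of permitted dimension with \<open>{1..p} \<subseteq> A \<union> B\<close>. Coning with the
  vertex 0 commutes with all cofaces but the one that induces the horizontal differential, and
  contracts the vertical direction onto pairs \<open>(S, T)\<close> with \<open>S \<union> T = {1..p}\<close>, whose members have \<open>s\<close>
  or \<open>s + r\<close> elements. The first page is therefore the homology of \<open>\<Sigma>\<^sub>2\<close> with coefficients in the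
  span of these pairs: coinvariants for \<open>i = 0\<close>, invariants modulo norms for \<open>i > 0\<close>.

  The swap moves every pair except the diagonal ones, and a diagonal covering pair is
  \<open>({1..p}, {1..p})\<close>; so the terms with \<open>i > 0\<close> are concentrated in the columns \<open>s\<close> and \<open>s + r\<close>. For
  \<open>i = 0\<close>, the span of the pairs of sizes \<open>\<sigma>\<close> and \<open>\<tau>\<close> has cohomology only in column \<open>\<sigma> + \<tau>\<close>, where it
  is one-dimensional. This settles the mixed sizes, which the swap permutes freely. For \<open>\<sigma> = \<tau>\<close> the
  connecting map of \<open>w \<mapsto> w + swp w\<close> propagates the class of the diagonal pair from column \<open>\<sigma>\<close> to each
  of the columns up to \<open>2\<sigma>\<close>.
\<close>

section \<open>Linear algebra over the field with two elements\<close>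

text \<open>The subsets of {1..p} of one size \<sigma> span a cosimplicial space whose
  conormalization lives in the single column \<sigma>, so Eilenberg-Zilber predicts one class of
  pairs in column \<sigma> + \<tau>. Because the swap has to be followed through, that class is
  found by hand, from an explicit formula for the horizontal differential on words. Two obstacles
  shape the rest. The contraction of a tensor square is not symmetric and does not descend to
  homotopy orbits; it is applied to one W-degree at a time, from the top. And the pages are cosets
  of families of cosets of cosets of formal tensors: every such space gets linear coordinates in a
  plain type and every structure map a formula in them. Dimensions never exceed one because r is at
  least 2: the two degrees in which D has homology are then distinct, the three kinds of pairs lie
  in three different degrees, and at most one W-degree contributes to a bidegree.\<close>

class char2 = ab_group_add +
  assumes add_self [simp]: "x + x = 0"
begin

lemma uminus_char2 [simp]: "- x = x"
  using add_self minus_unique by blast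

lemma minus_char2 [simp]: "x - y = x + y"
  using add_uminus_conv_diff uminus_char2 by metis

lemma add_self_left [simp]: "x + (x + y) = y"
  by (simp add: add.assoc[symmetric])

lemma add_eq_0_iff_char2: "x + y = 0 \<longleftrightarrow> x = y"
  by (metis add_self add_self_left add_0_right)

end

instance bit :: char2
  by standard simp

instance poly_mapping :: (type, char2) char2
  by standard (rule poly_mapping_eqI, simp add: lookup_add)

instance "fun" :: (type, char2) char2
  by standard (simp add: fun_eq_iff)

abbreviation gen :: "'b \<Rightarrow> 'b \<Rightarrow>\<^sub>0 bit"
  where "gen b \<equiv> Poly_Mapping.single b 1"

definition vspan :: "'b set \<Rightarrow> ('b \<Rightarrow>\<^sub>0 bit) set"
  where "vspan S = {x. Poly_Mapping.keys x \<subseteq> S}"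

text \<open>A formal sum over the two-element field is the set of its keys, so linear extension is a
  plain sum and makes sense for many targets; \<open>lin_ext_eq\<close> identifies it with the
  \<open>lin_ext\<close> of the definitions.\<close>

definition ext :: "('b \<Rightarrow> 'c::comm_monoid_add) \<Rightarrow> ('b \<Rightarrow>\<^sub>0 bit) \<Rightarrow> 'c"
  where "ext f x = (\<Sum>b\<in>Poly_Mapping.keys x. f b)"

definition vlinear :: "('a::plus \<Rightarrow> 'b::plus) \<Rightarrow> bool"
  where "vlinear f \<longleftrightarrow> (\<forall>x y. f (x + y) = f x + f y)"

lemma vlinearD: "vlinear f \<Longrightarrow> f (x + y) = f x + f y"
  by (simp add: vlinear_def)

lemma vlinear_0: "vlinear f \<Longrightarrow> f (0::'a::char2) = (0::'b::char2)"
  by (metis add_self vlinear_def)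

lemma vlinear_sum: "vlinear f \<Longrightarrow> f (\<Sum>i\<in>I. g i) = (\<Sum>i\<in>I. (f (g i::'a::char2) :: 'b::char2))"
  by (induction I rule: infinite_finite_induct) (auto simp: vlinear_0 vlinearD)

lemma vlinear_comp: "vlinear f \<Longrightarrow> vlinear g \<Longrightarrow> vlinear (\<lambda>x. f (g x))"
  by (simp add: vlinear_def)

lemma vlinear_plus:
  "vlinear f \<Longrightarrow> vlinear g \<Longrightarrow> vlinear (\<lambda>x. f x + g x :: 'a::ab_semigroup_add)"
  by (simp add: vlinear_def add_ac)

lemma vlinear_id: "vlinear (\<lambda>x. x)"
  by (simp add: vlinear_def)

lemma vlinear_zero: "vlinear (\<lambda>x. 0::'a::monoid_add)"
  by (simp add: vlinear_def)

lemma bit_neq_0: "(c::bit) \<noteq> 0 \<longleftrightarrow> c = 1"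
  by (cases c) auto

lemma lookup_in_keys: "b \<in> Poly_Mapping.keys x \<Longrightarrow> Poly_Mapping.lookup x b = (1::bit)"
  by (simp add: in_keys_iff bit_neq_0)

lemma keys_add_bit:
  fixes x y :: "'b \<Rightarrow>\<^sub>0 bit"
  shows "Poly_Mapping.keys (x + y) =
    (Poly_Mapping.keys x - Poly_Mapping.keys y) \<union> (Poly_Mapping.keys y - Poly_Mapping.keys x)"
proof -
  have "c + d \<noteq> 0 \<longleftrightarrow> (c \<noteq> 0) \<noteq> (d \<noteq> 0)" for c d :: bit
    by (cases c; cases d) simp_all
  then show ?thesis
    unfolding set_eq_iff Un_iff Diff_iff in_keys_iff lookup_add by blast
qed

text \<open>The keys of a sum form the symmetric difference of the key sets; common keys are counted
  twice on the other side and cancel.\<close>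

lemma vlinear_ext: "vlinear (ext (f :: 'b \<Rightarrow> 'c::char2))"
  unfolding vlinear_def
proof (intro allI)
  fix x y :: "'b \<Rightarrow>\<^sub>0 bit"
  let ?X = "Poly_Mapping.keys x" and ?Y = "Poly_Mapping.keys y"
  have X: "sum f ?X = sum f (?X - ?Y) + sum f (?X \<inter> ?Y)"
    by (metis finite_keys sum.Int_Diff add.commute)
  have Y: "sum f ?Y = sum f (?Y - ?X) + sum f (?X \<inter> ?Y)"
    by (metis finite_keys sum.Int_Diff add.commute Int_commute)
  have "ext f (x + y) = sum f (?X - ?Y) + sum f (?Y - ?X)"
    unfolding ext_def keys_add_bit by (rule sum.union_disjoint) auto
  also have "\<dots> = sum f ?X + sum f ?Y"
    unfolding X Y by (simp add: add.assoc add.left_commute)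
  finally show "ext f (x + y) = ext f x + ext f y"
    by (simp add: ext_def)
qed

lemma ext_add [simp]: "ext (f :: 'b \<Rightarrow> 'c::char2) (x + y) = ext f x + ext f y"
  by (rule vlinearD[OF vlinear_ext])

lemma ext_0 [simp]: "ext f 0 = 0"
  by (simp add: ext_def)

lemma ext_gen [simp]: "ext f (gen b) = f b"
  by (simp add: ext_def)

lemma ext_sum: "ext (f :: 'b \<Rightarrow> 'c::char2) (\<Sum>i\<in>I. g i) = (\<Sum>i\<in>I. ext f (g i))"
  by (rule vlinear_sum[OF vlinear_ext])

lemma ext_cong: "(\<And>b. b \<in> Poly_Mapping.keys x \<Longrightarrow> f b = g b) \<Longrightarrow> ext f x = ext g x"
  by (simp add: ext_def)

lemma vlinear_ext_comp: "vlinear (g::'c::char2\<Rightarrow>'d::char2) \<Longrightarrow> g (ext f x) = ext (\<lambda>b. g (f b)) x"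
  by (simp add: ext_def vlinear_sum)

lemma ext_gen_id: "ext gen x = x"
proof (rule poly_mapping_eqI)
  fix k
  show "Poly_Mapping.lookup (ext gen x) k = Poly_Mapping.lookup x k"
    by (auto simp: ext_def lookup_sum lookup_single when_def in_keys_iff)
qed

lemma vlinear_conv_ext: "vlinear f \<Longrightarrow> f x = (ext (\<lambda>b. f (gen b)) x :: 'c::char2)"
  by (metis vlinear_ext_comp ext_gen_id)

lemma vlinear_eqI:
  assumes "vlinear f" "vlinear (g :: _ \<Rightarrow> 'c::char2)" "x \<in> vspan S" "\<And>b. b \<in> S \<Longrightarrow> f (gen b) = g (gen b)"
  shows "f x = g x"
proof -
  have "ext (\<lambda>b. f (gen b)) x = ext (\<lambda>b. g (gen b)) x"
    using assms by (intro ext_cong) (auto simp: vspan_def)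
  then show ?thesis
    using vlinear_conv_ext[OF assms(1)] vlinear_conv_ext[OF assms(2)] by metis
qed

lemma vspan_UNIV [simp]: "x \<in> vspan UNIV"
  by (simp add: vspan_def)

lemma vspan_0 [simp]: "0 \<in> vspan S"
  by (simp add: vspan_def)

lemma vspan_add: "x \<in> vspan S \<Longrightarrow> y \<in> vspan S \<Longrightarrow> x + y \<in> vspan S"
  by (auto simp: vspan_def keys_add_bit)

lemma vspan_gen [simp]: "gen b \<in> vspan S \<longleftrightarrow> b \<in> S"
  by (simp add: vspan_def)

lemma vspan_sum: "(\<And>i. i \<in> I \<Longrightarrow> g i \<in> vspan S) \<Longrightarrow> (\<Sum>i\<in>I. g i) \<in> vspan S"
  by (induction I rule: infinite_finite_induct) (auto simp: vspan_add)

lemma vspan_mono: "x \<in> vspan S \<Longrightarrow> S \<subseteq> T \<Longrightarrow> x \<in> vspan T"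
  by (auto simp: vspan_def)

lemma vspan_empty [simp]: "x \<in> vspan {} \<longleftrightarrow> x = 0"
  by (simp add: vspan_def)

lemma vspan_ext: "x \<in> vspan S \<Longrightarrow> (\<And>b. b \<in> S \<Longrightarrow> f b \<in> vspan T) \<Longrightarrow> ext f x \<in> vspan T"
  unfolding ext_def by (rule vspan_sum) (auto simp: vspan_def)

lemma vlinear_vspan:
  assumes "vlinear f" "x \<in> vspan S" "\<And>b. b \<in> S \<Longrightarrow> f (gen b) \<in> vspan T"
  shows "f x \<in> vspan T"
  by (subst vlinear_conv_ext[OF assms(1)]) (rule vspan_ext[OF assms(2,3)])

lemma vspan_singleton:
  assumes "x \<in> vspan {b}"
  shows "x = 0 \<or> x = gen b"
proof -
  have "x = ext gen x"
    by (simp add: ext_gen_id)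
  moreover have "Poly_Mapping.keys x = {} \<or> Poly_Mapping.keys x = {b}"
    using assms subset_singletonD[of "Poly_Mapping.keys x" b] by (simp add: vspan_def)
  ultimately show ?thesis
    by (auto simp: ext_def)
qed

definition restrict_to :: "('b \<Rightarrow> bool) \<Rightarrow> ('b \<Rightarrow>\<^sub>0 bit) \<Rightarrow> ('b \<Rightarrow>\<^sub>0 bit)"
  where "restrict_to Q = ext (\<lambda>b. if Q b then gen b else 0)"

lemma vlinear_restrict_to: "vlinear (restrict_to Q)"
  unfolding restrict_to_def by (rule vlinear_ext)

lemma restrict_to_gen [simp]: "restrict_to Q (gen b) = (if Q b then gen b else 0)"
  by (simp add: restrict_to_def)

lemma restrict_to_0 [simp]: "restrict_to Q 0 = 0"
  by (simp add: restrict_to_def)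

lemma restrict_to_add [simp]: "restrict_to Q (x + y) = restrict_to Q x + restrict_to Q y"
  by (simp add: restrict_to_def)

lemma restrict_to_vspan: "x \<in> vspan S \<Longrightarrow> restrict_to Q x \<in> vspan {b \<in> S. Q b}"
  unfolding restrict_to_def by (rule vspan_ext) auto

lemma restrict_to_id: "x \<in> vspan S \<Longrightarrow> (\<And>b. b \<in> S \<Longrightarrow> Q b) \<Longrightarrow> restrict_to Q x = x"
  by (rule vlinear_eqI[OF vlinear_restrict_to vlinear_id, of _ S]) auto

lemma restrict_to_eq_0: "x \<in> vspan S \<Longrightarrow> (\<And>b. b \<in> S \<Longrightarrow> \<not> Q b) \<Longrightarrow> restrict_to Q x = 0"
  by (rule vlinear_eqI[OF vlinear_restrict_to vlinear_zero, of _ S]) auto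

lemma restrict_to_split: "restrict_to Q x + restrict_to (\<lambda>b. \<not> Q b) x = x"
  by (rule vlinear_eqI[OF vlinear_plus[OF vlinear_restrict_to vlinear_restrict_to] vlinear_id vspan_UNIV]) auto

lemma restrict_to_eq_0_iff: "restrict_to Q x = 0 \<longleftrightarrow> x \<in> vspan {b. \<not> Q b}"
proof
  assume "restrict_to Q x = 0"
  then show "x \<in> vspan {b. \<not> Q b}"
    using restrict_to_vspan[of x UNIV "\<lambda>b. \<not> Q b"] restrict_to_split[of Q x] by simp
qed (auto intro: restrict_to_eq_0)

subsection \<open>Chains on a product\<close>

definition cross :: "('a \<Rightarrow>\<^sub>0 bit) \<Rightarrow> ('b \<Rightarrow>\<^sub>0 bit) \<Rightarrow> ('a \<times> 'b \<Rightarrow>\<^sub>0 bit)"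
  where "cross x y = ext (\<lambda>a. ext (\<lambda>b. gen (a, b)) y) x"

definition lft :: "(('a \<Rightarrow>\<^sub>0 bit) \<Rightarrow> ('c \<Rightarrow>\<^sub>0 bit)) \<Rightarrow> ('a \<times> 'b \<Rightarrow>\<^sub>0 bit) \<Rightarrow> ('c \<times> 'b \<Rightarrow>\<^sub>0 bit)"
  where "lft u = ext (\<lambda>(a, b). cross (u (gen a)) (gen b))"

definition rgt :: "(('b \<Rightarrow>\<^sub>0 bit) \<Rightarrow> ('c \<Rightarrow>\<^sub>0 bit)) \<Rightarrow> ('a \<times> 'b \<Rightarrow>\<^sub>0 bit) \<Rightarrow> ('a \<times> 'c \<Rightarrow>\<^sub>0 bit)"
  where "rgt u = ext (\<lambda>(a, b). cross (gen a) (u (gen b)))"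

definition swp :: "('a \<times> 'b \<Rightarrow>\<^sub>0 bit) \<Rightarrow> ('b \<times> 'a \<Rightarrow>\<^sub>0 bit)"
  where "swp = ext (\<lambda>(a, b). gen (b, a))"

lemma cross_add_left [simp]: "cross (x + x') y = cross x y + cross x' y"
  by (simp add: cross_def)

lemma cross_add_right [simp]: "cross x (y + y') = cross x y + cross x y'"
  by (simp add: cross_def ext_def sum.distrib)
     (metis (mono_tags, lifting) ext_add ext_def sum.cong sum.distrib)

lemma cross_0 [simp]: "cross 0 y = 0" "cross x 0 = 0"
  by (simp_all add: cross_def ext_def)

lemma cross_gen [simp]: "cross (gen a) (gen b) = gen (a, b)"
  by (simp add: cross_def)

lemma vlinear_cross: "vlinear (\<lambda>x. cross x y)" "vlinear (cross x)"
  by (simp_all add: vlinear_def)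

lemma cross_vspan: "x \<in> vspan S \<Longrightarrow> y \<in> vspan T \<Longrightarrow> cross x y \<in> vspan (S \<times> T)"
  unfolding cross_def by (intro vspan_ext) auto

lemma vlinear_lft: "vlinear (lft u)"
  unfolding lft_def by (rule vlinear_ext)

lemma vlinear_rgt: "vlinear (rgt u)"
  unfolding rgt_def by (rule vlinear_ext)

lemma vlinear_swp: "vlinear swp"
  unfolding swp_def by (rule vlinear_ext)

lemma lft_simps [simp]: "lft u 0 = 0" "lft u (x + y) = lft u x + lft u y"
  by (simp_all add: lft_def)

lemma rgt_simps [simp]: "rgt u 0 = 0" "rgt u (x + y) = rgt u x + rgt u y"
  by (simp_all add: rgt_def)

lemma swp_simps [simp]: "swp 0 = 0" "swp (x + y) = swp x + swp y" "swp (gen (a, b)) = gen (b, a)"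
  by (simp_all add: swp_def)

lemma lft_gen: "lft u (gen (a, b)) = cross (u (gen a)) (gen b)"
  by (simp add: lft_def)

lemma rgt_gen: "rgt u (gen (a, b)) = cross (gen a) (u (gen b))"
  by (simp add: rgt_def)

lemma cross_eqI:
  assumes "vlinear f" "vlinear g" "\<And>a b. f (gen (a, b)) = (g (gen (a, b)) :: 'c::char2)"
  shows "f x = g x"
  by (rule vlinear_eqI[OF assms(1,2) vspan_UNIV]) (use assms(3) in auto)

lemma bilinear_eqI:
  assumes "\<And>x. vlinear (f x)" "\<And>x. vlinear (g x)" "\<And>y. vlinear (\<lambda>x. f x y)" "\<And>y. vlinear (\<lambda>x. g x y)"
    "\<And>a b. f (gen a) (gen b) = (g (gen a) (gen b) :: 'c::char2)"
  shows "f x y = g x y"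
proof -
  have "f (gen a) y = g (gen a) y" for a
    by (rule vlinear_eqI[where f = "f (gen a)" and g = "g (gen a)", OF assms(1,2) vspan_UNIV]) (rule assms(5))
  then show ?thesis
    by (rule vlinear_eqI[where f = "\<lambda>x. f x y" and g = "\<lambda>x. g x y", OF assms(3,4) vspan_UNIV])
qed

lemma lft_cross: "vlinear u \<Longrightarrow> lft u (cross x y) = cross (u x) y"
  by (rule bilinear_eqI[where f = "\<lambda>x y. lft u (cross x y)" and g = "\<lambda>x y. cross (u x) y"]) (auto simp: vlinear_def lft_gen)

lemma rgt_cross: "vlinear u \<Longrightarrow> rgt u (cross x y) = cross x (u y)"
  by (rule bilinear_eqI[where f = "\<lambda>x y. rgt u (cross x y)" and g = "\<lambda>x y. cross x (u y)"]) (auto simp: vlinear_def rgt_gen)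

lemma swp_cross: "swp (cross x y) = cross y x"
  by (rule bilinear_eqI[where f = "\<lambda>x y. swp (cross x y)" and g = "\<lambda>x y. cross y x"]) (auto simp: vlinear_def)

lemma lft_lft: "vlinear u \<Longrightarrow> lft u (lft v x) = lft (\<lambda>y. u (v y)) x"
  by (rule cross_eqI) (auto simp: vlinear_def lft_cross lft_gen)

lemma rgt_rgt: "vlinear u \<Longrightarrow> rgt u (rgt v x) = rgt (\<lambda>y. u (v y)) x"
  by (rule cross_eqI) (auto simp: vlinear_def rgt_cross rgt_gen)

lemma rgt_lft: "vlinear u \<Longrightarrow> vlinear v \<Longrightarrow> rgt v (lft u x) = lft u (rgt v x)"
  by (rule cross_eqI) (auto simp: vlinear_def rgt_cross lft_cross lft_gen rgt_gen)

lemma swp_lft: "swp (lft u x) = rgt u (swp x)"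
  by (rule cross_eqI) (auto simp: vlinear_def lft_gen rgt_gen swp_cross)

lemma swp_rgt: "swp (rgt u x) = lft u (swp x)"
  by (rule cross_eqI) (auto simp: vlinear_def lft_gen rgt_gen swp_cross)

lemma swp_swp [simp]: "swp (swp x) = x"
  by (rule cross_eqI) (auto simp: vlinear_def)

lemma lft_plus: "lft (\<lambda>y. u y + v y) x = lft u x + lft v x"
  by (rule cross_eqI) (auto simp: vlinear_def lft_gen add_ac)

lemma rgt_plus: "rgt (\<lambda>y. u y + v y) x = rgt u x + rgt v x"
  by (rule cross_eqI) (auto simp: vlinear_def rgt_gen add_ac)

lemma lft_cong: "x \<in> vspan (S \<times> T) \<Longrightarrow> (\<And>a. a \<in> S \<Longrightarrow> u (gen a) = v (gen a)) \<Longrightarrow> lft u x = lft v x"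
  by (rule vlinear_eqI[OF vlinear_lft vlinear_lft]) (auto simp: lft_gen)

lemma rgt_cong: "x \<in> vspan (S \<times> T) \<Longrightarrow> (\<And>a. a \<in> T \<Longrightarrow> u (gen a) = v (gen a)) \<Longrightarrow> rgt u x = rgt v x"
  by (rule vlinear_eqI[OF vlinear_rgt vlinear_rgt]) (auto simp: rgt_gen)

lemma lft_id: "lft (\<lambda>x. x) x = x"
  by (rule cross_eqI) (auto simp: vlinear_def lft_gen)

lemma rgt_id: "rgt (\<lambda>x. x) x = x"
  by (rule cross_eqI) (auto simp: vlinear_def rgt_gen)

lemma lft_zero: "lft (\<lambda>x. 0) x = 0"
  by (rule cross_eqI) (auto simp: vlinear_def lft_gen)

lemma rgt_zero: "rgt (\<lambda>x. 0) x = 0"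
  by (rule cross_eqI) (auto simp: vlinear_def rgt_gen)

lemma lft_vspan: "x \<in> vspan (S \<times> T) \<Longrightarrow> (\<And>a. a \<in> S \<Longrightarrow> u (gen a) \<in> vspan S') \<Longrightarrow> lft u x \<in> vspan (S' \<times> T)"
  by (rule vlinear_vspan[OF vlinear_lft]) (auto simp: lft_gen intro!: cross_vspan)

lemma rgt_vspan: "x \<in> vspan (S \<times> T) \<Longrightarrow> (\<And>a. a \<in> T \<Longrightarrow> u (gen a) \<in> vspan T') \<Longrightarrow> rgt u x \<in> vspan (S \<times> T')"
  by (rule vlinear_vspan[OF vlinear_rgt]) (auto simp: rgt_gen intro!: cross_vspan)

lemma swp_vspan: "x \<in> vspan S \<Longrightarrow> (\<And>a b. (a, b) \<in> S \<Longrightarrow> (b, a) \<in> T) \<Longrightarrow> swp x \<in> vspan T"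
  unfolding swp_def by (rule vspan_ext) auto

section \<open>Covering pairs of subsets\<close>

text \<open>The cofaces d^1, ..., d^p omit the vertices 1, ..., p respectively, so conormalization
  kills the pairs in which one of these is missing. The vertex 0 is exempt because the image of d^0
  is not divided out.\<close>

definition covering :: "nat \<Rightarrow> nat set \<times> nat set \<Rightarrow> bool"
  where "covering p = (\<lambda>(S, T). {1..p} \<subseteq> S \<union> T)"

abbreviation cov :: "nat \<Rightarrow> (nat set \<times> nat set \<Rightarrow>\<^sub>0 bit) \<Rightarrow> (nat set \<times> nat set \<Rightarrow>\<^sub>0 bit)"
  where "cov p \<equiv> restrict_to (covering p)"

lemma covering_swap: "covering p (T, S) \<longleftrightarrow> covering p (S, T)"
  by (auto simp: covering_def)

lemma swp_cov: "swp (cov p x) = cov p (swp x)"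
  by (rule cross_eqI) (auto simp: vlinear_def covering_swap)

text \<open>An operator that adds no element but 0 cannot repair a gap in {1..p}. It maps
  non-covering pairs to non-covering ones and so descends to the quotient that \<open>cov\<close>
  models.\<close>

lemma cov_lft:
  assumes "\<And>S S'. S' \<in> Poly_Mapping.keys (u (gen S)) \<Longrightarrow> S' \<subseteq> insert 0 S"
  shows "cov p (lft u (cov p x)) = cov p (lft u x)"
proof (rule cross_eqI[where f = "\<lambda>x. cov p (lft u (cov p x))" and g = "\<lambda>x. cov p (lft u x)"])
  show "vlinear (\<lambda>x. cov p (lft u (cov p x)))" "vlinear (\<lambda>x. cov p (lft u x))"
    by (auto simp: vlinear_def)
  fix S T
  show "cov p (lft u (cov p (gen (S, T)))) = cov p (lft u (gen (S, T)))"
  proof (cases "covering p (S, T)")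
    case False
    have "u (gen S) \<in> vspan {S'. S' \<subseteq> insert 0 S}"
      using assms by (auto simp: vspan_def)
    then have "lft u (gen (S, T)) \<in> vspan ({S'. S' \<subseteq> insert 0 S} \<times> {T})"
      unfolding lft_gen by (rule cross_vspan) simp
    moreover have "\<not> covering p b" if "b \<in> {S'. S' \<subseteq> insert 0 S} \<times> {T}" for b
    proof
      assume "covering p b"
      then have "covering p (insert 0 S, T)"
        using that by (auto simp: covering_def)
      with False show False
        by (auto simp: covering_def)
    qed
    ultimately show ?thesis
      using False by (simp add: restrict_to_eq_0)
  qed simp
qed

lemma cov_rgt:
  assumes "\<And>S S'. S' \<in> Poly_Mapping.keys (u (gen S)) \<Longrightarrow> S' \<subseteq> insert 0 S"
  shows "cov p (rgt u (cov p x)) = cov p (rgt u x)"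
proof -
  have "swp (cov p (rgt u (cov p x))) = swp (cov p (rgt u x))"
    by (simp add: swp_cov swp_rgt cov_lft[OF assms])
  then show ?thesis
    by (metis swp_swp)
qed

section \<open>Deleting, shifting and prepending elements of subsets\<close>

definition del :: "(nat set \<Rightarrow>\<^sub>0 bit) \<Rightarrow> (nat set \<Rightarrow>\<^sub>0 bit)"
  where "del = ext (\<lambda>S. \<Sum>x\<in>S. gen (S - {x}))"

definition sh :: "(nat set \<Rightarrow>\<^sub>0 bit) \<Rightarrow> (nat set \<Rightarrow>\<^sub>0 bit)"
  where "sh = ext (\<lambda>S. gen (Suc ` S))"

text \<open>The shift of the cone over S with vertex 0 (see \<open>sh_c0\<close>): the coface d^0
  turns the cone vertex into 1.\<close>

definition ins :: "(nat set \<Rightarrow>\<^sub>0 bit) \<Rightarrow> (nat set \<Rightarrow>\<^sub>0 bit)"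
  where "ins = ext (\<lambda>S. gen (insert 1 (Suc ` S)))"

lemma vlinear_del: "vlinear del" and vlinear_sh: "vlinear sh" and vlinear_ins: "vlinear ins"
  unfolding del_def sh_def ins_def by (rule vlinear_ext)+

lemma del_gen: "del (gen S) = (\<Sum>x\<in>S. gen (S - {x}))"
  and sh_gen: "sh (gen S) = gen (Suc ` S)"
  and ins_gen: "ins (gen S) = gen (insert 1 (Suc ` S))"
  by (simp_all add: del_def sh_def ins_def)

lemma del_simps [simp]: "del 0 = 0" "del (x + y) = del x + del y"
  and sh_simps [simp]: "sh 0 = 0" "sh (x + y) = sh x + sh y"
  and ins_simps [simp]: "ins 0 = 0" "ins (x + y) = ins x + ins y"
  by (simp_all add: del_def sh_def ins_def)

lemma keys_sum_gen: "b \<in> Poly_Mapping.keys (\<Sum>x\<in>I. gen (f x)) \<Longrightarrow> b \<in> f ` I"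
  using vspan_sum[of I "\<lambda>x. gen (f x)" "f ` I"] by (auto simp: vspan_def)

lemma keys_del: "S' \<in> Poly_Mapping.keys (del (gen S)) \<Longrightarrow> \<exists>x\<in>S. S' = S - {x}"
  unfolding del_gen by (drule keys_sum_gen) auto

lemma keys_del': "S' \<in> Poly_Mapping.keys (del (gen S)) \<Longrightarrow> S' \<subseteq> insert 0 S"
  by (drule keys_del) auto

text \<open>Every unordered pair occurs twice: a new element a contributes \<open>f a x\<close> and
  \<open>f x a\<close>, which cancel.\<close>

lemma sum_pairs_0:
  fixes f :: "'a \<Rightarrow> 'a \<Rightarrow> 'c::char2"
  assumes "finite S" "\<And>x y. f x y = f y x"
  shows "(\<Sum>x\<in>S. \<Sum>y\<in>S - {x}. f x y) = 0"
  using assms(1)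
proof induction
  case (insert a S)
  have "(\<Sum>x\<in>insert a S. \<Sum>y\<in>insert a S - {x}. f x y) =
    (\<Sum>y\<in>S. f a y) + (\<Sum>x\<in>S. \<Sum>y\<in>insert a (S - {x}). f x y)"
    using insert.hyps by (auto simp: insert_Diff_if intro!: arg_cong2[where f="(+)"] sum.cong)
  also have "(\<Sum>x\<in>S. \<Sum>y\<in>insert a (S - {x}). f x y) = (\<Sum>x\<in>S. f x a) + (\<Sum>x\<in>S. \<Sum>y\<in>S - {x}. f x y)"
    using insert.hyps by (simp add: sum.distrib)
  finally show ?case
    using insert.IH assms(2)[of _ a] by simp
qed simp

lemma del_del: "finite S \<Longrightarrow> del (del (gen S)) = 0"
proof -
  assume "finite S"
  have "del (del (gen S)) = (\<Sum>x\<in>S. \<Sum>y\<in>S - {x}. gen (S - {x} - {y}))"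
    by (simp add: del_gen vlinear_sum[OF vlinear_del])
  also have "\<dots> = 0"
    by (rule sum_pairs_0[OF \<open>finite S\<close>]) (metis Diff_insert Diff_insert2)
  finally show ?thesis .
qed

lemma del_sh: "del (sh x) = sh (del x)"
proof (rule vlinear_eqI[where f = "\<lambda>x. del (sh x)" and g = "\<lambda>x. sh (del x)", OF _ _ vspan_UNIV])
  show "vlinear (\<lambda>x. del (sh x))" "vlinear (\<lambda>x. sh (del x))"
    by (auto simp: vlinear_def)
  fix S :: "nat set"
  have "(\<Sum>x\<in>Suc ` S. gen (Suc ` S - {x})) = (\<Sum>x\<in>S. gen (Suc ` (S - {x})))"
    by (subst sum.reindex) (auto simp: image_set_diff intro!: sum.cong)
  then show "del (sh (gen S)) = sh (del (gen S))"
    by (simp add: sh_gen del_gen vlinear_sum[OF vlinear_sh])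
qed

text \<open>Deleting the new element 1 leaves the shift of S, deleting any other element commutes
  with prepending. Since 0 is not in S, the element 1 is indeed new.\<close>

lemma del_ins:
  assumes "finite S" "0 \<notin> S"
  shows "del (ins (gen S)) = sh (gen S) + ins (del (gen S))"
proof -
  have 1: "1 \<notin> Suc ` S"
    using assms(2) by auto
  have "del (ins (gen S)) = (\<Sum>x\<in>insert 1 (Suc ` S). gen (insert 1 (Suc ` S) - {x}))"
    by (simp add: ins_gen del_gen)
  also have "\<dots> = gen (Suc ` S) + (\<Sum>x\<in>Suc ` S. gen (insert 1 (Suc ` S) - {x}))"
    using 1 assms(1) by (subst sum.insert) (auto simp del: One_nat_def)
  also have "(\<Sum>x\<in>Suc ` S. gen (insert 1 (Suc ` S) - {x})) = (\<Sum>x\<in>S. gen (insert 1 (Suc ` (S - {x}))))"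
  proof (subst sum.reindex)
    show "sum ((\<lambda>x. gen (insert 1 (Suc ` S) - {x})) \<circ> Suc) S = (\<Sum>x\<in>S. gen (insert 1 (Suc ` (S - {x}))))"
    proof (rule sum.cong)
      fix x assume "x \<in> S"
      then have "insert 1 (Suc ` S) - {Suc x} = insert 1 (Suc ` (S - {x}))"
        using assms(2) by auto
      then show "((\<lambda>x. gen (insert 1 (Suc ` S) - {x})) \<circ> Suc) x = gen (insert 1 (Suc ` (S - {x})))"
        by simp
    qed simp
  qed simp
  finally show ?thesis
    by (simp add: sh_gen ins_gen del_gen vlinear_sum[OF vlinear_ins])
qed

text \<open>
  A covering pair \<open>(S, T)\<close> is a word of length \<open>p\<close> in letters X, Y, Z, which say that a position
  lies only in \<open>S\<close>, only in \<open>T\<close>, or in both. The maps \<open>consX\<close>, \<open>consY\<close>, \<open>consZ\<close> prepend a letter, and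
  \<open>pdy\<close>, \<open>pdx\<close> sum over the ways to replace a Z by a Y or an X, respectively.
\<close>

definition G2 :: "nat \<Rightarrow> nat \<Rightarrow> nat \<Rightarrow> (nat set \<times> nat set \<Rightarrow>\<^sub>0 bit) set"
  where "G2 p \<sigma> \<tau> = vspan {(S, T). S \<union> T = {1..p} \<and> card S = \<sigma> \<and> card T = \<tau>}"

definition pdy :: "nat \<Rightarrow> (nat set \<times> nat set \<Rightarrow>\<^sub>0 bit) \<Rightarrow> (nat set \<times> nat set \<Rightarrow>\<^sub>0 bit)"
  where "pdy p x = cov p (lft del x)"

definition pdx :: "nat \<Rightarrow> (nat set \<times> nat set \<Rightarrow>\<^sub>0 bit) \<Rightarrow> (nat set \<times> nat set \<Rightarrow>\<^sub>0 bit)"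
  where "pdx p x = cov p (rgt del x)"

definition consX :: "(nat set \<times> nat set \<Rightarrow>\<^sub>0 bit) \<Rightarrow> (nat set \<times> nat set \<Rightarrow>\<^sub>0 bit)"
  where "consX x = lft ins (rgt sh x)"

definition consY :: "(nat set \<times> nat set \<Rightarrow>\<^sub>0 bit) \<Rightarrow> (nat set \<times> nat set \<Rightarrow>\<^sub>0 bit)"
  where "consY x = lft sh (rgt ins x)"

definition consZ :: "(nat set \<times> nat set \<Rightarrow>\<^sub>0 bit) \<Rightarrow> (nat set \<times> nat set \<Rightarrow>\<^sub>0 bit)"
  where "consZ x = lft ins (rgt ins x)"

lemma op_simps [simp]:
  "pdy p 0 = 0" "pdy p (x + y) = pdy p x + pdy p y"
  "pdx p 0 = 0" "pdx p (x + y) = pdx p x + pdx p y"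
  "consX 0 = 0" "consX (x + y) = consX x + consX y" "consY 0 = 0" "consY (x + y) = consY x + consY y" "consZ 0 = 0" "consZ (x + y) = consZ x + consZ y"
  by (simp_all add: pdy_def pdx_def consX_def consY_def consZ_def)

lemma XYZ_gen:
  "consX (gen (S, T)) = gen (insert 1 (Suc ` S), Suc ` T)"
  "consY (gen (S, T)) = gen (Suc ` S, insert 1 (Suc ` T))"
  "consZ (gen (S, T)) = gen (insert 1 (Suc ` S), insert 1 (Suc ` T))"
  by (simp_all add: consX_def consY_def consZ_def lft_gen rgt_gen sh_gen ins_gen)

lemma union_interval:
  assumes "S \<union> T = {1..p::nat}"
  shows "finite S" "finite T" "0 \<notin> S" "0 \<notin> T"
proof -
  have "finite (S \<union> T)" "0 \<notin> S \<union> T"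
    unfolding assms by auto
  then show "finite S" "finite T" "0 \<notin> S" "0 \<notin> T"
    by simp_all
qed

lemma G2_subset: "G2 p \<sigma> \<tau> \<subseteq> vspan ({S. finite S \<and> 0 \<notin> S} \<times> {S. finite S \<and> 0 \<notin> S})"
  unfolding G2_def by (rule subsetI, erule vspan_mono) (auto dest: union_interval simp del: One_nat_def)

lemma swp_G2: "x \<in> G2 p \<sigma> \<tau> \<Longrightarrow> swp x \<in> G2 p \<tau> \<sigma>"
  unfolding G2_def by (erule swp_vspan) auto

lemma G2_add: "x \<in> G2 p \<sigma> \<tau> \<Longrightarrow> y \<in> G2 p \<sigma> \<tau> \<Longrightarrow> x + y \<in> G2 p \<sigma> \<tau>"
  unfolding G2_def by (rule vspan_add)

lemma G2_0 [simp]: "0 \<in> G2 p \<sigma> \<tau>"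
  by (simp add: G2_def)

lemma swp_pdy: "swp (pdy p x) = pdx p (swp x)"
  by (simp add: pdy_def pdx_def swp_cov swp_lft)

lemma swp_pdx: "swp (pdx p x) = pdy p (swp x)"
  by (simp add: pdy_def pdx_def swp_cov swp_rgt)

lemma pdx_pdy: "pdx p (pdy p x) = pdy p (pdx p x)"
  by (simp add: pdy_def pdx_def cov_lft[OF keys_del'] cov_rgt[OF keys_del'] rgt_lft[OF vlinear_del vlinear_del])

lemma pdy_pdy: "x \<in> G2 p \<sigma> \<tau> \<Longrightarrow> pdy p (pdy p x) = 0"
proof -
  assume "x \<in> G2 p \<sigma> \<tau>"
  then have "x \<in> vspan ({S. finite S \<and> 0 \<notin> S} \<times> {S. finite S \<and> 0 \<notin> S})"
    using G2_subset by blast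
  then have "lft (\<lambda>y. del (del y)) x = lft (\<lambda>y. 0) x"
    by (rule lft_cong) (simp add: del_del)
  then show ?thesis
    by (simp add: pdy_def cov_lft[OF keys_del'] lft_lft[OF vlinear_del] lft_zero)
qed

lemma pdx_pdx: "x \<in> G2 p \<sigma> \<tau> \<Longrightarrow> pdx p (pdx p x) = 0"
  using pdy_pdy[of "swp x" p \<tau> \<sigma>] by (metis swp_G2 swp_pdy swp_swp swp_simps(1))

lemma pdy_gen: "finite S \<Longrightarrow> pdy p (gen (S, T)) = (\<Sum>x\<in>S. if covering p (S - {x}, T) then gen (S - {x}, T) else 0)"
  by (simp add: pdy_def lft_gen del_gen vlinear_sum[OF vlinear_cross(1)] vlinear_sum[OF vlinear_restrict_to])

lemma pdy_G2: "x \<in> G2 p (Suc \<sigma>) \<tau> \<Longrightarrow> pdy p x \<in> G2 p \<sigma> \<tau>"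
  unfolding G2_def
proof (erule vlinear_vspan[rotated])
  show "vlinear (pdy p)"
    by (auto simp: vlinear_def)
  fix b :: "nat set \<times> nat set" assume "b \<in> {(S, T). S \<union> T = {1..p} \<and> card S = Suc \<sigma> \<and> card T = \<tau>}"
  then obtain S T where b: "b = (S, T)" "S \<union> T = {1..p}" "card S = Suc \<sigma>" "card T = \<tau>"
    by auto
  then have "finite S"
    using union_interval(1) by blast
  then show "pdy p (gen b) \<in> vspan {(S, T). S \<union> T = {1..p} \<and> card S = \<sigma> \<and> card T = \<tau>}"
    using b by (auto simp: pdy_gen covering_def intro!: vspan_sum)
qed

lemma pdx_G2: "x \<in> G2 p \<sigma> (Suc \<tau>) \<Longrightarrow> pdx p x \<in> G2 p \<sigma> \<tau>"
  using pdy_G2[of "swp x" p \<tau> \<sigma>] by (metis swp_G2 swp_pdy swp_swp)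

section \<open>Exactness of the two deletion maps, and the augmentation\<close>

definition hk :: "(nat set \<times> nat set \<Rightarrow>\<^sub>0 bit) \<Rightarrow> (nat set \<times> nat set \<Rightarrow>\<^sub>0 bit)"
  where "hk = ext (\<lambda>(S, T). if Min T \<in> S then 0 else gen (insert (Min T) S, T))"

text \<open>For fixed T a covering S consists of the complement of T and an arbitrary subset of T,
  and \<open>pdy\<close> is the augmented simplicial boundary of that subset. \<open>hk\<close> is
  the cone with vertex \<open>Min T\<close>, which lies in T because T has size
  \<open>Suc \<tau>\<close>.\<close>

lemma hk_homotopy:
  assumes "x \<in> G2 p \<sigma> (Suc \<tau>)"
  shows "pdy p (hk x) + hk (pdy p x) = x"
proof (rule vlinear_eqI[OF _ vlinear_id assms[unfolded G2_def]])
  show "vlinear (\<lambda>x. pdy p (hk x) + hk (pdy p x))"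
    by (auto simp: vlinear_def hk_def add_ac)
  fix b :: "nat set \<times> nat set" assume "b \<in> {(S, T). S \<union> T = {1..p} \<and> card S = \<sigma> \<and> card T = Suc \<tau>}"
  then obtain S T where b: "b = (S, T)" "S \<union> T = {1..p}" "card T = Suc \<tau>"
    by auto
  define t where "t = Min T"
  have fin: "finite S" "finite T"
    using union_interval[OF b(2)] by auto
  then have t: "t \<in> T"
    using b(3) unfolding t_def by (intro Min_in) auto
  have hk_sum: "hk (pdy p (gen (S, T))) =
    (\<Sum>x\<in>S. if covering p (S - {x}, T) \<and> t \<notin> S - {x} then gen (insert t (S - {x}), T) else 0)"
    unfolding pdy_gen[OF fin(1)] hk_def ext_sum t_def
  proof (rule sum.cong[OF refl])
    fix x
    let ?b = "(S - {x}, T)"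
    show "ext (\<lambda>(S, T). if Min T \<in> S then 0 else gen (insert (Min T) S, T)) (if covering p ?b then gen ?b else 0) =
      (if covering p ?b \<and> Min T \<notin> S - {x} then gen (insert (Min T) (S - {x}), T) else 0)"
      by (cases "covering p ?b"; cases "Min T \<in> S - {x}") (simp_all del: Diff_iff)
  qed
  show "pdy p (hk (gen b)) + hk (pdy p (gen b)) = gen b"
  proof (cases "t \<in> S")
    case True
    have "covering p (S - {t}, T)"
      using b(2) t by (auto simp: covering_def)
    then have "hk (pdy p (gen (S, T))) = (\<Sum>x\<in>S. if x = t then gen (S, T) else 0)"
      unfolding hk_sum using True by (intro sum.cong) (auto simp: insert_absorb)
    then show ?thesis
      using True fin by (simp add: b(1) hk_def t_def[symmetric])
  next
    case False
    have "pdy p (gen (insert t S, T)) = gen (S, T) +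
      (\<Sum>x\<in>S. if covering p (insert t S - {x}, T) then gen (insert t S - {x}, T) else 0)"
      using fin b(2) False by (auto simp: pdy_gen covering_def)
    also have "(\<Sum>x\<in>S. if covering p (insert t S - {x}, T) then gen (insert t S - {x}, T) else 0) = hk (pdy p (gen (S, T)))"
      unfolding hk_sum using False t
      by (intro sum.cong) (auto simp: covering_def insert_Diff_if)
    finally show ?thesis
      using False by (simp add: b(1) hk_def t_def[symmetric] add.assoc)
  qed
qed

lemma hk_G2: "x \<in> G2 p \<sigma> (Suc \<tau>) \<Longrightarrow> hk x \<in> G2 p (Suc \<sigma>) (Suc \<tau>)"
  unfolding G2_def hk_def
proof (erule vspan_ext)
  fix b :: "nat set \<times> nat set" assume "b \<in> {(S, T). S \<union> T = {1..p} \<and> card S = \<sigma> \<and> card T = Suc \<tau>}"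
  then obtain S T where b: "b = (S, T)" "S \<union> T = {1..p}" "card S = \<sigma>" "card T = Suc \<tau>"
    by auto
  have fin: "finite S" "finite T"
    using union_interval[OF b(2)] by auto
  then have "Min T \<in> T"
    using b(4) by (intro Min_in) auto
  then have "insert (Min T) S \<union> T = {1..p}"
    using b(2) by blast
  then show "(case b of (S, T) \<Rightarrow> if Min T \<in> S then 0 else gen (insert (Min T) S, T))
    \<in> vspan {(S, T). S \<union> T = {1..p} \<and> card S = Suc \<sigma> \<and> card T = Suc \<tau>}"
    using b fin by simp
qed

lemma pdy_exact:
  assumes "x \<in> G2 p \<sigma> (Suc \<tau>)" "pdy p x = 0"
  obtains v where "v \<in> G2 p (Suc \<sigma>) (Suc \<tau>)" "x = pdy p v"
  using that[OF hk_G2[OF assms(1)]] hk_homotopy[OF assms(1)] assms(2) by (simp add: hk_def)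

lemma pdx_exact:
  assumes "x \<in> G2 p (Suc \<sigma>) \<tau>" "pdx p x = 0"
  obtains v where "v \<in> G2 p (Suc \<sigma>) (Suc \<tau>)" "x = pdx p v"
proof -
  have "pdy p (swp x) = 0"
    using assms(2) by (metis swp_pdx swp_simps(1))
  then obtain v where "v \<in> G2 p (Suc \<tau>) (Suc \<sigma>)" "swp x = pdy p v"
    using pdy_exact swp_G2[OF assms(1)] by blast
  then show ?thesis
    using that[of "swp v"] by (metis swp_G2 swp_pdy swp_swp)
qed

text \<open>The number of words modulo 2. This functional detects the class in column \<sigma> +
  \<tau>; there it vanishes on coboundaries by \<open>eps_dG\<close>.\<close>

definition eps :: "('b \<Rightarrow>\<^sub>0 bit) \<Rightarrow> bit"
  where "eps = ext (\<lambda>_. 1)"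

lemma vlinear_eps: "vlinear eps"
  unfolding eps_def by (rule vlinear_ext)

lemma eps_simps [simp]: "eps 0 = 0" "eps (x + y) = eps x + eps y" "eps (gen b) = 1"
  by (simp_all add: eps_def)

lemma eps_swp [simp]: "eps (swp x) = eps x"
  by (rule cross_eqI) (auto simp: vlinear_def)

lemma eps_XYZ [simp]: "eps (consX x) = eps x" "eps (consY x) = eps x" "eps (consZ x) = eps x"
  by (rule cross_eqI, auto simp: vlinear_def XYZ_gen)+

text \<open>Sizes with sum n + 1 force the two sets to meet in exactly one point, so each word has a
  single Z and \<open>pdy\<close> sends it to a single word.\<close>

lemma eps_pdy:
  assumes "x \<in> G2 n i j" "i + j = Suc n"
  shows "eps (pdy n x) = eps x"
proof (rule vlinear_eqI[OF _ vlinear_eps assms(1)[unfolded G2_def]])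
  show "vlinear (\<lambda>x. eps (pdy n x))"
    by (auto simp: vlinear_def)
  fix b :: "nat set \<times> nat set" assume "b \<in> {(S, T). S \<union> T = {1..n} \<and> card S = i \<and> card T = j}"
  then obtain S T where b: "b = (S, T)" "S \<union> T = {1..n}" "card S = i" "card T = j"
    by auto
  have fin: "finite S" "finite T"
    using union_interval[OF b(2)] by auto
  then have "card (S \<inter> T) = 1"
    using card_Un_Int[of S T] b assms(2) by simp
  then obtain z where z: "S \<inter> T = {z}"
    by (meson card_1_singletonE)
  have "covering n (S - {x}, T) \<longleftrightarrow> x = z" if "x \<in> S" for x
    using that b(2) z by (auto simp: covering_def)
  then have "pdy n (gen b) = (\<Sum>x\<in>S. if x = z then gen (S - {z}, T) else 0)"
    unfolding b(1) pdy_gen[OF fin(1)] by (intro sum.cong) auto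
  also have "\<dots> = gen (S - {z}, T)"
    using fin z by auto
  finally show "eps (pdy n (gen b)) = eps (gen b)"
    by simp
qed

lemma eps_pdx: "x \<in> G2 n i j \<Longrightarrow> i + j = Suc n \<Longrightarrow> eps (pdx n x) = eps x"
  using eps_pdy[of "swp x" n j i] by (metis swp_G2 swp_pdx eps_swp add.commute)

lemma G2_small: "i + j < n \<Longrightarrow> x \<in> G2 n i j \<Longrightarrow> x = 0"
proof -
  assume *: "i + j < n" "x \<in> G2 n i j"
  have E: "{(S, T). S \<union> T = {1..n} \<and> card S = i \<and> card T = j} = {}"
  proof (safe)
    fix S T :: "nat set" assume "S \<union> T = {1..n}" "i = card S" "j = card T"
    then have "n \<le> i + j"
      using card_Un_le[of S T] by simp
    with *(1) show "(S, T) \<in> {}"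
      by simp
  qed
  then show ?thesis
    using *(2) unfolding G2_def E by simp
qed

lemma G2_large: "n < i \<or> n < j \<Longrightarrow> x \<in> G2 n i j \<Longrightarrow> x = 0"
proof -
  assume *: "n < i \<or> n < j" "x \<in> G2 n i j"
  have E: "{(S, T). S \<union> T = {1..n} \<and> card S = i \<and> card T = j} = {}"
  proof (safe)
    fix S T :: "nat set" assume "S \<union> T = {1..n}" "i = card S" "j = card T"
    then have "i \<le> n \<and> j \<le> n"
      using card_mono[of "{1..n}" S] card_mono[of "{1..n}" T] by auto
    with *(1) show "(S, T) \<in> {}"
      by simp
  qed
  then show ?thesis
    using *(2) unfolding G2_def E by simp
qed

lemma G2_extreme:
  assumes "x \<in> G2 n n 0" "eps x = 0"
  shows "x = 0"
proof -
  have "S = {1..n} \<and> T = {}" if "S \<union> T = {1..n}" "card T = 0" for S T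
    using union_interval(2)[OF that(1)] that by simp
  then have "{(S, T). S \<union> T = {1..n} \<and> card S = n \<and> card T = 0} \<subseteq> {({1..n}, {})}"
    by blast
  then have "x = 0 \<or> x = gen ({1..n}, {})"
    using assms(1) unfolding G2_def by (intro vspan_singleton) (rule vspan_mono)
  then show ?thesis
    using assms(2) by auto
qed

text \<open>A class in bidegree \<open>(i, j)\<close> is pushed along its antidiagonal to bidegree \<open>(i + j, 0)\<close>.\<close>

lemma staircase:
  assumes "\<beta> \<in> G2 n i j" "pdx n \<beta> = 0" "pdy n \<beta> = 0" "i + j = n \<Longrightarrow> eps \<beta> = 0"
  shows "\<exists>u \<in> G2 n (Suc i) (Suc j). \<beta> = pdx n (pdy n u)"
  using assms
proof (induction j arbitrary: i \<beta>)
  case 0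
  have "\<beta> = 0"
    using G2_extreme[of \<beta> n] G2_small[of i 0 n \<beta>] G2_large[of n i 0 \<beta>] 0 by (cases i n rule: linorder_cases) auto
  then show ?case
    by (intro bexI[of _ 0]) auto
next
  case (Suc j)
  \<comment> \<open>The lift v of \<beta> along \<open>pdy\<close> need not be
    \<open>pdx\<close>-closed. Its defect \<open>pdx n v\<close> satisfies the hypotheses one step
    further along the antidiagonal; in the critical case v has one Z, so \<beta>, v and
    \<open>pdx n v\<close> have the same \<open>eps\<close>.\<close>
  obtain v where v: "v \<in> G2 n (Suc i) (Suc j)" "\<beta> = pdy n v"
    using pdy_exact Suc.prems(1,3) by blast
  have 1: "pdx n v \<in> G2 n (Suc i) j"
    using v(1) by (rule pdx_G2)
  have "pdy n (pdx n v) = 0"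
    using Suc.prems(2) v(2) by (simp add: pdx_pdy)
  moreover have "eps (pdx n v) = 0" if "Suc i + j = n"
    using that Suc.prems(4) v eps_pdx[OF v(1)] eps_pdy[OF v(1)] by simp
  ultimately obtain u where u: "u \<in> G2 n (Suc (Suc i)) (Suc j)" "pdx n v = pdx n (pdy n u)"
    using Suc.IH[OF 1 pdx_pdx[OF v(1)]] by blast
  \<comment> \<open>Correcting v by the \<open>pdy\<close>-cycle \<open>pdy n u\<close> keeps its
    image \<beta> and makes it \<open>pdx\<close>-closed, so exactness in the other direction
    supplies w.\<close>
  have 2: "v + pdy n u \<in> G2 n (Suc i) (Suc j)"
    using v(1) u(1) by (intro G2_add pdy_G2)
  moreover have "pdx n (v + pdy n u) = 0"
    using u(2) by simp
  ultimately obtain w where w: "w \<in> G2 n (Suc i) (Suc (Suc j))" "v + pdy n u = pdx n w"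
    by (rule pdx_exact)
  have "\<beta> = pdy n (v + pdy n u)"
    using v(2) pdy_pdy[OF u(1)] by simp
  then show ?case
    using hk_G2 w by (metis pdx_pdy)
qed

section \<open>The horizontal differential on words\<close>

definition dd :: "(nat set \<Rightarrow>\<^sub>0 bit) \<Rightarrow> (nat set \<Rightarrow>\<^sub>0 bit)"
  where "dd y = sh y + ins (del y)"

text \<open>The coface d^0 acts diagonally on pairs. On the homology of a single factor it is
  \<open>dd\<close> in the basis of subsets of {1..p}, as \<open>proj_sh_incl\<close> will
  show.\<close>

definition dG :: "nat \<Rightarrow> (nat set \<times> nat set \<Rightarrow>\<^sub>0 bit) \<Rightarrow> (nat set \<times> nat set \<Rightarrow>\<^sub>0 bit)"
  where "dG p x = cov (Suc p) (lft dd (rgt dd x))"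

lemma vlinear_dd: "vlinear dd"
  by (auto simp: vlinear_def dd_def add_ac)

lemma dG_simps [simp]: "dG p 0 = 0" "dG p (x + y) = dG p x + dG p y"
  by (simp_all add: dG_def)

lemma swp_dG: "swp (dG p x) = dG p (swp x)"
  by (simp add: dG_def swp_cov swp_lft swp_rgt rgt_lft[OF vlinear_dd vlinear_dd])

lemma covering_Suc:
  "covering (Suc p) (insert (Suc 0) (Suc ` S), Suc ` T) \<longleftrightarrow> covering p (S, T)"
  "covering (Suc p) (Suc ` S, insert (Suc 0) (Suc ` T)) \<longleftrightarrow> covering p (S, T)"
  "covering (Suc p) (insert (Suc 0) (Suc ` S), insert (Suc 0) (Suc ` T)) \<longleftrightarrow> covering p (S, T)"
proof -
  have "{1..Suc p} = insert (Suc 0) (Suc ` {1..p})"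
    using atLeastAtMost_insertL[of 1 "Suc p"] by simp
  moreover have "Suc ` {1..p} \<subseteq> insert (Suc 0) (Suc ` U) \<longleftrightarrow> {1..p} \<subseteq> U" for U
    by (auto simp del: image_Suc_atLeastAtMost)
  ultimately show
    "covering (Suc p) (insert (Suc 0) (Suc ` S), Suc ` T) \<longleftrightarrow> covering p (S, T)"
    "covering (Suc p) (Suc ` S, insert (Suc 0) (Suc ` T)) \<longleftrightarrow> covering p (S, T)"
    "covering (Suc p) (insert (Suc 0) (Suc ` S), insert (Suc 0) (Suc ` T)) \<longleftrightarrow> covering p (S, T)"
    by (simp_all add: covering_def image_Un[symmetric] del: image_Suc_atLeastAtMost)
qed

lemma cov_XYZ: "cov (Suc p) (consX x) = consX (cov p x)" "cov (Suc p) (consY x) = consY (cov p x)" "cov (Suc p) (consZ x) = consZ (cov p x)"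
proof -
  show "cov (Suc p) (consX x) = consX (cov p x)"
    by (rule cross_eqI[where f = "\<lambda>x. cov (Suc p) (consX x)" and g = "\<lambda>x. consX (cov p x)"])
      (auto simp: vlinear_def XYZ_gen covering_Suc)
  show "cov (Suc p) (consY x) = consY (cov p x)"
    by (rule cross_eqI[where f = "\<lambda>x. cov (Suc p) (consY x)" and g = "\<lambda>x. consY (cov p x)"])
      (auto simp: vlinear_def XYZ_gen covering_Suc)
  show "cov (Suc p) (consZ x) = consZ (cov p x)"
    by (rule cross_eqI[where f = "\<lambda>x. cov (Suc p) (consZ x)" and g = "\<lambda>x. consZ (cov p x)"])
      (auto simp: vlinear_def XYZ_gen covering_Suc)
qed

text \<open>As 0 is in neither set, shifting both of them leaves position 1 without a
  letter.\<close>

lemma cov_sh_sh: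
  assumes "x \<in> vspan ({S. 0 \<notin> S} \<times> {S. 0 \<notin> S})"
  shows "cov (Suc p) (lft sh (rgt sh x)) = 0"
proof (rule vlinear_eqI[where f = "\<lambda>x. cov (Suc p) (lft sh (rgt sh x))", OF _ vlinear_zero assms])
  show "vlinear (\<lambda>x. cov (Suc p) (lft sh (rgt sh x)))"
    by (auto simp: vlinear_def)
  fix b :: "nat set \<times> nat set" assume "b \<in> {S. 0 \<notin> S} \<times> {S. 0 \<notin> S}"
  then obtain S T where b: "b = (S, T)" "0 \<notin> S" "0 \<notin> T"
    by auto
  have "\<not> covering (Suc p) (Suc ` S, Suc ` T)"
  proof
    assume "covering (Suc p) (Suc ` S, Suc ` T)"
    then have "Suc 0 \<in> Suc ` (S \<union> T)"
      by (auto simp: covering_def)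
    then show False
      using b by auto
  qed
  then show "cov (Suc p) (lft sh (rgt sh (gen b))) = 0"
    by (simp add: b(1) lft_gen rgt_gen sh_gen)
qed

text \<open>Each copy of \<open>dd\<close> has two summands. The product of the two shifts is not
  covering; the other three products prepend X, Y or Z to the word with the matching
  deletions.\<close>

lemma dG_expand:
  assumes "x \<in> vspan ({S. 0 \<notin> S} \<times> {S. 0 \<notin> S})"
  shows "dG p x = consX (pdy p x) + consY (pdx p x) + consZ (pdy p (pdx p x))"
proof -
  have dd: "lft dd w = lft sh w + lft ins (lft del w)" "rgt dd w = rgt sh w + rgt ins (rgt del w)"
    for w :: "nat set \<times> nat set \<Rightarrow>\<^sub>0 bit"
    unfolding dd_def[abs_def] by (simp_all add: lft_plus rgt_plus lft_lft[OF vlinear_ins] rgt_rgt[OF vlinear_ins])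
  note comm = rgt_lft[OF vlinear_del vlinear_del] rgt_lft[OF vlinear_del vlinear_sh] rgt_lft[OF vlinear_del vlinear_ins]
    rgt_lft[OF vlinear_sh vlinear_sh] rgt_lft[OF vlinear_ins vlinear_sh] rgt_lft[OF vlinear_ins vlinear_ins]
    rgt_lft[OF vlinear_sh vlinear_ins]
  have "lft dd (rgt dd x) = lft sh (rgt sh x) + consX (lft del x) + consY (rgt del x) + consZ (lft del (rgt del x))"
    by (simp add: dd consX_def consY_def consZ_def comm add_ac)
  then have "dG p x = consX (cov p (lft del x)) + consY (cov p (rgt del x)) + consZ (cov p (lft del (rgt del x)))"
    by (simp add: dG_def cov_XYZ cov_sh_sh[OF assms])
  then show ?thesis
    by (simp add: pdy_def pdx_def cov_lft[OF keys_del'])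
qed

lemma G2_no_0: "x \<in> G2 p \<sigma> \<tau> \<Longrightarrow> x \<in> vspan ({S. 0 \<notin> S} \<times> {S. 0 \<notin> S})"
  by (rule vspan_mono[OF subsetD[OF G2_subset]]) auto

lemma keys_dd:
  assumes "finite S" "S' \<in> Poly_Mapping.keys (dd (gen S))" "S \<subseteq> {1..p}"
  shows "S' \<subseteq> {1..Suc p} \<and> card S' = card S"
proof -
  have "dd (gen S) \<in> vspan (insert (Suc ` S) ((\<lambda>x. insert 1 (Suc ` (S - {x}))) ` S))"
    unfolding dd_def by (intro vspan_add) (auto simp: sh_gen del_gen vlinear_sum[OF vlinear_ins] ins_gen intro!: vspan_sum)
  then have "S' = Suc ` S \<or> (\<exists>x\<in>S. S' = insert 1 (Suc ` (S - {x})))"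
    using assms(2) by (auto simp: vspan_def)
  then show ?thesis
  proof
    assume "S' = Suc ` S"
    then show ?thesis
      using assms(3) by (auto simp: card_image)
  next
    assume "\<exists>x\<in>S. S' = insert 1 (Suc ` (S - {x}))"
    then obtain x where x: "x \<in> S" "S' = insert 1 (Suc ` (S - {x}))"
      by blast
    moreover have "1 \<notin> Suc ` (S - {x})"
      using assms(3) by auto
    ultimately have "card S' = Suc (card (S - {x}))"
      using assms(1) by (simp add: card_image)
    then have "card S' = card S"
      using card_Suc_Diff1[OF assms(1) x(1)] by simp
    moreover have "S' \<subseteq> {1..Suc p}"
      using x assms(3) by auto
    ultimately show ?thesis
      by simp
  qed
qed

lemma dG_G2:
  assumes "x \<in> G2 p \<sigma> \<tau>"
  shows "dG p x \<in> G2 (Suc p) \<sigma> \<tau>"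
proof -
  define A where "A = (\<lambda>p \<sigma>. {S::nat set. S \<subseteq> {1..p} \<and> card S = \<sigma>})"
  have dd: "dd (gen S) \<in> vspan (A (Suc p) \<sigma>)" if "S \<in> A p \<sigma>" for S \<sigma>
    using that keys_dd[of S _ p] finite_subset[of S "{1..p}"] by (auto simp: A_def vspan_def)
  have "x \<in> vspan (A p \<sigma> \<times> A p \<tau>)"
    using assms unfolding G2_def A_def by (rule vspan_mono) auto
  then have "lft dd (rgt dd x) \<in> vspan (A (Suc p) \<sigma> \<times> A (Suc p) \<tau>)"
    by (intro lft_vspan[where S = "A p \<sigma>"] rgt_vspan[where T = "A p \<tau>"] dd)
  then have "dG p x \<in> vspan {b \<in> A (Suc p) \<sigma> \<times> A (Suc p) \<tau>. covering (Suc p) b}"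
    unfolding dG_def by (rule restrict_to_vspan)
  then show ?thesis
    unfolding G2_def by (rule vspan_mono) (auto simp: A_def covering_def)
qed

section \<open>Splitting off the first letter of a word\<close>

definition pred_set :: "nat set \<Rightarrow> nat set"
  where "pred_set S = (\<lambda>x. x - 1) ` (S - {1})"

lemma card_pred_set: "0 \<notin> S \<Longrightarrow> card (pred_set S) = card (S - {1})"
  unfolding pred_set_def by (rule card_image, rule inj_onI, metis Diff_iff Suc_pred diff_Suc_1 gr0I One_nat_def)

lemma Suc_pred_set:
  assumes "0 \<notin> S"
  shows "Suc ` pred_set S = S - {1}"
proof -
  have "Suc ` pred_set S = (\<lambda>x. x) ` (S - {1})"
    unfolding pred_set_def image_image using assms by (intro image_cong) (auto, metis Suc_pred gr0I)
  then show ?thesis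
    by simp
qed

lemma pred_set_cover: "S \<union> T = {1..Suc n} \<Longrightarrow> pred_set S \<union> pred_set T = {1..n}"
proof -
  assume *: "S \<union> T = {1..Suc n}"
  have "Suc ` (pred_set S \<union> pred_set T) = {1..Suc n} - {1}"
    using Suc_pred_set[OF union_interval(3)[OF *]] Suc_pred_set[OF union_interval(4)[OF *]] * by (auto simp: image_Un)
  also have "\<dots> = Suc ` {1..n}"
    by (simp add: atLeastAtMost_insertL[symmetric])
  finally show ?thesis
    unfolding inj_image_eq_iff[OF inj_Suc] .
qed

text \<open>\<open>out1\<close> and \<open>out0\<close> are left inverses of \<open>ins\<close> and
  \<open>sh\<close> on sets without 0, and each kills the image of the other map
  (\<open>out_in\<close>). Applied to the two factors they read off the component with a given first
  letter.\<close>

definition out1 :: "(nat set \<Rightarrow>\<^sub>0 bit) \<Rightarrow> (nat set \<Rightarrow>\<^sub>0 bit)"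
  where "out1 = ext (\<lambda>S. if 1 \<in> S then gen (pred_set S) else 0)"

definition out0 :: "(nat set \<Rightarrow>\<^sub>0 bit) \<Rightarrow> (nat set \<Rightarrow>\<^sub>0 bit)"
  where "out0 = ext (\<lambda>S. if 1 \<in> S then 0 else gen (pred_set S))"

lemma vlinear_out1: "vlinear out1" and vlinear_out0: "vlinear out0"
  unfolding out1_def out0_def by (rule vlinear_ext)+

lemma out_in:
  assumes "0 \<notin> S"
  shows "out1 (ins (gen S)) = gen S" "out1 (sh (gen S)) = 0" "out0 (ins (gen S)) = 0" "out0 (sh (gen S)) = gen S"
proof -
  have "1 \<notin> Suc ` S"
    using assms by auto
  moreover from this have "pred_set (Suc ` S) = S" "pred_set (insert 1 (Suc ` S)) = S"
    by (simp_all add: pred_set_def image_image)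
  ultimately show "out1 (ins (gen S)) = gen S" "out1 (sh (gen S)) = 0" "out0 (ins (gen S)) = 0" "out0 (sh (gen S)) = gen S"
    by (simp_all add: out1_def out0_def ins_gen sh_gen)
qed

lemma extract_XYZ:
  assumes "x \<in> vspan ({S. 0 \<notin> S} \<times> {S. 0 \<notin> S})"
    "y \<in> vspan ({S. 0 \<notin> S} \<times> {S. 0 \<notin> S})" "z \<in> vspan ({S. 0 \<notin> S} \<times> {S. 0 \<notin> S})"
    and "consX x + consY y + consZ z = 0"
  shows "x = 0" "y = 0" "z = 0"
proof -
  let ?V = "vspan ({S::nat set. 0 \<notin> S} \<times> {S::nat set. 0 \<notin> S})"
  have *: "lft u (rgt v (consX w)) = lft (\<lambda>y. u (ins y)) (rgt (\<lambda>y. v (sh y)) w)"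
    "lft u (rgt v (consY w)) = lft (\<lambda>y. u (sh y)) (rgt (\<lambda>y. v (ins y)) w)"
    "lft u (rgt v (consZ w)) = lft (\<lambda>y. u (ins y)) (rgt (\<lambda>y. v (ins y)) w)"
    if "vlinear u" "vlinear v" for u v w
    by (simp_all add: consX_def consY_def consZ_def rgt_lft vlinear_ins vlinear_sh that lft_lft rgt_rgt)
  have red: "lft (\<lambda>y. u (f y)) (rgt (\<lambda>y. v (g y)) w) = lft f' (rgt g' w)"
    if "w \<in> ?V" "\<And>S. 0 \<notin> S \<Longrightarrow> u (f (gen S)) = f' (gen S)" "\<And>S. 0 \<notin> S \<Longrightarrow> v (g (gen S)) = g' (gen S)"
      "\<And>S. 0 \<notin> S \<Longrightarrow> g' (gen S) \<in> vspan {S. 0 \<notin> S}"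
    for u v f g w and f' g' :: "(nat set \<Rightarrow>\<^sub>0 bit) \<Rightarrow> (nat set \<Rightarrow>\<^sub>0 bit)"
  proof -
    have "rgt (\<lambda>y. v (g y)) w = rgt g' w"
      using that by (intro rgt_cong) auto
    moreover have "rgt g' w \<in> ?V"
      using that by (intro rgt_vspan) auto
    ultimately show ?thesis
      using lft_cong[of "rgt g' w" "{S. 0 \<notin> S}" "{S. 0 \<notin> S}" "\<lambda>y. u (f y)" f'] that(2) by simp
  qed
  note [simp] = out_in lft_id rgt_id lft_zero rgt_zero
  have "lft out1 (rgt out0 (consX x + consY y + consZ z)) = x"
    using red[of x out1 ins "\<lambda>y. y" out0 sh "\<lambda>y. y"] red[of y out1 sh "\<lambda>y. 0" out0 ins "\<lambda>y. 0"]
      red[of z out1 ins "\<lambda>y. y" out0 ins "\<lambda>y. 0"] assms(1-3)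
    by (simp add: *[OF vlinear_out1 vlinear_out0])
  then show "x = 0"
    using assms(4) by simp
  have "lft out0 (rgt out1 (consX x + consY y + consZ z)) = y"
    using red[of x out0 ins "\<lambda>y. 0" out1 sh "\<lambda>y. 0"] red[of y out0 sh "\<lambda>y. y" out1 ins "\<lambda>y. y"]
      red[of z out0 ins "\<lambda>y. 0" out1 ins "\<lambda>y. y"] assms(1-3)
    by (simp add: *[OF vlinear_out0 vlinear_out1])
  then show "y = 0"
    using assms(4) by simp
  have "lft out1 (rgt out1 (consX x + consY y + consZ z)) = z"
    using red[of x out1 ins "\<lambda>y. y" out1 sh "\<lambda>y. 0"] red[of y out1 sh "\<lambda>y. 0" out1 ins "\<lambda>y. y"]
      red[of z out1 ins "\<lambda>y. y" out1 ins "\<lambda>y. y"] assms(1-3)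
    by (simp add: *[OF vlinear_out1 vlinear_out1])
  then show "z = 0"
    using assms(4) by simp
qed

lemma decompose_XYZ:
  assumes "c \<in> G2 (Suc n) (Suc \<sigma>) (Suc \<tau>)"
  obtains \<alpha> \<beta> \<gamma> where "\<alpha> \<in> G2 n \<sigma> (Suc \<tau>)" "\<beta> \<in> G2 n (Suc \<sigma>) \<tau>" "\<gamma> \<in> G2 n \<sigma> \<tau>" "c = consX \<alpha> + consY \<beta> + consZ \<gamma>"
proof
  let ?B = "{(S, T). S \<union> T = {1..Suc n} \<and> card S = Suc \<sigma> \<and> card T = Suc \<tau>}"
  have outs: "lft out1 (rgt out0 (gen (S, T))) = (if 1 \<in> S \<and> 1 \<notin> T then gen (pred_set S, pred_set T) else 0)"
    "lft out0 (rgt out1 (gen (S, T))) = (if 1 \<notin> S \<and> 1 \<in> T then gen (pred_set S, pred_set T) else 0)"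
    "lft out1 (rgt out1 (gen (S, T))) = (if 1 \<in> S \<and> 1 \<in> T then gen (pred_set S, pred_set T) else 0)" for S T
    by (simp_all add: lft_gen rgt_gen out1_def out0_def)
  have B: "0 \<notin> S" "0 \<notin> T" "1 \<in> S \<or> 1 \<in> T" "pred_set S \<union> pred_set T = {1..n}"
    "card (pred_set S) = (if 1 \<in> S then \<sigma> else Suc \<sigma>)" "card (pred_set T) = (if 1 \<in> T then \<tau> else Suc \<tau>)"
    if "(S, T) \<in> ?B" for S T
  proof -
    from that have *: "S \<union> T = {1..Suc n}" and c: "card S = Suc \<sigma>" "card T = Suc \<tau>"
      by auto
    note f = union_interval[OF *]
    show "0 \<notin> S" "0 \<notin> T" "pred_set S \<union> pred_set T = {1..n}"
      using f pred_set_cover[OF *] by auto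
    have "1 \<in> S \<union> T"
      unfolding * by simp
    then show "1 \<in> S \<or> 1 \<in> T"
      by simp
    show "card (pred_set S) = (if 1 \<in> S then \<sigma> else Suc \<sigma>)" "card (pred_set T) = (if 1 \<in> T then \<tau> else Suc \<tau>)"
      using f c by (simp_all add: card_pred_set)
  qed
  show "lft out1 (rgt out0 c) \<in> G2 n \<sigma> (Suc \<tau>)"
    unfolding G2_def
  proof (rule vlinear_vspan[OF _ assms[unfolded G2_def]])
    show "vlinear (\<lambda>c. lft out1 (rgt out0 c))"
      by (auto simp: vlinear_def)
  qed (use B in \<open>auto simp: outs simp del: One_nat_def\<close>)
  show "lft out0 (rgt out1 c) \<in> G2 n (Suc \<sigma>) \<tau>"
    unfolding G2_def
  proof (rule vlinear_vspan[OF _ assms[unfolded G2_def]])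
    show "vlinear (\<lambda>c. lft out0 (rgt out1 c))"
      by (auto simp: vlinear_def)
  qed (use B in \<open>auto simp: outs simp del: One_nat_def\<close>)
  show "lft out1 (rgt out1 c) \<in> G2 n \<sigma> \<tau>"
    unfolding G2_def
  proof (rule vlinear_vspan[OF _ assms[unfolded G2_def]])
    show "vlinear (\<lambda>c. lft out1 (rgt out1 c))"
      by (auto simp: vlinear_def)
  qed (use B in \<open>auto simp: outs simp del: One_nat_def\<close>)
  show "c = consX (lft out1 (rgt out0 c)) + consY (lft out0 (rgt out1 c)) + consZ (lft out1 (rgt out1 c))"
  proof (rule vlinear_eqI[OF vlinear_id _ assms[unfolded G2_def]])
    show "vlinear (\<lambda>c. consX (lft out1 (rgt out0 c)) + consY (lft out0 (rgt out1 c)) + consZ (lft out1 (rgt out1 c)))"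
      by (auto simp: vlinear_def add_ac)
    fix b assume "b \<in> ?B"
    moreover obtain S T where b: "b = (S, T)"
      by fastforce
    ultimately have "(S, T) \<in> ?B"
      by simp
    note B = B[OF this]
    from B(3) consider "1 \<in> S" "1 \<notin> T" | "1 \<notin> S" "1 \<in> T" | "1 \<in> S" "1 \<in> T"
      by blast
    then show "gen b = consX (lft out1 (rgt out0 (gen b))) + consY (lft out0 (rgt out1 (gen b))) + consZ (lft out1 (rgt out1 (gen b)))"
      unfolding b outs
      by cases (simp_all add: XYZ_gen Suc_pred_set[OF B(1)] Suc_pred_set[OF B(2)] insert_absorb del: One_nat_def)
  qed
qed

lemma swp_XYZ: "swp (consX x) = consY (swp x)" "swp (consY x) = consX (swp x)" "swp (consZ x) = consZ (swp x)"
  by (simp_all add: consX_def consY_def consZ_def swp_lft swp_rgt rgt_lft vlinear_ins vlinear_sh)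

lemma lft_del_ins:
  assumes "y \<in> vspan ({S. finite S \<and> 0 \<notin> S} \<times> UNIV)"
  shows "lft del (lft ins y) = lft sh y + lft ins (lft del y)"
proof -
  have "lft (\<lambda>y. del (ins y)) y = lft (\<lambda>y. sh y + ins (del y)) y"
    using assms by (rule lft_cong) (simp add: del_ins)
  then show ?thesis
    by (simp add: lft_plus lft_lft[OF vlinear_del] lft_lft[OF vlinear_ins])
qed

lemma lft_del_sh: "lft del (lft sh y) = lft sh (lft del y)"
  by (simp add: lft_lft vlinear_del vlinear_sh del_sh)

text \<open>Words of all sizes together: the deletion maps preserve this space without index shifts,
  which suits the prefix rules below.\<close>

definition Gall :: "nat \<Rightarrow> (nat set \<times> nat set \<Rightarrow>\<^sub>0 bit) set"
  where "Gall p = vspan {(S, T). S \<union> T = {1..p}}"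

lemma G2_Gall: "x \<in> G2 p \<sigma> \<tau> \<Longrightarrow> x \<in> Gall p"
  unfolding G2_def Gall_def by (erule vspan_mono) auto

lemma cov_Gall: "x \<in> Gall n \<Longrightarrow> cov n x = x"
  unfolding Gall_def by (erule restrict_to_id) (auto simp: covering_def)

lemma swp_Gall: "x \<in> Gall p \<Longrightarrow> swp x \<in> Gall p"
  unfolding Gall_def by (erule swp_vspan) auto

lemma Gall_finite: "x \<in> Gall p \<Longrightarrow> x \<in> vspan ({S. finite S \<and> 0 \<notin> S} \<times> {S. finite S \<and> 0 \<notin> S})"
  unfolding Gall_def by (erule vspan_mono) (auto dest: union_interval simp del: One_nat_def)

lemma Gall_no_0: "x \<in> Gall p \<Longrightarrow> x \<in> vspan ({S. 0 \<notin> S} \<times> {S. 0 \<notin> S})"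
  by (rule vspan_mono[OF Gall_finite]) auto

lemma pdy_Gall: "x \<in> Gall p \<Longrightarrow> pdy p x \<in> Gall p"
  unfolding Gall_def
proof (erule vlinear_vspan[rotated])
  show "vlinear (pdy p)"
    by (auto simp: vlinear_def)
  fix b :: "nat set \<times> nat set" assume "b \<in> {(S, T). S \<union> T = {1..p}}"
  then obtain S T where b: "b = (S, T)" "S \<union> T = {1..p}"
    by auto
  then show "pdy p (gen b) \<in> vspan {(S, T). S \<union> T = {1..p}}"
    using union_interval(1)[OF b(2)] by (auto simp: pdy_gen covering_def intro!: vspan_sum)
qed

lemma pdx_Gall: "x \<in> Gall p \<Longrightarrow> pdx p x \<in> Gall p"
  using pdy_Gall[of "swp x" p] by (metis swp_Gall swp_pdy swp_swp)

text \<open>Deletions in the tail leave the first letter alone. Only an initial Z can itself become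
  a Y, hence the additional \<open>consY x\<close>.\<close>

lemma pdy_XYZ:
  assumes "x \<in> Gall n"
  shows "pdy (Suc n) (consX x) = consX (pdy n x)" "pdy (Suc n) (consY x) = consY (pdy n x)"
    "pdy (Suc n) (consZ x) = consY x + consZ (pdy n x)"
proof -
  have "x \<in> vspan ({S. finite S \<and> 0 \<notin> S} \<times> UNIV)"
    using Gall_finite[OF assms] by (rule vspan_mono) auto
  then have r: "rgt u x \<in> vspan ({S. finite S \<and> 0 \<notin> S} \<times> UNIV)" for u :: "(nat set \<Rightarrow>\<^sub>0 bit) \<Rightarrow> (nat set \<Rightarrow>\<^sub>0 bit)"
    by (rule rgt_vspan) simp
  note comm = rgt_lft[OF vlinear_del vlinear_sh, symmetric] rgt_lft[OF vlinear_del vlinear_ins, symmetric]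
  have "pdy (Suc n) (consX x) = cov (Suc n) (lft sh (rgt sh x) + consX (lft del x))"
    by (simp add: pdy_def consX_def lft_del_ins[OF r] comm)
  then show "pdy (Suc n) (consX x) = consX (pdy n x)"
    by (simp add: pdy_def cov_sh_sh[OF Gall_no_0[OF assms]] cov_XYZ)
  have "pdy (Suc n) (consY x) = cov (Suc n) (consY (lft del x))"
    by (simp add: pdy_def consY_def lft_del_sh comm)
  then show "pdy (Suc n) (consY x) = consY (pdy n x)"
    by (simp add: pdy_def cov_XYZ)
  have "pdy (Suc n) (consZ x) = cov (Suc n) (consY x + consZ (lft del x))"
    by (simp add: pdy_def consY_def consZ_def lft_del_ins[OF r] comm)
  then show "pdy (Suc n) (consZ x) = consY x + consZ (pdy n x)"
    by (simp add: pdy_def cov_XYZ cov_Gall[OF assms])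
qed

lemma pdx_XYZ:
  assumes "x \<in> Gall n"
  shows "pdx (Suc n) (consX x) = consX (pdx n x)" "pdx (Suc n) (consY x) = consY (pdx n x)"
    "pdx (Suc n) (consZ x) = consX x + consZ (pdx n x)"
proof -
  have *: "pdx p y = swp (pdy p (swp y))" for p y
    by (simp add: swp_pdy)
  show "pdx (Suc n) (consX x) = consX (pdx n x)" "pdx (Suc n) (consY x) = consY (pdx n x)"
    "pdx (Suc n) (consZ x) = consX x + consZ (pdx n x)"
    unfolding * swp_XYZ by (simp_all add: pdy_XYZ[OF swp_Gall[OF assms]] swp_XYZ)
qed

section \<open>Cohomology of the words of given sizes\<close>

lemma dG_dG:
  assumes "x \<in> G2 p \<sigma> \<tau>"
  shows "dG (Suc p) (dG p x) = 0"
proof -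
  let ?\<alpha> = "pdy p x" and ?\<beta> = "pdx p x" and ?\<gamma> = "pdy p (pdx p x)"
  note G = pdy_Gall[OF G2_Gall[OF assms]] pdx_Gall[OF G2_Gall[OF assms]] pdy_Gall[OF pdx_Gall[OF G2_Gall[OF assms]]]
  have \<gamma>: "pdy p ?\<gamma> = 0" "pdx p ?\<gamma> = 0"
    using pdy_pdy[OF assms] pdx_pdx[OF assms] by (simp_all add: pdx_pdy) (simp add: pdx_pdy[symmetric])
  have c: "dG p x = consX ?\<alpha> + consY ?\<beta> + consZ ?\<gamma>"
    by (rule dG_expand[OF G2_no_0[OF assms]])
  \<comment> \<open>Turning the initial Z into Y or X produces the term that cancels the tail
    deletion, so both deletion maps kill \<open>dG p x\<close>; by \<open>dG_expand\<close> every
    summand of the second \<open>dG\<close> contains one of them.\<close>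
  have "pdy (Suc p) (dG p x) = 0" "pdx (Suc p) (dG p x) = 0"
    unfolding c by (simp_all add: pdy_XYZ[OF G(1)] pdy_XYZ[OF G(2)] pdy_XYZ[OF G(3)]
      pdx_XYZ[OF G(1)] pdx_XYZ[OF G(2)] pdx_XYZ[OF G(3)] pdy_pdy[OF assms] pdx_pdx[OF assms] \<gamma> pdx_pdy)
  then show ?thesis
    by (simp add: dG_expand[OF G2_no_0[OF dG_G2[OF assms]]])
qed

text \<open>The components at X, Y and Z are independent, so a cocycle is an element killed by
  \<open>pdy\<close> and \<open>pdx\<close>. For c = X\<alpha> + Y\<beta> + Z\<gamma> this reads
  \<open>pdy n \<alpha> = 0\<close>, \<open>pdx n \<beta> = 0\<close> and
  \<open>pdy n \<beta> = \<gamma> = pdx n \<alpha>\<close>. It remains to find u with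
  \<open>pdy n u = \<alpha>\<close> and \<open>pdx n u = \<beta>\<close>; the Z-component then
  agrees by itself.\<close>

lemma cocycle_coboundary:
  assumes "c \<in> G2 (Suc n) \<sigma> \<tau>" "dG (Suc n) c = 0" "\<sigma> + \<tau> = Suc n \<Longrightarrow> eps c = 0"
  shows "\<exists>u \<in> G2 n \<sigma> \<tau>. c = dG n u"
proof (cases "\<sigma> = 0 \<or> \<tau> = 0")
  case True
  \<comment> \<open>One set is empty and the other is everything. So there is at most one word, and
    only if \<sigma> + \<tau> = n + 1, where \<open>eps\<close> detects it.\<close>
  have "c = 0"
  proof (cases "\<tau> = 0")
    case True
    then show ?thesis
      using assms G2_extreme[of c "Suc n"] G2_small[of \<sigma> 0 "Suc n" c] G2_large[of "Suc n" \<sigma> 0 c]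
      by (cases \<sigma> "Suc n" rule: linorder_cases) auto
  next
    case False
    with \<open>\<sigma> = 0 \<or> \<tau> = 0\<close> have "swp c \<in> G2 (Suc n) \<tau> 0"
      using swp_G2[OF assms(1)] by simp
    then have "swp c = 0"
      using assms(3) \<open>\<sigma> = 0 \<or> \<tau> = 0\<close> False
        G2_extreme[of "swp c" "Suc n"] G2_small[of \<tau> 0 "Suc n" "swp c"] G2_large[of "Suc n" \<tau> 0 "swp c"]
      by (cases \<tau> "Suc n" rule: linorder_cases) auto
    then show ?thesis
      by (metis swp_swp swp_simps(1))
  qed
  then show ?thesis
    by (intro bexI[of _ 0]) auto
next
  case False
  then obtain \<sigma>' \<tau>' where st: "\<sigma> = Suc \<sigma>'" "\<tau> = Suc \<tau>'"
    using not0_implies_Suc by blast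
  obtain \<alpha> \<beta> \<gamma> where abc: "\<alpha> \<in> G2 n \<sigma>' \<tau>" "\<beta> \<in> G2 n \<sigma> \<tau>'" "\<gamma> \<in> G2 n \<sigma>' \<tau>'" "c = consX \<alpha> + consY \<beta> + consZ \<gamma>"
    using assms(1) unfolding st by (rule decompose_XYZ)
  have pdc: "pdy (Suc n) c \<in> G2 (Suc n) \<sigma>' \<tau>" "pdx (Suc n) c \<in> G2 (Suc n) \<sigma> \<tau>'"
    "pdy (Suc n) (pdx (Suc n) c) \<in> G2 (Suc n) \<sigma>' \<tau>'"
    using assms(1) unfolding st by (auto intro: pdy_G2 pdx_G2)
  have "consX (pdy (Suc n) c) + consY (pdx (Suc n) c) + consZ (pdy (Suc n) (pdx (Suc n) c)) = 0"
    using assms(2) dG_expand[OF G2_no_0[OF assms(1)]] by simp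
  note cyc = extract_XYZ[OF pdc[THEN G2_no_0] this]
  define V where "V = vspan ({S::nat set. 0 \<notin> S} \<times> {S::nat set. 0 \<notin> S})"
  have del0: "del (gen S) \<in> vspan {S. 0 \<notin> S}" if "0 \<notin> S" for S
    using that keys_del[of _ S] by (auto simp: vspan_def)
  have pdV: "pdy n y \<in> V" "pdx n y \<in> V" if "y \<in> V" for y
    using that lft_vspan[of y "{S. 0 \<notin> S}" "{S. 0 \<notin> S}" del "{S. 0 \<notin> S}"]
      rgt_vspan[of y "{S. 0 \<notin> S}" "{S. 0 \<notin> S}" del "{S. 0 \<notin> S}"] del0
    unfolding V_def pdy_def pdx_def by (auto intro!: vspan_mono[OF restrict_to_vspan])
  have V: "\<alpha> \<in> V" "\<beta> \<in> V" "\<gamma> \<in> V"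
    using abc(1-3) by (auto simp: V_def intro: G2_no_0)
  have V_add: "y + z \<in> V" if "y \<in> V" "z \<in> V" for y z
    using that unfolding V_def by (rule vspan_add)
  note components = extract_XYZ[folded V_def]
  have "consX (pdy n \<alpha>) + consY (pdy n \<beta> + \<gamma>) + consZ (pdy n \<gamma>) = 0"
    using cyc(1) by (simp add: abc(4) pdy_XYZ[OF abc(1)[THEN G2_Gall]] pdy_XYZ[OF abc(2)[THEN G2_Gall]] pdy_XYZ[OF abc(3)[THEN G2_Gall]] pdx_XYZ[OF abc(1)[THEN G2_Gall]] pdx_XYZ[OF abc(2)[THEN G2_Gall]] pdx_XYZ[OF abc(3)[THEN G2_Gall]] add_ac)
  note ab = components[OF pdV(1)[OF V(1)] V_add[OF pdV(1)[OF V(2)] V(3)] pdV(1)[OF V(3)] this]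
  have a: "pdy n \<alpha> = 0" and b: "pdy n \<beta> = \<gamma>"
    using ab(1) ab(2)[unfolded add_eq_0_iff_char2] by simp_all
  have "consX (pdx n \<alpha> + \<gamma>) + consY (pdx n \<beta>) + consZ (pdx n \<gamma>) = 0"
    using cyc(2) by (simp add: abc(4) pdy_XYZ[OF abc(1)[THEN G2_Gall]] pdy_XYZ[OF abc(2)[THEN G2_Gall]] pdy_XYZ[OF abc(3)[THEN G2_Gall]] pdx_XYZ[OF abc(1)[THEN G2_Gall]] pdx_XYZ[OF abc(2)[THEN G2_Gall]] pdx_XYZ[OF abc(3)[THEN G2_Gall]] add_ac)
  note cd = components[OF V_add[OF pdV(2)[OF V(1)] V(3)] pdV(2)[OF V(2)] pdV(2)[OF V(3)] this]
  have c: "pdx n \<beta> = 0" and d: "pdx n \<alpha> = \<gamma>"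
    using cd(2) cd(1)[unfolded add_eq_0_iff_char2] by simp_all
  \<comment> \<open>Exactness solves the first equation. The error \<open>\<beta> + pdx n u\<close>
    of the second is killed by both deletion maps, and \<open>staircase\<close> writes it as
    \<open>pdx n (pdy n w)\<close>; adding \<open>pdy n w\<close> to u removes it without disturbing
    the first equation.\<close>
  obtain u where u: "u \<in> G2 n \<sigma> \<tau>" "\<alpha> = pdy n u"
    using pdy_exact[OF abc(1)[unfolded st]] a unfolding st by blast
  have "pdx n (\<beta> + pdx n u) = 0" "pdy n (\<beta> + pdx n u) = 0"
    using c b d u pdx_pdx[OF u(1)] pdx_pdy[of n u] by auto
  moreover have bu: "\<beta> + pdx n u \<in> G2 n (Suc \<sigma>') \<tau>'"
    using abc(2) u(1) unfolding st by (intro G2_add pdx_G2)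
  \<comment> \<open>In the critical case \<sigma> + \<tau> = n + 1 the sets of \<gamma> are too
    small to cover {1..n}, so the assumption on \<open>eps c\<close> says that \<alpha> and \<beta>
    have equal \<open>eps\<close>.\<close>
  moreover have "eps (\<beta> + pdx n u) = 0" if "Suc \<sigma>' + \<tau>' = n"
  proof -
    have "\<gamma> = 0"
      using that abc(3) by (intro G2_small[of \<sigma>' \<tau>' n]) auto
    moreover have "eps c = 0"
      using that assms(3) by (simp add: st)
    ultimately have "eps \<alpha> + eps \<beta> = 0"
      unfolding abc(4) by simp
    then have "eps \<alpha> = eps \<beta>"
      unfolding add_eq_0_iff_char2 .
    then show ?thesis
      using that u st eps_pdx[OF u(1)] eps_pdy[OF u(1)] by simp
  qed
  ultimately obtain w where w: "w \<in> G2 n (Suc (Suc \<sigma>')) \<tau>" "\<beta> + pdx n u = pdx n (pdy n w)"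
    using staircase[OF bu] st by blast
  have uw: "u + pdy n w \<in> G2 n \<sigma> \<tau>"
    using u(1) w(1) unfolding st by (intro G2_add pdy_G2)
  have y: "pdy n (u + pdy n w) = \<alpha>"
    using u pdy_pdy[OF w(1)] by simp
  have x: "pdx n (u + pdy n w) = \<beta>"
    using w(2) by (metis add_self_left add.commute op_simps(4))
  have "dG n (u + pdy n w) = c"
    unfolding dG_expand[OF G2_no_0[OF uw]] x y using abc(4) b by simp
  then show ?thesis
    using uw by blast
qed

text \<open>The words have one Z. The two single deletions contribute \<open>eps u\<close> each and
  cancel, and there is no second Z for the double deletion.\<close>

lemma eps_dG:
  assumes "u \<in> G2 n \<sigma> \<tau>" "\<sigma> + \<tau> = Suc n"
  shows "eps (dG n u) = 0"
proof -
  have "pdy n (pdx n u) = 0"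
  proof (cases "\<sigma> = 0 \<or> \<tau> = 0")
    case True
    then have "u = 0"
      using assms by (intro G2_large[of n \<sigma> \<tau>]) auto
    then show ?thesis
      by simp
  next
    case False
    then obtain \<sigma>' \<tau>' where st: "\<sigma> = Suc \<sigma>'" "\<tau> = Suc \<tau>'"
      using not0_implies_Suc by blast
    then have "pdy n (pdx n u) \<in> G2 n \<sigma>' \<tau>'"
      using assms by (auto intro: pdy_G2 pdx_G2)
    then show ?thesis
      using assms st by (intro G2_small[of \<sigma>' \<tau>' n]) auto
  qed
  then show ?thesis
    using dG_expand[OF G2_no_0[OF assms(1)]] eps_pdy[OF assms] eps_pdx[OF assms] by simp
qed

section \<open>Cycles modulo boundaries under the swap, for two sets of equal size\<close>

lemma char2_eqI: "a = b \<Longrightarrow> c + d = a + b \<Longrightarrow> c = (d :: 'a::char2)"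
  by (simp add: add_eq_0_iff_char2)

text \<open>The quotient of \<open>Z\<close> by a subspace \<open>B\<close> has dimension 0 or 1, respectively.\<close>

definition rank0 :: "'a set \<Rightarrow> 'a set \<Rightarrow> bool"
  where "rank0 Z B \<longleftrightarrow> Z \<subseteq> B"

definition rank1 :: "'a::plus set \<Rightarrow> 'a set \<Rightarrow> bool"
  where "rank1 Z B \<longleftrightarrow> (\<exists>z0\<in>Z. z0 \<notin> B \<and> (\<forall>z\<in>Z. z \<in> B \<or> z + z0 \<in> B))"

type_synonym pairs = "nat set \<times> nat set \<Rightarrow>\<^sub>0 bit"

text \<open>
  Cycles and boundaries at \<open>p\<close> of the complex with differential \<open>dG\<close> whose terms are the \<open>i\<close>-th
  homology of \<open>\<Sigma>\<^sub>2\<close> with coefficients in \<open>V p\<close>, on the level of representatives in \<open>V p\<close>.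
\<close>

definition TZ :: "(nat \<Rightarrow> pairs set) \<Rightarrow> nat \<Rightarrow> nat \<Rightarrow> pairs set"
  where "TZ V i p = {w \<in> V p. (i \<noteq> 0 \<longrightarrow> swp w = w) \<and> (\<exists>v\<in>V (Suc p). dG p w = v + swp v)}"

definition TB :: "(nat \<Rightarrow> pairs set) \<Rightarrow> nat \<Rightarrow> nat \<Rightarrow> pairs set"
  where "TB V i p = {v + swp v + (case p of 0 \<Rightarrow> 0 | Suc n \<Rightarrow> dG n u) | v u.
    v \<in> V p \<and> (case p of 0 \<Rightarrow> u = 0 | Suc n \<Rightarrow> u \<in> V n) \<and> (i \<noteq> 0 \<longrightarrow> swp u = u)}"

lemma TB_norm: "v \<in> V p \<Longrightarrow> (\<And>n. 0 \<in> V n) \<Longrightarrow> v + swp v \<in> TB V i p"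
  unfolding TB_def by (rule CollectI, rule exI[of _ v], rule exI[of _ 0]) (auto split: nat.split)

lemma TB_dG: "v \<in> V (Suc n) \<Longrightarrow> u \<in> V n \<Longrightarrow> v + swp v + dG n u \<in> TB V 0 (Suc n)"
  unfolding TB_def by auto

text \<open>Outside column \<sigma> no covering pair has equal members, so the swap is free. H
  selects from each orbit the pair whose first member contains the least element of the symmetric
  difference, and v is the selected half of x.\<close>

lemma G2_norm:
  assumes "x \<in> G2 p \<sigma> \<sigma>" "swp x = x" "p \<noteq> \<sigma>"
  obtains v where "v \<in> G2 p \<sigma> \<sigma>" "x = v + swp v"
proof -
  define H where "H = (\<lambda>(S, T). Min ((S - T) \<union> (T - S)) \<in> (S :: nat set))"
  have H: "H (T, S) \<longleftrightarrow> \<not> H (S, T)" if "S \<union> T = {1..p}" "card S = \<sigma>" for S T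
  proof -
    have "S \<noteq> T"
      using that assms(3) by auto
    then have "(S - T) \<union> (T - S) \<noteq> {}" "finite ((S - T) \<union> (T - S))"
      using union_interval[OF that(1)] by auto
    then have "Min ((S - T) \<union> (T - S)) \<in> (S - T) \<union> (T - S)"
      by (rule Min_in[rotated])
    then show ?thesis
      by (auto simp: H_def Un_commute)
  qed
  have v: "restrict_to H x \<in> G2 p \<sigma> \<sigma>"
    using restrict_to_vspan[OF assms(1)[unfolded G2_def], of H] unfolding G2_def by (rule vspan_mono) auto
  have "swp (restrict_to H x) = restrict_to (\<lambda>(S, T). H (T, S)) (swp x)"
    by (rule cross_eqI[where f = "\<lambda>x. swp (restrict_to H x)" and g = "\<lambda>x. restrict_to (\<lambda>(S, T). H (T, S)) (swp x)"])
      (auto simp: vlinear_def)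
  also have "\<dots> = restrict_to (\<lambda>b. \<not> H b) x"
    unfolding assms(2)
    by (rule vlinear_eqI[OF vlinear_restrict_to vlinear_restrict_to assms(1)[unfolded G2_def]]) (auto simp: H)
  finally have "x = restrict_to H x + swp (restrict_to H x)"
    by (simp add: restrict_to_split)
  with v show ?thesis
    by (rule that)
qed

lemma G2_diagonal: "x \<in> G2 p p p \<Longrightarrow> x = 0 \<or> x = gen ({1..p}, {1..p})"
proof -
  assume "x \<in> G2 p p p"
  moreover have "S = {1..p} \<and> T = {1..p}" if "S \<union> T = {1..p}" "card S = p" "card T = p" for S T
    using that card_subset_eq[of "{1..p}" S] card_subset_eq[of "{1..p}" T] by auto
  then have "{(S, T). S \<union> T = {1..p} \<and> card S = p \<and> card T = p} \<subseteq> {({1..p}, {1..p})}"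
    by blast
  ultimately show ?thesis
    unfolding G2_def by (intro vspan_singleton) (rule vspan_mono)
qed

text \<open>The only word in column \<sigma> is Z...Z, which the swap fixes, and the column before
  has none, so all boundaries vanish. The horizontal image of Z...Z is swap-invariant in a column
  where the swap is free, hence a norm.\<close>

lemma rank_square_diagonal: "rank1 (TZ (\<lambda>p. G2 p \<sigma> \<sigma>) i \<sigma>) (TB (\<lambda>p. G2 p \<sigma> \<sigma>) i \<sigma>)"
proof -
  let ?z = "gen ({1..\<sigma>}, {1..\<sigma>})"
  have z: "?z \<in> G2 \<sigma> \<sigma> \<sigma>" "swp ?z = ?z"
    by (simp_all add: G2_def)
  have "swp (dG \<sigma> ?z) = dG \<sigma> ?z"
    by (simp add: swp_dG)
  then obtain v where "v \<in> G2 (Suc \<sigma>) \<sigma> \<sigma>" "dG \<sigma> ?z = v + swp v"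
    using G2_norm[OF dG_G2[OF z(1)]] by auto
  then have Z: "?z \<in> TZ (\<lambda>p. G2 p \<sigma> \<sigma>) i \<sigma>"
    using z by (auto simp: TZ_def)
  have "b = 0" if b: "b \<in> TB (\<lambda>p. G2 p \<sigma> \<sigma>) i \<sigma>" for b
  proof -
    from b obtain v u where vu: "v \<in> G2 \<sigma> \<sigma> \<sigma>" "case \<sigma> of 0 \<Rightarrow> u = 0 | Suc n \<Rightarrow> u \<in> G2 n \<sigma> \<sigma>"
      "b = v + swp v + (case \<sigma> of 0 \<Rightarrow> 0 | Suc n \<Rightarrow> dG n u)"
      unfolding TB_def by blast
    have "u = 0"
      using vu(2) G2_large[of "\<sigma> - 1" \<sigma> \<sigma> u] by (cases \<sigma>) auto
    moreover have "v + swp v = 0"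
      using G2_diagonal[OF vu(1)] by auto
    ultimately show ?thesis
      using vu(3) by (auto split: nat.split)
  qed
  moreover have "?z \<noteq> 0"
    by (metis eps_simps(1) eps_simps(3) zero_neq_one)
  moreover have "0 \<in> TB (\<lambda>p. G2 p \<sigma> \<sigma>) i \<sigma>"
    using TB_norm[of 0 "\<lambda>p. G2 p \<sigma> \<sigma>"] by simp
  moreover have "w = 0 \<or> w + ?z = 0" if "w \<in> TZ (\<lambda>p. G2 p \<sigma> \<sigma>) i \<sigma>" for w
    using that G2_diagonal[of w \<sigma>] by (auto simp: TZ_def)
  ultimately show ?thesis
    unfolding rank1_def using Z by (metis (mono_tags, lifting))
qed

text \<open>
  The connecting map sending \<open>w\<close> with \<open>dG p w = v + swp v\<close> to \<open>v\<close> carries a generator in column \<open>p\<close>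
  to one in column \<open>Suc p\<close>.
\<close>

lemma rank_square_step:
  assumes "rank1 (TZ (\<lambda>p. G2 p \<sigma> \<sigma>) 0 p) (TB (\<lambda>p. G2 p \<sigma> \<sigma>) 0 p)" "\<sigma> \<le> p" "p < 2 * \<sigma>"
  shows "rank1 (TZ (\<lambda>p. G2 p \<sigma> \<sigma>) 0 (Suc p)) (TB (\<lambda>p. G2 p \<sigma> \<sigma>) 0 (Suc p))"
proof -
  let ?V = "\<lambda>p. G2 p \<sigma> \<sigma>"
  obtain w0 where w0: "w0 \<in> TZ ?V 0 p" "w0 \<notin> TB ?V 0 p" "\<And>w. w \<in> TZ ?V 0 p \<Longrightarrow> w \<in> TB ?V 0 p \<or> w + w0 \<in> TB ?V 0 p"
    using assms(1) unfolding rank1_def by blast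
  then obtain v0 where v0: "v0 \<in> ?V (Suc p)" "dG p w0 = v0 + swp v0" and w0V: "w0 \<in> ?V p"
    by (auto simp: TZ_def)
  \<comment> \<open>Since \<open>dG\<close> kills v + swp v, which is the image of w, it maps v to a
    swap-invariant element; as the swap is free there, this is a norm and v is a cycle
    again.\<close>
  have TZ_Suc: "v \<in> TZ ?V 0 (Suc p)" if v: "v \<in> ?V (Suc p)" and w: "w \<in> ?V p" "dG p w = v + swp v" for v w
  proof -
    have "dG (Suc p) (v + swp v) = 0"
      using dG_dG[OF w(1)] w(2) by simp
    then have "swp (dG (Suc p) v) = dG (Suc p) v"
      by (simp add: swp_dG add_eq_0_iff_char2)
    then show ?thesis
      using G2_norm[OF dG_G2[OF v]] assms(2) v unfolding TZ_def by auto
  qed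
  \<comment> \<open>Boundaries go to boundaries: w is a norm up to a coboundary, so
    \<open>v + dG p x\<close> is swap-invariant and therefore itself a norm.\<close>
  have TB_Suc: "v \<in> TB ?V 0 (Suc p)" if v: "v \<in> ?V (Suc p)" and w: "w \<in> TB ?V 0 p" "dG p w = v + swp v" for v w
  proof -
    obtain x u where xu: "x \<in> ?V p" "case p of 0 \<Rightarrow> u = 0 | Suc n \<Rightarrow> u \<in> ?V n"
      "w = x + swp x + (case p of 0 \<Rightarrow> 0 | Suc n \<Rightarrow> dG n u)"
      using w(1) unfolding TB_def by blast
    have "dG p (case p of 0 \<Rightarrow> 0 | Suc n \<Rightarrow> dG n u) = 0"
      using xu(2) by (auto split: nat.splits simp: dG_dG)
    then have "dG p x + dG p (swp x) = v + swp v"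
      using w(2) unfolding xu(3) by simp
    then have "swp (v + dG p x) = v + dG p x"
      by (rule char2_eqI) (simp add: swp_dG ac_simps)
    then obtain y where y: "y \<in> ?V (Suc p)" "v + dG p x = y + swp y"
      using G2_norm[OF G2_add[OF v dG_G2[OF xu(1)]]] assms(2) by auto
    moreover have "v = y + swp y + dG p x"
      by (rule char2_eqI[OF y(2)]) (simp add: ac_simps)
    ultimately show ?thesis
      using TB_dG[of y ?V p x] xu(1) by simp
  qed
  have "v0 \<notin> TB ?V 0 (Suc p)"
  proof
    assume "v0 \<in> TB ?V 0 (Suc p)"
    then obtain y u where yu: "y \<in> ?V (Suc p)" "u \<in> ?V p" "v0 = y + swp y + dG p u"
      unfolding TB_def by auto
    \<comment> \<open>Adding the norm of u turns w0 into a genuine \<open>dG\<close>-cocycle. Below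
      column 2\<sigma> such a cocycle is a coboundary, which would make w0 a boundary.\<close>
    have "dG p (w0 + u + swp u) = 0"
      using v0(2) unfolding yu(3) by (simp add: swp_dG ac_simps)
    moreover have wV: "w0 + u + swp u \<in> ?V p"
      using w0V yu(2) swp_G2[OF yu(2)] by (intro G2_add)
    ultimately have "w0 + u + swp u \<in> TB ?V 0 p"
    proof (cases p)
      case 0
      then show ?thesis using assms by simp
    next
      case (Suc n)
      then obtain u' where "u' \<in> ?V n" "w0 + u + swp u = dG n u'"
        using cocycle_coboundary[of "w0 + u + swp u" n \<sigma> \<sigma>] wV \<open>dG p _ = 0\<close> assms(3) by auto
      then show ?thesis
        using TB_dG[of 0 ?V n u'] Suc by simp
    qed
    then obtain x z where xz: "x \<in> ?V p" "case p of 0 \<Rightarrow> z = 0 | Suc n \<Rightarrow> z \<in> ?V n"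
      "w0 + u + swp u = x + swp x + (case p of 0 \<Rightarrow> 0 | Suc n \<Rightarrow> dG n z)"
      unfolding TB_def by blast
    moreover have "w0 = (x + u) + swp (x + u) + (case p of 0 \<Rightarrow> 0 | Suc n \<Rightarrow> dG n z)"
      by (rule char2_eqI[OF xz(3)]) (simp add: ac_simps)
    ultimately have "w0 \<in> TB ?V 0 p"
      using G2_add[of x p \<sigma> \<sigma> u] yu(2) unfolding TB_def by blast
    with w0(2) show False ..
  qed
  moreover have "v \<in> TB ?V 0 (Suc p) \<or> v + v0 \<in> TB ?V 0 (Suc p)" if v: "v \<in> TZ ?V 0 (Suc p)" for v
  proof -
    have vV: "v \<in> ?V (Suc p)"
      using v by (simp add: TZ_def)
    obtain y where "dG (Suc p) v = y + swp y"
      using v by (auto simp: TZ_def)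
    then have "dG (Suc p) (v + swp v) = 0"
      by (simp add: swp_dG[symmetric] ac_simps)
    \<comment> \<open>Norms have \<open>eps\<close> zero, so a norm that is a cocycle is a
      coboundary even in the critical column 2\<sigma>. The resulting w is a preimage of v under the
      connecting map.\<close>
    moreover have "eps (v + swp v) = 0"
      by (simp only: eps_simps eps_swp add_self)
    ultimately obtain w where w: "w \<in> ?V p" "v + swp v = dG p w"
      using cocycle_coboundary[OF G2_add[OF vV swp_G2[OF vV]]] by blast
    then have "w \<in> TZ ?V 0 p"
      using vV w(2)[symmetric] unfolding TZ_def by blast
    then show ?thesis
      using TB_Suc[OF vV, of w] TB_Suc[OF G2_add[OF vV v0(1)], of "w + w0"] w0(3)[of w] w v0(2)
      by (auto simp: ac_simps)
  qed
  ultimately show ?thesis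
    unfolding rank1_def using TZ_Suc[OF v0(1) w0V v0(2)] by blast
qed

lemma rank_square:
  "\<sigma> \<le> p \<Longrightarrow> p \<le> 2 * \<sigma> \<Longrightarrow> rank1 (TZ (\<lambda>p. G2 p \<sigma> \<sigma>) 0 p) (TB (\<lambda>p. G2 p \<sigma> \<sigma>) 0 p)"
proof (induction p rule: dec_induct)
  case base
  show ?case
    by (rule rank_square_diagonal)
next
  case (step n)
  then show ?case
    using rank_square_step[of \<sigma> n] by simp
qed

text \<open>For i = 0 these columns contain no covering pairs; for i > 0 every invariant in them is
  a norm.\<close>

lemma rank_square_0:
  assumes "if i = 0 then p < \<sigma> \<or> 2 * \<sigma> < p else p \<noteq> \<sigma>"
  shows "rank0 (TZ (\<lambda>p. G2 p \<sigma> \<sigma>) i p) (TB (\<lambda>p. G2 p \<sigma> \<sigma>) i p)"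
  unfolding rank0_def
proof
  fix w assume w: "w \<in> TZ (\<lambda>p. G2 p \<sigma> \<sigma>) i p"
  show "w \<in> TB (\<lambda>p. G2 p \<sigma> \<sigma>) i p"
  proof (cases "i = 0")
    case True
    then have "w = 0"
      using w assms G2_small[of \<sigma> \<sigma> p w] G2_large[of p \<sigma> \<sigma> w] by (auto simp: TZ_def)
    then show ?thesis
      using TB_norm[of 0 "\<lambda>p. G2 p \<sigma> \<sigma>"] by simp
  next
    case False
    then have "w \<in> G2 p \<sigma> \<sigma>" "swp w = w" "p \<noteq> \<sigma>"
      using w assms by (auto simp: TZ_def)
    then obtain v where "v \<in> G2 p \<sigma> \<sigma>" "w = v + swp v"
      by (rule G2_norm)
    then show ?thesis
      using TB_norm[of v "\<lambda>p. G2 p \<sigma> \<sigma>"] by simp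
  qed
qed

section \<open>Pairs of two different sizes\<close>

definition Gmix :: "nat \<Rightarrow> nat \<Rightarrow> nat \<Rightarrow> pairs set"
  where "Gmix \<sigma> \<tau> p = vspan {(S, T). S \<union> T = {1..p} \<and> (card S = \<sigma> \<and> card T = \<tau> \<or> card S = \<tau> \<and> card T = \<sigma>)}"

lemma G2_Gmix: "x \<in> G2 p \<sigma> \<tau> \<Longrightarrow> x \<in> Gmix \<sigma> \<tau> p" "x \<in> G2 p \<tau> \<sigma> \<Longrightarrow> x \<in> Gmix \<sigma> \<tau> p"
  unfolding Gmix_def G2_def by (erule vspan_mono, auto)+

lemma Gmix_0 [simp]: "0 \<in> Gmix \<sigma> \<tau> p"
  by (simp add: Gmix_def)

lemma Gmix_split:
  assumes "x \<in> Gmix \<sigma> \<tau> p"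
  obtains x1 x2 where "x1 \<in> G2 p \<sigma> \<tau>" "x2 \<in> G2 p \<tau> \<sigma>" "x = x1 + x2"
proof
  let ?Q = "\<lambda>(S, T). card S = \<sigma> \<and> card T = \<tau>"
  show "restrict_to ?Q x \<in> G2 p \<sigma> \<tau>" "restrict_to (\<lambda>b. \<not> ?Q b) x \<in> G2 p \<tau> \<sigma>"
    unfolding G2_def by (rule vspan_mono[OF restrict_to_vspan[OF assms[unfolded Gmix_def]]], auto)+
  show "x = restrict_to ?Q x + restrict_to (\<lambda>b. \<not> ?Q b) x"
    by (simp only: restrict_to_split)
qed

lemma G2_disjoint: "x \<in> G2 p \<sigma> \<tau> \<Longrightarrow> x \<in> G2 p \<tau> \<sigma> \<Longrightarrow> \<sigma> \<noteq> \<tau> \<Longrightarrow> x = 0"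
proof -
  assume *: "x \<in> G2 p \<sigma> \<tau>" "x \<in> G2 p \<tau> \<sigma>" "\<sigma> \<noteq> \<tau>"
  have "b \<notin> Poly_Mapping.keys x" for b
  proof
    assume "b \<in> Poly_Mapping.keys x"
    then have "case b of (S, T) \<Rightarrow> card S = \<sigma> \<and> card S = \<tau>"
      using *(1,2) by (auto simp: G2_def vspan_def)
    then show False
      using *(3) by (auto split: prod.splits)
  qed
  then have "Poly_Mapping.keys x = {}"
    by blast
  then show ?thesis
    by simp
qed

lemma G2_components:
  assumes "a1 + a2 = b1 + b2" "a1 \<in> G2 p \<sigma> \<tau>" "b1 \<in> G2 p \<sigma> \<tau>" "a2 \<in> G2 p \<tau> \<sigma>" "b2 \<in> G2 p \<tau> \<sigma>" "\<sigma> \<noteq> \<tau>"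
  shows "a1 = b1" "a2 = b2"
proof -
  have *: "a1 + b1 = a2 + b2"
    by (rule char2_eqI[OF assms(1)]) (simp add: ac_simps)
  then have "a1 + b1 \<in> G2 p \<tau> \<sigma>"
    using assms(4,5) by (simp add: G2_add)
  then have "a1 + b1 = 0"
    using G2_disjoint[OF G2_add[OF assms(2,3)] _ assms(6)] by simp
  then show "a1 = b1" "a2 = b2"
    using * by (simp_all add: add_eq_0_iff_char2)
qed

text \<open>Disjoint sets form words without Z, so neither deletion map has a term.\<close>

lemma dG_disjoint:
  assumes "x \<in> G2 p \<sigma> \<tau>" "\<sigma> + \<tau> = p"
  shows "dG p x = 0"
proof -
  have "pdy p y = 0" if y: "y \<in> G2 p \<sigma> \<tau>" "\<sigma> + \<tau> = p" for y \<sigma> \<tau>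
  proof (rule vlinear_eqI[where f = "pdy p", OF _ vlinear_zero y(1)[unfolded G2_def]])
    show "vlinear (pdy p)"
      by (auto simp: vlinear_def)
    fix b :: "nat set \<times> nat set" assume "b \<in> {(S, T). S \<union> T = {1..p} \<and> card S = \<sigma> \<and> card T = \<tau>}"
    then obtain S T where b: "b = (S, T)" "S \<union> T = {1..p}" "card S = \<sigma>" "card T = \<tau>"
      by auto
    have fin: "finite S" "finite T"
      using union_interval[OF b(2)] by auto
    then have "S \<inter> T = {}"
      using card_Un_Int[of S T] b y(2) by simp
    then have "\<not> covering p (S - {x}, T)" if "x \<in> S" for x
      using that b(2) by (auto simp: covering_def)
    then show "pdy p (gen b) = 0"
      by (simp add: b(1) pdy_gen fin)
  qed
  from this[of x \<sigma> \<tau>] this[of "swp x" \<tau> \<sigma>] have "pdy p x = 0" "pdx p x = 0"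
    using assms swp_G2[OF assms(1)] by (auto simp: add.commute swp_pdx[symmetric]) (metis swp_swp swp_simps(1))
  then show ?thesis
    by (simp add: dG_expand[OF G2_no_0[OF assms(1)]])
qed

text \<open>The coinvariants are the words of sizes (\<sigma>, \<tau>): the other half of w is moved
  over at the price of its norm. Comparing both halves of the cycle condition shows that the result
  is a cocycle for \<open>dG\<close> itself, not only modulo norms.\<close>

lemma TZ_Gmix_normal_form:
  assumes "w \<in> TZ (Gmix \<sigma> \<tau>) 0 p" "\<sigma> \<noteq> \<tau>"
  obtains x y where "x \<in> G2 p \<sigma> \<tau>" "y \<in> G2 p \<tau> \<sigma>" "dG p x = 0" "w = x + (y + swp y)"
proof -
  obtain v where w: "w \<in> Gmix \<sigma> \<tau> p" and v: "v \<in> Gmix \<sigma> \<tau> (Suc p)" "dG p w = v + swp v"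
    using assms(1) by (auto simp: TZ_def)
  obtain w1 w2 where w12: "w1 \<in> G2 p \<sigma> \<tau>" "w2 \<in> G2 p \<tau> \<sigma>" "w = w1 + w2"
    using w by (rule Gmix_split)
  obtain v1 v2 where v12: "v1 \<in> G2 (Suc p) \<sigma> \<tau>" "v2 \<in> G2 (Suc p) \<tau> \<sigma>" "v = v1 + v2"
    using v(1) by (rule Gmix_split)
  have *: "dG p w1 + dG p w2 = (v1 + swp v2) + (v2 + swp v1)"
    by (rule char2_eqI[OF v(2)]) (simp add: w12(3) v12(3) ac_simps)
  note c = G2_components[OF * dG_G2[OF w12(1)] G2_add[OF v12(1) swp_G2[OF v12(2)]]
    dG_G2[OF w12(2)] G2_add[OF v12(2) swp_G2[OF v12(1)]] assms(2)]
  have "dG p (w1 + swp w2) = 0"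
    using c by (simp add: swp_dG[symmetric] ac_simps)
  moreover have "w = (w1 + swp w2) + (w2 + swp w2)"
    by (simp add: w12(3) ac_simps)
  ultimately show ?thesis
    using that[OF G2_add[OF w12(1) swp_G2[OF w12(2)]] w12(2)] by blast
qed

lemma TB_Gmix_coboundary:
  assumes "u \<in> G2 n \<sigma> \<tau>" "y \<in> G2 (Suc n) \<tau> \<sigma>"
  shows "dG n u + (y + swp y) \<in> TB (Gmix \<sigma> \<tau>) 0 (Suc n)"
  using TB_dG[of y "Gmix \<sigma> \<tau>" n u] assms by (simp add: G2_Gmix add.commute)

lemma TZ_Gmix_eps:
  assumes "x \<in> G2 p \<sigma> \<tau>" "y \<in> G2 p \<tau> \<sigma>" "dG p x = 0" "p = \<sigma> + \<tau> \<Longrightarrow> eps x = 0"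
  shows "x + (y + swp y) \<in> TB (Gmix \<sigma> \<tau>) 0 p"
proof (cases p)
  case 0
  \<comment> \<open>No column precedes column 0. A nonzero x would need \<sigma> = \<tau> = 0, and
    then \<open>eps\<close> detects it.\<close>
  have "x = 0"
  proof (cases "\<sigma> = 0 \<and> \<tau> = 0")
    case True
    then show ?thesis
      using assms(1,4) 0 G2_extreme[of x 0] by simp
  next
    case False
    then show ?thesis
      using assms(1) 0 by (intro G2_large[of 0 \<sigma> \<tau>]) auto
  qed
  then show ?thesis
    using TB_norm[of y "Gmix \<sigma> \<tau>" p 0] assms(2) by (simp add: G2_Gmix)
next
  case (Suc n)
  then obtain u where "u \<in> G2 n \<sigma> \<tau>" "x = dG n u"
    using cocycle_coboundary[of x n \<sigma> \<tau>] assms by auto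
  then show ?thesis
    using TB_Gmix_coboundary assms(2) Suc by simp
qed

lemma rank_mixed:
  assumes "\<sigma> \<noteq> \<tau>"
  shows "rank1 (TZ (Gmix \<sigma> \<tau>) 0 (\<sigma> + \<tau>)) (TB (Gmix \<sigma> \<tau>) 0 (\<sigma> + \<tau>))"
proof -
  let ?p = "\<sigma> + \<tau>"
  \<comment> \<open>The word of \<sigma> letters X followed by \<tau> letters Y. What counts is that
    it is a single word of the critical column, so that its \<open>eps\<close> is 1.\<close>
  define z :: pairs where "z = gen ({1..\<sigma>}, {\<sigma><..?p})"
  have "{1..\<sigma>} \<union> {\<sigma><..?p} = {1..?p}"
    by auto
  then have z: "z \<in> G2 ?p \<sigma> \<tau>" "eps z = 1"
    by (simp_all add: z_def G2_def)
  have "z \<in> TZ (Gmix \<sigma> \<tau>) 0 ?p"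
    unfolding TZ_def using dG_disjoint[OF z(1)] G2_Gmix(1)[OF z(1)] by (auto intro!: bexI[of _ 0])
  moreover have "z \<notin> TB (Gmix \<sigma> \<tau>) 0 ?p"
  proof
    assume "z \<in> TB (Gmix \<sigma> \<tau>) 0 ?p"
    moreover obtain n where n: "?p = Suc n"
      using assms by (cases ?p) auto
    ultimately obtain v u where vu: "v \<in> Gmix \<sigma> \<tau> (Suc n)" "u \<in> Gmix \<sigma> \<tau> n" "z = v + swp v + dG n u"
      unfolding TB_def by auto
    obtain v1 v2 where v12: "v1 \<in> G2 (Suc n) \<sigma> \<tau>" "v2 \<in> G2 (Suc n) \<tau> \<sigma>" "v = v1 + v2"
      using vu(1) by (rule Gmix_split)
    obtain u1 u2 where u12: "u1 \<in> G2 n \<sigma> \<tau>" "u2 \<in> G2 n \<tau> \<sigma>" "u = u1 + u2"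
      using vu(2) by (rule Gmix_split)
    have *: "z + 0 = (v1 + swp v2 + dG n u1) + (v2 + swp v1 + dG n u2)"
      by (rule char2_eqI[OF vu(3)]) (simp add: v12(3) u12(3) ac_simps)
    note c = G2_components[OF * z(1)[unfolded n] _ G2_0 _ assms]
    have m: "v1 + swp v2 + dG n u1 \<in> G2 (Suc n) \<sigma> \<tau>" "v2 + swp v1 + dG n u2 \<in> G2 (Suc n) \<tau> \<sigma>"
      using v12 u12 by (auto intro!: G2_add swp_G2 dG_G2)
    \<comment> \<open>A norm adds \<open>eps v1 + eps v2\<close> to both halves. The second half of
      z is zero and coboundaries have \<open>eps\<close> zero, so this sum vanishes, and with it
      \<open>eps z\<close>.\<close>
    have 1: "eps z = eps v1 + eps v2 + eps (dG n u1)" "eps v2 + eps v1 + eps (dG n u2) = 0"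
      using c(1)[OF m] arg_cong[OF c(2)[OF m], of eps] by simp_all
    have "eps (dG n u1) = 0" "eps (dG n u2) = 0"
      using eps_dG[OF u12(1) n] eps_dG[OF u12(2)] n by (simp_all add: add.commute)
    then have "eps z = 0"
      using 1 by (simp add: add.commute)
    then show False
      using z(2) by simp
  qed
  moreover have "w \<in> TB (Gmix \<sigma> \<tau>) 0 ?p \<or> w + z \<in> TB (Gmix \<sigma> \<tau>) 0 ?p" if w: "w \<in> TZ (Gmix \<sigma> \<tau>) 0 ?p" for w
  proof -
    obtain x y where xy: "x \<in> G2 ?p \<sigma> \<tau>" "y \<in> G2 ?p \<tau> \<sigma>" "dG ?p x = 0" "w = x + (y + swp y)"
      using w assms by (rule TZ_Gmix_normal_form)
    show ?thesis
    proof (cases "eps x = 0")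
      case True
      then show ?thesis
        using TZ_Gmix_eps[OF xy(1-3)] xy(4) by simp
    next
      case False
      then have "eps (x + z) = 0"
        using z(2) by (cases "eps x") simp_all
      then have "(x + z) + (y + swp y) \<in> TB (Gmix \<sigma> \<tau>) 0 ?p"
        using dG_disjoint[OF z(1)] xy z(1) by (intro TZ_Gmix_eps G2_add) auto
      then show ?thesis
        using xy(4) by (simp add: ac_simps)
    qed
  qed
  ultimately show ?thesis
    unfolding rank1_def by blast
qed

text \<open>For i > 0 the swap exchanges the two halves, so an invariant is the norm of its first
  half. For i = 0 and outside column \<sigma> + \<tau> the cocycle in the normal form is a
  coboundary.\<close>

lemma rank_mixed_0:
  assumes "\<sigma> \<noteq> \<tau>" "i \<noteq> 0 \<or> p \<noteq> \<sigma> + \<tau>"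
  shows "rank0 (TZ (Gmix \<sigma> \<tau>) i p) (TB (Gmix \<sigma> \<tau>) i p)"
  unfolding rank0_def
proof
  fix w assume w: "w \<in> TZ (Gmix \<sigma> \<tau>) i p"
  show "w \<in> TB (Gmix \<sigma> \<tau>) i p"
  proof (cases "i = 0")
    case True
    then obtain x y where "x \<in> G2 p \<sigma> \<tau>" "y \<in> G2 p \<tau> \<sigma>" "dG p x = 0" "w = x + (y + swp y)"
      using w assms(1) TZ_Gmix_normal_form by blast
    then show ?thesis
      using TZ_Gmix_eps[of x p \<sigma> \<tau> y] assms(2) True by auto
  next
    case False
    then have w: "w \<in> Gmix \<sigma> \<tau> p" "swp w = w"
      using w by (auto simp: TZ_def)
    obtain w1 w2 where w12: "w1 \<in> G2 p \<sigma> \<tau>" "w2 \<in> G2 p \<tau> \<sigma>" "w = w1 + w2"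
      using w(1) by (rule Gmix_split)
    have "swp w2 + swp w1 = w1 + w2"
      using w(2) w12(3) by (simp add: add.commute)
    then have "w2 = swp w1"
      using G2_components(2)[of "swp w2" "swp w1" w1 w2 p \<sigma> \<tau>] w12 assms(1) swp_G2 by simp
    then show ?thesis
      using TB_norm[of w1 "Gmix \<sigma> \<tau>"] w12 by (simp add: G2_Gmix)
  qed
qed

section \<open>Operators on one factor modulo non-covering pairs\<close>

definition shrinking :: "((nat set \<Rightarrow>\<^sub>0 bit) \<Rightarrow> (nat set \<Rightarrow>\<^sub>0 bit)) \<Rightarrow> bool"
  where "shrinking u \<longleftrightarrow> vlinear u \<and> (\<forall>S. u (gen S) \<in> vspan {S'. S' \<subseteq> insert 0 S})"

definition Lc :: "nat \<Rightarrow> ((nat set \<Rightarrow>\<^sub>0 bit) \<Rightarrow> (nat set \<Rightarrow>\<^sub>0 bit)) \<Rightarrow> (nat set \<times> nat set \<Rightarrow>\<^sub>0 bit) \<Rightarrow> (nat set \<times> nat set \<Rightarrow>\<^sub>0 bit)"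
  where "Lc p u x = cov p (lft u x)"

definition Rc :: "nat \<Rightarrow> ((nat set \<Rightarrow>\<^sub>0 bit) \<Rightarrow> (nat set \<Rightarrow>\<^sub>0 bit)) \<Rightarrow> (nat set \<times> nat set \<Rightarrow>\<^sub>0 bit) \<Rightarrow> (nat set \<times> nat set \<Rightarrow>\<^sub>0 bit)"
  where "Rc p u x = cov p (rgt u x)"

lemma Lc_simps [simp]: "Lc p u 0 = 0" "Lc p u (x + y) = Lc p u x + Lc p u y"
  and Rc_simps [simp]: "Rc p u 0 = 0" "Rc p u (x + y) = Rc p u x + Rc p u y"
  by (simp_all add: Lc_def Rc_def)

lemma shrinking_cov_lft: "shrinking u \<Longrightarrow> cov p (lft u (cov p x)) = cov p (lft u x)"
  by (rule cov_lft) (auto simp: shrinking_def vspan_def)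

lemma shrinking_cov_rgt: "shrinking u \<Longrightarrow> cov p (rgt u (cov p x)) = cov p (rgt u x)"
  by (rule cov_rgt) (auto simp: shrinking_def vspan_def)

lemma Lc_Lc: "shrinking u \<Longrightarrow> Lc p u (Lc p v x) = Lc p (\<lambda>y. u (v y)) x"
  by (simp add: Lc_def shrinking_cov_lft lft_lft shrinking_def)

lemma Rc_Rc: "shrinking u \<Longrightarrow> Rc p u (Rc p v x) = Rc p (\<lambda>y. u (v y)) x"
  by (simp add: Rc_def shrinking_cov_rgt rgt_rgt shrinking_def)

lemma Rc_Lc: "shrinking u \<Longrightarrow> shrinking v \<Longrightarrow> Rc p v (Lc p u x) = Lc p u (Rc p v x)"
  by (simp add: Lc_def Rc_def shrinking_cov_lft shrinking_cov_rgt) (simp add: shrinking_def rgt_lft)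

lemma swp_Lc: "swp (Lc p u x) = Rc p u (swp x)" and swp_Rc: "swp (Rc p u x) = Lc p u (swp x)"
  by (simp_all add: Lc_def Rc_def swp_cov swp_lft swp_rgt)

lemma shrinking_comp:
  assumes "shrinking u" "shrinking v"
  shows "shrinking (\<lambda>y. u (v y))"
proof -
  have "u (v (gen S)) \<in> vspan {S'. S' \<subseteq> insert 0 S}" for S
  proof (rule vlinear_vspan[where f = u])
    show "vlinear u" "v (gen S) \<in> vspan {S'. S' \<subseteq> insert 0 S}"
      using assms by (auto simp: shrinking_def)
    fix T assume "T \<in> {S'. S' \<subseteq> insert 0 S}"
    then have "{S'. S' \<subseteq> insert 0 T} \<subseteq> {S'. S' \<subseteq> insert 0 S}"
      by auto
    then show "u (gen T) \<in> vspan {S'. S' \<subseteq> insert 0 S}"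
      using assms(1) vspan_mono unfolding shrinking_def by blast
  qed
  then show ?thesis
    using assms by (auto simp: shrinking_def intro: vlinear_comp)
qed

text \<open>The factors have separate bases and degree functions because \<open>proj\<close> and
  \<open>incl\<close> are applied to one factor at a time and pass through mixed spaces.\<close>

definition graded :: "nat \<Rightarrow> nat set set \<Rightarrow> (nat set \<Rightarrow> int) \<Rightarrow> nat set set \<Rightarrow> (nat set \<Rightarrow> int) \<Rightarrow> int \<Rightarrow> (nat set \<times> nat set \<Rightarrow>\<^sub>0 bit) set"
  where "graded p A g B h k = vspan {(S, T). S \<in> A \<and> T \<in> B \<and> covering p (S, T) \<and> g S + h T = k}"

lemma graded_add: "x \<in> graded p A g B h k \<Longrightarrow> y \<in> graded p A g B h k \<Longrightarrow> x + y \<in> graded p A g B h k"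
  unfolding graded_def by (rule vspan_add)

lemma graded_0 [simp]: "0 \<in> graded p A g B h k"
  by (simp add: graded_def)

lemma swp_graded: "x \<in> graded p A g B h k \<Longrightarrow> swp x \<in> graded p B h A g k"
  unfolding graded_def by (erule swp_vspan) (auto simp: covering_swap)

lemma cov_graded: "x \<in> graded p A g B h k \<Longrightarrow> cov p x = x"
  unfolding graded_def by (erule restrict_to_id) auto

lemma Lc_graded:
  assumes "x \<in> graded p A g B h k" "\<And>S. S \<in> A \<Longrightarrow> u (gen S) \<in> vspan {S' \<in> A'. g' S' = g S + d}"
  shows "Lc p u x \<in> graded p A' g' B h (k + d)"
  unfolding graded_def
proof (rule vlinear_vspan[OF _ assms(1)[unfolded graded_def]])
  show "vlinear (Lc p u)"
    by (auto simp: vlinear_def)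
  fix b :: "nat set \<times> nat set"
  assume "b \<in> {(S, T). S \<in> A \<and> T \<in> B \<and> covering p (S, T) \<and> g S + h T = k}"
  then obtain S T where b: "b = (S, T)" "S \<in> A" "T \<in> B" "g S + h T = k"
    by auto
  have "lft u (gen b) \<in> vspan ({S' \<in> A'. g' S' = g S + d} \<times> {T})"
    unfolding b(1) lft_gen by (intro cross_vspan assms(2)[OF b(2)]) simp
  then have "Lc p u (gen b) \<in> vspan {b \<in> {S' \<in> A'. g' S' = g S + d} \<times> {T}. covering p b}"
    unfolding Lc_def by (rule restrict_to_vspan)
  then show "Lc p u (gen b) \<in> vspan {(S, T). S \<in> A' \<and> T \<in> B \<and> covering p (S, T) \<and> g' S + h T = k + d}"
    by (rule vspan_mono) (use b in auto)
qed

lemma Rc_graded: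
  assumes "x \<in> graded p A g B h k" "\<And>S. S \<in> B \<Longrightarrow> u (gen S) \<in> vspan {S' \<in> B'. h' S' = h S + d}"
  shows "Rc p u x \<in> graded p A g B' h' (k + d)"
  using swp_graded[OF Lc_graded[OF swp_graded[OF assms(1)] assms(2)]] by (simp add: swp_Lc)

lemma Lc_cong:
  assumes "x \<in> graded p A g B h k" "\<And>S. S \<in> A \<Longrightarrow> u (gen S) = v (gen S)"
  shows "Lc p u x = Lc p v x"
proof -
  have "x \<in> vspan (A \<times> B)"
    using assms(1) unfolding graded_def by (rule vspan_mono) auto
  then show ?thesis
    unfolding Lc_def using lft_cong assms(2) by metis
qed

lemma Rc_cong:
  assumes "x \<in> graded p A g B h k" "\<And>S. S \<in> B \<Longrightarrow> u (gen S) = v (gen S)"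
  shows "Rc p u x = Rc p v x"
proof -
  have "x \<in> vspan (A \<times> B)"
    using assms(1) unfolding graded_def by (rule vspan_mono) auto
  then show ?thesis
    unfolding Rc_def using rgt_cong assms(2) by metis
qed

lemma Lc_id: "x \<in> graded p A g B h k \<Longrightarrow> (\<And>S. S \<in> A \<Longrightarrow> u (gen S) = gen S) \<Longrightarrow> Lc p u x = x"
  using Lc_cong[of x p A g B h k u "\<lambda>x. x"] by (simp add: Lc_def lft_id cov_graded)

lemma Rc_id: "x \<in> graded p A g B h k \<Longrightarrow> (\<And>S. S \<in> B \<Longrightarrow> u (gen S) = gen S) \<Longrightarrow> Rc p u x = x"
  using Rc_cong[of x p A g B h k u "\<lambda>x. x"] by (simp add: Rc_def rgt_id cov_graded)

lemma Lc_zero: "x \<in> graded p A g B h k \<Longrightarrow> (\<And>S. S \<in> A \<Longrightarrow> u (gen S) = 0) \<Longrightarrow> Lc p u x = 0"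
  using Lc_cong[of x p A g B h k u "\<lambda>x. 0"] by (simp add: Lc_def lft_zero)

lemma Rc_zero: "x \<in> graded p A g B h k \<Longrightarrow> (\<And>S. S \<in> B \<Longrightarrow> u (gen S) = 0) \<Longrightarrow> Rc p u x = 0"
  using Rc_cong[of x p A g B h k u "\<lambda>x. 0"] by (simp add: Rc_def rgt_zero)

section \<open>The contraction of the Bousfield-Kan complexes\<close>

text \<open>
  The vertex sets \<open>A\<close> with \<open>s + 1 \<le> card A \<le> b\<close> form a basis of \<open>D\<^sup>p\<close> for \<open>b = s + r\<close>. Its homology sits
  in the extreme degrees; a set \<open>S\<close> without 0 stands for the class of the face \<open>insert 0 S\<close> if
  \<open>card S = s\<close>, and for the boundary of the (missing) face \<open>insert 0 S\<close> if \<open>card S = b\<close>.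
\<close>

locale bk =
  fixes s :: nat and b :: enat
  assumes b_ge: "enat (s + 2) \<le> b"
begin

text \<open>Faces with s elements are divided out, so the boundary vanishes in the lowest degree,
  where faces have s + 1 elements.\<close>

definition bd :: "(nat set \<Rightarrow>\<^sub>0 bit) \<Rightarrow> (nat set \<Rightarrow>\<^sub>0 bit)"
  where "bd = ext (\<lambda>A. if Suc s < card A then \<Sum>x\<in>A. gen (A - {x}) else 0)"

definition cone :: "(nat set \<Rightarrow>\<^sub>0 bit) \<Rightarrow> (nat set \<Rightarrow>\<^sub>0 bit)"
  where "cone = ext (\<lambda>A. if 0 \<notin> A \<and> enat (card A) < b then gen (insert 0 A) else 0)"

text \<open>In the lowest degree a face without 0 is homologous to the sum of the cones over its
  facets, and a cone is recorded by its base. In the top degree a cycle is determined by its faces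
  without 0.\<close>

definition proj :: "(nat set \<Rightarrow>\<^sub>0 bit) \<Rightarrow> (nat set \<Rightarrow>\<^sub>0 bit)"
  where "proj = ext (\<lambda>A. if card A = Suc s then if 0 \<in> A then gen (A - {0}) else \<Sum>x\<in>A. gen (A - {x})
    else if enat (card A) = b \<and> 0 \<notin> A then gen A else 0)"

definition incl :: "(nat set \<Rightarrow>\<^sub>0 bit) \<Rightarrow> (nat set \<Rightarrow>\<^sub>0 bit)"
  where "incl = ext (\<lambda>S. if card S = s then gen (insert 0 S)
    else if enat (card S) = b then gen S + (\<Sum>x\<in>S. gen (insert 0 (S - {x}))) else 0)"

definition c0 :: "(nat set \<Rightarrow>\<^sub>0 bit) \<Rightarrow> (nat set \<Rightarrow>\<^sub>0 bit)"
  where "c0 = ext (\<lambda>S. gen (insert 0 S))"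

text \<open>Each basis face either avoids 0 or is the cone \<open>c0\<close> over a face that does.
  For these two kinds all operators have closed formulas in \<open>del\<close> and
  \<open>c0\<close>, which reduces the identities below to case distinctions on the size.\<close>

definition pure :: "nat \<Rightarrow> (nat set \<Rightarrow>\<^sub>0 bit) set"
  where "pure k = vspan {S. finite S \<and> 0 \<notin> S \<and> card S = k}"

lemma ops_simps [simp]:
  "bd 0 = 0" "bd (x + y) = bd x + bd y" "cone 0 = 0" "cone (x + y) = cone x + cone y"
  "proj 0 = 0" "proj (x + y) = proj x + proj y" "incl 0 = 0" "incl (x + y) = incl x + incl y"
  "c0 0 = 0" "c0 (x + y) = c0 x + c0 y"
  by (simp_all add: bd_def cone_def proj_def incl_def c0_def)

lemma vlinear_ops: "vlinear bd" "vlinear cone" "vlinear proj" "vlinear incl" "vlinear c0"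
  unfolding bd_def cone_def proj_def incl_def c0_def by (rule vlinear_ext)+

lemma del_pure: "y \<in> pure k \<Longrightarrow> del y \<in> pure (k - 1)"
  unfolding pure_def
  by (erule vlinear_vspan[OF vlinear_del]) (auto simp: del_gen card_Diff_singleton intro!: vspan_sum)

lemma pure_eqI:
  assumes "y \<in> pure k" "vlinear f" "vlinear g"
    "\<And>S. finite S \<Longrightarrow> 0 \<notin> S \<Longrightarrow> card S = k \<Longrightarrow> f (gen S) = (g (gen S) :: 'c::char2)"
  shows "f y = g y"
  by (rule vlinear_eqI[OF assms(2,3) assms(1)[unfolded pure_def]]) (use assms(4) in auto)

lemma pure_del_del: "y \<in> pure k \<Longrightarrow> del (del y) = 0"
  by (erule pure_eqI[where f = "\<lambda>y. del (del y)"]) (auto simp: vlinear_def del_del)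

lemma pure_del_c0: "y \<in> pure k \<Longrightarrow> del (c0 y) = y + c0 (del y)"
proof (erule pure_eqI[where f = "\<lambda>y. del (c0 y)"])
  show "vlinear (\<lambda>y. del (c0 y))" "vlinear (\<lambda>y. y + c0 (del y))"
    by (auto simp: vlinear_def add_ac)
  fix S :: "nat set" assume S: "finite S" "0 \<notin> S"
  have "(\<Sum>x\<in>S. gen (insert 0 S - {x})) = (\<Sum>x\<in>S. gen (insert 0 (S - {x})))"
    using S by (intro sum.cong) (auto simp: insert_Diff_if)
  then show "del (c0 (gen S)) = gen S + c0 (del (gen S))"
    using S by (simp add: c0_def del_gen ext_sum)
qed

lemma pure_bd: "y \<in> pure k \<Longrightarrow> bd y = (if Suc s < k then del y else 0)"
  by (erule pure_eqI[where f = bd]) (auto simp: vlinear_def bd_def del_gen)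

lemma pure_bd_c0:
  assumes "y \<in> pure k"
  shows "bd (c0 y) = (if s < k then y + c0 (del y) else 0)"
proof -
  have "bd (c0 y) = (if s < k then del (c0 y) else 0)"
    by (rule pure_eqI[OF assms, where f = "\<lambda>y. bd (c0 y)"]) (auto simp: vlinear_def bd_def c0_def del_gen)
  then show ?thesis
    using pure_del_c0[OF assms] by simp
qed

lemma pure_cone: "y \<in> pure k \<Longrightarrow> cone y = (if enat k < b then c0 y else 0)"
  by (erule pure_eqI[where f = cone]) (auto simp: vlinear_def cone_def c0_def)

lemma pure_cone_c0: "y \<in> pure k \<Longrightarrow> cone (c0 y) = 0"
  by (erule pure_eqI[where f = "\<lambda>y. cone (c0 y)"]) (auto simp: vlinear_def cone_def c0_def)

lemma pure_proj: "y \<in> pure k \<Longrightarrow> proj y = (if k = Suc s then del y else if enat k = b then y else 0)"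
  by (erule pure_eqI[where f = proj]) (auto simp: vlinear_def proj_def del_gen)

lemma pure_proj_c0: "y \<in> pure k \<Longrightarrow> proj (c0 y) = (if k = s then y else 0)"
  by (erule pure_eqI[where f = "\<lambda>y. proj (c0 y)"]) (auto simp: vlinear_def proj_def c0_def)

lemma pure_incl: "y \<in> pure k \<Longrightarrow> incl y = (if k = s then c0 y else if enat k = b then y + c0 (del y) else 0)"
  by (erule pure_eqI[where f = incl]) (auto simp: vlinear_def incl_def c0_def del_gen ext_sum add_ac)

lemmas pure_rules = pure_del_del pure_bd pure_bd_c0 pure_cone pure_cone_c0 pure_proj pure_proj_c0 pure_incl

lemma b_neq [simp]: "enat s \<noteq> b" "enat (Suc s) \<noteq> b" "enat s < b" "enat (Suc s) < b"
  using b_ge by (cases b; simp)+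

lemma b_eq: "enat k = b \<Longrightarrow> Suc s < k"
  using b_ge by auto

lemma b_pred: "enat k \<le> b \<Longrightarrow> 0 < k \<Longrightarrow> enat (k - Suc 0) < b \<and> enat (k - Suc 0) \<noteq> b"
  by (cases b) auto

lemma b_Suc: "enat (Suc k) \<le> b \<Longrightarrow> enat k < b \<and> enat k \<noteq> b"
  by (cases b) auto

definition Sp :: "nat \<Rightarrow> nat set set"
  where "Sp p = {A. A \<subseteq> {0..p} \<and> Suc s \<le> card A \<and> enat (card A) \<le> b}"

definition Vp :: "nat \<Rightarrow> nat set set"
  where "Vp p = {S. S \<subseteq> {1..p} \<and> (card S = s \<or> enat (card S) = b)}"

lemma Sp_cases:
  assumes "A \<in> Sp p"
  obtains (no) "gen A \<in> pure (card A)" "Suc s \<le> card A" "enat (card A) \<le> b"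
  | (yes) y k where "gen A = c0 y" "y \<in> pure k" "s \<le> k" "enat (Suc k) \<le> b"
proof (cases "0 \<in> A")
  case False
  then show ?thesis
    using assms no finite_subset[of A "{0..p}"] by (auto simp: Sp_def pure_def)
next
  case True
  have "finite A"
    using assms finite_subset[of A "{0..p}"] by (auto simp: Sp_def)
  then have "card A = Suc (card (A - {0}))"
    using True by (metis card_Suc_Diff1)
  then show ?thesis
    using True assms \<open>finite A\<close> by (intro yes[of "gen (A - {0})" "card (A - {0})"]) (auto simp: Sp_def pure_def c0_def insert_absorb)
qed

lemma Vp_pure: "S \<in> Vp p \<Longrightarrow> gen S \<in> pure (card S)"
  using finite_subset[of S "{1..p}"] by (auto simp: Vp_def pure_def)

lemma proj_bd: "A \<in> Sp p \<Longrightarrow> proj (bd (gen A)) = 0"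
proof (erule Sp_cases)
  assume A: "gen A \<in> pure (card A)" "Suc s \<le> card A" "enat (card A) \<le> b"
  then show ?thesis
    using pure_proj[OF del_pure[OF A(1)]] pure_bd[OF A(1)] pure_del_del[OF A(1)] b_pred[OF A(3)] by auto
next
  fix y k assume y: "gen A = c0 y" "y \<in> pure k" "s \<le> k" "enat (Suc k) \<le> b"
  show ?thesis
  proof (cases "k = s")
    case True
    then show ?thesis
      using pure_bd_c0[OF y(2)] by (simp add: y(1))
  next
    case False
    then show ?thesis
      using pure_proj_c0[OF del_pure[OF y(2)]] pure_proj[OF y(2)] pure_bd_c0[OF y(2)] b_Suc[OF y(4)] y(1,3) by auto
  qed
qed

lemma bd_incl:
  assumes "S \<in> Vp p"
  shows "bd (incl (gen S)) = 0"
proof -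
  note y = Vp_pure[OF assms]
  show ?thesis
    using pure_bd_c0[OF del_pure[OF y]] pure_bd_c0[OF y] pure_bd[OF y] pure_incl[OF y] pure_del_del[OF y]
      b_eq[of "card S"] assms by (auto simp: Vp_def)
qed

lemma proj_incl:
  assumes "S \<in> Vp p"
  shows "proj (incl (gen S)) = gen S"
proof -
  note y = Vp_pure[OF assms]
  show ?thesis
    using pure_proj_c0[OF del_pure[OF y]] pure_proj_c0[OF y] pure_proj[OF y] pure_incl[OF y]
      b_eq[of "card S"] assms by (auto simp: Vp_def)
qed

lemma proj_cone: "A \<in> Sp p \<Longrightarrow> proj (cone (gen A)) = 0"
  by (erule Sp_cases) (auto simp: pure_rules)

text \<open>Away from the extreme degrees this is the usual cone identity. At the bottom the
  boundary is cut off and at the top the cone, and what is lost there is the term with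
  \<open>incl\<close> and \<open>proj\<close>.\<close>

lemma cone_homotopy: "A \<in> Sp p \<Longrightarrow> bd (cone (gen A)) + cone (bd (gen A)) = gen A + incl (proj (gen A))"
proof (erule Sp_cases)
  assume A: "gen A \<in> pure (card A)" "Suc s \<le> card A" "enat (card A) \<le> b"
  show ?thesis
    using pure_cone[OF del_pure[OF A(1)]] pure_incl[OF del_pure[OF A(1)]] pure_cone[OF A(1)] pure_bd[OF A(1)]
      pure_bd_c0[OF A(1)] pure_proj[OF A(1)] pure_incl[OF A(1)] b_pred[OF A(3)] A(2,3)
    by (auto simp: add.assoc)
next
  fix y k assume y: "gen A = c0 y" "y \<in> pure k" "s \<le> k" "enat (Suc k) \<le> b"
  show ?thesis
    unfolding y(1)
    using pure_cone_c0[OF del_pure[OF y(2)]] pure_cone_c0[OF y(2)] pure_bd_c0[OF y(2)] pure_cone[OF y(2)]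
      pure_proj_c0[OF y(2)] pure_incl[OF y(2)] b_Suc[OF y(4)] y(3) by auto
qed

lemma sh_pure: "y \<in> pure k \<Longrightarrow> sh y \<in> pure k"
  unfolding pure_def by (erule vlinear_vspan[OF vlinear_sh]) (auto simp: sh_gen card_image)

lemma ins_pure: "y \<in> pure k \<Longrightarrow> ins y \<in> pure (Suc k)"
  unfolding pure_def
proof (erule vlinear_vspan[OF vlinear_ins])
  fix S :: "nat set" assume "S \<in> {S. finite S \<and> 0 \<notin> S \<and> card S = k}"
  moreover from this have "Suc 0 \<notin> Suc ` S"
    by auto
  ultimately show "ins (gen S) \<in> vspan {S. finite S \<and> 0 \<notin> S \<and> card S = Suc k}"
    by (auto simp: ins_gen card_image)
qed

lemma sh_c0: "sh (c0 y) = ins y"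
proof (rule vlinear_eqI[where f = "\<lambda>y. sh (c0 y)" and g = ins, OF _ vlinear_ins vspan_UNIV])
  show "vlinear (\<lambda>y. sh (c0 y))"
    by (auto simp: vlinear_def)
qed (simp add: c0_def sh_gen ins_gen)

lemma pure_del_ins: "y \<in> pure k \<Longrightarrow> del (ins y) = sh y + ins (del y)"
  by (erule pure_eqI[where f = "\<lambda>y. del (ins y)"]) (auto simp: vlinear_def del_ins add_ac)

text \<open>The shift moves the cone vertex to 1, and the class has to be expressed with respect to
  the new vertex 0: at the bottom by the boundary of the prepended set, at the top by the faces
  without 0. Both give the same formula.\<close>

lemma proj_sh_incl:
  assumes "S \<in> Vp p"
  shows "proj (sh (incl (gen S))) = dd (gen S)"
proof -
  note y = Vp_pure[OF assms]
  show ?thesis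
  proof (cases "card S = s")
    case True
    then show ?thesis
      using pure_proj[OF ins_pure[OF y]] pure_incl[OF y] pure_del_ins[OF y] by (simp add: sh_c0 dd_def)
  next
    case False
    then have b: "enat (card S) = b"
      using assms by (simp add: Vp_def)
    then have "Suc (card S - 1) = card S" "card S \<noteq> Suc s"
      using b_eq[OF b] by auto
    then show ?thesis
      using False b pure_proj[OF ins_pure[OF del_pure[OF y]]] pure_proj[OF sh_pure[OF y]] pure_incl[OF y]
      by (simp add: sh_c0 dd_def)
  qed
qed

lemma bd_sh: "bd (sh x) = sh (bd x)"
proof (rule vlinear_eqI[where f = "\<lambda>x. bd (sh x)" and g = "\<lambda>x. sh (bd x)", OF _ _ vspan_UNIV])
  show "vlinear (\<lambda>x. bd (sh x))" "vlinear (\<lambda>x. sh (bd x))"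
    by (auto simp: vlinear_def)
  fix S :: "nat set"
  show "bd (sh (gen S)) = sh (bd (gen S))"
    using del_sh[of "gen S"] by (simp add: sh_gen bd_def del_gen card_image)
qed

lemma shrinking_ops: "shrinking bd" "shrinking cone" "shrinking proj" "shrinking incl"
  using vlinear_ops
  by (auto simp: shrinking_def bd_def cone_def proj_def incl_def intro!: vspan_sum vspan_add)

section \<open>The contraction on pairs of faces\<close>

definition cd :: "nat set \<Rightarrow> int"
  where "cd A = int (card A)"

text \<open>The number of vertices of the faces occurring in \<open>incl\<close>: a set of size s
  stands for a cone and is counted together with the cone vertex.\<close>

definition dg :: "nat set \<Rightarrow> int"
  where "dg S = (if card S = s then int (Suc s) else int (card S))"

definition Pc :: "nat \<Rightarrow> int \<Rightarrow> (nat set \<times> nat set \<Rightarrow>\<^sub>0 bit) set"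
  where "Pc p k = graded p (Sp p) cd (Sp p) cd k"

definition Vc :: "int \<Rightarrow> nat \<Rightarrow> (nat set \<times> nat set \<Rightarrow>\<^sub>0 bit) set"
  where "Vc k p = graded p (Vp p) dg (Vp p) dg k"

lemma bd_Sp: "A \<in> Sp p \<Longrightarrow> bd (gen A) \<in> vspan {A' \<in> Sp p. cd A' = cd A + - 1}"
  using b_pred[of "card A"] finite_subset[of A "{0..p}"]
  by (auto simp: bd_def Sp_def cd_def card_Diff_singleton intro!: vspan_sum)

lemma cone_Sp: "A \<in> Sp p \<Longrightarrow> cone (gen A) \<in> vspan {A' \<in> Sp p. cd A' = cd A + 1}"
  using finite_subset[of A "{0..p}"]
  by (auto simp: cone_def Sp_def cd_def) (metis Suc_ile_eq)

lemma proj_Sp: "A \<in> Sp p \<Longrightarrow> proj (gen A) \<in> vspan {S \<in> Vp p. dg S = cd A + 0}"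
proof -
  assume A: "A \<in> Sp p"
  then have fin: "finite A" "A \<subseteq> {0..p}"
    using finite_subset[of A "{0..p}"] by (auto simp: Sp_def)
  have A0: "A \<subseteq> {1..p}" if "0 \<notin> A"
  proof
    fix x assume "x \<in> A"
    then show "x \<in> {1..p}"
      using fin(2) that by (cases x) auto
  qed
  have A1: "A - {0} \<subseteq> {1..p}"
  proof
    fix x assume "x \<in> A - {0}"
    then show "x \<in> {1..p}"
      using fin(2) by (cases x) auto
  qed
  show ?thesis
  proof (cases "card A = Suc s")
    case True
    then show ?thesis
      using fin A0 A1 by (auto simp: proj_def Vp_def dg_def cd_def card_Diff_singleton intro!: vspan_sum)
  next
    case False
    then show ?thesis
      using A0 b_eq[of "card A"] by (auto simp: proj_def Vp_def dg_def cd_def)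
  qed
qed

lemma incl_Vp: "S \<in> Vp p \<Longrightarrow> incl (gen S) \<in> vspan {A' \<in> Sp p. cd A' = dg S + 0}"
proof -
  assume S: "S \<in> Vp p"
  then have fin: "finite S" "S \<subseteq> {1..p}" "0 \<notin> S"
    using finite_subset[of S "{1..p}"] by (auto simp: Vp_def)
  then have S0: "S \<subseteq> {0..p}"
    by auto
  show ?thesis
  proof (cases "card S = s")
    case True
    then show ?thesis
      using fin S0 by (simp add: incl_def Sp_def dg_def cd_def less_imp_le)
  next
    case False
    then have b: "enat (card S) = b"
      using S by (simp add: Vp_def)
    have "insert 0 (S - {x}) \<in> Sp p \<and> int (card (insert 0 (S - {x}))) = int (card S)" if "x \<in> S" for x
    proof -
      have "card (insert 0 (S - {x})) = card S"
        using fin that card_Suc_Diff1[OF fin(1) that] by simp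
      then show ?thesis
        using S0 b b_eq[OF b] by (auto simp: Sp_def)
    qed
    then show ?thesis
      using False b S0 b_eq[OF b] by (auto simp: incl_def dg_def Sp_def cd_def intro!: vspan_add vspan_sum)
  qed
qed

definition bdP :: "nat \<Rightarrow> (nat set \<times> nat set \<Rightarrow>\<^sub>0 bit) \<Rightarrow> (nat set \<times> nat set \<Rightarrow>\<^sub>0 bit)"
  where "bdP p x = Lc p bd x + Rc p bd x"

definition projP :: "nat \<Rightarrow> (nat set \<times> nat set \<Rightarrow>\<^sub>0 bit) \<Rightarrow> (nat set \<times> nat set \<Rightarrow>\<^sub>0 bit)"
  where "projP p x = Lc p proj (Rc p proj x)"

definition inclP :: "nat \<Rightarrow> (nat set \<times> nat set \<Rightarrow>\<^sub>0 bit) \<Rightarrow> (nat set \<times> nat set \<Rightarrow>\<^sub>0 bit)"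
  where "inclP p x = Lc p incl (Rc p incl x)"

text \<open>The usual homotopy of a tensor product, h tensor 1 plus q tensor h, where h is the cone
  and q is \<open>incl\<close> after \<open>proj\<close>. It is not symmetric, so it has no
  counterpart in \<open>swp_P\<close>.\<close>

definition coneP :: "nat \<Rightarrow> (nat set \<times> nat set \<Rightarrow>\<^sub>0 bit) \<Rightarrow> (nat set \<times> nat set \<Rightarrow>\<^sub>0 bit)"
  where "coneP p x = Lc p cone x + Rc p cone (Lc p (\<lambda>y. incl (proj y)) x)"

definition dh :: "nat \<Rightarrow> (nat set \<times> nat set \<Rightarrow>\<^sub>0 bit) \<Rightarrow> (nat set \<times> nat set \<Rightarrow>\<^sub>0 bit)"
  where "dh p x = cov (Suc p) (lft sh (rgt sh x))"

lemma P_simps [simp]: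
  "bdP p 0 = 0" "bdP p (x + y) = bdP p x + bdP p y"
  "projP p 0 = 0" "projP p (x + y) = projP p x + projP p y"
  "inclP p 0 = 0" "inclP p (x + y) = inclP p x + inclP p y"
  "coneP p 0 = 0" "coneP p (x + y) = coneP p x + coneP p y"
  "dh p 0 = 0" "dh p (x + y) = dh p x + dh p y"
  by (simp_all add: bdP_def projP_def inclP_def coneP_def dh_def ac_simps)

lemma swp_P: "swp (bdP p x) = bdP p (swp x)" "swp (projP p x) = projP p (swp x)"
  "swp (inclP p x) = inclP p (swp x)" "swp (dh p x) = dh p (swp x)"
  by (simp_all add: bdP_def projP_def inclP_def dh_def swp_Lc swp_Rc add.commute
    Rc_Lc shrinking_ops swp_cov swp_lft swp_rgt rgt_lft vlinear_sh)

lemma swp_Pc: "x \<in> Pc p k \<Longrightarrow> swp x \<in> Pc p k"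
  unfolding Pc_def by (rule swp_graded)

lemma Pc_add: "x \<in> Pc p k \<Longrightarrow> y \<in> Pc p k \<Longrightarrow> x + y \<in> Pc p k"
  unfolding Pc_def by (rule graded_add)

lemma Vc_add: "x \<in> Vc k p \<Longrightarrow> y \<in> Vc k p \<Longrightarrow> x + y \<in> Vc k p"
  unfolding Vc_def by (rule graded_add)

lemma Pc_0 [simp]: "0 \<in> Pc p k" and Vc_0 [simp]: "0 \<in> Vc k p"
  by (simp_all add: Pc_def Vc_def)

lemma bdP_Pc: "x \<in> Pc p k \<Longrightarrow> bdP p x \<in> Pc p (k - 1)"
proof -
  assume x: "x \<in> Pc p k"
  have "Lc p bd x \<in> Pc p (k + - 1)"
    using x bd_Sp unfolding Pc_def by (rule Lc_graded)
  moreover have "Rc p bd x \<in> Pc p (k + - 1)"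
    using x bd_Sp unfolding Pc_def by (rule Rc_graded)
  ultimately show ?thesis
    unfolding bdP_def by (simp add: Pc_add)
qed

lemma projP_Pc: "x \<in> Pc p k \<Longrightarrow> projP p x \<in> Vc k p"
proof -
  assume x: "x \<in> Pc p k"
  have "Rc p proj x \<in> graded p (Sp p) cd (Vp p) dg (k + 0)"
    using x proj_Sp unfolding Pc_def by (rule Rc_graded)
  then have "Lc p proj (Rc p proj x) \<in> graded p (Vp p) dg (Vp p) dg (k + 0 + 0)"
    using proj_Sp by (rule Lc_graded)
  then show ?thesis
    by (simp add: projP_def Vc_def)
qed

lemma inclP_Vc: "x \<in> Vc k p \<Longrightarrow> inclP p x \<in> Pc p k"
proof -
  assume x: "x \<in> Vc k p"
  have "Rc p incl x \<in> graded p (Vp p) dg (Sp p) cd (k + 0)"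
    using x incl_Vp unfolding Vc_def by (rule Rc_graded)
  then have "Lc p incl (Rc p incl x) \<in> graded p (Sp p) cd (Sp p) cd (k + 0 + 0)"
    using incl_Vp by (rule Lc_graded)
  then show ?thesis
    by (simp add: inclP_def Pc_def)
qed

lemma incl_proj_Sp: "A \<in> Sp p \<Longrightarrow> incl (proj (gen A)) \<in> vspan {A' \<in> Sp p. cd A' = cd A + 0}"
proof (rule vlinear_vspan[where f = incl, OF vlinear_ops(4)])
  assume "A \<in> Sp p"
  then show "proj (gen A) \<in> vspan {S \<in> Vp p. dg S = cd A + 0}"
    by (rule proj_Sp)
  fix S assume "S \<in> {S \<in> Vp p. dg S = cd A + 0}"
  then show "incl (gen S) \<in> vspan {A' \<in> Sp p. cd A' = cd A + 0}"
    using incl_Vp[of S p] by simp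
qed

lemma coneP_Pc: "x \<in> Pc p k \<Longrightarrow> coneP p x \<in> Pc p (k + 1)"
proof -
  assume x: "x \<in> Pc p k"
  have 1: "Lc p cone x \<in> Pc p (k + 1)"
    using x cone_Sp unfolding Pc_def by (rule Lc_graded)
  have 2: "Lc p (\<lambda>y. incl (proj y)) x \<in> Pc p (k + 0)"
    using x incl_proj_Sp unfolding Pc_def by (rule Lc_graded)
  then have "Rc p cone (Lc p (\<lambda>y. incl (proj y)) x) \<in> Pc p (k + 0 + 1)"
    using cone_Sp unfolding Pc_def by (rule Rc_graded)
  then have "Rc p cone (Lc p (\<lambda>y. incl (proj y)) x) \<in> Pc p (k + 1)"
    by simp
  with 1 show ?thesis
    unfolding coneP_def by (rule Pc_add)
qed

lemma projP_bdP:
  assumes "x \<in> Pc p k"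
  shows "projP p (bdP p x) = 0"
proof -
  note x = assms[unfolded Pc_def]
  have "Lc p (\<lambda>y. proj (bd y)) x = 0" "Rc p (\<lambda>y. proj (bd y)) x = 0"
    using Lc_zero[OF x, of "\<lambda>y. proj (bd y)"] Rc_zero[OF x, of "\<lambda>y. proj (bd y)"] proj_bd by auto
  moreover have "projP p (bdP p x) = Rc p proj (Lc p (\<lambda>y. proj (bd y)) x) + Lc p proj (Rc p (\<lambda>y. proj (bd y)) x)"
    by (simp add: projP_def bdP_def Rc_Rc shrinking_ops Rc_Lc Lc_Lc[symmetric])
  ultimately show ?thesis
    by simp
qed

lemma bdP_inclP:
  assumes "x \<in> Vc k p"
  shows "bdP p (inclP p x) = 0"
proof -
  note x = assms[unfolded Vc_def]
  have "Lc p (\<lambda>y. bd (incl y)) x = 0" "Rc p (\<lambda>y. bd (incl y)) x = 0"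
    using Lc_zero[OF x, of "\<lambda>y. bd (incl y)"] Rc_zero[OF x, of "\<lambda>y. bd (incl y)"] bd_incl by auto
  moreover have "bdP p (inclP p x) = Rc p incl (Lc p (\<lambda>y. bd (incl y)) x) + Lc p incl (Rc p (\<lambda>y. bd (incl y)) x)"
    by (simp add: inclP_def bdP_def Rc_Lc shrinking_ops Lc_Lc[symmetric] Rc_Rc[symmetric])
  ultimately show ?thesis
    by simp
qed

lemma projP_inclP:
  assumes "x \<in> Vc k p"
  shows "projP p (inclP p x) = x"
proof -
  note x = assms[unfolded Vc_def]
  have "projP p (inclP p x) = Lc p (\<lambda>y. proj (incl y)) (Rc p (\<lambda>y. proj (incl y)) x)"
    by (simp add: inclP_def projP_def Rc_Lc shrinking_ops Lc_Lc[symmetric] Rc_Rc[symmetric])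
  also have "Rc p (\<lambda>y. proj (incl y)) x = x"
    using proj_incl by (rule Rc_id[OF x])
  also have "Lc p (\<lambda>y. proj (incl y)) x = x"
    using proj_incl by (rule Lc_id[OF x])
  finally show ?thesis .
qed

lemma projP_coneP:
  assumes "x \<in> Pc p k"
  shows "projP p (coneP p x) = 0"
proof -
  note x = assms[unfolded Pc_def]
  have 2: "Lc p (\<lambda>y. incl (proj y)) x \<in> Pc p (k + 0)"
    using x incl_proj_Sp unfolding Pc_def by (rule Lc_graded)
  have "Lc p (\<lambda>y. proj (cone y)) x = 0" "Rc p (\<lambda>y. proj (cone y)) (Lc p (\<lambda>y. incl (proj y)) x) = 0"
    using Lc_zero[OF x, of "\<lambda>y. proj (cone y)"] Rc_zero[OF 2[unfolded Pc_def], of "\<lambda>y. proj (cone y)"] proj_cone by auto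
  moreover have "projP p (coneP p x) = Rc p proj (Lc p (\<lambda>y. proj (cone y)) x) +
      Lc p proj (Rc p (\<lambda>y. proj (cone y)) (Lc p (\<lambda>y. incl (proj y)) x))"
    by (simp add: projP_def coneP_def Rc_Rc[symmetric] shrinking_ops Rc_Lc Lc_Lc[symmetric])
  ultimately show ?thesis
    by simp
qed

lemma coneP_homotopy:
  assumes "x \<in> Pc p k"
  shows "bdP p (coneP p x) + coneP p (bdP p x) = x + inclP p (projP p x)"
proof -
  note x = assms[unfolded Pc_def]
  let ?h = "\<lambda>y. bd (cone y) + cone (bd y)"
  define q where "q = (\<lambda>y. incl (proj y))"
  have sh: "shrinking bd" "shrinking cone" "shrinking proj" "shrinking incl" "shrinking q"
    unfolding q_def by (simp_all add: shrinking_ops shrinking_comp[OF shrinking_ops(4,3)])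
  define w where "w = Lc p q x"
  have w: "w \<in> graded p (Sp p) cd (Sp p) cd (k + 0)"
    unfolding w_def q_def using x incl_proj_Sp by (rule Lc_graded)
  \<comment> \<open>The map q lands in cycles and kills boundaries, so both mixed terms of the
    homotopy formula vanish.\<close>
  have z: "Lc p bd w = 0" "Lc p q (Lc p bd x) = 0"
  proof -
    have "bd (q (gen A)) = 0" if "A \<in> Sp p" for A
      unfolding q_def
      using vlinear_eqI[where f = "\<lambda>y. bd (incl y)", OF _ vlinear_zero proj_Sp[OF that]] bd_incl
      by (auto simp: vlinear_def)
    then have "Lc p (\<lambda>y. bd (q y)) x = 0"
      by (rule Lc_zero[OF x])
    then show "Lc p bd w = 0"
      by (simp add: w_def Lc_Lc sh)
    have "Lc p (\<lambda>y. q (bd y)) x = 0"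
      using proj_bd by (intro Lc_zero[OF x]) (simp add: q_def)
    then show "Lc p q (Lc p bd x) = 0"
      by (simp add: Lc_Lc sh)
  qed
  have "bdP p (coneP p x) + coneP p (bdP p x) =
    Lc p bd (Lc p cone x) + Lc p cone (Lc p bd x)
    + (Rc p bd (Rc p cone w) + Rc p cone (Rc p bd w))
    + Rc p cone (Lc p bd w) + Rc p cone (Lc p q (Lc p bd x))"
    unfolding w_def q_def[symmetric]
    by (simp add: bdP_def coneP_def q_def[symmetric] Rc_Lc sh ac_simps)
  also have "\<dots> = Lc p ?h x + Rc p ?h w"
    using z by (simp add: Lc_Lc Rc_Rc sh) (simp add: Lc_def Rc_def lft_plus rgt_plus)
  also have "Lc p ?h x = Lc p (\<lambda>y. y + q y) x"
    using cone_homotopy unfolding q_def by (rule Lc_cong[OF x])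
  also have "\<dots> = x + w"
    using cov_graded[OF x] by (simp add: Lc_def lft_plus lft_id w_def)
  also have "Rc p ?h w = Rc p (\<lambda>y. y + q y) w"
    using cone_homotopy unfolding q_def by (rule Rc_cong[OF w])
  also have "\<dots> = w + Rc p q w"
    using cov_graded[OF w] by (simp add: Rc_def rgt_plus rgt_id)
  also have "Rc p q w = inclP p (projP p x)"
    unfolding w_def q_def
    by (simp add: inclP_def projP_def Lc_Lc[symmetric] Rc_Rc[symmetric] Rc_Lc sh)
  finally show ?thesis
    by (simp add: ac_simps)
qed

lemma dh_cov: "dh p (cov p x) = dh p x"
proof (rule cross_eqI[where f = "\<lambda>x. dh p (cov p x)" and g = "dh p"])
  show "vlinear (\<lambda>x. dh p (cov p x))" "vlinear (dh p)"
    by (auto simp: vlinear_def)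
  fix S T :: "nat set"
  have "covering p (S, T)" if "covering (Suc p) (Suc ` S, Suc ` T)"
    unfolding covering_def
  proof (clarify)
    fix j assume "j \<in> {1..p}" "j \<notin> T"
    moreover from this have "Suc j \<in> {1..Suc p}"
      by simp
    then have "Suc j \<in> Suc ` S \<union> Suc ` T"
      using that unfolding covering_def by blast
    ultimately show "j \<in> S"
      by auto
  qed
  then show "dh p (cov p (gen (S, T))) = dh p (gen (S, T))"
    by (auto simp: dh_def lft_gen rgt_gen sh_gen)
qed

lemma dh_bdP: "dh p (bdP p x) = bdP (Suc p) (dh p x)"
proof -
  have 1: "dh p (Lc p bd x) = Lc (Suc p) bd (dh p x)" for x
  proof -
    have "dh p (Lc p bd x) = cov (Suc p) (lft sh (lft bd (rgt sh x)))"
      by (simp add: Lc_def dh_cov) (simp add: dh_def rgt_lft vlinear_sh vlinear_ops)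
    also have "lft sh (lft bd (rgt sh x)) = lft bd (lft sh (rgt sh x))"
      by (simp add: lft_lft vlinear_sh vlinear_ops bd_sh)
    finally show ?thesis
      by (simp add: Lc_def dh_def shrinking_cov_lft shrinking_ops)
  qed
  have "swp (dh p (Lc p bd (swp x))) = swp (Lc (Suc p) bd (dh p (swp x)))"
    by (simp add: 1)
  then have "dh p (Rc p bd x) = Rc (Suc p) bd (dh p x)"
    by (simp add: swp_P swp_Lc)
  then show ?thesis
    by (simp add: bdP_def 1)
qed

lemma dh_Pc: "x \<in> Pc p k \<Longrightarrow> dh p x \<in> Pc (Suc p) k"
  unfolding Pc_def graded_def
proof (erule vlinear_vspan[rotated])
  show "vlinear (dh p)"
    by (auto simp: vlinear_def)
  have "Suc ` A \<in> Sp (Suc p)" "cd (Suc ` A) = cd A" if "A \<in> Sp p" for A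
    using that by (auto simp: Sp_def cd_def card_image)
  then show "dh p (gen b) \<in> vspan {(S, T). S \<in> Sp (Suc p) \<and> T \<in> Sp (Suc p) \<and> covering (Suc p) (S, T) \<and> cd S + cd T = k}"
    if "b \<in> {(S, T). S \<in> Sp p \<and> T \<in> Sp p \<and> covering p (S, T) \<and> cd S + cd T = k}" for b
    using that by (auto simp: dh_def lft_gen rgt_gen sh_gen)
qed

text \<open>This identifies the horizontal differential induced on vertical homology. The
  restrictions to covering pairs can be postponed to the end, and each factor then contributes the
  map computed in \<open>proj_sh_incl\<close>.\<close>

lemma projP_dh_inclP:
  assumes "x \<in> Vc k p"
  shows "projP (Suc p) (dh p (inclP p x)) = dG p x"
proof -
  have LR: "Lc q u (Rc q v y) = cov q (lft u (rgt v y))" if "shrinking u" for q u v y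
    using that by (simp add: Lc_def Rc_def shrinking_cov_lft)
  let ?u = "\<lambda>y. proj (sh (incl y))"
  have x: "x \<in> vspan (Vp p \<times> Vp p)"
    using assms unfolding Vc_def graded_def by (rule vspan_mono) auto
  have c: "cov q (lft u (rgt v (cov q y))) = cov q (lft u (rgt v y))" if "shrinking u" "shrinking v" for q u v y
    using that by (metis shrinking_cov_lft shrinking_cov_rgt)
  have "projP (Suc p) (dh p (inclP p x)) =
    cov (Suc p) (lft proj (rgt proj (lft sh (rgt sh (lft incl (rgt incl x))))))"
    by (simp add: projP_def inclP_def LR shrinking_ops dh_cov) (simp add: dh_def c shrinking_ops)
  also have "lft proj (rgt proj (lft sh (rgt sh (lft incl (rgt incl x))))) = lft ?u (rgt ?u x)"
    by (simp add: rgt_lft vlinear_ops vlinear_sh lft_lft rgt_rgt vlinear_comp)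
  also have "rgt ?u x = rgt dd x"
    using x proj_sh_incl by (rule rgt_cong)
  also have "lft ?u (rgt dd x) = lft dd (rgt dd x)"
  proof (rule lft_cong)
    show "rgt dd x \<in> vspan (Vp p \<times> UNIV)"
      using x by (rule rgt_vspan) simp
  qed (rule proj_sh_incl)
  finally show ?thesis
    by (simp add: dG_def)
qed

end

lemma TB_I: "v \<in> V (Suc n) \<Longrightarrow> u \<in> V n \<Longrightarrow> (i \<noteq> 0 \<Longrightarrow> swp u = u) \<Longrightarrow> v + swp v + dG n u \<in> TB V i (Suc n)"
  unfolding TB_def by auto

text \<open>F induces an isomorphism of the quotients. G is a section on the level of sets, so it
  may be obtained by choice.\<close>

lemma rank_transfer:
  assumes F_add: "\<And>x y. F (x + y) = F x + (F y :: 'b::plus)"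
    and Z_add: "\<And>x y. x \<in> Z \<Longrightarrow> y \<in> Z \<Longrightarrow> x + y \<in> (Z :: 'a::plus set)"
    and F: "\<And>x. x \<in> Z \<Longrightarrow> F x \<in> Z'" and G: "\<And>y. y \<in> Z' \<Longrightarrow> G y \<in> Z \<and> F (G y) = y"
    and B: "\<And>x. x \<in> Z \<Longrightarrow> x \<in> B \<longleftrightarrow> F x \<in> B'"
  shows "rank0 Z' B' \<Longrightarrow> rank0 Z B" "rank1 Z' B' \<Longrightarrow> rank1 Z B"
proof -
  show "rank0 Z' B' \<Longrightarrow> rank0 Z B"
    unfolding rank0_def using F B by blast
  assume "rank1 Z' B'"
  then obtain z where z: "z \<in> Z'" "z \<notin> B'" "\<And>w. w \<in> Z' \<Longrightarrow> w \<in> B' \<or> w + z \<in> B'"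
    unfolding rank1_def by blast
  note Gz = G[OF z(1)]
  have "x \<in> B \<or> x + G z \<in> B" if "x \<in> Z" for x
    using z(3)[OF F[OF that]] B[OF that] B[OF Z_add[OF that conjunct1[OF Gz]]] Gz F_add by simp
  moreover have "G z \<notin> B"
    using B[of "G z"] Gz z(2) by simp
  ultimately show "rank1 Z B"
    unfolding rank1_def using Gz by blast
qed

section \<open>From homotopy orbits to words\<close>

context bk
begin

text \<open>The component \<open>c i\<close> is the coefficient of \<open>e\<^sub>i\<close>.\<close>

definition Cw :: "nat \<Rightarrow> int \<Rightarrow> (nat \<Rightarrow> pairs) set"
  where "Cw p \<kappa> = {c. \<forall>i. c i \<in> Pc p (\<kappa> - int i)}"

definition DW :: "nat \<Rightarrow> (nat \<Rightarrow> pairs) \<Rightarrow> nat \<Rightarrow> pairs"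
  where "DW p c = (\<lambda>i. bdP p (c i) + (c (Suc i) + swp (c (Suc i))))"

definition dhW :: "nat \<Rightarrow> (nat \<Rightarrow> pairs) \<Rightarrow> nat \<Rightarrow> pairs"
  where "dhW p c = (\<lambda>i. dh p (c i))"

text \<open>Cycles of the first differential d^1, on the level of representatives: e witnesses that
  the horizontal image is zero in vertical homology. Likewise \<open>BC\<close> collects the zero
  classes and the image of d^1, so the first page itself is never formed.\<close>

definition ZC :: "nat \<Rightarrow> int \<Rightarrow> (nat \<Rightarrow> pairs) set"
  where "ZC p \<kappa> = {c \<in> Cw p \<kappa>. DW p c = 0 \<and> (\<exists>e\<in>Cw (Suc p) (\<kappa> + 1). dhW p c = DW (Suc p) e)}"

definition BC :: "nat \<Rightarrow> int \<Rightarrow> (nat \<Rightarrow> pairs) set"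
  where "BC p \<kappa> = {DW p e + (case p of 0 \<Rightarrow> 0 | Suc n \<Rightarrow> dhW n y) | e y.
    e \<in> Cw p (\<kappa> + 1) \<and> (case p of 0 \<Rightarrow> y = 0 | Suc n \<Rightarrow> y \<in> Cw n \<kappa> \<and> DW n y = 0)}"

definition ZV :: "nat \<Rightarrow> int \<Rightarrow> (nat \<Rightarrow> pairs) set"
  where "ZV p \<kappa> = {w. \<forall>i. w i \<in> TZ (Vc (\<kappa> - int i)) i p}"

definition BV :: "nat \<Rightarrow> int \<Rightarrow> (nat \<Rightarrow> pairs) set"
  where "BV p \<kappa> = {w. \<forall>i. w i \<in> TB (Vc (\<kappa> - int i)) i p}"

definition projW :: "nat \<Rightarrow> (nat \<Rightarrow> pairs) \<Rightarrow> nat \<Rightarrow> pairs"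
  where "projW p c = (\<lambda>i. projP p (c i))"

definition inclW :: "nat \<Rightarrow> (nat \<Rightarrow> pairs) \<Rightarrow> nat \<Rightarrow> pairs"
  where "inclW p c = (\<lambda>i. inclP p (c i))"

lemma W_add: "DW p (c + c') = DW p c + DW p c'" "dhW p (c + c') = dhW p c + dhW p c'"
  "projW p (c + c') = projW p c + projW p c'" "inclW p (c + c') = inclW p c + inclW p c'"
  by (simp_all add: DW_def dhW_def projW_def inclW_def fun_eq_iff ac_simps)

lemma Pc_neg: "x \<in> Pc p k \<Longrightarrow> k < 0 \<Longrightarrow> x = 0"
proof -
  assume "x \<in> Pc p k" "k < 0"
  then have "x \<in> vspan {}"
    unfolding Pc_def graded_def by (elim vspan_mono) (auto simp: cd_def)
  then show ?thesis
    by simp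
qed

lemma bd_bd: "A \<in> Sp p \<Longrightarrow> bd (bd (gen A)) = 0"
proof (erule Sp_cases)
  assume A: "gen A \<in> pure (card A)"
  then show ?thesis
    using pure_bd[OF del_pure[OF A]] pure_bd[OF A] pure_del_del[OF A] by auto
next
  fix y k assume y: "gen A = c0 y" "y \<in> pure k"
  show ?thesis
  proof (cases "Suc s < k")
    case True
    then have "s < k - 1" "s < k"
      by auto
    then show ?thesis
      using pure_bd_c0[OF del_pure[OF y(2)]] pure_bd_c0[OF y(2)] pure_bd[OF y(2)] pure_del_del[OF y(2)] True
      by (simp add: y(1))
  next
    case False
    then have "\<not> s < k - 1"
      by auto
    then show ?thesis
      using pure_bd_c0[OF del_pure[OF y(2)]] pure_bd_c0[OF y(2)] pure_bd[OF y(2)] False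
      by (simp add: y(1))
  qed
qed

lemma bdP_bdP:
  assumes "x \<in> Pc p k"
  shows "bdP p (bdP p x) = 0"
proof -
  note x = assms[unfolded Pc_def]
  have "Lc p (\<lambda>y. bd (bd y)) x = 0" "Rc p (\<lambda>y. bd (bd y)) x = 0"
    using Lc_zero[OF x, of "\<lambda>y. bd (bd y)"] Rc_zero[OF x, of "\<lambda>y. bd (bd y)"] bd_bd by auto
  then show ?thesis
    by (simp add: bdP_def Lc_Lc Rc_Rc Rc_Lc shrinking_ops)
qed

lemma Cw_add: "c \<in> Cw p \<kappa> \<Longrightarrow> c' \<in> Cw p \<kappa> \<Longrightarrow> c + c' \<in> Cw p \<kappa>"
  by (auto simp: Cw_def intro: Pc_add)

lemma Cw_0 [simp]: "0 \<in> Cw p \<kappa>"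
  by (simp add: Cw_def)

lemma W_0 [simp]: "DW p 0 = 0" "dhW p 0 = 0" "projW p 0 = 0" "inclW p 0 = 0"
  by (simp_all add: DW_def dhW_def projW_def inclW_def fun_eq_iff)

lemma DW_Cw: "c \<in> Cw p (\<kappa> + 1) \<Longrightarrow> DW p c \<in> Cw p \<kappa>"
  unfolding Cw_def DW_def
proof (safe)
  fix i assume c: "\<forall>i. c i \<in> Pc p (\<kappa> + 1 - int i)"
  have "bdP p (c i) \<in> Pc p (\<kappa> - int i)"
    using bdP_Pc[of "c i" p "\<kappa> + 1 - int i"] c by (simp add: algebra_simps)
  moreover have "c (Suc i) \<in> Pc p (\<kappa> - int i)"
    using c[rule_format, of "Suc i"] by simp
  ultimately show "bdP p (c i) + (c (Suc i) + swp (c (Suc i))) \<in> Pc p (\<kappa> - int i)"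
    by (intro Pc_add swp_Pc)
qed

lemma dhW_Cw: "c \<in> Cw p \<kappa> \<Longrightarrow> dhW p c \<in> Cw (Suc p) \<kappa>"
  by (auto simp: Cw_def dhW_def intro: dh_Pc)

lemma dhW_DW: "dhW p (DW p c) = DW (Suc p) (dhW p c)"
  by (simp add: dhW_def DW_def dh_bdP swp_P)

lemma DW_DW: "c \<in> Cw p \<kappa> \<Longrightarrow> DW p (DW p c) = 0"
proof
  fix i assume "c \<in> Cw p \<kappa>"
  then have "bdP p (bdP p (c i)) = 0"
    using bdP_bdP unfolding Cw_def by blast
  then show "DW p (DW p c) i = 0 i"
    by (simp add: DW_def swp_P ac_simps)
qed

lemma inclW_Cw: "(\<And>i. w i \<in> Vc (\<kappa> - int i) p) \<Longrightarrow> inclW p w \<in> Cw p \<kappa>"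
  by (auto simp: Cw_def inclW_def intro: inclP_Vc)

lemma projW_Vc: "c \<in> Cw p \<kappa> \<Longrightarrow> projW p c i \<in> Vc (\<kappa> - int i) p"
  by (auto simp: Cw_def projW_def intro: projP_Pc)

lemma projW_inclW: "(\<And>i. w i \<in> Vc (\<kappa> - int i) p) \<Longrightarrow> projW p (inclW p w) = w"
  unfolding projW_def inclW_def using projP_inclP by blast

lemma DW_inclW:
  assumes "\<And>i. w i \<in> Vc (\<kappa> - int i) p" "\<And>i. i \<noteq> 0 \<Longrightarrow> swp (w i) = w i"
  shows "DW p (inclW p w) = 0"
proof
  fix i
  have "bdP p (inclP p (w i)) = 0"
    using bdP_inclP assms(1) by blast
  then show "DW p (inclW p w) i = 0 i"
    using assms(2)[of "Suc i"] by (simp add: DW_def inclW_def swp_P)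
qed

lemma projW_DW: "c \<in> Cw p \<kappa> \<Longrightarrow> projW p (DW p c) i = projW p c (Suc i) + swp (projW p c (Suc i))"
  unfolding Cw_def projW_def DW_def using projP_bdP by (simp add: swp_P) blast

text \<open>Since \<open>coneP\<close> does not commute with the swap, it is not applied to all
  components at once. The highest nonzero component is a \<open>bdP\<close>-cycle by itself and is
  coned off; this alters only lower components, whence the induction on M.\<close>

lemma kernel_acyclic:
  assumes "c \<in> Cw p \<kappa>" "DW p c = 0" "projW p c = 0"
  shows "\<exists>e\<in>Cw p (\<kappa> + 1). c = DW p e"
proof -
  have "\<forall>c. c \<in> Cw p \<kappa> \<longrightarrow> DW p c = 0 \<longrightarrow> projW p c = 0 \<longrightarrow> (\<forall>i\<ge>M. c i = 0) \<longrightarrow> (\<exists>e\<in>Cw p (\<kappa> + 1). c = DW p e)" for M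
  proof (induction M)
    case 0
    show ?case
    proof (intro allI impI)
      fix c :: "nat \<Rightarrow> pairs" assume "\<forall>i\<ge>0. c i = 0"
      then have "c = 0"
        by (auto simp: fun_eq_iff)
      then show "\<exists>e\<in>Cw p (\<kappa> + 1). c = DW p e"
        by (intro bexI[of _ 0]) auto
    qed
  next
    case (Suc M)
    show ?case
    proof (intro allI impI)
      fix c :: "nat \<Rightarrow> pairs"
      assume c: "c \<in> Cw p \<kappa>" "DW p c = 0" "projW p c = 0" "\<forall>i\<ge>Suc M. c i = 0"
      have cM: "c M \<in> Pc p (\<kappa> - int M)"
        using c(1) by (simp add: Cw_def)
      define y where "y = coneP p (c M)"
      define e where "e = (\<lambda>i. if i = M then y else 0)"
      have y: "y \<in> Pc p (\<kappa> + 1 - int M)"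
        using coneP_Pc[OF cM] by (simp add: y_def algebra_simps)
      have "bdP p (c M) = 0" "projP p (c M) = 0"
        using fun_cong[OF c(2), of M] fun_cong[OF c(3), of M] c(4) by (simp_all add: DW_def projW_def)
      then have bdy: "bdP p y = c M"
        using coneP_homotopy[OF cM] by (simp add: y_def)
      have e: "e \<in> Cw p (\<kappa> + 1)"
        using y by (auto simp: e_def Cw_def)
      have "projW p e = 0"
        using projP_coneP[OF cM] by (auto simp: fun_eq_iff e_def projW_def y_def)
      then have "projW p (DW p e) = 0"
        using projW_DW[OF e] by (simp add: fun_eq_iff)
      moreover have "(c + DW p e) i = 0" if "M \<le> i" for i
        using that c(4) bdy by (cases "i = M") (auto simp: DW_def e_def)
      ultimately obtain e' where e': "e' \<in> Cw p (\<kappa> + 1)" "c + DW p e = DW p e'"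
        using Suc.IH[rule_format, of "c + DW p e"] c e DW_DW[OF e] DW_Cw[OF e] Cw_add by (auto simp: W_add)
      have "c = DW p (e' + e)"
        unfolding W_add e'(2)[symmetric] by (simp add: add.assoc)
      then show "\<exists>e\<in>Cw p (\<kappa> + 1). c = DW p e"
        using Cw_add[OF e'(1) e] by blast
    qed
  qed
  \<comment> \<open>Component i has vertex count \<kappa> - i, which cannot be negative; so every
    element of \<open>Cw\<close> has only finitely many nonzero components and the induction
    applies.\<close>
  moreover have "c i = 0" if "i \<ge> nat (\<kappa> + 1)" for i
    using Pc_neg[of "c i" p "\<kappa> - int i"] assms(1) that by (simp add: Cw_def)
  ultimately show ?thesis
    using assms by blast
qed

lemma cycle_projW:
  assumes "c \<in> Cw p \<kappa>" "DW p c = 0" "i \<noteq> 0"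
  shows "swp (projW p c i) = projW p c i"
proof -
  obtain j where "i = Suc j"
    using assms(3) not0_implies_Suc by blast
  moreover have "projW p c (Suc j) + swp (projW p c (Suc j)) = 0"
    using projW_DW[OF assms(1), of j] assms(2) by simp
  ultimately show ?thesis
    by (simp add: add_eq_0_iff_char2)
qed

text \<open>The difference of c and the inclusion of its projection is a cycle with projection zero,
  to which \<open>kernel_acyclic\<close> applies.\<close>

lemma cycle_decomposition:
  assumes "c \<in> Cw p \<kappa>" "DW p c = 0"
  obtains e where "e \<in> Cw p (\<kappa> + 1)" "c = inclW p (projW p c) + DW p e"
proof -
  let ?w = "projW p c"
  have w: "?w i \<in> Vc (\<kappa> - int i) p" for i
    using assms(1) by (rule projW_Vc)
  have "projW p (c + inclW p ?w) = 0"
    by (simp add: W_add projW_inclW[OF w])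
  moreover have "DW p (c + inclW p ?w) = 0"
    using DW_inclW[OF w cycle_projW[OF assms]] assms(2) by (simp add: W_add)
  ultimately obtain e where "e \<in> Cw p (\<kappa> + 1)" "c + inclW p ?w = DW p e"
    using kernel_acyclic[OF Cw_add[OF assms(1) inclW_Cw[OF w]]] by blast
  then show ?thesis
    using that[of e] by (metis add.commute add_self_left)
qed

text \<open>On the vertical homology of the components \<open>bdP\<close> is zero, and all that
  remains of \<open>DW\<close> is the norm from component i + 1 to component i.\<close>

lemma boundary_iff:
  assumes "c \<in> Cw p \<kappa>" "DW p c = 0"
  shows "(\<exists>e\<in>Cw p (\<kappa> + 1). c = DW p e) \<longleftrightarrow> (\<forall>i. \<exists>v\<in>Vc (\<kappa> - int i) p. projW p c i = v + swp v)"
proof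
  assume "\<exists>e\<in>Cw p (\<kappa> + 1). c = DW p e"
  then obtain e where e: "e \<in> Cw p (\<kappa> + 1)" "c = DW p e"
    by blast
  have "projW p e (Suc i) \<in> Vc (\<kappa> - int i) p" for i
    using projW_Vc[OF e(1), of "Suc i"] by simp
  then show "\<forall>i. \<exists>v\<in>Vc (\<kappa> - int i) p. projW p c i = v + swp v"
    using projW_DW[OF e(1)] e(2) by blast
next
  assume "\<forall>i. \<exists>v\<in>Vc (\<kappa> - int i) p. projW p c i = v + swp v"
  then obtain v where v: "\<And>i. v i \<in> Vc (\<kappa> - int i) p" "\<And>i. projW p c i = v i + swp (v i)"
    by metis
  \<comment> \<open>The norm of \<open>v i\<close> comes from component i + 1, so v is shifted up by
    one and u starts with 0.\<close>
  define u where "u = (\<lambda>i. case i of 0 \<Rightarrow> 0 | Suc j \<Rightarrow> v j)"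
  have u: "u i \<in> Vc (\<kappa> + 1 - int i) p" for i
    using v(1) by (cases i) (auto simp: u_def)
  obtain e where e: "e \<in> Cw p (\<kappa> + 1)" "c = inclW p (projW p c) + DW p e"
    using assms by (rule cycle_decomposition)
  have "DW p (inclW p u) = inclW p (projW p c)"
  proof
    fix i
    have "bdP p (inclP p (u i)) = 0"
      using bdP_inclP[OF u] .
    then show "DW p (inclW p u) i = inclW p (projW p c) i"
      by (simp add: DW_def inclW_def v(2) swp_P) (simp add: u_def)
  qed
  then have "c = DW p (inclW p u + e)"
    using e(2) by (simp add: W_add)
  then show "\<exists>e\<in>Cw p (\<kappa> + 1). c = DW p e"
    using Cw_add[OF inclW_Cw[OF u] e(1)] by blast
qed

lemma projW_dhW_inclW: "(\<And>i. w i \<in> Vc (\<kappa> - int i) p) \<Longrightarrow> projW (Suc p) (dhW p (inclW p w)) = (\<lambda>i. dG p (w i))"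
  unfolding projW_def inclW_def dhW_def using projP_dh_inclP by blast

text \<open>A cycle is the inclusion of its projection up to a vertical boundary. On inclusions the
  induced map is \<open>dG\<close>, and the horizontal image of the vertical boundary projects to a
  norm.\<close>

lemma projW_dhW:
  assumes "c \<in> Cw p \<kappa>" "DW p c = 0"
  shows "\<exists>v\<in>Vc (\<kappa> - int i) (Suc p). projW (Suc p) (dhW p c) i = dG p (projW p c i) + (v + swp v)"
proof -
  obtain e where e: "e \<in> Cw p (\<kappa> + 1)" "c = inclW p (projW p c) + DW p e"
    using assms by (rule cycle_decomposition)
  let ?v = "projW (Suc p) (dhW p e) (Suc i)"
  have "projW (Suc p) (dhW p (inclW p (projW p c) + DW p e)) =
    projW (Suc p) (dhW p (inclW p (projW p c))) + projW (Suc p) (DW (Suc p) (dhW p e))"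
    by (simp only: W_add dhW_DW)
  then have "projW (Suc p) (dhW p c) =
    projW (Suc p) (dhW p (inclW p (projW p c))) + projW (Suc p) (DW (Suc p) (dhW p e))"
    using e(2) by simp
  then have "projW (Suc p) (dhW p c) i =
    projW (Suc p) (dhW p (inclW p (projW p c))) i + projW (Suc p) (DW (Suc p) (dhW p e)) i"
    by simp
  then have "projW (Suc p) (dhW p c) i = dG p (projW p c i) + (?v + swp ?v)"
    unfolding projW_DW[OF dhW_Cw[OF e(1)]] projW_dhW_inclW[OF projW_Vc[OF assms(1)]] .
  moreover have "?v \<in> Vc (\<kappa> - int i) (Suc p)"
    using projW_Vc[OF dhW_Cw[OF e(1)], of "Suc i"] by simp
  ultimately show ?thesis
    by (rule bexI)
qed

lemma dhW_boundary_iff: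
  assumes "c \<in> Cw p \<kappa>" "DW p c = 0"
  shows "(\<exists>e\<in>Cw (Suc p) (\<kappa> + 1). dhW p c = DW (Suc p) e) \<longleftrightarrow>
    (\<forall>i. \<exists>v\<in>Vc (\<kappa> - int i) (Suc p). dG p (projW p c i) = v + swp v)"
proof -
  have "DW (Suc p) (dhW p c) = 0"
    using assms(2) by (simp add: dhW_DW[symmetric])
  note iff = boundary_iff[OF dhW_Cw[OF assms(1)] this]
  have "(\<exists>v\<in>Vc (\<kappa> - int i) (Suc p). projW (Suc p) (dhW p c) i = v + swp v) \<longleftrightarrow>
    (\<exists>v\<in>Vc (\<kappa> - int i) (Suc p). dG p (projW p c i) = v + swp v)" for i
  proof -
    obtain u where u: "u \<in> Vc (\<kappa> - int i) (Suc p)" "projW (Suc p) (dhW p c) i = dG p (projW p c i) + (u + swp u)"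
      using projW_dhW[OF assms] by blast
    show ?thesis
    proof
      assume "\<exists>v\<in>Vc (\<kappa> - int i) (Suc p). projW (Suc p) (dhW p c) i = v + swp v"
      then obtain v where v: "v \<in> Vc (\<kappa> - int i) (Suc p)" "projW (Suc p) (dhW p c) i = v + swp v"
        by blast
      have "dG p (projW p c i) = (v + u) + swp (v + u)"
        using u(2) unfolding v(2) by (rule char2_eqI) (simp add: ac_simps)
      then show "\<exists>v\<in>Vc (\<kappa> - int i) (Suc p). dG p (projW p c i) = v + swp v"
        using Vc_add[OF v(1) u(1)] by blast
    next
      assume "\<exists>v\<in>Vc (\<kappa> - int i) (Suc p). dG p (projW p c i) = v + swp v"
      then obtain v where v: "v \<in> Vc (\<kappa> - int i) (Suc p)" "dG p (projW p c i) = v + swp v"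
        by blast
      have "projW (Suc p) (dhW p c) i = (v + u) + swp (v + u)"
        using u(2) unfolding v(2) by (simp add: ac_simps)
      then show "\<exists>v\<in>Vc (\<kappa> - int i) (Suc p). projW (Suc p) (dhW p c) i = v + swp v"
        using Vc_add[OF v(1) u(1)] by blast
    qed
  qed
  then show ?thesis
    using iff by simp
qed

lemma ZC_iff: "c \<in> Cw p \<kappa> \<Longrightarrow> DW p c = 0 \<Longrightarrow> c \<in> ZC p \<kappa> \<longleftrightarrow> projW p c \<in> ZV p \<kappa>"
  unfolding ZC_def ZV_def TZ_def using dhW_boundary_iff[of c p \<kappa>] projW_Vc[of c p \<kappa>] cycle_projW[of c p \<kappa>] by auto

lemma ZV_D: "w \<in> ZV p \<kappa> \<Longrightarrow> w i \<in> Vc (\<kappa> - int i) p" "w \<in> ZV p \<kappa> \<Longrightarrow> i \<noteq> 0 \<Longrightarrow> swp (w i) = w i"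
  by (auto simp: ZV_def TZ_def)

lemma inclW_ZC:
  assumes "w \<in> ZV p \<kappa>"
  shows "inclW p w \<in> ZC p \<kappa> \<and> projW p (inclW p w) = w"
proof -
  note w = ZV_D[OF assms]
  have "inclW p w \<in> Cw p \<kappa>" "DW p (inclW p w) = 0" "projW p (inclW p w) = w"
    using inclW_Cw[of w \<kappa> p] DW_inclW[of w \<kappa> p] projW_inclW[of w \<kappa> p] w by simp_all
  then show ?thesis
    using ZC_iff assms by simp
qed

lemma BC_iff:
  assumes "c \<in> ZC p \<kappa>"
  shows "c \<in> BC p \<kappa> \<longleftrightarrow> projW p c \<in> BV p \<kappa>"
proof
  assume "c \<in> BC p \<kappa>"
  then obtain e y where ey: "c = DW p e + (case p of 0 \<Rightarrow> 0 | Suc n \<Rightarrow> dhW n y)" "e \<in> Cw p (\<kappa> + 1)"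
    "case p of 0 \<Rightarrow> y = 0 | Suc n \<Rightarrow> y \<in> Cw n \<kappa> \<and> DW n y = 0"
    unfolding BC_def by blast
  have "projW p c i \<in> TB (Vc (\<kappa> - int i)) i p" for i
  proof (cases p)
    case 0
    then have "projW p c i = projW p e (Suc i) + swp (projW p e (Suc i))"
      using ey projW_DW[OF ey(2)] by simp
    then show ?thesis
      using TB_norm[of "projW p e (Suc i)" "Vc (\<kappa> - int i)"] projW_Vc[OF ey(2), of "Suc i"] by simp
  next
    case (Suc n)
    then have y: "y \<in> Cw n \<kappa>" "DW n y = 0"
      using ey(3) by auto
    obtain v where v: "v \<in> Vc (\<kappa> - int i) (Suc n)" "projW (Suc n) (dhW n y) i = dG n (projW n y i) + (v + swp v)"
      using projW_dhW[OF y] by blast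
    let ?u = "projW p e (Suc i)"
    have "projW p c i = (?u + v) + swp (?u + v) + dG n (projW n y i)"
      using projW_DW[OF ey(2)] v(2) by (simp add: ey(1) Suc W_add ac_simps)
    moreover have "?u + v \<in> Vc (\<kappa> - int i) p"
      using projW_Vc[OF ey(2), of "Suc i"] v(1) Suc by (intro Vc_add) auto
    ultimately show ?thesis
      using TB_I[of "?u + v" "Vc (\<kappa> - int i)" n "projW n y i" i] projW_Vc[OF y(1), of i] cycle_projW[OF y, of i] Suc
      by simp
  qed
  then show "projW p c \<in> BV p \<kappa>"
    by (simp add: BV_def)
next
  assume "projW p c \<in> BV p \<kappa>"
  then have "\<forall>i. \<exists>v u. projW p c i = v + swp v + (case p of 0 \<Rightarrow> 0 | Suc n \<Rightarrow> dG n u) \<and> v \<in> Vc (\<kappa> - int i) p \<and>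
    (case p of 0 \<Rightarrow> u = 0 | Suc n \<Rightarrow> u \<in> Vc (\<kappa> - int i) n) \<and> (i \<noteq> 0 \<longrightarrow> swp u = u)"
    unfolding BV_def TB_def by blast
  then obtain v u where vu: "\<And>i. projW p c i = v i + swp (v i) + (case p of 0 \<Rightarrow> 0 | Suc n \<Rightarrow> dG n (u i))"
    "\<And>i. v i \<in> Vc (\<kappa> - int i) p" "\<And>i. case p of 0 \<Rightarrow> u i = 0 | Suc n \<Rightarrow> u i \<in> Vc (\<kappa> - int i) n"
    "\<And>i. i \<noteq> 0 \<Longrightarrow> swp (u i) = u i"
    by metis
  have c: "c \<in> Cw p \<kappa>" "DW p c = 0"
    using assms by (auto simp: ZC_def)
  show "c \<in> BC p \<kappa>"
  proof (cases p)
    case 0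
    then have "\<exists>e\<in>Cw p (\<kappa> + 1). c = DW p e"
      unfolding boundary_iff[OF c] using vu by auto
    then show ?thesis
      unfolding BC_def using 0 by auto
  next
    case (Suc n)
    \<comment> \<open>The invariance of \<open>u i\<close> for i > 0, demanded in \<open>TB\<close>,
      is what makes this inclusion a vertical cycle.\<close>
    let ?y = "inclW n u"
    have u: "u i \<in> Vc (\<kappa> - int i) n" for i
      using vu(3)[of i] Suc by simp
    have y: "?y \<in> Cw n \<kappa>" "DW n ?y = 0"
      using inclW_Cw[OF u] DW_inclW[OF u vu(4)] by auto
    have "projW p (c + dhW n ?y) i = v i + swp (v i)" for i
      using vu(1)[of i] projW_dhW_inclW[OF u] Suc by (simp add: W_add add.assoc)
    moreover have "c + dhW n ?y \<in> Cw p \<kappa>" "DW p (c + dhW n ?y) = 0"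
      using Cw_add[OF c(1)] dhW_Cw[OF y(1)] Suc c(2) dhW_DW[of n ?y] y(2) by (auto simp: W_add)
    ultimately obtain e where e: "e \<in> Cw p (\<kappa> + 1)" "c + dhW n ?y = DW p e"
      using boundary_iff[of "c + dhW n ?y" p \<kappa>] vu(2) by blast
    have "c = DW p e + dhW n ?y"
      unfolding e(2)[symmetric] by (simp add: add.assoc)
    then show ?thesis
      unfolding BC_def using e(1) y Suc by auto
  qed
qed

lemma ZC_add: "c \<in> ZC p \<kappa> \<Longrightarrow> c' \<in> ZC p \<kappa> \<Longrightarrow> c + c' \<in> ZC p \<kappa>"
  unfolding ZC_def using Cw_add by (auto simp: W_add) (metis W_add(1))

lemma rank_ZC:
  "rank0 (ZV p \<kappa>) (BV p \<kappa>) \<Longrightarrow> rank0 (ZC p \<kappa>) (BC p \<kappa>)"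
  "rank1 (ZV p \<kappa>) (BV p \<kappa>) \<Longrightarrow> rank1 (ZC p \<kappa>) (BC p \<kappa>)"
proof -
  have *: "projW p c \<in> ZV p \<kappa>" if "c \<in> ZC p \<kappa>" for c
    using that ZC_iff[of c p \<kappa>] by (auto simp: ZC_def)
  note tr = rank_transfer[where F = "projW p" and G = "inclW p", OF W_add(3) ZC_add * inclW_ZC BC_iff]
  show "rank0 (ZV p \<kappa>) (BV p \<kappa>) \<Longrightarrow> rank0 (ZC p \<kappa>) (BC p \<kappa>)"
    "rank1 (ZV p \<kappa>) (BV p \<kappa>) \<Longrightarrow> rank1 (ZC p \<kappa>) (BC p \<kappa>)"
    using tr by blast+
qed

section \<open>The degrees in which each type of sizes occurs\<close>

lemma Vc_conv: "Vc k p = vspan {(S, T). S \<union> T = {1..p} \<and> (card S = s \<or> enat (card S) = b) \<and>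
    (card T = s \<or> enat (card T) = b) \<and> dg S + dg T = k}"
  unfolding Vc_def graded_def by (rule arg_cong[where f = vspan]) (auto simp: Vp_def covering_def)

lemma dg_cases: "card S = s \<or> enat (card S) = b \<Longrightarrow>
  card S = s \<and> dg S = int (Suc s) \<or> enat (card S) = b \<and> dg S = int (card S) \<and> Suc s < card S"
  using b_eq by (auto simp: dg_def)

lemma Vc_square: "Vc (2 * int (Suc s)) = (\<lambda>p. G2 p s s)"
proof -
  have "(card S = s \<or> enat (card S) = b) \<and> (card T = s \<or> enat (card T) = b) \<and> dg S + dg T = 2 * int (Suc s)
    \<longleftrightarrow> card S = s \<and> card T = s" for S T
    using dg_cases[of S] dg_cases[of T] by (auto simp: dg_def)
  then show ?thesis
    unfolding Vc_conv[abs_def] G2_def by simp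
qed

lemma Vc_mixed:
  assumes "b = enat \<beta>"
  shows "Vc (int (Suc s) + int \<beta>) = Gmix s \<beta>"
proof -
  have "(card S = s \<or> enat (card S) = b) \<and> (card T = s \<or> enat (card T) = b) \<and> dg S + dg T = int (Suc s) + int \<beta>
    \<longleftrightarrow> card S = s \<and> card T = \<beta> \<or> card S = \<beta> \<and> card T = s" for S T
    using dg_cases[of S] dg_cases[of T] b_eq[of \<beta>] assms by (auto simp: dg_def)
  then show ?thesis
    unfolding Vc_conv[abs_def] Gmix_def[abs_def] by simp
qed

lemma Vc_square':
  assumes "b = enat \<beta>"
  shows "Vc (2 * int \<beta>) = (\<lambda>p. G2 p \<beta> \<beta>)"
proof -
  have "(card S = s \<or> enat (card S) = b) \<and> (card T = s \<or> enat (card T) = b) \<and> dg S + dg T = 2 * int \<beta>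
    \<longleftrightarrow> card S = \<beta> \<and> card T = \<beta>" for S T
    using dg_cases[of S] dg_cases[of T] b_eq[of \<beta>] assms by (auto simp: dg_def)
  then show ?thesis
    unfolding Vc_conv[abs_def] G2_def by simp
qed

lemma Vc_zero:
  assumes "k \<noteq> 2 * int (Suc s)" "\<And>\<beta>. b = enat \<beta> \<Longrightarrow> k \<noteq> int (Suc s) + int \<beta> \<and> k \<noteq> 2 * int \<beta>" "x \<in> Vc k p"
  shows "x = 0"
proof -
  have False if "card S = s \<or> enat (card S) = b" "card T = s \<or> enat (card T) = b" "dg S + dg T = k" for S T
  proof -
    have "k \<noteq> int (Suc s) + int (card U) \<and> k \<noteq> int (card U) + int (card U)" if "enat (card U) = b" for U :: "nat set"
      using assms(2)[of "card U"] that by simp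
    moreover have "card S = card T" if "enat (card S) = b" "enat (card T) = b"
      using that by (metis enat.inject)
    ultimately show False
      using dg_cases[OF that(1)] dg_cases[OF that(2)] that(3) assms(1) by (metis add.commute mult_2)
  qed
  then have "{(S, T). S \<union> T = {1..p} \<and> (card S = s \<or> enat (card S) = b) \<and>
    (card T = s \<or> enat (card T) = b) \<and> dg S + dg T = k} = {}"
    by blast
  then show ?thesis
    using assms(3) unfolding Vc_conv by (simp only: vspan_empty)
qed

text \<open>The alternatives are the size types (s, s), mixed and (b, b); positive i occur only in
  the columns of diagonal pairs.\<close>

definition active :: "nat \<Rightarrow> int \<Rightarrow> nat \<Rightarrow> bool"
  where "active p k i \<longleftrightarrow> k = 2 * int (Suc s) \<and> (if i = 0 then s \<le> p \<and> p \<le> 2 * s else p = s)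
    \<or> (\<exists>\<beta>. b = enat \<beta> \<and> (k = int (Suc s) + int \<beta> \<and> i = 0 \<and> p = s + \<beta>
      \<or> k = 2 * int \<beta> \<and> (if i = 0 then \<beta> \<le> p \<and> p \<le> 2 * \<beta> else p = \<beta>)))"

lemma rank_T:
  "active p k i \<Longrightarrow> rank1 (TZ (Vc k) i p) (TB (Vc k) i p)"
  "\<not> active p k i \<Longrightarrow> rank0 (TZ (Vc k) i p) (TB (Vc k) i p)"
proof -
  consider (ss) "k = 2 * int (Suc s)" | (mix) \<beta> where "b = enat \<beta>" "k = int (Suc s) + int \<beta>"
    | (bb) \<beta> where "b = enat \<beta>" "k = 2 * int \<beta>"
    | (none) "k \<noteq> 2 * int (Suc s)" "\<And>\<beta>. b = enat \<beta> \<Longrightarrow> k \<noteq> int (Suc s) + int \<beta> \<and> k \<noteq> 2 * int \<beta>"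
    by blast
  then have "(active p k i \<longrightarrow> rank1 (TZ (Vc k) i p) (TB (Vc k) i p)) \<and>
    (\<not> active p k i \<longrightarrow> rank0 (TZ (Vc k) i p) (TB (Vc k) i p))"
  proof cases
    case ss
    have "active p k i \<longleftrightarrow> (if i = 0 then s \<le> p \<and> p \<le> 2 * s else p = s)"
      using ss b_eq unfolding active_def by fastforce
    then show ?thesis
      unfolding ss Vc_square using rank_square[of s p] rank_square_diagonal[of s i] rank_square_0[of i p s] by (auto split: if_splits)
  next
    case mix
    have \<beta>: "Suc s < \<beta>"
      using b_eq mix(1) by simp
    then have "active p k i \<longleftrightarrow> i = 0 \<and> p = s + \<beta>"
      using mix unfolding active_def by auto
    then show ?thesis
      unfolding mix(2) Vc_mixed[OF mix(1)] using rank_mixed[of s \<beta>] rank_mixed_0[of s \<beta> i p] \<beta> by auto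
  next
    case bb
    have \<beta>: "Suc s < \<beta>"
      using b_eq bb(1) by simp
    then have "active p k i \<longleftrightarrow> (if i = 0 then \<beta> \<le> p \<and> p \<le> 2 * \<beta> else p = \<beta>)"
      using bb unfolding active_def by auto
    then show ?thesis
      unfolding bb(2) Vc_square'[OF bb(1)]
      using rank_square[of \<beta> p] rank_square_diagonal[of \<beta> i] rank_square_0[of i p \<beta>] by (auto split: if_splits)
  next
    case none
    then have "\<not> active p k i"
      unfolding active_def by blast
    moreover have "TZ (Vc k) i p \<subseteq> TB (Vc k) i p"
      using Vc_zero[OF none] TB_norm[of 0 "Vc k"] by (auto simp: TZ_def)
    ultimately show ?thesis
      by (simp add: rank0_def)
  qed
  then show "active p k i \<Longrightarrow> rank1 (TZ (Vc k) i p) (TB (Vc k) i p)"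
    "\<not> active p k i \<Longrightarrow> rank0 (TZ (Vc k) i p) (TB (Vc k) i p)"
    by blast+
qed

text \<open>Different i with the same \<kappa> belong to different size types, and one i is
  positive. It forces column s, where only (s, s) occurs, or column b with type (b, b), whose degree
  already exceeds that of the other types at i = 0.\<close>

lemma active_unique:
  assumes "active p (\<kappa> - int i) i" "active p (\<kappa> - int j) j"
  shows "i = j"
proof (cases "\<exists>\<beta>. b = enat \<beta>")
  case True
  then obtain \<beta> where \<beta>: "b = enat \<beta>"
    by blast
  have *: "k = 2 * int (Suc s) \<and> (i \<noteq> 0 \<longrightarrow> p = s) \<or> k = int (Suc s) + int \<beta> \<and> i = 0 \<and> p = s + \<beta>
    \<or> k = 2 * int \<beta> \<and> \<beta> \<le> p" if "active p k i" for k i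
    using that \<beta> unfolding active_def by (auto split: if_splits)
  have "Suc s < \<beta>"
    using b_eq \<beta> by simp
  then show ?thesis
    using *[OF assms(1)] *[OF assms(2)] by (elim disjE conjE; cases "i = 0"; cases "j = 0"; auto)
next
  case False
  then show ?thesis
    using assms unfolding active_def by auto
qed

lemma TZ_0: "0 \<in> TZ (Vc k) i p" and TB_0: "0 \<in> TB (Vc k) i p"
  using TB_norm[of 0 "Vc k"] by (auto simp: TZ_def intro!: bexI[of _ 0])

theorem rank_C:
  "(\<exists>i. active p (\<kappa> - int i) i) \<Longrightarrow> rank1 (ZC p \<kappa>) (BC p \<kappa>)"
  "\<not> (\<exists>i. active p (\<kappa> - int i) i) \<Longrightarrow> rank0 (ZC p \<kappa>) (BC p \<kappa>)"
proof -
  assume "\<exists>i. active p (\<kappa> - int i) i"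
  then obtain i where i: "active p (\<kappa> - int i) i"
    by blast
  then obtain z where z: "z \<in> TZ (Vc (\<kappa> - int i)) i p" "z \<notin> TB (Vc (\<kappa> - int i)) i p"
    "\<And>w. w \<in> TZ (Vc (\<kappa> - int i)) i p \<Longrightarrow> w \<in> TB (Vc (\<kappa> - int i)) i p \<or> w + z \<in> TB (Vc (\<kappa> - int i)) i p"
    using rank_T(1) unfolding rank1_def by blast
  have other: "TZ (Vc (\<kappa> - int j)) j p \<subseteq> TB (Vc (\<kappa> - int j)) j p" if "j \<noteq> i" for j
    using rank_T(2)[of p "\<kappa> - int j" j] active_unique[OF i, of j] that unfolding rank0_def by blast
  \<comment> \<open>In all other components cycles are boundaries, so the generator can be
    concentrated in component i.\<close>
  let ?z = "\<lambda>j. if j = i then z else 0"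
  have "?z \<in> ZV p \<kappa>" "?z \<notin> BV p \<kappa>"
    using z TZ_0 by (auto simp: ZV_def BV_def)
  moreover have "w \<in> BV p \<kappa> \<or> w + ?z \<in> BV p \<kappa>" if w: "w \<in> ZV p \<kappa>" for w
  proof -
    have "w i \<in> TB (Vc (\<kappa> - int i)) i p \<or> w i + z \<in> TB (Vc (\<kappa> - int i)) i p"
      using w z(3) by (auto simp: ZV_def)
    moreover have "w j \<in> TB (Vc (\<kappa> - int j)) j p" if "j \<noteq> i" for j
      using w other[OF that] by (auto simp: ZV_def)
    ultimately show ?thesis
      by (auto simp: BV_def) metis+
  qed
  ultimately have "rank1 (ZV p \<kappa>) (BV p \<kappa>)"
    unfolding rank1_def by blast
  then show "rank1 (ZC p \<kappa>) (BC p \<kappa>)"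
    by (rule rank_ZC)
next
  assume "\<not> (\<exists>i. active p (\<kappa> - int i) i)"
  then have "rank0 (ZV p \<kappa>) (BV p \<kappa>)"
    using rank_T(2) unfolding rank0_def ZV_def BV_def by blast
  then show "rank0 (ZC p \<kappa>) (BC p \<kappa>)"
    by (rule rank_ZC)
qed

end

section \<open>Coordinates on vector spaces\<close>

text \<open>In an abelian group of exponent two elements are their own inverses, so inverses need
  not be mentioned; the scalars are left to \<open>linmap\<close>.\<close>

definition vgroup :: "'a vs \<Rightarrow> bool"
  where "vgroup M \<longleftrightarrow> \<zero>\<^bsub>M\<^esub> \<in> carrier M \<and>
    (\<forall>x\<in>carrier M. \<zero>\<^bsub>M\<^esub> \<oplus>\<^bsub>M\<^esub> x = x \<and> x \<oplus>\<^bsub>M\<^esub> x = \<zero>\<^bsub>M\<^esub> \<and>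
      (\<forall>y\<in>carrier M. x \<oplus>\<^bsub>M\<^esub> y \<in> carrier M \<and> x \<oplus>\<^bsub>M\<^esub> y = y \<oplus>\<^bsub>M\<^esub> x \<and>
        (\<forall>z\<in>carrier M. (x \<oplus>\<^bsub>M\<^esub> y) \<oplus>\<^bsub>M\<^esub> z = x \<oplus>\<^bsub>M\<^esub> (y \<oplus>\<^bsub>M\<^esub> z))))"

text \<open>A surjection onto a subset of a plain type. Its kernel is the subspace that a quotient
  divides out, and \<open>quot_coords\<close> then makes it a coordinate system of the
  quotient.\<close>

definition linmap :: "'a vs \<Rightarrow> ('a \<Rightarrow> 'c::char2) \<Rightarrow> 'c set \<Rightarrow> bool"
  where "linmap M f T \<longleftrightarrow> vgroup M \<and> f ` carrier M = T \<and>
    (\<forall>x\<in>carrier M. \<forall>y\<in>carrier M. f (x \<oplus>\<^bsub>M\<^esub> y) = f x + f y) \<and>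
    (\<forall>x\<in>carrier M. \<forall>c. c \<odot>\<^bsub>M\<^esub> x \<in> carrier M \<and> f (c \<odot>\<^bsub>M\<^esub> x) = (if c = 0 then 0 else f x))"

definition coords :: "'a vs \<Rightarrow> ('a \<Rightarrow> 'c::char2) \<Rightarrow> 'c set \<Rightarrow> bool"
  where "coords M f T \<longleftrightarrow> linmap M f T \<and> inj_on f (carrier M)"

lemma vgroupD:
  assumes "vgroup M"
  shows "\<zero>\<^bsub>M\<^esub> \<in> carrier M" "x \<in> carrier M \<Longrightarrow> \<zero>\<^bsub>M\<^esub> \<oplus>\<^bsub>M\<^esub> x = x" "x \<in> carrier M \<Longrightarrow> x \<oplus>\<^bsub>M\<^esub> x = \<zero>\<^bsub>M\<^esub>"
    "x \<in> carrier M \<Longrightarrow> y \<in> carrier M \<Longrightarrow> x \<oplus>\<^bsub>M\<^esub> y \<in> carrier M"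
    "x \<in> carrier M \<Longrightarrow> y \<in> carrier M \<Longrightarrow> x \<oplus>\<^bsub>M\<^esub> y = y \<oplus>\<^bsub>M\<^esub> x"
    "x \<in> carrier M \<Longrightarrow> y \<in> carrier M \<Longrightarrow> z \<in> carrier M \<Longrightarrow> (x \<oplus>\<^bsub>M\<^esub> y) \<oplus>\<^bsub>M\<^esub> z = x \<oplus>\<^bsub>M\<^esub> (y \<oplus>\<^bsub>M\<^esub> z)"
  using assms unfolding vgroup_def by blast+

lemma vgroup_cancel:
  assumes "vgroup M" "x \<in> carrier M" "y \<in> carrier M"
  shows "(x \<oplus>\<^bsub>M\<^esub> y) \<oplus>\<^bsub>M\<^esub> y = x"
proof -
  note g = vgroupD[OF assms(1)]
  have "(x \<oplus>\<^bsub>M\<^esub> y) \<oplus>\<^bsub>M\<^esub> y = x \<oplus>\<^bsub>M\<^esub> \<zero>\<^bsub>M\<^esub>"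
    using g(6)[OF assms(2,3,3)] g(3)[OF assms(3)] by simp
  then show ?thesis
    using g(5)[OF assms(2) g(1)] g(2)[OF assms(2)] by simp
qed

lemma vgroup_abelian_group: "vgroup M \<Longrightarrow> abelian_group M"
  by (rule abelian_groupI) (use vgroupD in metis)+

lemma linmapD:
  assumes "linmap M f T"
  shows "vgroup M" "f ` carrier M = T" "x \<in> carrier M \<Longrightarrow> y \<in> carrier M \<Longrightarrow> f (x \<oplus>\<^bsub>M\<^esub> y) = f x + f y"
    "x \<in> carrier M \<Longrightarrow> c \<odot>\<^bsub>M\<^esub> x \<in> carrier M" "x \<in> carrier M \<Longrightarrow> f (c \<odot>\<^bsub>M\<^esub> x) = (if c = 0 then 0 else f x)"
    "f \<zero>\<^bsub>M\<^esub> = 0" "x \<in> carrier M \<Longrightarrow> f x \<in> T"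
proof -
  show g: "vgroup M" and "f ` carrier M = T" and add: "x \<in> carrier M \<Longrightarrow> y \<in> carrier M \<Longrightarrow> f (x \<oplus>\<^bsub>M\<^esub> y) = f x + f y"
    and "x \<in> carrier M \<Longrightarrow> c \<odot>\<^bsub>M\<^esub> x \<in> carrier M" "x \<in> carrier M \<Longrightarrow> f (c \<odot>\<^bsub>M\<^esub> x) = (if c = 0 then 0 else f x)"
    "x \<in> carrier M \<Longrightarrow> f x \<in> T" for x y
    using assms unfolding linmap_def by blast+
  show "f \<zero>\<^bsub>M\<^esub> = 0"
    using add[of "\<zero>\<^bsub>M\<^esub>" "\<zero>\<^bsub>M\<^esub>"] vgroupD(1,2)[OF g] by simp
qed

lemma linmap_add_in:
  assumes "linmap M f T" "x \<in> T" "y \<in> T"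
  shows "x + y \<in> T"
proof -
  obtain x' y' where "x' \<in> carrier M" "y' \<in> carrier M" "x = f x'" "y = f y'"
    using assms(2,3) linmapD(2)[OF assms(1)] by blast
  then show ?thesis
    using linmapD(3)[OF assms(1), of x' y'] linmapD(7)[OF assms(1) vgroupD(4)[OF linmapD(1)[OF assms(1)], of x' y']] by simp
qed

lemma coordsD: "coords M f T \<Longrightarrow> linmap M f T" "coords M f T \<Longrightarrow> inj_on f (carrier M)"
  by (simp_all add: coords_def)

lemma coords_eqI: "coords M f T \<Longrightarrow> x \<in> carrier M \<Longrightarrow> y \<in> carrier M \<Longrightarrow> f x = f y \<Longrightarrow> x = y"
  by (auto simp: coords_def inj_on_def)

definition from_coords :: "'a vs \<Rightarrow> ('a \<Rightarrow> 'c) \<Rightarrow> 'c \<Rightarrow> 'a"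
  where "from_coords M f = inv_into (carrier M) f"

lemma from_coords:
  assumes "linmap M f T" "t \<in> T"
  shows "from_coords M f t \<in> carrier M" "f (from_coords M f t) = t"
  using assms linmapD(2)[OF assms(1)] unfolding from_coords_def by (auto intro: inv_into_into f_inv_into_f)

lemma from_coords_f: "coords M f T \<Longrightarrow> x \<in> carrier M \<Longrightarrow> from_coords M f (f x) = x"
  unfolding coords_def from_coords_def by simp

lemma coordsI:
  assumes "\<zero>\<^bsub>M\<^esub> \<in> carrier M" "f \<zero>\<^bsub>M\<^esub> = 0" "f ` carrier M = T" "inj_on f (carrier M)"
    "\<And>x y. x \<in> carrier M \<Longrightarrow> y \<in> carrier M \<Longrightarrow> x \<oplus>\<^bsub>M\<^esub> y \<in> carrier M \<and> f (x \<oplus>\<^bsub>M\<^esub> y) = f x + f y"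
    "\<And>x c. x \<in> carrier M \<Longrightarrow> c \<odot>\<^bsub>M\<^esub> x \<in> carrier M \<and> f (c \<odot>\<^bsub>M\<^esub> x) = (if c = 0 then 0 else f x)"
  shows "coords M f T"
proof -
  have eqI: "x = y" if "x \<in> carrier M" "y \<in> carrier M" "f x = f y" for x y
    using assms(4) that by (auto simp: inj_on_def)
  have "vgroup M"
    unfolding vgroup_def
  proof (intro conjI ballI)
    fix x y z assume [simp]: "x \<in> carrier M" "y \<in> carrier M" "z \<in> carrier M"
    note [simp] = assms(1,2,5)
    show "\<zero>\<^bsub>M\<^esub> \<oplus>\<^bsub>M\<^esub> x = x" "x \<oplus>\<^bsub>M\<^esub> x = \<zero>\<^bsub>M\<^esub>" "x \<oplus>\<^bsub>M\<^esub> y = y \<oplus>\<^bsub>M\<^esub> x"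
      "(x \<oplus>\<^bsub>M\<^esub> y) \<oplus>\<^bsub>M\<^esub> z = x \<oplus>\<^bsub>M\<^esub> (y \<oplus>\<^bsub>M\<^esub> z)"
      by (rule eqI; simp add: ac_simps)+
  qed (use assms(1,5) in auto)
  then show ?thesis
    using assms unfolding coords_def linmap_def by blast
qed

lemma coset_fibre:
  assumes "linmap M f T" "N = {x \<in> carrier M. f x = 0}" "x \<in> carrier M"
  shows "N +>\<^bsub>M\<^esub> x = {y \<in> carrier M. f y = f x}"
proof -
  note g = vgroupD[OF linmapD(1)[OF assms(1)]]
  have "y \<in> N +>\<^bsub>M\<^esub> x" if y: "y \<in> carrier M" "f y = f x" for y
  proof -
    have "y \<oplus>\<^bsub>M\<^esub> x \<in> N"
      using y assms g(4) by (simp add: linmapD(3)[OF assms(1)])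
    moreover have "(y \<oplus>\<^bsub>M\<^esub> x) \<oplus>\<^bsub>M\<^esub> x = y"
      using vgroup_cancel[OF linmapD(1)[OF assms(1)] y(1) assms(3)] .
    ultimately show ?thesis
      unfolding a_r_coset_def' by force
  qed
  moreover have "y \<in> carrier M \<and> f y = f x" if y: "y \<in> N +>\<^bsub>M\<^esub> x" for y
  proof -
    obtain h where "h \<in> N" "y = h \<oplus>\<^bsub>M\<^esub> x"
      using y unfolding a_r_coset_def' by blast
    then show ?thesis
      using g(4)[of h x] assms(2,3) linmapD(3)[OF assms(1)] by simp
  qed
  ultimately show ?thesis
    by blast
qed

text \<open>The cosets of the kernel are the fibres of f by \<open>coset_fibre\<close>, so the
  chosen element does not affect the value.\<close>

definition lift :: "('a \<Rightarrow> 'c) \<Rightarrow> 'a set \<Rightarrow> 'c"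
  where "lift f X = f (SOME x. x \<in> X)"

lemma carrier_quot_vs: "carrier (quot_vs M N) = (\<lambda>x. N +>\<^bsub>M\<^esub> x) ` carrier M"
  unfolding quot_vs_def partial_object.simps A_RCOSETS_def' by blast

lemma quot_vs_coset:
  assumes "linmap M f T" "N = {x \<in> carrier M. f x = 0}" "x \<in> carrier M"
  shows "N +>\<^bsub>M\<^esub> x \<in> carrier (quot_vs M N)" "lift f (N +>\<^bsub>M\<^esub> x) = f x"
proof -
  show "N +>\<^bsub>M\<^esub> x \<in> carrier (quot_vs M N)"
    unfolding carrier_quot_vs using assms(3) by (rule imageI)
  have "(SOME y. y \<in> N +>\<^bsub>M\<^esub> x) \<in> N +>\<^bsub>M\<^esub> x"
    by (rule someI[of _ x]) (simp add: coset_fibre[OF assms] assms(3))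
  then show "lift f (N +>\<^bsub>M\<^esub> x) = f x"
    unfolding lift_def coset_fibre[OF assms] by simp
qed

lemma quot_vs_cases:
  assumes "X \<in> carrier (quot_vs M N)"
  obtains x where "x \<in> carrier M" "X = N +>\<^bsub>M\<^esub> x"
  using assms unfolding carrier_quot_vs by blast

text \<open>Cosets, their sums and their multiples are all written as fibres of f; coset arithmetic
  becomes arithmetic of values.\<close>

lemma quot_coords:
  assumes f: "linmap M f T" and N: "N = {x \<in> carrier M. f x = 0}"
  shows "coords (quot_vs M N) (lift f) T"
proof (rule coordsI)
  note fib = coset_fibre[OF f N] and q = quot_vs_coset[OF f N]
  note g = vgroupD[OF linmapD(1)[OF f]]
  have z: "N = N +>\<^bsub>M\<^esub> \<zero>\<^bsub>M\<^esub>"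
    using fib[OF g(1)] linmapD(6)[OF f] N by simp
  have zero: "\<zero>\<^bsub>quot_vs M N\<^esub> = N +>\<^bsub>M\<^esub> \<zero>\<^bsub>M\<^esub>"
    using z by (simp add: quot_vs_def)
  show "\<zero>\<^bsub>quot_vs M N\<^esub> \<in> carrier (quot_vs M N)" "lift f \<zero>\<^bsub>quot_vs M N\<^esub> = 0"
    unfolding zero using q g(1) linmapD(6)[OF f] by auto
  show "lift f ` carrier (quot_vs M N) = T"
  proof -
    have "(\<lambda>x. lift f (N +>\<^bsub>M\<^esub> x)) ` carrier M = f ` carrier M"
      using q(2) by (rule image_cong[OF refl])
    then show ?thesis
      unfolding linmapD(2)[OF f, symmetric] carrier_quot_vs image_image .
  qed
  show "inj_on (lift f) (carrier (quot_vs M N))"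
  proof (rule inj_onI)
    fix X Y assume X: "X \<in> carrier (quot_vs M N)" and Y: "Y \<in> carrier (quot_vs M N)" and eq: "lift f X = lift f Y"
    obtain x where x: "x \<in> carrier M" "X = N +>\<^bsub>M\<^esub> x"
      using X by (rule quot_vs_cases)
    obtain y where y: "y \<in> carrier M" "Y = N +>\<^bsub>M\<^esub> y"
      using Y by (rule quot_vs_cases)
    then show "X = Y"
      using x y eq q(2) by (simp add: fib)
  qed
  fix X assume "X \<in> carrier (quot_vs M N)"
  then obtain x where x: "x \<in> carrier M" "X = N +>\<^bsub>M\<^esub> x"
    by (rule quot_vs_cases)
  show "c \<odot>\<^bsub>quot_vs M N\<^esub> X \<in> carrier (quot_vs M N) \<and> lift f (c \<odot>\<^bsub>quot_vs M N\<^esub> X) = (if c = 0 then 0 else lift f X)" for c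
  proof -
    have *: "N +>\<^bsub>M\<^esub> (c \<odot>\<^bsub>M\<^esub> y) = N +>\<^bsub>M\<^esub> (c \<odot>\<^bsub>M\<^esub> x)" if "y \<in> X" for y
      using that x linmapD(4,5)[OF f] by (simp add: fib)
    have "X \<noteq> {}"
      using x by (auto simp: fib)
    have "c \<odot>\<^bsub>quot_vs M N\<^esub> X = (\<Union>y\<in>X. N +>\<^bsub>M\<^esub> (c \<odot>\<^bsub>M\<^esub> y))"
      by (simp add: quot_vs_def)
    also have "\<dots> = (\<Union>y\<in>X. N +>\<^bsub>M\<^esub> (c \<odot>\<^bsub>M\<^esub> x))"
      using * by (rule SUP_cong[OF refl])
    also have "\<dots> = N +>\<^bsub>M\<^esub> (c \<odot>\<^bsub>M\<^esub> x)"
      using \<open>X \<noteq> {}\<close> by simp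
    finally have "c \<odot>\<^bsub>quot_vs M N\<^esub> X = N +>\<^bsub>M\<^esub> (c \<odot>\<^bsub>M\<^esub> x)" .
    then show ?thesis
      using q[OF linmapD(4)[OF f x(1)]] q(2)[OF x(1)] x linmapD(5)[OF f x(1)] by simp
  qed
  fix Y assume "Y \<in> carrier (quot_vs M N)"
  then obtain y where y: "y \<in> carrier M" "Y = N +>\<^bsub>M\<^esub> y"
    by (rule quot_vs_cases)
  have "X \<oplus>\<^bsub>quot_vs M N\<^esub> Y = N +>\<^bsub>M\<^esub> (x \<oplus>\<^bsub>M\<^esub> y)"
  proof -
    have "X <+>\<^bsub>M\<^esub> Y = {z \<in> carrier M. f z = f x + f y}"
    proof (intro equalityI subsetI)
      fix z assume "z \<in> X <+>\<^bsub>M\<^esub> Y"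
      then obtain h k where "h \<in> X" "k \<in> Y" "z = h \<oplus>\<^bsub>M\<^esub> k"
        unfolding set_add_def' by blast
      then show "z \<in> {z \<in> carrier M. f z = f x + f y}"
        using x y fib g(4) linmapD(3)[OF f] by simp
    next
      fix z assume z: "z \<in> {z \<in> carrier M. f z = f x + f y}"
      then have "z \<in> carrier M" "f (z \<oplus>\<^bsub>M\<^esub> y) = f x"
        using linmapD(3)[OF f _ y(1)] by (auto simp: add.assoc)
      then have "z \<oplus>\<^bsub>M\<^esub> y \<in> X"
        unfolding x(2) fib[OF x(1)] using g(4)[OF _ y(1)] by blast
      moreover have "y \<in> Y"
        unfolding y(2) fib[OF y(1)] using y(1) by blast
      moreover have "z = (z \<oplus>\<^bsub>M\<^esub> y) \<oplus>\<^bsub>M\<^esub> y"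
        using vgroup_cancel[OF linmapD(1)[OF f] \<open>z \<in> carrier M\<close> y(1)] by (rule sym)
      ultimately show "z \<in> X <+>\<^bsub>M\<^esub> Y"
        unfolding set_add_def' by blast
    qed
    then show ?thesis
      using x y g(4) linmapD(3)[OF f] by (simp add: quot_vs_def fib)
  qed
  then show "X \<oplus>\<^bsub>quot_vs M N\<^esub> Y \<in> carrier (quot_vs M N) \<and> lift f (X \<oplus>\<^bsub>quot_vs M N\<^esub> Y) = lift f X + lift f Y"
    using q[OF g(4)[OF x(1) y(1)]] q(2)[OF x(1)] q(2)[OF y(1)] x y linmapD(3)[OF f] by simp
qed

text \<open>The map h is the formula for g in coordinates; by \<open>quot_map_reps\<close> it
  survives the passage to a quotient unchanged.\<close>

definition reps :: "'a vs \<Rightarrow> ('a \<Rightarrow> 'c) \<Rightarrow> 'b vs \<Rightarrow> ('b \<Rightarrow> 'd) \<Rightarrow> ('a \<Rightarrow> 'b) \<Rightarrow> ('c \<Rightarrow> 'd) \<Rightarrow> bool"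
  where "reps M f M' f' g h \<longleftrightarrow> (\<forall>x\<in>carrier M. g x \<in> carrier M' \<and> f' (g x) = h (f x))"

lemma quot_map_reps:
  assumes f: "linmap M f T" "N = {x \<in> carrier M. f x = 0}"
    and f': "linmap M' f' T'" "N' = {x \<in> carrier M'. f' x = 0}"
    and g: "reps M f M' f' g h"
  shows "reps (quot_vs M N) (lift f) (quot_vs M' N') (lift f') (quot_map M' N' g) h"
  unfolding reps_def
proof
  fix X assume "X \<in> carrier (quot_vs M N)"
  then obtain x where x: "x \<in> carrier M" "X = N +>\<^bsub>M\<^esub> x"
    by (rule quot_vs_cases)
  note X = coset_fibre[OF f x(1)]
  have "N' +>\<^bsub>M'\<^esub> g y = N' +>\<^bsub>M'\<^esub> g x" if "y \<in> X" for y
    using that g x X by (simp add: reps_def coset_fibre[OF f'])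
  then have "quot_map M' N' g X = (\<Union>y\<in>X. N' +>\<^bsub>M'\<^esub> g x)"
    unfolding quot_map_def by (rule SUP_cong[OF refl])
  moreover have "X \<noteq> {}"
    using x X by auto
  ultimately have "quot_map M' N' g X = N' +>\<^bsub>M'\<^esub> g x"
    by simp
  then show "quot_map M' N' g X \<in> carrier (quot_vs M' N') \<and> lift f' (quot_map M' N' g X) = h (lift f X)"
    using quot_vs_coset[OF f' , of "g x"] quot_vs_coset(2)[OF f x(1)] g x by (simp add: reps_def)
qed

section \<open>Free spaces and tensor products\<close>

lemma bit_scale: "Poly_Mapping.map ((*) c) x = (if c = 0 then 0 else (x :: 'b \<Rightarrow>\<^sub>0 bit))"
  by (cases c) (auto intro!: poly_mapping_eqI simp: Poly_Mapping.map.rep_eq when_def)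

lemma lin_ext_eq: "lin_ext g = ext g"
proof
  fix x
  show "lin_ext g x = ext g x"
    unfolding lin_ext_def ext_def bit_scale by (rule sum.cong) (simp_all add: lookup_in_keys)
qed

lemma linmap_free:
  assumes "vlinear f" "f ` vspan S = T"
  shows "linmap (free_vs S) f T"
  unfolding linmap_def vgroup_def free_vs_def module.simps partial_object.simps ring.simps bit_scale vspan_def[symmetric]
  using assms vlinear_0[OF assms(1)] vspan_add[of _ S] by (simp add: add.assoc add.commute vlinear_def)

lemma coords_free: "coords (free_vs S) (\<lambda>x. x) (vspan S)"
  unfolding coords_def using linmap_free[OF vlinear_id, of S] by simp

lemma carrier_free [simp]: "carrier (free_vs S) = vspan S"
  by (simp add: free_vs_def vspan_def)

lemma submodule_freeD:
  assumes "submodule N \<bbbK> (free_vs S)"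
  shows "0 \<in> N" "x \<in> N \<Longrightarrow> y \<in> N \<Longrightarrow> x + y \<in> N"
proof -
  interpret submodule N "\<bbbK>" "free_vs S" by fact
  show "0 \<in> N"
    using one_closed by (simp add: free_vs_def)
  show "x \<in> N \<Longrightarrow> y \<in> N \<Longrightarrow> x + y \<in> N"
    using m_closed[of x y] by (simp add: free_vs_def)
qed

lemma submodule_kernel:
  fixes f :: "('b \<Rightarrow>\<^sub>0 bit) \<Rightarrow> 'c::char2"
  assumes "vlinear f"
  shows "submodule {x \<in> vspan S. f x = 0} \<bbbK> (free_vs S)"
proof -
  have g: "group (add_monoid (free_vs S))"
    using abelian_group.a_group[OF vgroup_abelian_group[OF linmapD(1)[OF linmap_free[OF assms refl]]]] .
  have inv: "inv\<^bsub>add_monoid (free_vs S)\<^esub> x = x" if "x \<in> vspan S" for x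
    using group.inv_equality[OF g, of x x] that by (simp add: free_vs_def vspan_def[symmetric])
  show ?thesis
  proof (intro submodule.intro subgroup.intro submodule_axioms.intro)
    fix x assume "x \<in> {x \<in> vspan S. f x = 0}"
    then show "inv\<^bsub>add_monoid (free_vs S)\<^esub> x \<in> {x \<in> vspan S. f x = 0}"
      using inv by simp
  next
    fix c x assume "x \<in> {x \<in> vspan S. f x = 0}"
    then show "c \<odot>\<^bsub>free_vs S\<^esub> x \<in> {x \<in> vspan S. f x = 0}"
      unfolding free_vs_def module.simps bit_scale using vlinear_0[OF assms] by simp
  qed (use vlinear_0[OF assms] vlinearD[OF assms] in \<open>auto simp: free_vs_def vspan_def[symmetric] vspan_add\<close>)
qed

text \<open>
  A presented space has the coordinates \<open>ext \<phi>\<close> as soon as, modulo the relations, the section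
  \<open>\<psi>\<close> is additive and inverts \<open>\<phi>\<close> on generators.
\<close>

lemma gen_subspace_kernel:
  fixes \<phi> :: "'b \<Rightarrow> 'c::char2"
  assumes R: "\<And>x. x \<in> R \<Longrightarrow> x \<in> vspan S \<and> ext \<phi> x = 0"
    and \<psi>_add: "\<And>N t u. submodule N \<bbbK> (free_vs S) \<Longrightarrow> R \<subseteq> N \<Longrightarrow> t \<in> T \<Longrightarrow> u \<in> T \<Longrightarrow> \<psi> (t + u) + (\<psi> t + \<psi> u) \<in> N"
    and \<psi>: "\<And>N b. submodule N \<bbbK> (free_vs S) \<Longrightarrow> R \<subseteq> N \<Longrightarrow> b \<in> S \<Longrightarrow> gen b + \<psi> (\<phi> b) \<in> N"
    and T: "0 \<in> T" "\<And>t u. t \<in> T \<Longrightarrow> u \<in> T \<Longrightarrow> t + u \<in> T" "\<And>b. b \<in> S \<Longrightarrow> \<phi> b \<in> T"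
  shows "gen_subspace (free_vs S) R = {x \<in> carrier (free_vs S). ext \<phi> x = 0}"
proof
  show "gen_subspace (free_vs S) R \<subseteq> {x \<in> carrier (free_vs S). ext \<phi> x = 0}"
    unfolding gen_subspace_def using submodule_kernel[OF vlinear_ext, of S \<phi>] R by (intro Inter_lower) auto
  show "{x \<in> carrier (free_vs S). ext \<phi> x = 0} \<subseteq> gen_subspace (free_vs S) R"
    unfolding gen_subspace_def
  proof (intro Inter_greatest subsetI)
    fix N x assume "N \<in> {N. submodule N \<bbbK> (free_vs S) \<and> R \<subseteq> N}" and x: "x \<in> {x \<in> carrier (free_vs S). ext \<phi> x = 0}"
    then have N: "submodule N \<bbbK> (free_vs S)" "R \<subseteq> N"
      by auto
    note N' = submodule_freeD[OF N(1)]
    have \<psi>0: "\<psi> 0 \<in> N"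
      using \<psi>_add[OF N T(1) T(1)] by simp
    \<comment> \<open>Modulo the arbitrary submodule N a sum of generators equals \<psi> of the sum
      of their values, as is seen by adding one generator at a time.\<close>
    have "finite K \<Longrightarrow> K \<subseteq> S \<Longrightarrow> sum \<phi> K \<in> T \<and> sum gen K + \<psi> (sum \<phi> K) \<in> N" for K
    proof (induction K rule: finite_induct)
      case empty
      then show ?case using T(1) \<psi>0 by simp
    next
      case (insert b K)
      then have IH: "sum \<phi> K \<in> T" "sum gen K + \<psi> (sum \<phi> K) \<in> N" and b: "b \<in> S"
        by auto
      have "(sum gen K + \<psi> (sum \<phi> K)) + (gen b + \<psi> (\<phi> b)) + (\<psi> (\<phi> b + sum \<phi> K) + (\<psi> (\<phi> b) + \<psi> (sum \<phi> K))) \<in> N"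
        by (rule N'(2)[OF N'(2)[OF IH(2) \<psi>[OF N b]] \<psi>_add[OF N T(3)[OF b] IH(1)]])
      moreover have "(sum gen K + \<psi> (sum \<phi> K)) + (gen b + \<psi> (\<phi> b)) + (\<psi> (\<phi> b + sum \<phi> K) + (\<psi> (\<phi> b) + \<psi> (sum \<phi> K)))
        = (gen b + sum gen K) + \<psi> (\<phi> b + sum \<phi> K)"
        by (simp add: ac_simps)
      ultimately show ?case
        using insert.hyps T(2)[OF T(3)[OF b] IH(1)] by simp
    qed
    from this[of "Poly_Mapping.keys x"] have "ext gen x + \<psi> (ext \<phi> x) \<in> N"
      using x unfolding ext_def by (simp add: vspan_def)
    \<comment> \<open>The section need not send 0 to 0; its value there is only known to lie in N
      and is cancelled last.\<close>
    then have "x + \<psi> 0 \<in> N"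
      using x by (simp add: ext_gen_id)
    then have "(x + \<psi> 0) + \<psi> 0 \<in> N"
      using \<psi>0 by (rule N'(2))
    then show "x \<in> N"
      by (simp add: add.assoc)
  qed
qed

text \<open>Formal tensors are additive only modulo the relations. Adding basis elements one at a
  time still allows an argument to be expanded in a basis modulo N.\<close>

lemma near_additive:
  assumes N: "0 \<in> N" "\<And>x y. x \<in> N \<Longrightarrow> y \<in> N \<Longrightarrow> x + y \<in> (N :: 'c::char2 set)"
    and D: "\<And>t u. t \<in> vspan S \<Longrightarrow> u \<in> vspan S \<Longrightarrow> D (t + u) + (D t + D u) \<in> N"
    and t: "t \<in> vspan S"
  shows "D t + ext (\<lambda>b. D (gen b)) t \<in> N"
proof -
  have "finite K \<Longrightarrow> K \<subseteq> S \<Longrightarrow> D (sum gen K) + (\<Sum>b\<in>K. D (gen b)) \<in> N" for K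
  proof (induction K rule: finite_induct)
    case empty
    then show ?case using D[of 0 0] by simp
  next
    case (insert b K)
    then have K: "sum gen K \<in> vspan S" "gen b \<in> vspan S" "D (sum gen K) + (\<Sum>b\<in>K. D (gen b)) \<in> N"
      by (auto intro!: vspan_sum)
    have "(D (sum gen K) + (\<Sum>b\<in>K. D (gen b))) + (D (gen b + sum gen K) + (D (gen b) + D (sum gen K))) \<in> N"
      by (rule N(2)[OF K(3) D[OF K(2,1)]])
    moreover have "(D (sum gen K) + (\<Sum>b\<in>K. D (gen b))) + (D (gen b + sum gen K) + (D (gen b) + D (sum gen K)))
      = D (gen b + sum gen K) + (D (gen b) + (\<Sum>b\<in>K. D (gen b)))"
      by (simp add: ac_simps)
    ultimately show ?case
      using insert.hyps by simp
  qed
  from this[of "Poly_Mapping.keys t"] have "D (ext gen t) + ext (\<lambda>b. D (gen b)) t \<in> N"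
    using t unfolding ext_def by (simp add: vspan_def)
  then show ?thesis
    by (simp add: ext_gen_id)
qed

lemma from_coords_add:
  assumes "coords M f T" "t \<in> T" "u \<in> T"
  shows "from_coords M f (t + u) = from_coords M f t \<oplus>\<^bsub>M\<^esub> from_coords M f u"
proof (rule coords_eqI[OF assms(1)])
  note L = coordsD(1)[OF assms(1)]
  note F = from_coords[OF L]
  show "from_coords M f (t + u) \<in> carrier M"
    using F(1) linmap_add_in[OF L assms(2,3)] .
  show "from_coords M f t \<oplus>\<^bsub>M\<^esub> from_coords M f u \<in> carrier M"
    using F(1)[OF assms(2)] F(1)[OF assms(3)] by (rule vgroupD(4)[OF linmapD(1)[OF L]])
  show "f (from_coords M f (t + u)) = f (from_coords M f t \<oplus>\<^bsub>M\<^esub> from_coords M f u)"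
    using linmapD(3)[OF L F(1)[OF assms(2)] F(1)[OF assms(3)]] F(2) assms(2,3) linmap_add_in[OF L assms(2,3)] by simp
qed

definition tcong ::
    "((int \<Rightarrow> 'a \<Rightarrow> 'a) \<times> (int \<Rightarrow> 'b \<Rightarrow> 'b)) set \<Rightarrow> 'a chain_complex \<Rightarrow> 'b chain_complex \<Rightarrow> int
      \<Rightarrow> ('a, 'b) pretensor set \<Rightarrow> bool"
  where "tcong P A B n N \<longleftrightarrow> 0 \<in> N \<and> (\<forall>x\<in>N. \<forall>y\<in>N. x + y \<in> N) \<and>
    (\<forall>i. \<forall>a\<in>carrier (obj A i). \<forall>b\<in>carrier (obj B (n - i)).
      (\<forall>a'\<in>carrier (obj A i). ptens i (a \<oplus>\<^bsub>obj A i\<^esub> a') b + (ptens i a b + ptens i a' b) \<in> N) \<and>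
      (\<forall>b'\<in>carrier (obj B (n - i)). ptens i a (b \<oplus>\<^bsub>obj B (n - i)\<^esub> b') + (ptens i a b + ptens i a b') \<in> N) \<and>
      (\<forall>(\<rho>, \<kappa>)\<in>P. ptens i (\<rho> i a) b + ptens i a (\<kappa> (n - i) b) \<in> N))"

lemma tcongD:
  assumes "tcong P A B n N"
  shows "0 \<in> N" "x \<in> N \<Longrightarrow> y \<in> N \<Longrightarrow> x + y \<in> N"
    "a \<in> carrier (obj A i) \<Longrightarrow> a' \<in> carrier (obj A i) \<Longrightarrow> b \<in> carrier (obj B (n - i)) \<Longrightarrow>
      ptens i (a \<oplus>\<^bsub>obj A i\<^esub> a') b + (ptens i a b + ptens i a' b) \<in> N"
    "a \<in> carrier (obj A i) \<Longrightarrow> b \<in> carrier (obj B (n - i)) \<Longrightarrow> b' \<in> carrier (obj B (n - i)) \<Longrightarrow>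
      ptens i a (b \<oplus>\<^bsub>obj B (n - i)\<^esub> b') + (ptens i a b + ptens i a b') \<in> N"
    "a \<in> carrier (obj A i) \<Longrightarrow> b \<in> carrier (obj B (n - i)) \<Longrightarrow> (\<rho>, \<kappa>) \<in> P \<Longrightarrow>
      ptens i (\<rho> i a) b + ptens i a (\<kappa> (n - i) b) \<in> N"
  using assms unfolding tcong_def by blast+

lemma tcongI:
  assumes "0 \<in> N" "\<And>x y. x \<in> N \<Longrightarrow> y \<in> N \<Longrightarrow> x + y \<in> N"
    "\<And>i a a' b. a \<in> carrier (obj A i) \<Longrightarrow> a' \<in> carrier (obj A i) \<Longrightarrow> b \<in> carrier (obj B (n - i)) \<Longrightarrow>
      ptens i (a \<oplus>\<^bsub>obj A i\<^esub> a') b + (ptens i a b + ptens i a' b) \<in> N"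
    "\<And>i a b b'. a \<in> carrier (obj A i) \<Longrightarrow> b \<in> carrier (obj B (n - i)) \<Longrightarrow> b' \<in> carrier (obj B (n - i)) \<Longrightarrow>
      ptens i a (b \<oplus>\<^bsub>obj B (n - i)\<^esub> b') + (ptens i a b + ptens i a b') \<in> N"
    "\<And>i a b \<rho> \<kappa>. a \<in> carrier (obj A i) \<Longrightarrow> b \<in> carrier (obj B (n - i)) \<Longrightarrow> (\<rho>, \<kappa>) \<in> P \<Longrightarrow>
      ptens i (\<rho> i a) b + ptens i a (\<kappa> (n - i) b) \<in> N"
  shows "tcong P A B n N"
  unfolding tcong_def using assms by (simp add: case_prod_beta)

lemma tcong_sum: "tcong P A B n N \<Longrightarrow> (\<And>k. k \<in> K \<Longrightarrow> g k \<in> N) \<Longrightarrow> sum g K \<in> N"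
  by (induction K rule: infinite_finite_induct) (auto dest: tcongD(1) intro: tcongD(2))

text \<open>\<Phi> is a bilinear model of the tensor product, and \<psi> writes its elements as
  formal tensors. As \<psi> inverts \<Phi> modulo the relations, these are the whole kernel. The
  instances are \<open>cross\<close> for the tensor square and \<open>orb\<close> for homotopy
  orbits.\<close>

lemma tensor_coords:
  fixes \<Phi> :: "int \<Rightarrow> 's::char2 \<Rightarrow> 't::char2 \<Rightarrow> 'c::char2"
  defines "\<phi> \<equiv> \<lambda>n cA cB (i, a, b). \<Phi> i (cA i a) (cB (n - i) b)"
  assumes A: "\<And>i. coords (obj A i) (cA i) (UA i)" and B: "\<And>i. coords (obj B i) (cB i) (UB i)"
    and \<Phi>: "\<And>i y. vlinear (\<lambda>x. \<Phi> i x y)" "\<And>i x. vlinear (\<Phi> i x)"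
    and P: "\<And>\<rho> \<kappa> i a b. (\<rho>, \<kappa>) \<in> P \<Longrightarrow> a \<in> carrier (obj A i) \<Longrightarrow> b \<in> carrier (obj B (n - i)) \<Longrightarrow>
      \<rho> i a \<in> carrier (obj A i) \<and> \<kappa> (n - i) b \<in> carrier (obj B (n - i)) \<and>
      \<Phi> i (cA i (\<rho> i a)) (cB (n - i) b) = \<Phi> i (cA i a) (cB (n - i) (\<kappa> (n - i) b))"
    and T: "0 \<in> T" "\<And>t u. t \<in> T \<Longrightarrow> u \<in> T \<Longrightarrow> t + u \<in> T" "\<And>i x y. x \<in> UA i \<Longrightarrow> y \<in> UB (n - i) \<Longrightarrow> \<Phi> i x y \<in> T"
    and \<psi>: "\<And>t. t \<in> T \<Longrightarrow> \<psi> t \<in> carrier (tensor_free A B n) \<and> ext (\<phi> n cA cB) (\<psi> t) = t"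
    and near: "\<And>N t u. tcong P A B n N \<Longrightarrow> t \<in> T \<Longrightarrow> u \<in> T \<Longrightarrow> \<psi> (t + u) + (\<psi> t + \<psi> u) \<in> N"
      "\<And>N i a b. tcong P A B n N \<Longrightarrow> a \<in> carrier (obj A i) \<Longrightarrow> b \<in> carrier (obj B (n - i)) \<Longrightarrow>
        ptens i a b + \<psi> (\<Phi> i (cA i a) (cB (n - i) b)) \<in> N"
  shows "linmap (tensor_free A B n) (ext (\<phi> n cA cB)) T"
    and "tensor_rels P A B n = {x \<in> carrier (tensor_free A B n). ext (\<phi> n cA cB) x = 0}"
    and "coords (obj (tensor P A B) n) (lift (ext (\<phi> n cA cB))) T"
proof -
  define S where "S = {(i, a, b) | i a b. a \<in> carrier (obj A i) \<and> b \<in> carrier (obj B (n - i))}"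
  have free: "tensor_free A B n = free_vs S"
    by (simp add: tensor_free_def S_def)
  note LA = coordsD(1)[OF A] and LB = coordsD(1)[OF B]
  note gA = vgroupD(4)[OF linmapD(1)[OF LA]] and gB = vgroupD(4)[OF linmapD(1)[OF LB]]
  let ?f = "ext (\<phi> n cA cB)"
  have \<phi>_T: "\<phi> n cA cB x \<in> T" if "x \<in> S" for x
    using that T(3) linmapD(7)[OF LA] linmapD(7)[OF LB] by (auto simp: S_def \<phi>_def)
  have sum_T: "finite K \<Longrightarrow> K \<subseteq> S \<Longrightarrow> sum (\<phi> n cA cB) K \<in> T" for K
    by (induction K rule: finite_induct) (auto simp: T \<phi>_T)
  have "?f ` vspan S = T"
  proof (intro equalityI subsetI)
    fix t assume "t \<in> ?f ` vspan S"
    then show "t \<in> T"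
      using sum_T[of "Poly_Mapping.keys _"] by (auto simp: ext_def vspan_def)
  next
    fix t assume "t \<in> T"
    then show "t \<in> ?f ` vspan S"
      using \<psi>[of t] by (metis carrier_free free imageI)
  qed
  then show lin: "linmap (tensor_free A B n) ?f T"
    unfolding free by (rule linmap_free[OF vlinear_ext])
  have Sg: "gen (i, a, b) \<in> vspan S" if "a \<in> carrier (obj A i)" "b \<in> carrier (obj B (n - i))" for i a b
    using that by (simp add: S_def)
  have f_gen: "?f (gen (i, a, b)) = \<Phi> i (cA i a) (cB (n - i) b)" for i a b
    by (simp add: \<phi>_def)
  note \<Phi>_add = vlinearD[OF \<Phi>(1)] vlinearD[OF \<Phi>(2)]
  define R where "R =
    {ptens i (a \<oplus>\<^bsub>obj A i\<^esub> a') b - (ptens i a b + ptens i a' b) | i a a' b.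
       a \<in> carrier (obj A i) \<and> a' \<in> carrier (obj A i) \<and> b \<in> carrier (obj B (n - i))} \<union>
    {ptens i a (b \<oplus>\<^bsub>obj B (n - i)\<^esub> b') - (ptens i a b + ptens i a b') | i a b b'.
       a \<in> carrier (obj A i) \<and> b \<in> carrier (obj B (n - i)) \<and> b' \<in> carrier (obj B (n - i))} \<union>
    {ptens i (c \<odot>\<^bsub>obj A i\<^esub> a) b - Poly_Mapping.map ((*) c) (ptens i a b) | i a b c.
       a \<in> carrier (obj A i) \<and> b \<in> carrier (obj B (n - i))} \<union>
    {ptens i a (c \<odot>\<^bsub>obj B (n - i)\<^esub> b) - Poly_Mapping.map ((*) c) (ptens i a b) | i a b c.
       a \<in> carrier (obj A i) \<and> b \<in> carrier (obj B (n - i))} \<union>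
    {ptens i (\<rho> i a) b - ptens i a (\<kappa> (n - i) b) | i a b \<rho> \<kappa>.
       (\<rho>, \<kappa>) \<in> P \<and> a \<in> carrier (obj A i) \<and> b \<in> carrier (obj B (n - i))}"
  have rels: "tensor_rels P A B n = gen_subspace (free_vs S) R"
    unfolding tensor_rels_def R_def free ..
  have R: "x \<in> vspan S \<and> ?f x = 0" if "x \<in> R" for x
    using that unfolding R_def
  proof (elim UnE CollectE exE conjE)
    fix i a a' b assume x: "x = ptens i (a \<oplus>\<^bsub>obj A i\<^esub> a') b - (ptens i a b + ptens i a' b)"
      and c: "a \<in> carrier (obj A i)" "a' \<in> carrier (obj A i)" "b \<in> carrier (obj B (n - i))"
    show ?thesis
      unfolding x minus_char2 ext_add f_gen linmapD(3)[OF LA c(1,2)] \<Phi>_add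
      using c Sg gA by (auto intro!: vspan_add)
  next
    fix i a b b' assume x: "x = ptens i a (b \<oplus>\<^bsub>obj B (n - i)\<^esub> b') - (ptens i a b + ptens i a b')"
      and c: "a \<in> carrier (obj A i)" "b \<in> carrier (obj B (n - i))" "b' \<in> carrier (obj B (n - i))"
    show ?thesis
      unfolding x minus_char2 ext_add f_gen linmapD(3)[OF LB c(2,3)] \<Phi>_add
      using c Sg gB by (auto intro!: vspan_add)
  next
    fix i a b and c :: bit assume x: "x = ptens i (c \<odot>\<^bsub>obj A i\<^esub> a) b - Poly_Mapping.map ((*) c) (ptens i a b)"
      and c: "a \<in> carrier (obj A i)" "b \<in> carrier (obj B (n - i))"
    show ?thesis
      unfolding x minus_char2 ext_add f_gen linmapD(5)[OF LA c(1)] bit_scale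
      using c Sg linmapD(4)[OF LA c(1), of c] vlinear_0[OF \<Phi>(1)] by (auto intro!: vspan_add simp: f_gen \<phi>_def)
  next
    fix i a b and c :: bit assume x: "x = ptens i a (c \<odot>\<^bsub>obj B (n - i)\<^esub> b) - Poly_Mapping.map ((*) c) (ptens i a b)"
      and c: "a \<in> carrier (obj A i)" "b \<in> carrier (obj B (n - i))"
    show ?thesis
      unfolding x minus_char2 ext_add f_gen linmapD(5)[OF LB c(2)] bit_scale
      using c Sg linmapD(4)[OF LB c(2), of c] vlinear_0[OF \<Phi>(2)] by (auto intro!: vspan_add simp: f_gen \<phi>_def)
  next
    fix i a b \<rho> \<kappa> assume x: "x = ptens i (\<rho> i a) b - ptens i a (\<kappa> (n - i) b)"
      and c: "(\<rho>, \<kappa>) \<in> P" "a \<in> carrier (obj A i)" "b \<in> carrier (obj B (n - i))"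
    show ?thesis
      unfolding x minus_char2 ext_add f_gen
      using P[OF c] c Sg by (auto intro!: vspan_add)
  qed
  have N: "tcong P A B n N" if N: "submodule N \<bbbK> (free_vs S)" "R \<subseteq> N" for N
  proof (rule tcongI)
    show "0 \<in> N"
      by (rule submodule_freeD(1)[OF N(1)])
    show "x + y \<in> N" if "x \<in> N" "y \<in> N" for x y
      using that by (rule submodule_freeD(2)[OF N(1)])
    fix i a b assume ab: "a \<in> carrier (obj A i)" "b \<in> carrier (obj B (n - i))"
    show "ptens i (a \<oplus>\<^bsub>obj A i\<^esub> a') b + (ptens i a b + ptens i a' b) \<in> N" if "a' \<in> carrier (obj A i)" for a'
      by (rule subsetD[OF N(2)], unfold R_def minus_char2, rule UnI1, rule UnI1, rule UnI1, rule UnI1, intro CollectI exI conjI)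
        (rule refl ab that)+
    show "ptens i a (b \<oplus>\<^bsub>obj B (n - i)\<^esub> b') + (ptens i a b + ptens i a b') \<in> N" if "b' \<in> carrier (obj B (n - i))" for b'
      by (rule subsetD[OF N(2)], unfold R_def minus_char2, rule UnI1, rule UnI1, rule UnI1, rule UnI2, intro CollectI exI conjI)
        (rule refl ab that)+
    show "ptens i (\<rho> i a) b + ptens i a (\<kappa> (n - i) b) \<in> N" if "(\<rho>, \<kappa>) \<in> P" for \<rho> \<kappa>
      by (rule subsetD[OF N(2)], unfold R_def minus_char2, rule UnI2, intro CollectI exI conjI)
        (rule refl ab that)+
  qed
  show ker: "tensor_rels P A B n = {x \<in> carrier (tensor_free A B n). ?f x = 0}"
    unfolding rels free
  proof (rule gen_subspace_kernel[where T = T and \<psi> = \<psi>])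
    show "gen b + \<psi> (\<phi> n cA cB b) \<in> M" if "submodule M \<bbbK> (free_vs S)" "R \<subseteq> M" "b \<in> S" for M b
      using that near(2)[OF N[OF that(1,2)]] by (auto simp: S_def \<phi>_def)
  qed (use R near(1)[OF N] T \<phi>_T in auto)
  show "coords (obj (tensor P A B) n) (lift ?f) T"
    using quot_coords[OF lin ker] by (simp add: tensor_def)
qed

text \<open>\<open>dA\<close> reads the degree off a basis element of the left factor. A pair of
  basis elements thus determines the summand i, which the coordinates need not record.\<close>

lemma tensor_basis_coords:
  fixes dA :: "'s \<Rightarrow> int" and SA :: "int \<Rightarrow> 's set" and SB :: "int \<Rightarrow> 't set"
  defines "\<phi> \<equiv> \<lambda>n cA cB (i, a, b). cross (cA i a) (cB (n - i) b)"
  assumes A: "\<And>i. coords (obj A i) (cA i) (vspan (SA i))" and B: "\<And>i. coords (obj B i) (cB i) (vspan (SB i))"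
    and dA: "\<And>i s. s \<in> SA i \<Longrightarrow> dA s = i"
  defines "T \<equiv> \<lambda>n. vspan {(s, u). s \<in> SA (dA s) \<and> u \<in> SB (n - dA s)}"
  shows "linmap (tensor_free A B n) (ext (\<phi> n cA cB)) (T n)"
    and "tensor_rels {} A B n = {x \<in> carrier (tensor_free A B n). ext (\<phi> n cA cB) x = 0}"
    and "coords (obj (tensor {} A B) n) (lift (ext (\<phi> n cA cB))) (T n)"
proof -
  note LA = coordsD(1)[OF A] and LB = coordsD(1)[OF B]
  define iA where "iA i = from_coords (obj A i) (cA i)" for i
  define iB where "iB i = from_coords (obj B i) (cB i)" for i
  note fA = from_coords[OF LA, folded iA_def] and fB = from_coords[OF LB, folded iB_def]
  define \<psi>0 where "\<psi>0 = (\<lambda>(s, u). ptens (dA s) (iA (dA s) (gen s)) (iB (n - dA s) (gen u)))"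
  have expand: "ptens i a b + ext \<psi>0 (cross (cA i a) (cB (n - i) b)) \<in> N"
    if N: "tcong {} A B n N" and ab: "a \<in> carrier (obj A i)" "b \<in> carrier (obj B (n - i))" for N i a b
  proof -
    let ?t = "cA i a" and ?u = "cB (n - i) b"
    have tu: "?t \<in> vspan (SA i)" "?u \<in> vspan (SB (n - i))"
      using linmapD(7)[OF LA] linmapD(7)[OF LB] ab by auto
    have a: "a = iA i ?t" and b: "b = iB (n - i) ?u"
      using from_coords_f[OF A ab(1)] from_coords_f[OF B ab(2)] by (simp_all add: iA_def iB_def)
    note N' = tcongD[OF N]
    \<comment> \<open>The formal tensor is expanded modulo N, here in the left argument and then,
      for each basis element on the left, in the right one.\<close>
    have 1: "ptens i (iA i ?t) b + ext (\<lambda>s. ptens i (iA i (gen s)) b) ?t \<in> N"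
    proof (rule near_additive[OF N'(1,2) _ tu(1)])
      fix t u assume "t \<in> vspan (SA i)" "u \<in> vspan (SA i)"
      then show "ptens i (iA i (t + u)) b + (ptens i (iA i t) b + ptens i (iA i u) b) \<in> N"
        using N'(3)[of "iA i t" i "iA i u" b] fA(1) ab(2) from_coords_add[OF A[of i], of t u] by (simp add: iA_def)
    qed
    have 2: "ptens i (iA i (gen s)) (iB (n - i) ?u) + ext (\<lambda>u. ptens i (iA i (gen s)) (iB (n - i) (gen u))) ?u \<in> N"
      if s: "s \<in> SA i" for s
    proof (rule near_additive[OF N'(1,2) _ tu(2)])
      fix t u assume tu: "t \<in> vspan (SB (n - i))" "u \<in> vspan (SB (n - i))"
      have "iA i (gen s) \<in> carrier (obj A i)"
        using s by (intro fA(1)) simp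
      then show "ptens i (iA i (gen s)) (iB (n - i) (t + u)) +
          (ptens i (iA i (gen s)) (iB (n - i) t) + ptens i (iA i (gen s)) (iB (n - i) u)) \<in> N"
        using N'(4)[OF _ fB(1)[OF tu(1)] fB(1)[OF tu(2)], of "iA i (gen s)"] from_coords_add[OF B tu]
        by (simp add: iB_def)
    qed
    have "ext \<psi>0 (cross ?t ?u) = ext (\<lambda>s. ext (\<lambda>u. \<psi>0 (s, u)) ?u) ?t"
      unfolding cross_def by (simp add: vlinear_ext_comp[OF vlinear_ext])
    also have "\<dots> = ext (\<lambda>s. ext (\<lambda>u. ptens i (iA i (gen s)) (iB (n - i) (gen u))) ?u) ?t"
      using tu dA by (intro ext_cong) (auto simp: \<psi>0_def vspan_def)
    finally have \<psi>: "ext \<psi>0 (cross ?t ?u) = ext (\<lambda>s. ext (\<lambda>u. ptens i (iA i (gen s)) (iB (n - i) (gen u))) ?u) ?t" .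
    have "ext (\<lambda>s. ptens i (iA i (gen s)) b) ?t + ext \<psi>0 (cross ?t ?u) =
      (\<Sum>s\<in>Poly_Mapping.keys ?t. ptens i (iA i (gen s)) b + ext (\<lambda>u. ptens i (iA i (gen s)) (iB (n - i) (gen u))) ?u)"
      unfolding \<psi> by (simp add: ext_def sum.distrib)
    also have "\<dots> \<in> N"
      using 2 tu(1) b by (intro tcong_sum[OF N]) (auto simp: vspan_def)
    finally have "(ptens i (iA i ?t) b + ext (\<lambda>s. ptens i (iA i (gen s)) b) ?t) +
        (ext (\<lambda>s. ptens i (iA i (gen s)) b) ?t + ext \<psi>0 (cross ?t ?u)) \<in> N"
      by (rule N'(2)[OF 1])
    then show ?thesis
      using a by (simp add: add.assoc)
  qed
  have \<psi>: "ext \<psi>0 t \<in> carrier (tensor_free A B n) \<and> ext (\<phi> n cA cB) (ext \<psi>0 t) = t" if t: "t \<in> T n" for t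
  proof
    have g: "iA (dA s) (gen s) \<in> carrier (obj A (dA s))" "cA (dA s) (iA (dA s) (gen s)) = gen s"
      "iB (n - dA s) (gen u) \<in> carrier (obj B (n - dA s))" "cB (n - dA s) (iB (n - dA s) (gen u)) = gen u"
      if "s \<in> SA (dA s)" "u \<in> SB (n - dA s)" for s u
      using fA[of "gen s" "dA s"] fB[of "gen u" "n - dA s"] that by auto
    show "ext \<psi>0 t \<in> carrier (tensor_free A B n)"
      unfolding tensor_free_def carrier_free
      by (rule vspan_ext[OF t[unfolded T_def]]) (use g in \<open>auto simp: \<psi>0_def\<close>)
    show "ext (\<phi> n cA cB) (ext \<psi>0 t) = t"
    proof (rule vlinear_eqI[where f = "\<lambda>t. ext (\<phi> n cA cB) (ext \<psi>0 t)", OF _ vlinear_id t[unfolded T_def]])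
      show "vlinear (\<lambda>t. ext (\<phi> n cA cB) (ext \<psi>0 t))"
        by (simp add: vlinear_def)
    qed (use g in \<open>auto simp: \<psi>0_def \<phi>_def\<close>)
  qed
  have tc: "cross x y \<in> T n" if "x \<in> vspan (SA i)" "y \<in> vspan (SB (n - i))" for i x y
    using cross_vspan[OF that] unfolding T_def by (rule vspan_mono) (use dA in auto)
  note tc' = tensor_coords[where \<Phi> = "\<lambda>i. cross" and P = "{}" and T = "T n" and \<psi> = "ext \<psi>0" and n = n
    and UA = "\<lambda>i. vspan (SA i)" and UB = "\<lambda>i. vspan (SB i)",
    OF A B vlinear_cross(1) vlinear_cross(2) _ _ _ tc \<psi>[unfolded \<phi>_def] _ expand]
  show "linmap (tensor_free A B n) (ext (\<phi> n cA cB)) (T n)"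
    unfolding \<phi>_def by (rule tc'(1)) (auto simp: T_def vspan_add dest: tcongD(1))
  show "tensor_rels {} A B n = {x \<in> carrier (tensor_free A B n). ext (\<phi> n cA cB) x = 0}"
    unfolding \<phi>_def by (rule tc'(2)) (auto simp: T_def vspan_add dest: tcongD(1))
  show "coords (obj (tensor {} A B) n) (lift (ext (\<phi> n cA cB))) (T n)"
    unfolding \<phi>_def by (rule tc'(3)) (auto simp: T_def vspan_add dest: tcongD(1))
qed

subsection \<open>Homotopy orbits in coordinates\<close>

fun act :: "sigma2 \<Rightarrow> ('s \<times> 's \<Rightarrow>\<^sub>0 bit) \<Rightarrow> ('s \<times> 's \<Rightarrow>\<^sub>0 bit)"
  where "act Sig_e x = x" | "act Sig_sigma x = swp x"

text \<open>W is free on the e_i, and g e_i tensor y equals e_i tensor g y. An element of the orbits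
  is therefore the sequence of its coefficients at e_0, e_1, and so on.\<close>

definition orb :: "int \<Rightarrow> (sigma2 \<Rightarrow>\<^sub>0 bit) \<Rightarrow> ('s \<times> 's \<Rightarrow>\<^sub>0 bit) \<Rightarrow> nat \<Rightarrow> ('s \<times> 's \<Rightarrow>\<^sub>0 bit)"
  where "orb i w y = (\<lambda>j. if int j = i then ext (\<lambda>g. act g y) w else 0)"

lemma vlinear_act: "vlinear (act g)"
  by (cases g) (auto simp: vlinear_def)

lemma act_times: "act (times_sigma g) y = act g (swp y)"
  by (cases g) auto

lemma vlinear_orb_left: "vlinear (\<lambda>w. orb i w y)"
  by (auto simp: vlinear_def orb_def fun_eq_iff)

lemma vlinear_orb_right: "vlinear (orb i w)"
proof -
  have "ext (\<lambda>g. act g (x + y)) w = ext (\<lambda>g. act g x) w + ext (\<lambda>g. act g y) w" for x y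
    by (simp add: ext_def vlinearD[OF vlinear_act] sum.distrib)
  then show ?thesis
    by (auto simp: vlinear_def orb_def fun_eq_iff)
qed

lemmas vlinear_orb = vlinear_orb_left vlinear_orb_right

lemma sum_fun_apply: "(\<Sum>j\<in>J. f j) k = (\<Sum>j\<in>J. f j k)"
  by (induction J rule: infinite_finite_induct) auto

lemma coords_W: "coords (obj W_complex i) (\<lambda>w. w) (vspan (if 0 \<le> i then UNIV else {}))"
  by (simp add: W_complex_def coords_free)

lemma W_sigma_ext: "W_sigma i w = ext (\<lambda>g. gen (times_sigma g)) w"
  by (simp add: W_sigma_def lin_ext_eq)

lemma orb_W_sigma: "orb i (W_sigma i w) y = orb i w (swp y)"
  by (simp add: orb_def W_sigma_ext vlinear_ext_comp[OF vlinear_ext] act_times fun_eq_iff)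

locale coord_complex =
  fixes B :: "('a, 'a) pretensor set chain_complex" and cB :: "int \<Rightarrow> ('a, 'a) pretensor set \<Rightarrow> 's \<times> 's \<Rightarrow>\<^sub>0 bit"
    and SB :: "int \<Rightarrow> ('s \<times> 's) set" and \<tau> :: "int \<Rightarrow> ('a, 'a) pretensor set \<Rightarrow> ('a, 'a) pretensor set"
  assumes B: "\<And>i. coords (obj B i) (cB i) (vspan (SB i))"
    and neg: "\<And>i. i < 0 \<Longrightarrow> SB i = {}"
    and sw: "\<And>i x y. (x, y) \<in> SB i \<Longrightarrow> (y, x) \<in> SB i"
    and \<tau>: "\<And>i. reps (obj B i) (cB i) (obj B i) (cB i) (\<tau> i) swp"
begin

definition orbT :: "int \<Rightarrow> (nat \<Rightarrow> 's \<times> 's \<Rightarrow>\<^sub>0 bit) set"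
  where "orbT n = {c. \<forall>j. c j \<in> vspan (SB (n - int j))}"

definition orb\<phi> :: "int \<Rightarrow> (int \<times> (sigma2 \<Rightarrow>\<^sub>0 bit) \<times> ('a, 'a) pretensor set) \<Rightarrow> nat \<Rightarrow> 's \<times> 's \<Rightarrow>\<^sub>0 bit"
  where "orb\<phi> n = (\<lambda>(i, w, b). orb i w (cB (n - i) b))"

lemma act_SB: "y \<in> vspan (SB i) \<Longrightarrow> act g y \<in> vspan (SB i)"
  by (cases g) (auto intro: swp_vspan sw)

lemma horbit_coords:
  shows "linmap (tensor_free W_complex B n) (ext (orb\<phi> n)) (orbT n)"
    and "tensor_rels {(W_sigma, \<tau>)} W_complex B n = {x \<in> carrier (tensor_free W_complex B n). ext (orb\<phi> n) x = 0}"
    and "coords (obj (tensor {(W_sigma, \<tau>)} W_complex B) n) (lift (ext (orb\<phi> n))) (orbT n)"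
proof -
  note LB = coordsD(1)[OF B]
  define iB where "iB i = from_coords (obj B i) (cB i)" for i
  note fB = from_coords[OF LB, folded iB_def]
  have cW: "carrier (obj W_complex i) = vspan (if 0 \<le> i then UNIV else {})" for i
    by (simp add: W_complex_def)
  have addW: "a \<oplus>\<^bsub>obj W_complex i\<^esub> a' = a + a'" for i a a'
    by (simp add: W_complex_def free_vs_def)
  let ?e = "gen Sig_e"
  have eW: "?e \<in> carrier (obj W_complex (int j))" for j
    by (simp add: cW)
  \<comment> \<open>Since B has no negative degrees, the coefficients vanish beyond n and a finite
    sum reaches all of them.\<close>
  define \<psi> where "\<psi> = (\<lambda>t. \<Sum>j\<in>{..nat n}. ptens (int j) ?e (iB (n - int j) (t j)))"
  have iB_add: "iB i (x + y) = iB i x \<oplus>\<^bsub>obj B i\<^esub> iB i y" if "x \<in> vspan (SB i)" "y \<in> vspan (SB i)" for i x y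
    unfolding iB_def using from_coords_add[OF B that] .
  have high: "t j = 0" if "t \<in> orbT n" "j \<notin> {..nat n}" for t j
  proof -
    have "SB (n - int j) = {}"
      using that(2) by (intro neg) auto
    moreover have "t j \<in> vspan (SB (n - int j))"
      using that(1) by (simp add: orbT_def)
    ultimately show ?thesis
      by simp
  qed
  have P: "W_sigma i w \<in> carrier (obj W_complex i) \<and> \<tau> (n - i) b \<in> carrier (obj B (n - i)) \<and>
      orb i (W_sigma i w) (cB (n - i) b) = orb i w (cB (n - i) (\<tau> (n - i) b))"
    if "w \<in> carrier (obj W_complex i)" "b \<in> carrier (obj B (n - i))" for i w b
    using that \<tau>[of "n - i"] orb_W_sigma[of i w] by (auto simp: cW reps_def W_sigma_ext)
  have T: "0 \<in> orbT n" "\<And>t u. t \<in> orbT n \<Longrightarrow> u \<in> orbT n \<Longrightarrow> t + u \<in> orbT n"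
    by (auto simp: orbT_def vspan_add)
  have T\<Phi>: "orb i w y \<in> orbT n" if "y \<in> vspan (SB (n - i))" for i w y
    using that act_SB by (auto simp: orbT_def orb_def ext_def intro!: vspan_sum)
  have \<psi>: "\<psi> t \<in> carrier (tensor_free W_complex B n) \<and> ext (\<lambda>(i, a, b). orb i a (cB (n - i) b)) (\<psi> t) = t" if t: "t \<in> orbT n" for t
  proof
    have tj: "t j \<in> vspan (SB (n - int j))" for j
      using t by (simp add: orbT_def)
    show "\<psi> t \<in> carrier (tensor_free W_complex B n)"
      unfolding tensor_free_def carrier_free \<psi>_def using fB(1)[OF tj] eW by (intro vspan_sum) auto
    have "ext (\<lambda>(i, a, b). orb i a (cB (n - i) b)) (\<psi> t) = (\<Sum>j\<in>{..nat n}. orb (int j) ?e (t j))"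
      unfolding \<psi>_def ext_sum using fB(2)[OF tj] by simp
    also have "\<dots> = t"
    proof
      fix k
      have "(\<Sum>j\<in>{..nat n}. orb (int j) ?e (t j)) k = (\<Sum>j\<in>{..nat n}. orb (int j) ?e (t j) k)"
        by (rule sum_fun_apply)
      also have "\<dots> = (\<Sum>j\<in>{..nat n}. if j = k then t k else 0)"
        by (rule sum.cong) (auto simp: orb_def)
      also have "\<dots> = t k"
        using high[OF t, of k] by auto
      finally show "(\<Sum>j\<in>{..nat n}. orb (int j) ?e (t j)) k = t k" .
    qed
    finally show "ext (\<lambda>(i, a, b). orb i a (cB (n - i) b)) (\<psi> t) = t" .
  qed
  have near1: "\<psi> (t + u) + (\<psi> t + \<psi> u) \<in> N" if N: "tcong {(W_sigma, \<tau>)} W_complex B n N" and tu: "t \<in> orbT n" "u \<in> orbT n" for N t u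
  proof -
    have "\<psi> (t + u) + (\<psi> t + \<psi> u) = (\<Sum>j\<in>{..nat n}. ptens (int j) ?e (iB (n - int j) (t j + u j)) +
      (ptens (int j) ?e (iB (n - int j) (t j)) + ptens (int j) ?e (iB (n - int j) (u j))))"
      unfolding \<psi>_def by (simp add: sum.distrib)
    also have "\<dots> \<in> N"
    proof (rule tcong_sum[OF N])
      fix j
      have tj: "t j \<in> vspan (SB (n - int j))" "u j \<in> vspan (SB (n - int j))"
        using tu by (auto simp: orbT_def)
      show "ptens (int j) ?e (iB (n - int j) (t j + u j)) +
        (ptens (int j) ?e (iB (n - int j) (t j)) + ptens (int j) ?e (iB (n - int j) (u j))) \<in> N"
        unfolding iB_add[OF tj] using tcongD(4)[OF N eW fB(1)[OF tj(1)] fB(1)[OF tj(2)]] .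
    qed
    finally show ?thesis .
  qed
  have near2: "ptens i w b + \<psi> (orb i w (cB (n - i) b)) \<in> N"
    if N: "tcong {(W_sigma, \<tau>)} W_complex B n N" and wb: "w \<in> carrier (obj W_complex i)" "b \<in> carrier (obj B (n - i))" for N i w b
  proof -
    note N' = tcongD[OF N]
    let ?y = "cB (n - i) b"
    have y: "?y \<in> vspan (SB (n - i))"
      using linmapD(7)[OF LB wb(2)] .
    have b: "b = iB (n - i) ?y"
      using from_coords_f[OF B wb(2)] by (simp add: iB_def)
    have zero: "\<psi> 0 \<in> N"
      using near1[OF N T(1) T(1)] by simp
    have pt0: "ptens i 0 b \<in> N"
    proof -
      have "0 \<in> carrier (obj W_complex i)"
        by (simp add: cW)
      from N'(3)[OF this this wb(2)] show ?thesis
        by (simp add: addW)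
    qed
    show ?thesis
    proof (cases "0 \<le> i")
      case False
      then have "w = 0"
        using wb(1) by (simp add: cW)
      then show ?thesis
        using pt0 zero N'(2) by (simp add: vlinear_0[OF vlinear_orb(1)])
    next
      case i: True
      then have w: "w \<in> vspan UNIV"
        by simp
      have cWi: "carrier (obj W_complex i) = UNIV"
        using i by (auto simp: cW)
      \<comment> \<open>Five congruences modulo N: w is expanded into group elements, each is moved
        across the tensor sign, the results are collected in the right factor, and this is compared
        with \<psi>, whose other summands are tensors with 0.\<close>
      have 1: "ptens i w b + ext (\<lambda>g. ptens i (gen g) b) w \<in> N"
      proof (rule near_additive[where D = "\<lambda>w. ptens i w b", OF N'(1,2) _ w])
        fix t u show "ptens i (t + u) b + (ptens i t b + ptens i u b) \<in> N"
          using N'(3)[of t i u b] wb(2) by (simp add: cWi addW)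
      qed
      have 2: "ptens i (gen g) b + ptens i ?e (iB (n - i) (act g ?y)) \<in> N" for g
      proof (cases g)
        case Sig_e
        then show ?thesis using b N'(1) by simp
      next
        case Sig_sigma
        have "\<tau> (n - i) b \<in> carrier (obj B (n - i))" "cB (n - i) (\<tau> (n - i) b) = swp ?y"
          using \<tau> wb(2) by (auto simp: reps_def)
        then have "\<tau> (n - i) b = iB (n - i) (swp ?y)"
          using from_coords_f[OF B, of "\<tau> (n - i) b" "n - i"] by (simp add: iB_def)
        then show ?thesis
          using N'(5)[of ?e i b W_sigma \<tau>] wb(2) Sig_sigma by (simp add: cWi W_sigma_ext)
      qed
      have 3: "ptens i ?e (iB (n - i) (ext (\<lambda>g. act g ?y) w)) + ext (\<lambda>g. ptens i ?e (iB (n - i) (act g ?y))) w \<in> N"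
      proof -
        have "ptens i ?e (iB (n - i) (ext (\<lambda>g. act g ?y) w)) + ext (\<lambda>g. ptens i ?e (iB (n - i) (ext (\<lambda>g. act g ?y) (gen g)))) w \<in> N"
        proof (rule near_additive[where D = "\<lambda>w. ptens i ?e (iB (n - i) (ext (\<lambda>g. act g ?y) w))", OF N'(1,2) _ w])
          fix t u :: "sigma2 \<Rightarrow>\<^sub>0 bit"
          have m: "ext (\<lambda>g. act g ?y) t \<in> vspan (SB (n - i))" for t :: "sigma2 \<Rightarrow>\<^sub>0 bit"
            unfolding ext_def using act_SB[OF y] by (intro vspan_sum)
          show "ptens i ?e (iB (n - i) (ext (\<lambda>g. act g ?y) (t + u))) +
            (ptens i ?e (iB (n - i) (ext (\<lambda>g. act g ?y) t)) + ptens i ?e (iB (n - i) (ext (\<lambda>g. act g ?y) u))) \<in> N"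
            unfolding ext_add iB_add[OF m m] using N'(4)[OF _ fB(1)[OF m] fB(1)[OF m]] by (simp add: cWi)
        qed
        then show ?thesis
          by simp
      qed
      have 4: "\<psi> (orb i w ?y) + ptens i ?e (iB (n - i) (ext (\<lambda>g. act g ?y) w)) \<in> N"
      proof -
        let ?x = "ext (\<lambda>g. act g ?y) w"
        have z: "ptens (int j) ?e (iB (n - int j) 0) \<in> N" for j
          using N'(4)[OF eW fB(1)[OF vspan_0] fB(1)[OF vspan_0], of j] iB_add[OF vspan_0 vspan_0, of "n - int j"] by simp
        have "ptens (int j) ?e (iB (n - int j) (orb i w ?y j)) = (if j = nat i then ptens i ?e (iB (n - i) ?x) else ptens (int j) ?e (iB (n - int j) 0))" for j
          using i by (auto simp: orb_def)
        then have \<psi>_eq: "\<psi> (orb i w ?y) = (\<Sum>j\<in>{..nat n}. if j = nat i then ptens i ?e (iB (n - i) ?x) else ptens (int j) ?e (iB (n - int j) 0))"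
          unfolding \<psi>_def by simp
        show ?thesis
        proof (cases "nat i \<in> {..nat n}")
          case True
          have "\<psi> (orb i w ?y) = ptens i ?e (iB (n - i) ?x) + (\<Sum>j\<in>{..nat n} - {nat i}. ptens (int j) ?e (iB (n - int j) 0))"
            unfolding \<psi>_eq by (subst sum.remove[OF _ True]) auto
          then have "\<psi> (orb i w ?y) + ptens i ?e (iB (n - i) ?x) = (\<Sum>j\<in>{..nat n} - {nat i}. ptens (int j) ?e (iB (n - int j) 0))"
            by (simp add: ac_simps)
          also have "\<dots> \<in> N"
            using z by (rule tcong_sum[OF N])
          finally show ?thesis .
        next
          case False
          then have "n - i < 0"
            using i by auto
          then have "?x = 0"
            using y neg by (simp add: ext_def vlinear_0[OF vlinear_act])
          then have "ptens i ?e (iB (n - i) ?x) \<in> N"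
            using z[of "nat i"] i by simp
          moreover have "\<psi> (orb i w ?y) = (\<Sum>j\<in>{..nat n}. ptens (int j) ?e (iB (n - int j) 0))"
            unfolding \<psi>_eq using False by (intro sum.cong) auto
          moreover have "\<dots> \<in> N"
            using z by (rule tcong_sum[OF N])
          ultimately show ?thesis
            using N'(2) by simp
        qed
      qed
      have 5: "ext (\<lambda>g. ptens i (gen g) b) w + ext (\<lambda>g. ptens i ?e (iB (n - i) (act g ?y))) w \<in> N"
        unfolding ext_def sum.distrib[symmetric] using 2 by (rule tcong_sum[OF N])
      have "(ptens i w b + ext (\<lambda>g. ptens i (gen g) b) w) +
        ((ext (\<lambda>g. ptens i (gen g) b) w + ext (\<lambda>g. ptens i ?e (iB (n - i) (act g ?y))) w) +
        ((ptens i ?e (iB (n - i) (ext (\<lambda>g. act g ?y) w)) + ext (\<lambda>g. ptens i ?e (iB (n - i) (act g ?y))) w) +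
        (\<psi> (orb i w ?y) + ptens i ?e (iB (n - i) (ext (\<lambda>g. act g ?y) w))))) \<in> N"
        by (rule N'(2)[OF 1 N'(2)[OF 5 N'(2)[OF 3 4]]])
      then show ?thesis
        by (simp add: ac_simps)
    qed
  qed
  note tc = tensor_coords[where A = W_complex and B = B and cA = "\<lambda>i w. w" and cB = cB and \<Phi> = orb
    and P = "{(W_sigma, \<tau>)}" and T = "orbT n" and \<psi> = \<psi> and n = n
    and UA = "\<lambda>i. vspan (if 0 \<le> i then UNIV else {})" and UB = "\<lambda>i. vspan (SB i)",
    OF coords_W B vlinear_orb(1) vlinear_orb(2) _ T T\<Phi> \<psi> near1 near2, folded orb\<phi>_def]
  show "linmap (tensor_free W_complex B n) (ext (orb\<phi> n)) (orbT n)"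
    by (rule tc(1)) (use P in auto)
  show "tensor_rels {(W_sigma, \<tau>)} W_complex B n = {x \<in> carrier (tensor_free W_complex B n). ext (orb\<phi> n) x = 0}"
    by (rule tc(2)) (use P in auto)
  show "coords (obj (tensor {(W_sigma, \<tau>)} W_complex B) n) (lift (ext (orb\<phi> n))) (orbT n)"
    by (rule tc(3)) (use P in auto)
qed

end

lemma reps_free:
  assumes "vlinear h" "\<And>b. b \<in> S \<Longrightarrow> G b \<in> vspan S' \<and> ext \<phi>' (G b) = h (\<phi> b)"
  shows "reps (free_vs S) (ext \<phi>) (free_vs S') (ext (\<phi>' :: _ \<Rightarrow> 'c::char2)) (lin_ext G) (h :: 'd::char2 \<Rightarrow> 'c)"
  unfolding reps_def carrier_free lin_ext_eq
proof (intro ballI conjI)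
  fix x assume x: "x \<in> vspan S"
  show "ext G x \<in> vspan S'"
    using x assms(2) by (auto intro: vspan_ext)
  have "ext \<phi>' (ext G x) = ext (\<lambda>b. ext \<phi>' (G b)) x"
    by (rule vlinear_ext_comp[OF vlinear_ext])
  also have "\<dots> = ext (\<lambda>b. h (\<phi> b)) x"
    using x assms(2) by (intro ext_cong) (auto simp: vspan_def)
  also have "\<dots> = h (ext \<phi> x)"
    by (rule vlinear_ext_comp[OF assms(1), symmetric])
  finally show "ext \<phi>' (ext G x) = h (ext \<phi> x)" .
qed

section \<open>The Bousfield-Kan complexes in coordinates\<close>

definition am :: "(nat \<Rightarrow> nat) \<Rightarrow> (nat set \<Rightarrow>\<^sub>0 bit) \<Rightarrow> (nat set \<Rightarrow>\<^sub>0 bit)"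
  where "am \<alpha> = ext (\<lambda>A. gen (\<alpha> ` A))"

lemma vlinear_am: "vlinear (am \<alpha>)"
  unfolding am_def by (rule vlinear_ext)

lemma am_gen: "am \<alpha> (gen A) = gen (\<alpha> ` A)"
  by (simp add: am_def)

locale bkp =
  fixes r :: enat and s t :: nat
  assumes r_ge: "2 \<le> r"

sublocale bkp \<subseteq> bk s "enat s + r"
proof
  show "enat (s + 2) \<le> enat s + r"
    using r_ge by (cases r) (auto simp: numeral_eq_enat)
qed

context bkp
begin

abbreviation "shift \<equiv> int t - int s"

abbreviation "Lv p \<equiv> level (BK r s t) p"

text \<open>The coordinate that divides out the lower skeleton: within the upper truncation its
  kernel consists of the chains on faces with at most s vertices.\<close>

definition big :: "(nat set \<Rightarrow>\<^sub>0 bit) \<Rightarrow> (nat set \<Rightarrow>\<^sub>0 bit)"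
  where "big = restrict_to (\<lambda>A. Suc s \<le> card A)"

definition SD :: "nat \<Rightarrow> int \<Rightarrow> nat set set"
  where "SD p q = {A \<in> Sp p. int (card A) = q - shift + 1}"

definition simp_basis :: "nat \<Rightarrow> int \<Rightarrow> nat set set"
  where "simp_basis p m = {A. A \<subseteq> {0..p} \<and> A \<noteq> {} \<and> int (card A) = m + 1}"

abbreviation "skhigh p m \<equiv> obj (sk_below (enat s + r) (simplex_complex p)) m"
abbreviation "sklow p m \<equiv> (\<lambda>x. x) ` carrier (obj (sk_below (enat s) (simplex_complex p)) m)"

lemma Lv_obj: "obj (Lv p) q = quot_vs (skhigh p (q - shift)) (sklow p (q - shift))"
  by (simp add: BK_def cosimp_suspend_def suspend_def BK_base_def coker_complex_def)

lemma Lv_diff: "diff (Lv p) q = quot_map (skhigh p (q - 1 - shift)) (sklow p (q - 1 - shift))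
    (diff (sk_below (enat s + r) (simplex_complex p)) (q - shift))"
proof -
  have "diff (Lv p) q = quot_map (skhigh p (q - shift - 1)) (sklow p (q - shift - 1))
      (diff (sk_below (enat s + r) (simplex_complex p)) (q - shift))"
    by (simp add: BK_def cosimp_suspend_def suspend_def BK_base_def coker_complex_def)
  moreover have "q - shift - 1 = q - 1 - shift"
    by simp
  ultimately show ?thesis
    by (simp only:)
qed

lemma Lv_cmap: "cmap (BK r s t) m n \<alpha> q = quot_map (skhigh n (q - shift)) (sklow n (q - shift)) (simplex_map \<alpha>)"
  by (simp add: BK_def cosimp_suspend_def BK_base_def)

lemma obj_simplex: "obj (simplex_complex p) m = free_vs (simp_basis p m)"
  by (simp add: simplex_complex_def simp_basis_def)

lemma simp_basis_finite: "A \<in> simp_basis p m \<Longrightarrow> finite A"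
  using finite_subset[of A "{0..p}"] by (auto simp: simp_basis_def)

lemma simp_basis_Diff:
  assumes "A \<in> simp_basis p m" "0 < m" "i \<in> A"
  shows "A - {i} \<in> simp_basis p (m - 1)"
proof -
  have c: "int (card (A - {i})) = m"
    using assms simp_basis_finite[OF assms(1)] by (auto simp: simp_basis_def card_Diff_singleton)
  moreover have "A - {i} \<noteq> {}"
  proof
    assume "A - {i} = {}"
    then have "int (card (A - {i})) = 0"
      by (simp only: card.empty of_nat_0)
    then show False
      using c assms(2) by simp
  qed
  moreover have "A - {i} \<subseteq> {0..p}"
    using assms(1) by (auto simp: simp_basis_def)
  ultimately show ?thesis
    unfolding simp_basis_def mem_Collect_eq by (simp only: diff_add_cancel) simp
qed

lemma carrier_sk: "carrier (obj (sk_below j (simplex_complex p)) m) = vspan (if in_sk_below j m then simp_basis p m else {})"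
proof -
  have "vspan {} = {0 :: nat set \<Rightarrow>\<^sub>0 bit}"
    by auto
  moreover have "\<zero>\<^bsub>free_vs (simp_basis p m)\<^esub> = 0"
    by (simp add: free_vs_def)
  ultimately show ?thesis
    by (simp add: sk_below_def obj_simplex sub_vs_def)
qed

lemma in_sk_below_top: "in_sk_below (enat s + r) m \<longleftrightarrow> m < 0 \<or> enat (Suc (nat m)) \<le> enat s + r"
  by (simp add: in_sk_below_def Suc_ile_eq)

lemma in_sk_below_bottom: "in_sk_below (enat s) m \<longleftrightarrow> m < int s"
  by (auto simp: in_sk_below_def)

lemma vlinear_big: "vlinear big"
  unfolding big_def by (rule vlinear_restrict_to)

lemma big_simps [simp]: "big 0 = 0" "big (x + y) = big x + big y" "big (gen A) = (if Suc s \<le> card A then gen A else 0)"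
  by (simp_all add: big_def)

lemma SD_eq: "SD p (m + shift) = (if in_sk_below (enat s + r) m \<and> int s \<le> m then simp_basis p m else {})"
proof -
  have "A \<in> SD p (m + shift) \<longleftrightarrow> in_sk_below (enat s + r) m \<and> int s \<le> m \<and> A \<in> simp_basis p m" for A
  proof (cases "int (card A) = m + 1")
    case True
    \<comment> \<open>Only the empty set has the size belonging to degree -1, and it is a basis
      element on neither side; the case is separated because \<open>nat\<close> sends -1 to
      0.\<close>
    then have "nat m = card A - 1 \<and> 0 \<le> m \<or> card A = 0 \<and> m = -1"
      by auto
    then show ?thesis
      using True by (auto simp: SD_def Sp_def simp_basis_def in_sk_below_top)
  next
    case False
    then show ?thesis
      by (simp add: SD_def simp_basis_def)
  qed
  then show ?thesis
    by auto
qed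

lemma ambient_linmap:
  shows "linmap (skhigh p m) big (vspan (SD p (m + shift)))"
    and "sklow p m = {x \<in> carrier (skhigh p m). big x = 0}"
proof -
  let ?S = "if in_sk_below (enat s + r) m then simp_basis p m else {}"
  have im: "big x = (if int s \<le> m then x else 0)" if "x \<in> vspan (simp_basis p m)" for x
  proof (rule vlinear_eqI[OF vlinear_big _ that])
    show "vlinear (\<lambda>x :: nat set \<Rightarrow>\<^sub>0 bit. if int s \<le> m then x else 0)"
      by (auto simp: vlinear_def)
  qed (auto simp: simp_basis_def)
  have "big ` vspan ?S = vspan (SD p (m + shift))"
    using im by (auto simp: SD_eq image_iff intro!: bexI[of _ 0] exI[of _ 0])
  then have l: "linmap (free_vs ?S) big (vspan (SD p (m + shift)))"
    by (rule linmap_free[OF vlinear_big])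
  show "linmap (skhigh p m) big (vspan (SD p (m + shift)))"
  proof (cases "in_sk_below (enat s + r) m")
    case True
    then show ?thesis
      using l by (simp add: sk_below_def obj_simplex)
  next
    case False
    have "obj (sk_below (enat s + r) (simplex_complex p)) m = free_vs {}"
      using False by (simp add: sk_below_def obj_simplex sub_vs_def free_vs_def)
    then show ?thesis
      using l False by simp
  qed
  have "in_sk_below (enat s + r) m" if "in_sk_below (enat s) m"
    using that by (cases r) (auto simp: in_sk_below_def)
  then show "sklow p m = {x \<in> carrier (skhigh p m). big x = 0}"
    unfolding carrier_sk using im by (auto simp: in_sk_below_bottom split: if_splits)
qed

definition cD :: "(nat set \<Rightarrow>\<^sub>0 bit) set \<Rightarrow> (nat set \<Rightarrow>\<^sub>0 bit)"
  where "cD = lift big"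

lemma coords_Lv: "coords (obj (Lv p) q) cD (vspan (SD p q))"
  using quot_coords[OF ambient_linmap, of p "q - shift"] by (simp add: Lv_obj cD_def)

lemma reps_Lv_diff: "reps (obj (Lv p) q) cD (obj (Lv p) (q - 1)) cD (diff (Lv p) q) bd"
  unfolding Lv_obj Lv_diff cD_def
proof (rule quot_map_reps[OF ambient_linmap ambient_linmap])
  let ?m = "q - shift"
  have m: "q - 1 - shift = ?m - 1"
    by simp
  show "reps (skhigh p ?m) big (skhigh p (q - 1 - shift)) big (diff (sk_below (enat s + r) (simplex_complex p)) ?m) bd"
    unfolding reps_def m
  proof
    fix x assume x: "x \<in> carrier (skhigh p ?m)"
    let ?d = "ext (\<lambda>A. \<Sum>i\<in>A. gen (A - {i}))"
    show "diff (sk_below (enat s + r) (simplex_complex p)) ?m x \<in> carrier (skhigh p (?m - 1)) \<and>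
        big (diff (sk_below (enat s + r) (simplex_complex p)) ?m x) = bd (big x)"
    proof (cases "in_sk_below (enat s + r) ?m \<and> 0 < ?m")
      case True
      then have d: "diff (sk_below (enat s + r) (simplex_complex p)) ?m x = ?d x"
        by (simp add: sk_below_def simplex_complex_def lin_ext_eq)
      have xs: "x \<in> vspan (simp_basis p ?m)"
        using x True by (simp add: carrier_sk)
      have "in_sk_below (enat s + r) (?m - 1)"
        using True by (auto simp: in_sk_below_def elim: less_trans[rotated])
      moreover have "?d x \<in> vspan (simp_basis p (?m - 1))"
        by (rule vspan_ext[OF xs])
          (use True simp_basis_Diff[of _ p ?m] in \<open>auto intro!: vspan_sum\<close>)
      moreover have "big (?d x) = bd (big x)"
      proof (rule vlinear_eqI[where f = "\<lambda>x. big (?d x)" and g = "\<lambda>x. bd (big x)", OF _ _ xs])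
        show "vlinear (\<lambda>x. big (?d x))" "vlinear (\<lambda>x. bd (big x))"
          by (auto simp: vlinear_def)
        fix A assume A: "A \<in> simp_basis p ?m"
        then have "card (A - {i}) = card A - 1" if "i \<in> A" for i
          using that simp_basis_finite by (simp add: card_Diff_singleton)
        then show "big (?d (gen A)) = bd (big (gen A))"
          by (auto simp: bd_def vlinear_sum[OF vlinear_big] intro!: sum.neutral sum.cong)
      qed
      ultimately show ?thesis
        unfolding d carrier_sk by simp
    next
      \<comment> \<open>Either x is zero, or the degree is at most 0 and a face has at most one
        vertex, too few for a nonzero \<open>bd\<close>.\<close>
      case False
      have "diff (sk_below (enat s + r) (simplex_complex p)) ?m x = 0"
        using False by (auto simp: sk_below_def simplex_complex_def free_vs_def)
      moreover have "bd (big x) = 0"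
      proof (cases "in_sk_below (enat s + r) ?m")
        case True
        then have xs: "x \<in> vspan (simp_basis p ?m)"
          using x by (simp add: carrier_sk)
        show ?thesis
        proof (rule vlinear_eqI[where f = "\<lambda>x. bd (big x)", OF _ vlinear_zero xs])
          show "vlinear (\<lambda>x. bd (big x))"
            by (auto simp: vlinear_def)
        qed (use False True in \<open>auto simp: simp_basis_def bd_def\<close>)
      next
        case False
        then show ?thesis
          using x by (simp add: carrier_sk)
      qed
      ultimately show ?thesis
        by (simp add: carrier_sk)
    qed
  qed
qed

text \<open>Under an injective map no simplex degenerates, so \<open>simplex_map\<close> reduces to
  the image map \<open>am\<close>; cofaces are of this kind.\<close>

lemma reps_Lv_cmap:
  assumes "inj \<alpha>" "\<alpha> ` {0..p} \<subseteq> {0..p'}"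
  shows "reps (obj (Lv p) q) cD (obj (Lv p') q) cD (cmap (BK r s t) p p' \<alpha> q) (am \<alpha>)"
  unfolding Lv_obj Lv_cmap cD_def
proof (rule quot_map_reps[OF ambient_linmap ambient_linmap])
  let ?m = "q - shift"
  have inj: "inj_on \<alpha> A" for A
    using assms(1) by (rule inj_on_subset) simp
  have eq: "simplex_map \<alpha> = am \<alpha>"
    unfolding simplex_map_def lin_ext_eq am_def using inj by simp
  show "reps (skhigh p ?m) big (skhigh p' ?m) big (simplex_map \<alpha>) (am \<alpha>)"
    unfolding reps_def eq
  proof (intro ballI conjI)
    fix x assume "x \<in> carrier (skhigh p ?m)"
    then have xs: "x \<in> vspan (if in_sk_below (enat s + r) ?m then simp_basis p ?m else {})"
      by (simp add: carrier_sk)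
    show "am \<alpha> x \<in> carrier (skhigh p' ?m)"
      unfolding carrier_sk
      by (rule vlinear_vspan[OF vlinear_am xs]) (use assms(2) inj in \<open>auto simp: am_gen simp_basis_def card_image split: if_splits\<close>)
    show "big (am \<alpha> x) = am \<alpha> (big x)"
    proof (rule vlinear_eqI[where f = "\<lambda>x. big (am \<alpha> x)" and g = "\<lambda>x. am \<alpha> (big x)", OF _ _ xs])
      show "vlinear (\<lambda>x. big (am \<alpha> x))" "vlinear (\<lambda>x. am \<alpha> (big x))"
        by (auto simp: vlinear_def am_def)
    qed (auto simp: am_gen card_image[OF inj] am_def)
  qed
qed

definition dD :: "nat set \<Rightarrow> int"
  where "dD A = int (card A) - 1 + shift"

lemma dD: "A \<in> SD p i \<Longrightarrow> dD A = i"
  by (simp add: SD_def dD_def)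

definition SDD :: "nat \<Rightarrow> int \<Rightarrow> (nat set \<times> nat set) set"
  where "SDD p n = {(A, B). A \<in> Sp p \<and> B \<in> Sp p \<and> cd A + cd B = n - 2 * shift + 2}"

definition \<phi>D :: "int \<Rightarrow> int \<times> (nat set \<Rightarrow>\<^sub>0 bit) set \<times> (nat set \<Rightarrow>\<^sub>0 bit) set \<Rightarrow> (nat set \<times> nat set \<Rightarrow>\<^sub>0 bit)"
  where "\<phi>D n = (\<lambda>(i, a, b). cross (cD a) (cD b))"

abbreviation "DD p \<equiv> tensor {} (Lv p) (Lv p)"

lemma SDD_eq: "{(A, B). A \<in> SD p (dD A) \<and> B \<in> SD p (n - dD A)} = SDD p n"
  by (auto simp: SDD_def SD_def dD_def cd_def)

lemma DD_coords:
  shows "linmap (tensor_free (Lv p) (Lv p) n) (ext (\<phi>D n)) (vspan (SDD p n))"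
    and "tensor_rels {} (Lv p) (Lv p) n = {x \<in> carrier (tensor_free (Lv p) (Lv p) n). ext (\<phi>D n) x = 0}"
    and "coords (obj (DD p) n) (lift (ext (\<phi>D n))) (vspan (SDD p n))"
  using tensor_basis_coords[where A = "Lv p" and B = "Lv p" and cA = "\<lambda>_. cD" and cB = "\<lambda>_. cD" and SA = "SD p" and SB = "SD p"
    and dA = dD and n = n, OF coords_Lv coords_Lv dD[where p = p]]
  unfolding SDD_eq \<phi>D_def by blast+

definition cDD :: "int \<Rightarrow> ((nat set \<Rightarrow>\<^sub>0 bit) set, (nat set \<Rightarrow>\<^sub>0 bit) set) pretensor set \<Rightarrow> (nat set \<times> nat set \<Rightarrow>\<^sub>0 bit)"
  where "cDD n = lift (ext (\<phi>D n))"

lemma coords_DD: "coords (obj (DD p) n) (cDD n) (vspan (SDD p n))"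
  unfolding cDD_def by (rule DD_coords(3))

lemma reps_DD_diff: "reps (obj (DD p) n) (cDD n) (obj (DD p) (n - 1)) (cDD (n - 1)) (diff (DD p) n) (\<lambda>y. lft bd y + rgt bd y)"
proof -
  have "reps (tensor_free (Lv p) (Lv p) n) (ext (\<phi>D n)) (tensor_free (Lv p) (Lv p) (n - 1)) (ext (\<phi>D (n - 1)))
    (lin_ext (\<lambda>(i, a, b). ptens (i - 1) (diff (Lv p) i a) b + ptens i a (diff (Lv p) (n - i) b))) (\<lambda>y. lft bd y + rgt bd y)"
    unfolding tensor_free_def
  proof (rule reps_free)
    show "vlinear (\<lambda>y. lft bd y + rgt bd y)"
      by (auto simp: vlinear_def ac_simps)
    fix x assume "x \<in> {(i, a, b) |i a b. a \<in> carrier (obj (Lv p) i) \<and> b \<in> carrier (obj (Lv p) (n - i))}"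
    then obtain i a b where x: "x = (i, a, b)" "a \<in> carrier (obj (Lv p) i)" "b \<in> carrier (obj (Lv p) (n - i))"
      by blast
    have d: "diff (Lv p) i a \<in> carrier (obj (Lv p) (i - 1))" "cD (diff (Lv p) i a) = bd (cD a)"
      "diff (Lv p) (n - i) b \<in> carrier (obj (Lv p) (n - i - 1))" "cD (diff (Lv p) (n - i) b) = bd (cD b)"
      using reps_Lv_diff x(2,3) by (auto simp: reps_def)
    have e: "n - 1 - (i - 1) = n - i" "n - 1 - i = n - i - 1"
      by auto
    show "(case x of (i, a, b) \<Rightarrow> ptens (i - 1) (diff (Lv p) i a) b + ptens i a (diff (Lv p) (n - i) b))
        \<in> vspan {(i, a, b) |i a b. a \<in> carrier (obj (Lv p) i) \<and> b \<in> carrier (obj (Lv p) (n - 1 - i))} \<and>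
      ext (\<phi>D (n - 1)) (case x of (i, a, b) \<Rightarrow> ptens (i - 1) (diff (Lv p) i a) b + ptens i a (diff (Lv p) (n - i) b)) =
      lft bd (\<phi>D n x) + rgt bd (\<phi>D n x)"
    proof
      show "(case x of (i, a, b) \<Rightarrow> ptens (i - 1) (diff (Lv p) i a) b + ptens i a (diff (Lv p) (n - i) b))
        \<in> vspan {(i, a, b) |i a b. a \<in> carrier (obj (Lv p) i) \<and> b \<in> carrier (obj (Lv p) (n - 1 - i))}"
        using d(1,2) d(3)[unfolded e(2)[symmetric]] x by (auto intro!: vspan_add)
      show "ext (\<phi>D (n - 1)) (case x of (i, a, b) \<Rightarrow> ptens (i - 1) (diff (Lv p) i a) b + ptens i a (diff (Lv p) (n - i) b)) =
        lft bd (\<phi>D n x) + rgt bd (\<phi>D n x)"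
        using d x by (simp add: \<phi>D_def lft_cross rgt_cross vlinear_ops)
    qed
  qed
  from quot_map_reps[OF DD_coords(1,2) DD_coords(1,2) this] show ?thesis
    by (simp add: tensor_def cDD_def)
qed

lemma reps_swap: "reps (obj (DD p) n) (cDD n) (obj (DD p) n) (cDD n) (tensor_swap (Lv p) n) swp"
proof -
  have "reps (tensor_free (Lv p) (Lv p) n) (ext (\<phi>D n)) (tensor_free (Lv p) (Lv p) n) (ext (\<phi>D n))
    (lin_ext (\<lambda>(i, a, b). ptens (n - i) b a)) swp"
    unfolding tensor_free_def
    by (rule reps_free[OF vlinear_swp]) (auto simp: \<phi>D_def swp_cross)
  from quot_map_reps[OF DD_coords(1,2) DD_coords(1,2) this] show ?thesis
    by (simp add: tensor_def cDD_def tensor_swap_def)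
qed

definition amP :: "(nat \<Rightarrow> nat) \<Rightarrow> (nat set \<times> nat set \<Rightarrow>\<^sub>0 bit) \<Rightarrow> (nat set \<times> nat set \<Rightarrow>\<^sub>0 bit)"
  where "amP \<alpha> y = lft (am \<alpha>) (rgt (am \<alpha>) y)"

lemma vlinear_amP: "vlinear (amP \<alpha>)"
  by (auto simp: vlinear_def amP_def)

lemma reps_DD_map:
  assumes "inj \<alpha>" "\<alpha> ` {0..p} \<subseteq> {0..p'}"
  shows "reps (obj (DD p) n) (cDD n) (obj (DD p') n) (cDD n)
    (tensor_map {} (Lv p') (Lv p') (cmap (BK r s t) p p' \<alpha>) (cmap (BK r s t) p p' \<alpha>) n) (amP \<alpha>)"
proof -
  have "reps (tensor_free (Lv p) (Lv p) n) (ext (\<phi>D n)) (tensor_free (Lv p') (Lv p') n) (ext (\<phi>D n))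
    (lin_ext (\<lambda>(i, a, b). ptens i (cmap (BK r s t) p p' \<alpha> i a) (cmap (BK r s t) p p' \<alpha> (n - i) b))) (amP \<alpha>)"
    unfolding tensor_free_def
    by (rule reps_free[OF vlinear_amP])
      (use reps_Lv_cmap[OF assms] in \<open>auto simp: \<phi>D_def reps_def amP_def lft_cross rgt_cross vlinear_am\<close>)
  from quot_map_reps[OF DD_coords(1,2) DD_coords(1,2) this] show ?thesis
    by (simp add: tensor_def cDD_def tensor_map_def)
qed

end

lemma image_face: "face k ` {0..p - 1} \<subseteq> {0..p}" if "1 \<le> p"
  using that by (auto simp: face_def)

lemma inj_face: "inj (face k)"
  by (auto simp: inj_def face_def split: if_splits)

lemma am_face_0: "am (face 0) = sh"
  by (auto simp: am_def sh_def face_def)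

context bkp
begin

sublocale DD: coord_complex "DD p" cDD "SDD p" "tensor_swap (Lv p)" for p
proof
  show "coords (obj (DD p) i) (cDD i) (vspan (SDD p i))" for i
    by (rule coords_DD)
  show "SDD p i = {}" if "i < 0" for i
    using that by (auto simp: SDD_def Sp_def cd_def)
  show "(y, x) \<in> SDD p i" if "(x, y) \<in> SDD p i" for i x y
    using that by (auto simp: SDD_def)
  show "reps (obj (DD p) i) (cDD i) (obj (DD p) i) (cDD i) (tensor_swap (Lv p) i) swp" for i
    by (rule reps_swap)
qed

abbreviation "EE p \<equiv> level (\<E> (BK r s t)) p"

lemma EE_eq: "EE p = tensor {(W_sigma, tensor_swap (Lv p))} W_complex (DD p)"
  by (simp add: cosimp_horbit_def horbit_def)

definition cE :: "int \<Rightarrow> (nat set \<Rightarrow>\<^sub>0 bit) set orbit \<Rightarrow> nat \<Rightarrow> pairs"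
  where "cE n = lift (ext (DD.orb\<phi> n))"

lemma coords_EE: "coords (obj (EE p) n) (cE n) (DD.orbT p n)"
  unfolding EE_eq cE_def by (rule DD.horbit_coords(3))

lemma W_diff: "diff W_complex i w = (if i \<le> 0 then 0 else w + W_sigma i w)"
proof -
  have "ext (\<lambda>g. gen g + gen (times_sigma g)) w = ext gen w + ext (\<lambda>g. gen (times_sigma g)) w"
    by (simp add: ext_def sum.distrib)
  then show ?thesis
    by (simp add: W_complex_def lin_ext_eq W_sigma_ext ext_gen_id)
qed

text \<open>As e_(j+1) has boundary (1 + \<sigma>) e_j, component j receives the norm of component j
  + 1 besides its own boundary.\<close>

lemma reps_EE_diff: "reps (obj (EE p) n) (cE n) (obj (EE p) (n - 1)) (cE (n - 1)) (diff (EE p) n)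
    (\<lambda>c j. (lft bd (c j) + rgt bd (c j)) + (c (Suc j) + swp (c (Suc j))))"
  (is "reps _ _ _ _ _ ?h")
proof -
  have "reps (tensor_free W_complex (DD p) n) (ext (DD.orb\<phi> n)) (tensor_free W_complex (DD p) (n - 1)) (ext (DD.orb\<phi> (n - 1)))
    (lin_ext (\<lambda>(i, a, b). ptens (i - 1) (diff W_complex i a) b + ptens i a (diff (DD p) (n - i) b))) ?h"
    unfolding tensor_free_def
  proof (rule reps_free)
    show "vlinear ?h"
      by (auto simp: vlinear_def fun_eq_iff ac_simps)
    fix x assume "x \<in> {(i, a, b) |i a b. a \<in> carrier (obj W_complex i) \<and> b \<in> carrier (obj (DD p) (n - i))}"
    then obtain i w b where x: "x = (i, w, b)" "w \<in> carrier (obj W_complex i)" "b \<in> carrier (obj (DD p) (n - i))"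
      by blast
    have e: "n - 1 - (i - 1) = n - i" "n - 1 - i = n - i - 1"
      by auto
    let ?y = "cDD (n - i) b"
    have d: "diff (DD p) (n - i) b \<in> carrier (obj (DD p) (n - 1 - i))"
      "cDD (n - 1 - i) (diff (DD p) (n - i) b) = lft bd ?y + rgt bd ?y"
      using reps_DD_diff[of p "n - i"] x(3) unfolding e(2) by (auto simp: reps_def)
    have w: "diff W_complex i w \<in> carrier (obj W_complex (i - 1))"
      using x(2) by (auto simp: W_diff W_complex_def)
    have "orb (i - 1) (diff W_complex i w) ?y + orb i w (lft bd ?y + rgt bd ?y) = ?h (orb i w ?y)"
    proof
      fix j
      let ?a = "\<lambda>y. ext (\<lambda>g. act g y) w"
      have swp_act: "swp (act g y) = act g (swp y)" for g and y :: pairs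
        by (cases g) auto
      have swp_a: "?a (swp y) = swp (?a y)" for y :: pairs
        by (simp add: vlinear_ext_comp[OF vlinear_swp] swp_act)
      have bd_act: "lft bd (act g y) + rgt bd (act g y) = act g (lft bd y + rgt bd y)" for g and y :: pairs
        by (cases g) (auto simp: swp_lft swp_rgt add.commute)
      have bd_a: "lft bd (?a y) + rgt bd (?a y) = ?a (lft bd y + rgt bd y)" for y :: pairs
      proof -
        have "vlinear (\<lambda>z. lft bd z + rgt bd z)"
          by (auto simp: vlinear_def ac_simps)
        from vlinear_ext_comp[OF this, of "\<lambda>g. act g y" w] show ?thesis
          by (simp add: bd_act)
      qed
      show "(orb (i - 1) (diff W_complex i w) ?y + orb i w (lft bd ?y + rgt bd ?y)) j = ?h (orb i w ?y) j"
        using bd_a[of ?y] swp_a[of ?y]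
        by (auto simp: orb_def W_diff W_sigma_ext vlinear_ext_comp[OF vlinear_ext] act_times)
    qed
    then show "(case x of (i, a, b) \<Rightarrow> ptens (i - 1) (diff W_complex i a) b + ptens i a (diff (DD p) (n - i) b))
        \<in> vspan {(i, a, b) |i a b. a \<in> carrier (obj W_complex i) \<and> b \<in> carrier (obj (DD p) (n - 1 - i))} \<and>
      ext (DD.orb\<phi> (n - 1)) (case x of (i, a, b) \<Rightarrow> ptens (i - 1) (diff W_complex i a) b + ptens i a (diff (DD p) (n - i) b)) =
      ?h (DD.orb\<phi> n x)"
      using x d w e(1) by (auto simp: DD.orb\<phi>_def intro!: vspan_add)
  qed
  from quot_map_reps[OF DD.horbit_coords(1,2) DD.horbit_coords(1,2) this] show ?thesis
    unfolding EE_eq cE_def by (simp add: tensor_def)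
qed

lemma reps_EE_map:
  assumes "inj \<alpha>" "\<alpha> ` {0..p} \<subseteq> {0..p'}"
  shows "reps (obj (EE p) n) (cE n) (obj (EE p') n) (cE n) (cmap (\<E> (BK r s t)) p p' \<alpha> n) (\<lambda>c j. amP \<alpha> (c j))"
    (is "reps _ _ _ _ _ ?h")
proof -
  let ?f = "\<lambda>n. tensor_map {} (Lv p') (Lv p') (cmap (BK r s t) p p' \<alpha>) (cmap (BK r s t) p p' \<alpha>) n"
  have "reps (tensor_free W_complex (DD p) n) (ext (DD.orb\<phi> n)) (tensor_free W_complex (DD p') n) (ext (DD.orb\<phi> n))
    (lin_ext (\<lambda>(i, a, b). ptens i a (?f (n - i) b))) ?h"
    unfolding tensor_free_def
  proof (rule reps_free)
    show "vlinear ?h"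
      by (auto simp: vlinear_def fun_eq_iff vlinearD[OF vlinear_amP])
    fix x assume "x \<in> {(i, a, b) |i a b. a \<in> carrier (obj W_complex i) \<and> b \<in> carrier (obj (DD p) (n - i))}"
    then obtain i w b where x: "x = (i, w, b)" "w \<in> carrier (obj W_complex i)" "b \<in> carrier (obj (DD p) (n - i))"
      by blast
    let ?y = "cDD (n - i) b"
    have d: "?f (n - i) b \<in> carrier (obj (DD p') (n - i))" "cDD (n - i) (?f (n - i) b) = amP \<alpha> ?y"
      using reps_DD_map[OF assms, of "n - i"] x(3) by (auto simp: reps_def)
    have am_act: "amP \<alpha> (act g y) = act g (amP \<alpha> y)" for g y
      by (cases g) (auto simp: amP_def swp_lft swp_rgt rgt_lft vlinear_am)
    have "orb i w (amP \<alpha> ?y) = ?h (orb i w ?y)"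
      using vlinear_ext_comp[OF vlinear_amP, of \<alpha> "\<lambda>g. act g ?y" w]
      by (auto simp: orb_def am_act vlinear_0[OF vlinear_amP])
    then show "(case x of (i, a, b) \<Rightarrow> ptens i a (?f (n - i) b))
        \<in> vspan {(i, a, b) |i a b. a \<in> carrier (obj W_complex i) \<and> b \<in> carrier (obj (DD p') (n - i))} \<and>
      ext (DD.orb\<phi> n) (case x of (i, a, b) \<Rightarrow> ptens i a (?f (n - i) b)) = ?h (DD.orb\<phi> n x)"
      using x d by (auto simp: DD.orb\<phi>_def)
  qed
  from quot_map_reps[OF DD.horbit_coords(1,2) DD.horbit_coords(1,2) this] show ?thesis
    unfolding EE_eq cE_def by (simp add: tensor_def cosimp_horbit_def horbit_map_def tensor_map_def)
qed

subsection \<open>The conormalization in coordinates\<close>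

text \<open>
  Degrees are measured by numbers of vertices: a pair \<open>(A, B)\<close> of faces has degree
  \<open>card A + card B - 2\<close> before suspension.
\<close>

definition kap :: "int \<Rightarrow> int"
  where "kap q = q - 2 * shift + 2"

definition cf :: "nat \<Rightarrow> int \<Rightarrow> (nat set \<Rightarrow>\<^sub>0 bit) set orbit \<Rightarrow> nat \<Rightarrow> pairs"
  where "cf p q = (\<lambda>x j. cov p (cE q x j))"

lemma orbT_iff: "c \<in> DD.orbT p q \<longleftrightarrow> (\<forall>j. c j \<in> vspan {(A, B). A \<in> Sp p \<and> B \<in> Sp p \<and> cd A + cd B = kap q - int j})"
proof -
  have "SDD p (q - int j) = {(A, B). A \<in> Sp p \<and> B \<in> Sp p \<and> cd A + cd B = kap q - int j}" for j
    by (auto simp: SDD_def kap_def)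
  then show ?thesis
    by (simp add: DD.orbT_def)
qed

lemma Cw_orbT: "c \<in> Cw p (kap q) \<Longrightarrow> c \<in> DD.orbT p q"
  unfolding orbT_iff Cw_def Pc_def graded_def by (auto elim!: vspan_mono)

lemma cov_orbT: "c \<in> DD.orbT p q \<Longrightarrow> (\<lambda>j. cov p (c j)) \<in> Cw p (kap q)"
  unfolding orbT_iff Cw_def Pc_def graded_def
  by (auto intro!: vspan_mono[OF restrict_to_vspan])

lemma cov_Cw: "c \<in> Cw p k \<Longrightarrow> cov p (c j) = c j"
  unfolding Cw_def Pc_def using cov_graded by blast

lemma linmap_EE: "linmap (obj (EE p) q) (cf p q) (Cw p (kap q))"
proof -
  note L = coordsD(1)[OF coords_EE[of p q]]
  have "cf p q ` carrier (obj (EE p) q) = Cw p (kap q)"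
  proof (intro equalityI subsetI)
    fix c assume "c \<in> cf p q ` carrier (obj (EE p) q)"
    then show "c \<in> Cw p (kap q)"
      using cov_orbT linmapD(7)[OF L] by (auto simp: cf_def)
  next
    fix c assume c: "c \<in> Cw p (kap q)"
    then obtain x where x: "x \<in> carrier (obj (EE p) q)" "c = cE q x"
      using Cw_orbT linmapD(2)[OF L] by blast
    then have "c = cf p q x"
      using cov_Cw[OF c] by (auto simp: cf_def)
    then show "c \<in> cf p q ` carrier (obj (EE p) q)"
      using x(1) by blast
  qed
  then show ?thesis
    using linmapD(1,3,4,5)[OF L] unfolding linmap_def by (auto simp: cf_def fun_eq_iff)
qed

lemma amP_gen: "amP \<alpha> (gen (A, B)) = gen (\<alpha> ` A, \<alpha> ` B)"
  by (simp add: amP_def lft_gen rgt_gen am_gen)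

lemma finsum_linmap:
  assumes L: "linmap M f T" and "finite K" "\<And>k. k \<in> K \<Longrightarrow> g k \<in> carrier M"
  shows "finsum M g K \<in> carrier M \<and> f (finsum M g K) = (\<Sum>k\<in>K. f (g k))"
  using assms(2,3)
proof (induction K rule: finite_induct)
  interpret abelian_group M
    by (rule vgroup_abelian_group[OF linmapD(1)[OF L]])
  {
    case empty
    then show ?case
      using linmapD(6)[OF L] by simp
  next
    case (insert k K)
    then have "finsum M g (insert k K) = g k \<oplus>\<^bsub>M\<^esub> finsum M g K"
      by (intro finsum_insert) auto
    then show ?case
      using insert linmapD(3)[OF L] by simp
  }
qed

end

lemma cov_amP_face:
  assumes "k \<in> {1..p}"
  shows "cov p (lft (am (face k)) (rgt (am (face k)) z)) = 0"
proof (rule cross_eqI[where f = "\<lambda>z. cov p (lft (am (face k)) (rgt (am (face k)) z))", OF _ vlinear_zero])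
  show "vlinear (\<lambda>z. cov p (lft (am (face k)) (rgt (am (face k)) z)))"
    by (auto simp: vlinear_def)
  fix A B
  have "k \<notin> face k ` A \<union> face k ` B"
    by (auto simp: face_def split: if_splits)
  then have "\<not> covering p (face k ` A, face k ` B)"
    using assms by (auto simp: covering_def)
  then show "cov p (lft (am (face k)) (rgt (am (face k)) (gen (A, B)))) = 0"
    by (simp add: lft_gen rgt_gen am_gen)
qed

definition unface :: "nat \<Rightarrow> nat \<Rightarrow> nat"
  where "unface k i = (if i < k then i else i - 1)"

lemma face_unface: "i \<noteq> k \<Longrightarrow> face k (unface k i) = i"
  by (auto simp: face_def unface_def)

lemma face_unface_image: "k \<notin> A \<Longrightarrow> face k ` unface k ` A = A"
proof -
  assume "k \<notin> A"
  then have "face k ` unface k ` A = (\<lambda>x. x) ` A"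
    unfolding image_image by (intro image_cong) (auto intro!: face_unface)
  then show ?thesis
    by simp
qed

text \<open>Assigns a non-covering pair to a single coface whose image contains it, so that a chain
  splits without overlap.\<close>

definition first_gap :: "nat set \<times> nat set \<Rightarrow> nat"
  where "first_gap = (\<lambda>(A, B). LEAST k. 1 \<le> k \<and> k \<notin> A \<union> B)"

lemma first_gap:
  assumes "\<not> covering p (A, B)"
  shows "first_gap (A, B) \<in> {1..p}" "first_gap (A, B) \<notin> A" "first_gap (A, B) \<notin> B"
proof -
  have "\<not> {1..p} \<subseteq> A \<union> B"
    using assms by (simp add: covering_def)
  then obtain k where k: "k \<in> {1..p}" "k \<notin> A \<union> B"
    by blast
  then have k': "1 \<le> k \<and> k \<notin> A \<union> B"
    by simp
  have "1 \<le> first_gap (A, B) \<and> first_gap (A, B) \<notin> A \<union> B"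
    unfolding first_gap_def prod.case using k' by (rule LeastI)
  moreover have "first_gap (A, B) \<le> k"
    unfolding first_gap_def prod.case using k' by (rule Least_le)
  ultimately show "first_gap (A, B) \<in> {1..p}" "first_gap (A, B) \<notin> A" "first_gap (A, B) \<notin> B"
    using k(1) by auto
qed

lemma gap_decomposition:
  assumes "cov p z = 0"
  shows "(\<Sum>k\<in>{1..p}. restrict_to (\<lambda>b. \<not> covering p b \<and> first_gap b = k) z) = z"
proof -
  have z: "z \<in> vspan {b. \<not> covering p b}"
    using assms unfolding restrict_to_eq_0_iff .
  show ?thesis
  proof (rule vlinear_eqI[where f = "\<lambda>z. \<Sum>k\<in>{1..p}. restrict_to (\<lambda>b. \<not> covering p b \<and> first_gap b = k) z", OF _ vlinear_id z])
    show "vlinear (\<lambda>z. \<Sum>k\<in>{1..p}. restrict_to (\<lambda>b. \<not> covering p b \<and> first_gap b = k) z)"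
      by (simp add: vlinear_def sum.distrib)
    fix b assume b: "b \<in> {b. \<not> covering p b}"
    obtain A B where "b = (A, B)"
      by fastforce
    then have "first_gap b \<in> {1..p}"
      using b first_gap(1)[of p A B] by simp
    then show "(\<Sum>k\<in>{1..p}. restrict_to (\<lambda>b. \<not> covering p b \<and> first_gap b = k) (gen b)) = gen b"
      using b by simp
  qed
qed

context bkp
begin

abbreviation "Y \<equiv> \<E> (BK r s t)"

lemma reps_coface:
  assumes "k \<in> {1..p}"
  shows "reps (obj (EE (p - 1)) q) (cE q) (obj (EE p) q) (cE q) (coface Y p k q) (\<lambda>c j. amP (face k) (c j))"
  unfolding coface_def using assms by (intro reps_EE_map inj_face image_face) auto

lemma unface_part:
  assumes "z \<in> vspan {(A, B). A \<in> Sp p \<and> B \<in> Sp p \<and> cd A + cd B = m}" "1 \<le> k"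
  defines "z' \<equiv> restrict_to (\<lambda>b. \<not> covering p b \<and> first_gap b = k) z"
  shows "amP (unface k) z' \<in> vspan {(A, B). A \<in> Sp (p - 1) \<and> B \<in> Sp (p - 1) \<and> cd A + cd B = m}"
    and "amP (face k) (amP (unface k) z') = z'"
proof -
  have z': "z' \<in> vspan {(A, B). (A \<in> Sp p \<and> B \<in> Sp p \<and> cd A + cd B = m) \<and> k \<notin> A \<and> k \<notin> B \<and> k \<in> {1..p}}"
    unfolding z'_def by (rule vspan_mono[OF restrict_to_vspan[OF assms(1)]]) (auto dest: first_gap)
  have u: "unface k ` A \<in> Sp (p - 1) \<and> cd (unface k ` A) = cd A" if "A \<in> Sp p" "k \<notin> A" "k \<in> {1..p}" for A
  proof -
    have "inj_on (unface k) A"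
      using that(2) face_unface by (metis inj_onI)
    then have "card (unface k ` A) = card A"
      by (rule card_image)
    moreover have "unface k ` A \<subseteq> {0..p - 1}"
    proof (rule image_subsetI)
      fix i assume i: "i \<in> A"
      then have "i \<le> p" "i \<noteq> k"
        using that by (auto simp: Sp_def)
      then show "unface k i \<in> {0..p - 1}"
        using that(3) by (auto simp: unface_def)
    qed
    ultimately show ?thesis
      using that(1) by (simp add: Sp_def cd_def)
  qed
  show "amP (unface k) z' \<in> vspan {(A, B). A \<in> Sp (p - 1) \<and> B \<in> Sp (p - 1) \<and> cd A + cd B = m}"
    by (rule vlinear_vspan[OF vlinear_amP z']) (use u in \<open>auto simp: amP_gen\<close>)
  show "amP (face k) (amP (unface k) z') = z'"
  proof (rule vlinear_eqI[where f = "\<lambda>z. amP (face k) (amP (unface k) z)", OF _ vlinear_id z'])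
    show "vlinear (\<lambda>z. amP (face k) (amP (unface k) z))"
      using vlinear_amP vlinear_amP by (rule vlinear_comp)
  qed (auto simp: amP_gen face_unface_image)
qed

text \<open>The image of d^k consists of chains on pairs that miss k. Conversely a chain of
  non-covering pairs is split by first gap, and \<open>unface k\<close> pulls the part with gap k
  back along d^k.\<close>

lemma conorm_image_kernel: "conorm_image Y p q = {x \<in> carrier (obj (EE p) q). cf p q x = 0}"
proof (intro equalityI subsetI)
  fix x assume "x \<in> conorm_image Y p q"
  then obtain y where x: "x = (\<Oplus>\<^bsub>obj (EE p) q\<^esub>k\<in>{1..p}. coface Y p k q (y k))"
    and y: "y \<in> {1..p} \<rightarrow> carrier (obj (EE (p - 1)) q)"
    unfolding conorm_image_def by blast
  have g: "coface Y p k q (y k) \<in> carrier (obj (EE p) q) \<and> cf p q (coface Y p k q (y k)) = 0" if "k \<in> {1..p}" for k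
  proof -
    have "y k \<in> carrier (obj (EE (p - 1)) q)"
      using y that by (rule funcset_mem)
    then have "coface Y p k q (y k) \<in> carrier (obj (EE p) q)" "cE q (coface Y p k q (y k)) = (\<lambda>j. amP (face k) (cE q (y k) j))"
      using reps_coface[OF that, of q] by (auto simp: reps_def)
    then show ?thesis
      using cov_amP_face[OF that] by (simp add: cf_def fun_eq_iff amP_def)
  qed
  then show "x \<in> {x \<in> carrier (obj (EE p) q). cf p q x = 0}"
    using finsum_linmap[OF linmap_EE, of "{1..p}" "\<lambda>k. coface Y p k q (y k)" p q] by (simp add: x)
next
  fix x assume "x \<in> {x \<in> carrier (obj (EE p) q). cf p q x = 0}"
  then have x: "x \<in> carrier (obj (EE p) q)" "cf p q x = 0"
    by auto
  note L = coordsD(1)[OF coords_EE]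
  let ?c = "cE q x"
  have c: "?c j \<in> vspan {(A, B). A \<in> Sp p \<and> B \<in> Sp p \<and> cd A + cd B = kap q - int j}" for j
    using linmapD(7)[OF L x(1)] unfolding orbT_iff by blast
  define part where "part k j = restrict_to (\<lambda>b. \<not> covering p b \<and> first_gap b = k) (?c j)" for k j
  define y where "y k = from_coords (obj (EE (p - 1)) q) (cE q) (\<lambda>j. amP (unface k) (part k j))" for k
  have y: "y k \<in> carrier (obj (EE (p - 1)) q)" "cE q (y k) = (\<lambda>j. amP (unface k) (part k j))" if "k \<in> {1..p}" for k
  proof -
    have "(\<lambda>j. amP (unface k) (part k j)) \<in> DD.orbT (p - 1) q"
      unfolding orbT_iff part_def using unface_part(1)[OF c] that by simp
    from from_coords[OF L this] show "y k \<in> carrier (obj (EE (p - 1)) q)" "cE q (y k) = (\<lambda>j. amP (unface k) (part k j))"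
      by (simp_all add: y_def)
  qed
  have g: "coface Y p k q (y k) \<in> carrier (obj (EE p) q) \<and> cE q (coface Y p k q (y k)) = part k" if k: "k \<in> {1..p}" for k
    using reps_coface[OF k, of q] y[OF k] unface_part(2)[OF c, of k] k by (auto simp: reps_def part_def fun_eq_iff)
  let ?s = "\<Oplus>\<^bsub>obj (EE p) q\<^esub>k\<in>{1..p}. coface Y p k q (y k)"
  have s: "?s \<in> carrier (obj (EE p) q)" "cE q ?s = (\<Sum>k\<in>{1..p}. part k)"
    using finsum_linmap[OF L, of "{1..p}" "\<lambda>k. coface Y p k q (y k)" p q] g by auto
  have "(\<Sum>k\<in>{1..p}. part k) = ?c"
  proof
    fix j
    show "(\<Sum>k\<in>{1..p}. part k) j = ?c j"
      using gap_decomposition[of p "?c j"] fun_cong[OF x(2), of j] by (simp add: sum_fun_apply part_def cf_def)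
  qed
  then have "x = ?s"
    using coords_eqI[OF coords_EE x(1) s(1)] s(2) by simp
  then show "x \<in> conorm_image Y p q"
    unfolding conorm_image_def using y(1) by blast
qed

definition cc :: "nat \<Rightarrow> int \<Rightarrow> (nat set \<Rightarrow>\<^sub>0 bit) set orbit set \<Rightarrow> nat \<Rightarrow> pairs"
  where "cc p q = lift (cf p q)"

lemma coords_conorm: "coords (conorm Y p q) (cc p q) (Cw p (kap q))"
  unfolding conorm_def cc_def by (rule quot_coords[OF linmap_EE conorm_image_kernel])

lemma bdP_cov: "bdP p (cov p z) = cov p (lft bd z + rgt bd z)"
  by (simp add: bdP_def Lc_def Rc_def shrinking_cov_lft shrinking_cov_rgt shrinking_ops)

lemma reps_d_vert: "reps (conorm Y p q) (cc p q) (conorm Y p (q - 1)) (cc p (q - 1)) (d_vert Y p q) (DW p)"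
  unfolding conorm_def d_vert_def cc_def
proof (rule quot_map_reps[OF linmap_EE conorm_image_kernel linmap_EE conorm_image_kernel])
  show "reps (obj (EE p) q) (cf p q) (obj (EE p) (q - 1)) (cf p (q - 1)) (diff (EE p) q) (DW p)"
    using reps_EE_diff[of p q] by (auto simp: reps_def cf_def DW_def bdP_cov swp_cov fun_eq_iff)
qed

lemma reps_d_hor: "reps (conorm Y p q) (cc p q) (conorm Y (p + 1) q) (cc (p + 1) q) (d_hor Y p q) (dhW p)"
  unfolding conorm_def d_hor_def cc_def
proof (rule quot_map_reps[OF linmap_EE conorm_image_kernel linmap_EE conorm_image_kernel])
  have "reps (obj (EE p) q) (cE q) (obj (EE (p + 1)) q) (cE q) (coface Y (p + 1) 0 q) (\<lambda>c j. amP (face 0) (c j))"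
    unfolding coface_def using reps_EE_map[OF inj_face, of 0 p "p + 1" q] by (auto simp: face_def)
  then show "reps (obj (EE p) q) (cf p q) (obj (EE (p + 1)) q) (cf (p + 1) q) (coface Y (p + 1) 0 q) (dhW p)"
    by (auto simp: reps_def cf_def dhW_def dh_cov fun_eq_iff amP_def am_face_0) (simp_all add: dh_def)
qed

subsection \<open>The total complex in coordinates\<close>

definition TT :: "int \<Rightarrow> (nat \<Rightarrow> nat \<Rightarrow> pairs) set"
  where "TT m = {y. \<forall>p. y p \<in> Cw p (kap (m + int p))}"

definition cT :: "int \<Rightarrow> (nat \<Rightarrow> (nat set \<Rightarrow>\<^sub>0 bit) set orbit set) \<Rightarrow> nat \<Rightarrow> nat \<Rightarrow> pairs"
  where "cT m x = (\<lambda>p. cc p (m + int p) (x p))"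

definition dT :: "(nat \<Rightarrow> nat \<Rightarrow> pairs) \<Rightarrow> nat \<Rightarrow> nat \<Rightarrow> pairs"
  where "dT y = (\<lambda>p. DW p (y p) + (case p of 0 \<Rightarrow> 0 | Suc n \<Rightarrow> dhW n (y n)))"

lemma coords_Tot: "coords (obj (Tot Y) m) (cT m) (TT m)"
proof (rule coordsI)
  note L = coordsD(1)[OF coords_conorm]
  note g = vgroupD[OF linmapD(1)[OF L]]
  have car: "x \<in> carrier (obj (Tot Y) m) \<longleftrightarrow> (\<forall>p. x p \<in> carrier (conorm Y p (m + int p)))" for x
    by (simp add: Tot_def)
  show "\<zero>\<^bsub>obj (Tot Y) m\<^esub> \<in> carrier (obj (Tot Y) m)"
    unfolding car using g(1) by (simp add: Tot_def)
  show "cT m \<zero>\<^bsub>obj (Tot Y) m\<^esub> = 0"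
    using linmapD(6)[OF L] by (simp add: Tot_def cT_def fun_eq_iff)
  show "cT m ` carrier (obj (Tot Y) m) = TT m"
  proof (intro equalityI subsetI)
    fix y assume "y \<in> cT m ` carrier (obj (Tot Y) m)"
    then show "y \<in> TT m"
      using linmapD(7)[OF L] by (auto simp: car cT_def TT_def)
  next
    fix y assume y: "y \<in> TT m"
    let ?x = "\<lambda>p. from_coords (conorm Y p (m + int p)) (cc p (m + int p)) (y p)"
    have "?x \<in> carrier (obj (Tot Y) m)" "y = cT m ?x"
      using from_coords[OF L] y by (auto simp: car cT_def TT_def)
    then show "y \<in> cT m ` carrier (obj (Tot Y) m)"
      by (intro image_eqI)
  qed
  show "inj_on (cT m) (carrier (obj (Tot Y) m))"
  proof (rule inj_onI)
    fix x x' assume "x \<in> carrier (obj (Tot Y) m)" "x' \<in> carrier (obj (Tot Y) m)" "cT m x = cT m x'"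
    then have "x p = x' p" for p
      by (intro coords_eqI[OF coords_conorm, of _ p "m + int p"]) (auto simp: car cT_def dest: fun_cong)
    then show "x = x'"
      by blast
  qed
  fix x assume x: "x \<in> carrier (obj (Tot Y) m)"
  show "x \<oplus>\<^bsub>obj (Tot Y) m\<^esub> y \<in> carrier (obj (Tot Y) m) \<and> cT m (x \<oplus>\<^bsub>obj (Tot Y) m\<^esub> y) = cT m x + cT m y"
    if "y \<in> carrier (obj (Tot Y) m)" for y
    using x that g(4) linmapD(3)[OF L] unfolding car by (simp add: Tot_def cT_def fun_eq_iff)
  show "c \<odot>\<^bsub>obj (Tot Y) m\<^esub> x \<in> carrier (obj (Tot Y) m) \<and> cT m (c \<odot>\<^bsub>obj (Tot Y) m\<^esub> x) = (if c = 0 then 0 else cT m x)" for c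
    using x linmapD(4,5)[OF L] unfolding car by (simp add: Tot_def cT_def fun_eq_iff)
qed

lemma reps_Tot: "reps (obj (Tot Y) m) (cT m) (obj (Tot Y) (m - 1)) (cT (m - 1)) (diff (Tot Y) m) dT"
  unfolding reps_def
proof
  fix x assume "x \<in> carrier (obj (Tot Y) m)"
  then have x: "x p \<in> carrier (conorm Y p (m + int p))" for p
    by (simp add: Tot_def)
  note L = coordsD(1)[OF coords_conorm]
  have "diff (Tot Y) m x p \<in> carrier (conorm Y p (m - 1 + int p)) \<and>
    cc p (m - 1 + int p) (diff (Tot Y) m x p) = dT (cT m x) p" for p
  proof -
    have e: "m + int p - 1 = m - 1 + int p"
      by simp
    have v: "d_vert Y p (m + int p) (x p) \<in> carrier (conorm Y p (m - 1 + int p))"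
      "cc p (m - 1 + int p) (d_vert Y p (m + int p) (x p)) = DW p (cc p (m + int p) (x p))"
      using reps_d_vert[of p "m + int p"] x[of p] unfolding e reps_def by auto
    show ?thesis
    proof (cases p)
      case 0
      then show ?thesis
        using v by (simp add: Tot_def dT_def cT_def)
    next
      case (Suc n)
      have e': "m - 1 + int p = m + int n"
        using Suc by simp
      have "d_hor Y n (m + int n) (x n) \<in> carrier (conorm Y p k)"
        "cc p k (d_hor Y n (m + int n) (x n)) = dhW n (cc n (m + int n) (x n))" if "k = m + int n" for k
        using reps_d_hor[of n k] x[of n] Suc that by (simp_all add: reps_def)
      note h = this[OF e']
      have d: "diff (Tot Y) m x p = d_vert Y p (m + int p) (x p) \<oplus>\<^bsub>conorm Y p (m - 1 + int p)\<^esub> d_hor Y n (m + int n) (x n)"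
        using Suc by (simp add: Tot_def)
      have "dT (cT m x) p = DW p (cc p (m + int p) (x p)) + dhW n (cc n (m + int n) (x n))"
        using Suc by (simp add: dT_def cT_def)
      then show ?thesis
        unfolding d using vgroupD(4)[OF linmapD(1)[OF L] v(1) h(1)] linmapD(3)[OF L v(1) h(1)] v(2) h(2) by simp
    qed
  qed
  then show "diff (Tot Y) m x \<in> carrier (obj (Tot Y) (m - 1)) \<and> cT (m - 1) (diff (Tot Y) m x) = dT (cT m x)"
    by (auto simp: Tot_def cT_def fun_eq_iff)
qed

lemma dT_TT: "y \<in> TT m \<Longrightarrow> dT y \<in> TT (m - 1)"
proof -
  assume "y \<in> TT m"
  then obtain x where x: "x \<in> carrier (obj (Tot Y) m)" "y = cT m x"
    using linmapD(2)[OF coordsD(1)[OF coords_Tot]] by blast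
  then have "diff (Tot Y) m x \<in> carrier (obj (Tot Y) (m - 1))" "cT (m - 1) (diff (Tot Y) m x) = dT y"
    using reps_Tot[of m] by (simp_all add: reps_def)
  then show ?thesis
    using linmapD(7)[OF coordsD(1)[OF coords_Tot]] by fastforce
qed

lemma dT_add: "dT (x + y) = dT x + dT y"
  by (auto simp: dT_def W_add fun_eq_iff ac_simps split: nat.split)

text \<open>After two shifts neither set contains the vertex 1.\<close>

lemma dh_dh: "dh (Suc p) (dh p x) = 0"
proof -
  have "dh (Suc p) (dh p x) = cov (Suc (Suc p)) (lft sh (rgt sh (lft sh (rgt sh x))))"
    by (simp add: dh_def[of p] dh_cov) (simp add: dh_def)
  also have "\<dots> = 0"
  proof (rule cross_eqI[where f = "\<lambda>x. cov (Suc (Suc p)) (lft sh (rgt sh (lft sh (rgt sh x))))", OF _ vlinear_zero])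
    show "vlinear (\<lambda>x. cov (Suc (Suc p)) (lft sh (rgt sh (lft sh (rgt sh x)))))"
      by (auto simp: vlinear_def)
    fix A B :: "nat set"
    have "\<not> covering (Suc (Suc p)) (Suc ` Suc ` A, Suc ` Suc ` B)"
    proof
      assume "covering (Suc (Suc p)) (Suc ` Suc ` A, Suc ` Suc ` B)"
      then have "Suc 0 \<in> Suc ` Suc ` A \<union> Suc ` Suc ` B"
        by (auto simp: covering_def)
      then show False
        by auto
    qed
    then show "cov (Suc (Suc p)) (lft sh (rgt sh (lft sh (rgt sh (gen (A, B)))))) = 0"
      by (simp add: lft_gen rgt_gen sh_gen)
  qed
  finally show ?thesis .
qed

lemma dT_dT: "y \<in> TT m \<Longrightarrow> dT (dT y) = 0"
proof
  fix p assume y: "y \<in> TT m"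
  then have D: "DW p (DW p (y p)) = 0" for p
    using DW_DW unfolding TT_def by blast
  have hh: "dhW (Suc n) (dhW n c) = 0" for n c
    by (simp add: dhW_def dh_dh fun_eq_iff)
  show "dT (dT y) p = 0 p"
    using D by (cases p) (auto simp: dT_def W_add hh dhW_DW ac_simps split: nat.splits)
qed

definition FF :: "int \<Rightarrow> int \<Rightarrow> (nat \<Rightarrow> nat \<Rightarrow> pairs) set"
  where "FF f m = {y \<in> TT m. \<forall>p. int p < - f \<longrightarrow> y p = 0}"

lemma col_filt_coords: "x \<in> carrier (obj (Tot Y) m) \<Longrightarrow> x \<in> col_filt Y f m \<longleftrightarrow> cT m x \<in> FF f m"
proof -
  assume x: "x \<in> carrier (obj (Tot Y) m)"
  note L = coordsD(1)[OF coords_conorm]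
  have "x p = \<zero>\<^bsub>conorm Y p (m + int p)\<^esub> \<longleftrightarrow> cc p (m + int p) (x p) = 0" for p
  proof
    have "x p \<in> carrier (conorm Y p (m + int p))"
      using x by (simp add: Tot_def)
    moreover have "cc p (m + int p) \<zero>\<^bsub>conorm Y p (m + int p)\<^esub> = 0"
      by (rule linmapD(6)[OF L])
    ultimately show "x p = \<zero>\<^bsub>conorm Y p (m + int p)\<^esub>" if "cc p (m + int p) (x p) = 0"
      using that coords_eqI[OF coords_conorm _ vgroupD(1)[OF linmapD(1)[OF L]]] by simp
  qed (simp add: linmapD(6)[OF L])
  moreover have "cT m x \<in> TT m"
    using linmapD(7)[OF coordsD(1)[OF coords_Tot] x] .
  ultimately show ?thesis
    using x by (simp add: col_filt_def FF_def) (simp add: cT_def)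
qed

definition ZF :: "int \<Rightarrow> int \<Rightarrow> int \<Rightarrow> (nat \<Rightarrow> nat \<Rightarrow> pairs) set"
  where "ZF e p n = {y \<in> FF p n. dT y \<in> FF (p - e) (n - 1)}"

lemma approx_cycles_coords: "approx_cycles (Tot Y) (col_filt Y) e p n = {x \<in> carrier (obj (Tot Y) n). cT n x \<in> ZF e p n}"
proof -
  have "x \<in> approx_cycles (Tot Y) (col_filt Y) e p n \<longleftrightarrow> cT n x \<in> ZF e p n" if "x \<in> carrier (obj (Tot Y) n)" for x
    using that reps_Tot[of n] by (simp add: approx_cycles_def ZF_def col_filt_coords reps_def)
  moreover have "x \<in> carrier (obj (Tot Y) n)" if "x \<in> approx_cycles (Tot Y) (col_filt Y) e p n" for x
    using that by (simp add: approx_cycles_def col_filt_def)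
  ultimately show ?thesis
    by blast
qed

text \<open>The denominator of the page for r = 2, where r - 1 and p + r - 1 become 1 and p +
  1.\<close>

definition BF :: "int \<Rightarrow> int \<Rightarrow> (nat \<Rightarrow> nat \<Rightarrow> pairs) set"
  where "BF p n = {u + dT v | u v. u \<in> ZF 1 (p - 1) n \<and> v \<in> ZF 1 (p + 1) (n + 1)}"

lemma FF_TT: "y \<in> FF p n \<Longrightarrow> y \<in> TT n"
  by (simp add: FF_def)

lemma TT_add: "x \<in> TT n \<Longrightarrow> y \<in> TT n \<Longrightarrow> x + y \<in> TT n"
  by (auto simp: TT_def Cw_add)

lemma TT_0: "0 \<in> TT n"
  by (simp add: TT_def)

lemma FF_add: "x \<in> FF p n \<Longrightarrow> y \<in> FF p n \<Longrightarrow> x + y \<in> FF p n"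
  by (auto simp: FF_def TT_add)

lemma FF_0: "0 \<in> FF p n"
  by (simp add: FF_def TT_0)

lemma dT_0: "dT 0 = 0"
  by (auto simp: dT_def fun_eq_iff split: nat.split)

lemma ZF_add: "x \<in> ZF e p n \<Longrightarrow> y \<in> ZF e p n \<Longrightarrow> x + y \<in> ZF e p n"
  by (auto simp: ZF_def FF_add dT_add)

lemma ZF_0: "0 \<in> ZF e p n"
  by (simp add: ZF_def FF_0 dT_0)

lemma boundaries_coords:
  "approx_cycles (Tot Y) (col_filt Y) 1 (p - 1) n <+>\<^bsub>obj (Tot Y) n\<^esub>
      diff (Tot Y) (n + 1) ` approx_cycles (Tot Y) (col_filt Y) 1 (p + 1) (n + 1)
    = {x \<in> carrier (obj (Tot Y) n). cT n x \<in> BF p n}" (is "?L = ?R")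
proof -
  note C = coords_Tot and L = coordsD(1)[OF coords_Tot]
  have d: "diff (Tot Y) (n + 1) v \<in> carrier (obj (Tot Y) n) \<and> cT n (diff (Tot Y) (n + 1) v) = dT (cT (n + 1) v)"
    if "v \<in> carrier (obj (Tot Y) (n + 1))" for v
    using reps_Tot[of "n + 1"] that by (auto simp: reps_def)
  show ?thesis
  proof (intro equalityI subsetI)
    fix x assume "x \<in> ?L"
    then obtain u v where "x = u \<oplus>\<^bsub>obj (Tot Y) n\<^esub> diff (Tot Y) (n + 1) v"
      "u \<in> carrier (obj (Tot Y) n)" "cT n u \<in> ZF 1 (p - 1) n" "v \<in> carrier (obj (Tot Y) (n + 1))" "cT (n + 1) v \<in> ZF 1 (p + 1) (n + 1)"
      unfolding set_add_def' approx_cycles_coords by blast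
    then have "x \<in> carrier (obj (Tot Y) n)" "cT n x = cT n u + dT (cT (n + 1) v)"
      using d[of v] vgroupD(4)[OF linmapD(1)[OF L], of u] linmapD(3)[OF L, of u] by simp_all
    then show "x \<in> ?R"
      unfolding BF_def using \<open>cT n u \<in> _\<close> \<open>cT (n + 1) v \<in> _\<close> by blast
  next
    fix x assume "x \<in> ?R"
    then obtain u v where x: "x \<in> carrier (obj (Tot Y) n)" and uv: "cT n x = u + dT v" "u \<in> ZF 1 (p - 1) n" "v \<in> ZF 1 (p + 1) (n + 1)"
      unfolding BF_def by blast
    have "u \<in> TT n" "v \<in> TT (n + 1)"
      using uv FF_TT by (auto simp: ZF_def)
    then obtain u' v' where uv': "u' \<in> carrier (obj (Tot Y) n)" "cT n u' = u" "v' \<in> carrier (obj (Tot Y) (n + 1))" "cT (n + 1) v' = v"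
      using from_coords[OF L, of u n] from_coords[OF L, of v "n + 1"] by blast
    have "x = u' \<oplus>\<^bsub>obj (Tot Y) n\<^esub> diff (Tot Y) (n + 1) v'"
    proof (rule coords_eqI[OF C x])
      show "u' \<oplus>\<^bsub>obj (Tot Y) n\<^esub> diff (Tot Y) (n + 1) v' \<in> carrier (obj (Tot Y) n)"
        using d[OF uv'(3)] by (intro vgroupD(4)[OF linmapD(1)[OF L]] uv'(1)) simp
      show "cT n x = cT n (u' \<oplus>\<^bsub>obj (Tot Y) n\<^esub> diff (Tot Y) (n + 1) v')"
        using d[OF uv'(3)] linmapD(3)[OF L uv'(1)] uv uv' by simp
    qed
    moreover have "u' \<in> approx_cycles (Tot Y) (col_filt Y) 1 (p - 1) n" "v' \<in> approx_cycles (Tot Y) (col_filt Y) 1 (p + 1) (n + 1)"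
      using uv uv' by (simp_all add: approx_cycles_coords)
    ultimately show "x \<in> ?L"
      unfolding set_add_def' by blast
  qed
qed

end

text \<open>By the assumption \<open>two\<close> there is at most one nonzero class, so the
  indicator of the complement of \<open>Bc\<close> is additive and serves as a coordinate.\<close>

lemma index_two_quotient:
  assumes M: "coords M c T" and Z: "Z = {x \<in> carrier M. c x \<in> Zc}" and B: "B = {x \<in> carrier M. c x \<in> Bc}"
    and sub: "Zc \<subseteq> T" "Bc \<subseteq> Zc" "0 \<in> Bc"
    and add: "\<And>x y. x \<in> Zc \<Longrightarrow> y \<in> Zc \<Longrightarrow> x + y \<in> Zc" "\<And>x y. x \<in> Bc \<Longrightarrow> y \<in> Bc \<Longrightarrow> x + y \<in> Bc"
    and two: "\<And>x y. x \<in> Zc \<Longrightarrow> y \<in> Zc \<Longrightarrow> x \<in> Bc \<or> y \<in> Bc \<or> x + y \<in> Bc"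
  defines "f \<equiv> \<lambda>x. if c x \<in> Bc then 0 else (1 :: bit)"
  shows "coords (quot_vs (sub_vs M Z) B) (lift f) (f ` Z)"
proof (rule quot_coords)
  note L = coordsD(1)[OF M]
  note g = vgroupD[OF linmapD(1)[OF L]]
  have Zin: "x \<in> carrier M" "c x \<in> Zc" if "x \<in> Z" for x
    using that Z by auto
  have "vgroup (sub_vs M Z)"
    unfolding vgroup_def sub_vs_def
  proof (simp, intro conjI ballI)
    have "c \<zero>\<^bsub>M\<^esub> \<in> Zc"
      using linmapD(6)[OF L] sub by auto
    then show "\<zero>\<^bsub>M\<^esub> \<in> Z"
      using g(1) Z by simp
    fix x y z assume x: "x \<in> Z" and y: "y \<in> Z" and z: "z \<in> Z"
    show "\<zero>\<^bsub>M\<^esub> \<oplus>\<^bsub>M\<^esub> x = x" "x \<oplus>\<^bsub>M\<^esub> x = \<zero>\<^bsub>M\<^esub>"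
      using g(2,3)[OF Zin(1)[OF x]] .
    show "x \<oplus>\<^bsub>M\<^esub> y = y \<oplus>\<^bsub>M\<^esub> x"
      using g(5)[OF Zin(1)[OF x] Zin(1)[OF y]] .
    show "x \<oplus>\<^bsub>M\<^esub> y \<oplus>\<^bsub>M\<^esub> z = x \<oplus>\<^bsub>M\<^esub> (y \<oplus>\<^bsub>M\<^esub> z)"
      using g(6)[OF Zin(1)[OF x] Zin(1)[OF y] Zin(1)[OF z]] .
    show "x \<oplus>\<^bsub>M\<^esub> y \<in> Z"
      using g(4)[OF Zin(1)[OF x] Zin(1)[OF y]] linmapD(3)[OF L Zin(1)[OF x] Zin(1)[OF y]]
        add(1)[OF Zin(2)[OF x] Zin(2)[OF y]] Z by simp
  qed
  moreover have "f (x \<oplus>\<^bsub>M\<^esub> y) = f x + f y" if x: "x \<in> Z" and y: "y \<in> Z" for x y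
  proof -
    have "c (x \<oplus>\<^bsub>M\<^esub> y) = c x + c y"
      using linmapD(3)[OF L Zin(1)[OF x] Zin(1)[OF y]] .
    moreover have "c y \<in> Bc" if "c x \<in> Bc" "c x + c y \<in> Bc"
      using add(2)[OF that] by (simp add: add.assoc[symmetric])
    moreover have "c x \<in> Bc" if "c y \<in> Bc" "c x + c y \<in> Bc"
      using add(2)[OF that(2,1)] by (simp add: add.assoc)
    ultimately show ?thesis
      using add(2)[of "c x" "c y"] two[OF Zin(2)[OF x] Zin(2)[OF y]] unfolding f_def by auto
  qed
  moreover have "k \<odot>\<^bsub>M\<^esub> x \<in> Z \<and> f (k \<odot>\<^bsub>M\<^esub> x) = (if k = 0 then 0 else f x)" if "x \<in> Z" for x k
    using linmapD(4,5)[OF L Zin(1)[OF that], of k] Zin(2)[OF that] sub Z by (auto simp: f_def)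
  ultimately show "linmap (sub_vs M Z) f (f ` Z)"
    unfolding linmap_def by (simp add: sub_vs_def)
  show "B = {x \<in> carrier (sub_vs M Z). f x = 0}"
    using sub B Z by (auto simp: sub_vs_def f_def)
qed

lemma trivial_coords: "coords M f {0} \<Longrightarrow> trivial_vs M"
proof -
  assume M: "coords M f {0}"
  note L = coordsD(1)[OF M]
  have "x = \<zero>\<^bsub>M\<^esub>" if "x \<in> carrier M" for x
    using linmapD(7)[OF L that] linmapD(6)[OF L] by (intro coords_eqI[OF M that vgroupD(1)[OF linmapD(1)[OF L]]]) simp
  then show ?thesis
    using vgroupD(1)[OF linmapD(1)[OF L]] unfolding trivial_vs_def by blast
qed

lemma line_coords:
  assumes M: "coords M f (UNIV :: bit set)"
  shows "M \<cong>\<^sub>\<bbbK> KK_vs" "\<not> trivial_vs M"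
proof -
  note L = coordsD(1)[OF M]
  have "f \<in> iso (add_monoid M) (add_monoid KK_vs)"
    using linmapD(2,3)[OF L] coordsD(2)[OF M] by (auto simp: iso_def hom_def bij_betw_def KK_vs_def)
  moreover have "f (k \<odot>\<^bsub>M\<^esub> x) = k \<odot>\<^bsub>KK_vs\<^esub> f x" if "x \<in> carrier M" for k x
    using linmapD(5)[OF L that, of k] by (cases k) (simp_all add: KK_vs_def)
  ultimately show "M \<cong>\<^sub>\<bbbK> KK_vs"
    unfolding vs_iso_def by blast
  show "\<not> trivial_vs M"
  proof
    assume "trivial_vs M"
    then have "f ` carrier M = {f \<zero>\<^bsub>M\<^esub>}"
      by (simp add: trivial_vs_def)
    then show False
      using linmapD(2)[OF L] linmapD(6)[OF L] by (metis UNIV_I singletonD zero_neq_one)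
  qed
qed

lemma rank_quotient:
  assumes M: "coords M c T" and Z: "Z = {x \<in> carrier M. c x \<in> Zc}" and B: "B = {x \<in> carrier M. c x \<in> Bc}"
    and sub: "Zc \<subseteq> T" "Bc \<subseteq> Zc" "0 \<in> Bc"
    and add: "\<And>x y. x \<in> Zc \<Longrightarrow> y \<in> Zc \<Longrightarrow> x + y \<in> Zc" "\<And>x y. x \<in> Bc \<Longrightarrow> y \<in> Bc \<Longrightarrow> x + y \<in> Bc"
  defines "Q \<equiv> quot_vs (sub_vs M Z) B"
  shows "rank0 Zc Bc \<Longrightarrow> trivial_vs Q" "rank1 Zc Bc \<Longrightarrow> Q \<cong>\<^sub>\<bbbK> KK_vs \<and> \<not> trivial_vs Q"
proof -
  let ?f = "\<lambda>x. if c x \<in> Bc then 0 else (1 :: bit)"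
  note q = index_two_quotient[OF M Z B sub add]
  have cZ: "Zc = c ` Z"
    using sub(1) linmapD(2)[OF coordsD(1)[OF M]] Z by blast
  have im: "?f ` Z = (\<lambda>z. if z \<in> Bc then 0 else 1) ` Zc"
    unfolding cZ image_image ..
  {
    assume r: "rank0 Zc Bc"
    then have "?f ` Z = {0}"
      unfolding im using sub by (auto simp: rank0_def)
    moreover have "x \<in> Bc \<or> y \<in> Bc \<or> x + y \<in> Bc" if "x \<in> Zc" "y \<in> Zc" for x y
      using r that by (auto simp: rank0_def)
    ultimately show "trivial_vs Q"
      using trivial_coords q unfolding Q_def by metis
  next
    assume "rank1 Zc Bc"
    then obtain z0 where z0: "z0 \<in> Zc" "z0 \<notin> Bc" "\<And>z. z \<in> Zc \<Longrightarrow> z \<in> Bc \<or> z + z0 \<in> Bc"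
      unfolding rank1_def by blast
    have zero: "0 \<in> ?f ` Z"
      unfolding im using sub by (intro image_eqI[of _ _ 0]) auto
    have one: "1 \<in> ?f ` Z"
      unfolding im using z0 by (intro image_eqI[of _ _ z0]) auto
    have im1: "?f ` Z = UNIV"
    proof (rule UNIV_eq_I[symmetric])
      show "k \<in> ?f ` Z" for k :: bit
        using zero one by (cases k) (simp_all only:)
    qed
    have "x \<in> Bc \<or> y \<in> Bc \<or> x + y \<in> Bc" if "x \<in> Zc" "y \<in> Zc" for x y
    proof -
      have e: "(x + z0) + (y + z0) = x + y"
        by (rule char2_eqI[OF refl[of 0]]) (simp add: ac_simps)
      show ?thesis
        using z0(3)[OF that(1)] z0(3)[OF that(2)] add(2)[of "x + z0" "y + z0", unfolded e] by blast
    qed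
    then have "coords Q (lift ?f) UNIV"
      using q[unfolded im1] unfolding Q_def by blast
    then show "Q \<cong>\<^sub>\<bbbK> KK_vs \<and> \<not> trivial_vs Q"
      using line_coords by blast
  }
qed

section \<open>The second page, column by column\<close>

context bkp
begin

lemma TT_D: "y \<in> TT m \<Longrightarrow> y i \<in> Cw i (kap (m + int i))"
  by (simp add: TT_def)

lemma dT_0_nth: "dT y 0 = DW 0 (y 0)"
  and dT_Suc: "dT y (Suc i) = DW (Suc i) (y (Suc i)) + dhW i (y i)"
  by (simp_all add: dT_def)

lemma BF_add: "x \<in> BF p n \<Longrightarrow> y \<in> BF p n \<Longrightarrow> x + y \<in> BF p n"
proof -
  assume "x \<in> BF p n" "y \<in> BF p n"
  then obtain u v u' v' where *: "x = u + dT v" "y = u' + dT v'" "u \<in> ZF 1 (p - 1) n" "v \<in> ZF 1 (p + 1) (n + 1)"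
    "u' \<in> ZF 1 (p - 1) n" "v' \<in> ZF 1 (p + 1) (n + 1)"
    unfolding BF_def by blast
  have "x + y = (u + u') + dT (v + v')"
    using *(1,2) by (simp add: dT_add ac_simps)
  then show ?thesis
    unfolding BF_def using ZF_add[OF *(3,5)] ZF_add[OF *(4,6)] by blast
qed

lemma BF_I: "u \<in> ZF 1 (p - 1) n \<Longrightarrow> u \<in> BF p n"
proof -
  assume "u \<in> ZF 1 (p - 1) n"
  moreover have "u = u + dT 0"
    by (simp add: dT_0)
  ultimately show ?thesis
    unfolding BF_def using ZF_0 by blast
qed

lemma FF_mono: "y \<in> FF p n \<Longrightarrow> p \<le> p' \<Longrightarrow> y \<in> FF p' n"
  by (auto simp: FF_def)

lemma BF_ZF: "x \<in> BF p n \<Longrightarrow> x \<in> ZF 2 p n"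
proof -
  assume "x \<in> BF p n"
  then obtain u v where x: "x = u + dT v" and u: "u \<in> ZF 1 (p - 1) n" and v: "v \<in> ZF 1 (p + 1) (n + 1)"
    unfolding BF_def by blast
  have "u \<in> ZF 2 p n"
    using u FF_mono[of u "p - 1" n p] by (simp add: ZF_def)
  moreover have "dT v \<in> FF p n" "v \<in> TT (n + 1)"
    using v FF_TT by (auto simp: ZF_def)
  then have "dT v \<in> ZF 2 p n"
    by (simp add: ZF_def FF_0 dT_dT)
  ultimately show ?thesis
    unfolding x by (rule ZF_add)
qed

text \<open>Columns have nonnegative index, so for p > 0 the filtration stages p and p - 1 are both
  everything.\<close>

lemma ZF_pos: "0 < p \<Longrightarrow> y \<in> ZF 2 p n \<Longrightarrow> y \<in> ZF 1 (p - 1) n"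
  by (auto simp: ZF_def FF_def)

lemma rank_negative_column: "0 < p \<Longrightarrow> rank0 (ZF 2 p n) (BF p n)"
  unfolding rank0_def using ZF_pos BF_I by blast

text \<open>Columns before P carry nothing and columns after P + 1 are unconstrained. Two equations
  remain: column P holds a vertical cycle, and column P + 1 cancels its horizontal image.\<close>

lemma ZF_iff: "y \<in> ZF 2 (- int P) n \<longleftrightarrow>
    y \<in> TT n \<and> (\<forall>i<P. y i = 0) \<and> DW P (y P) = 0 \<and> DW (Suc P) (y (Suc P)) = dhW P (y P)"
proof -
  have "(\<forall>i. int i < int P + 2 \<longrightarrow> dT y i = 0) \<longleftrightarrow> DW P (y P) = 0 \<and> DW (Suc P) (y (Suc P)) = dhW P (y P)"
    if "\<forall>i<P. y i = 0"
  proof -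
    have "dT y i = 0" if "i < P" for i
      using that \<open>\<forall>i<P. y i = 0\<close> by (cases i) (auto simp: dT_0_nth dT_Suc)
    moreover have "dT y P = DW P (y P)"
      using \<open>\<forall>i<P. y i = 0\<close> by (cases P) (auto simp: dT_0_nth dT_Suc)
    moreover have "dT y (Suc P) = 0 \<longleftrightarrow> DW (Suc P) (y (Suc P)) = dhW P (y P)"
      by (simp add: dT_Suc add_eq_0_iff_char2)
    moreover have "int i < int P + 2 \<longleftrightarrow> i < P \<or> i = P \<or> i = Suc P" for i
      by linarith
    ultimately show ?thesis
      by auto
  qed
  then show ?thesis
    using dT_TT[of y n] by (auto simp: ZF_def FF_def)
qed

lemma ZF_ZC:
  assumes "y \<in> ZF 2 (- int P) n"
  shows "y P \<in> ZC P (kap (n + int P))"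
proof -
  have y: "y \<in> TT n" "DW P (y P) = 0" "DW (Suc P) (y (Suc P)) = dhW P (y P)"
    using assms by (simp_all add: ZF_iff)
  have "kap (n + int (Suc P)) = kap (n + int P) + 1"
    by (simp add: kap_def)
  then have "y (Suc P) \<in> Cw (Suc P) (kap (n + int P) + 1)"
    using TT_D[OF y(1), of "Suc P"] by simp
  then show ?thesis
    using TT_D[OF y(1), of P] y(2,3) unfolding ZC_def by force
qed

lemma ZC_ZF:
  assumes "c \<in> ZC P (kap (n + int P))"
  shows "\<exists>y. y \<in> ZF 2 (- int P) n \<and> y P = c"
proof -
  obtain e where e: "e \<in> Cw (Suc P) (kap (n + int P) + 1)" "dhW P c = DW (Suc P) e"
    and c: "c \<in> Cw P (kap (n + int P))" "DW P c = 0"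
    using assms unfolding ZC_def by blast
  let ?y = "\<lambda>i. if i = P then c else if i = Suc P then e else 0"
  have "kap (n + int (Suc P)) = kap (n + int P) + 1"
    by (simp add: kap_def)
  then have "?y i \<in> Cw i (kap (n + int i))" for i
    using e(1) c(1) by auto
  then have "?y \<in> TT n"
    by (simp add: TT_def)
  then have "?y \<in> ZF 2 (- int P) n \<and> ?y P = c"
    unfolding ZF_iff using e(2) c(2) by simp
  then show ?thesis
    by blast
qed

text \<open>A cycle that vanishes in column P lies in the first summand of \<open>BF\<close>, so
  being a boundary is decided by column P.\<close>

lemma BF_iff:
  assumes y: "y \<in> ZF 2 (- int P) n"
  shows "y \<in> BF (- int P) n \<longleftrightarrow> y P \<in> BC P (kap (n + int P))"
proof
  have kap_Suc: "kap (n + 1 + int P) = kap (n + int P) + 1"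
    by (simp add: kap_def)
  {
    assume "y \<in> BF (- int P) n"
    then obtain u v where uv: "y = u + dT v" "u \<in> ZF 1 (- int P - 1) n" "v \<in> ZF 1 (- int P + 1) (n + 1)"
      unfolding BF_def by blast
    have u: "u P = 0"
      using uv(2) by (simp add: ZF_def FF_def)
    have v: "v \<in> TT (n + 1)" "\<And>i. Suc i < P \<Longrightarrow> v i = 0" "\<And>i. i < P \<Longrightarrow> dT v i = 0"
      using uv(3) by (auto simp: ZF_def FF_def)
    have "y P = dT v P"
      using uv(1) u by simp
    moreover have "v P \<in> Cw P (kap (n + int P) + 1)"
      using TT_D[OF v(1), of P] unfolding kap_Suc .
    \<comment> \<open>The chain v may start in column P - 1 but its boundary may not, so its
      component there is a vertical cycle.\<close>
    moreover have "v m \<in> Cw m (kap (n + int P)) \<and> DW m (v m) = 0" if "P = Suc m" for m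
    proof
      show "v m \<in> Cw m (kap (n + int P))"
        using TT_D[OF v(1), of m] that by (simp add: add.assoc)
      show "DW m (v m) = 0"
        using v(3)[of m] v(2) that by (cases m) (simp_all add: dT_0_nth dT_Suc)
    qed
    ultimately show "y P \<in> BC P (kap (n + int P))"
      unfolding BC_def dT_def
      by (intro CollectI exI[of _ "v P"] exI[of _ "case P of 0 \<Rightarrow> 0 | Suc m \<Rightarrow> v m"]) (auto split: nat.splits)
  next
    assume "y P \<in> BC P (kap (n + int P))"
    then obtain e z where yP: "y P = DW P e + (case P of 0 \<Rightarrow> 0 | Suc m \<Rightarrow> dhW m z)"
      and e: "e \<in> Cw P (kap (n + int P) + 1)"
      and z: "case P of 0 \<Rightarrow> z = 0 | Suc m \<Rightarrow> z \<in> Cw m (kap (n + int P)) \<and> DW m z = 0"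
      unfolding BC_def by blast
    define v where "v i = (if i = P then e else if Suc i = P then z else 0)" for i
    have "v i \<in> Cw i (kap (n + 1 + int i))" for i
    proof -
      have "z \<in> Cw i (kap (n + 1 + int i))" if "P = Suc i"
      proof -
        have "n + int P = n + 1 + int i"
          using that by simp
        moreover have "z \<in> Cw i (kap (n + int P))"
          using z that by simp
        ultimately show ?thesis
          by (simp only:)
      qed
      then show ?thesis
        using e unfolding kap_Suc[symmetric] by (auto simp: v_def)
    qed
    then have v: "v \<in> TT (n + 1)"
      by (simp add: TT_def)
    have vi: "v i = 0" if "Suc i < P" for i
      using that by (simp add: v_def)
    have dv: "dT v i = 0" if "i < P" for i
    proof (cases i)
      case 0
      then show ?thesis
        using that z by (auto simp: dT_0_nth v_def)
    next
      case (Suc m)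
      then show ?thesis
        using that z by (auto simp: dT_Suc v_def)
    qed
    have dvP: "dT v P = y P"
      unfolding yP by (cases P) (simp_all add: dT_0_nth dT_Suc v_def)
    have dvT: "dT v \<in> TT n"
      using dT_TT[OF v] by simp
    have yT: "y \<in> TT n" "\<And>i. i < P \<Longrightarrow> y i = 0" "dT y \<in> FF (- int P - 2) (n - 1)"
      using y by (auto simp: ZF_def FF_def)
    have "(y + dT v) i = 0" if "i < P + 1" for i
      using that yT(2) dv dvP by (cases "i = P") simp_all
    then have "y + dT v \<in> FF (- int P - 1) n"
      using TT_add[OF yT(1) dvT] by (simp add: FF_def)
    moreover have "dT (y + dT v) = dT y"
      by (simp add: dT_add dT_dT[OF v])
    moreover have "- int P - 1 - 1 = - int P - 2"
      by simp
    ultimately have "y + dT v \<in> ZF 1 (- int P - 1) n"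
      using yT(3) by (simp only: ZF_def mem_Collect_eq)
    moreover have "v \<in> ZF 1 (- int P + 1) (n + 1)"
      using v vi dvT dv by (simp add: ZF_def FF_def)
    moreover have "y = (y + dT v) + dT v"
      by (simp add: add.assoc)
    ultimately show "y \<in> BF (- int P) n"
      unfolding BF_def by blast
  }
qed

lemma rank_column:
  shows "(\<exists>i. active P (kap (n + int P) - int i) i) \<Longrightarrow> rank1 (ZF 2 (- int P) n) (BF (- int P) n)"
    and "\<not> (\<exists>i. active P (kap (n + int P) - int i) i) \<Longrightarrow> rank0 (ZF 2 (- int P) n) (BF (- int P) n)"
proof -
  let ?Z = "ZF 2 (- int P) n" and ?B = "BF (- int P) n" and ?k = "kap (n + int P)"
  \<comment> \<open>A section of the passage to column P, as \<open>rank_transfer\<close> asks for;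
    it extends a class of the column to an element of the total complex.\<close>
  define G where "G c = (SOME y. y \<in> ?Z \<and> y P = c)" for c
  have G: "G c \<in> ?Z \<and> G c P = c" if "c \<in> ZC P ?k" for c
    unfolding G_def using ZC_ZF[OF that] by (rule someI_ex)
  define F :: "(nat \<Rightarrow> nat \<Rightarrow> pairs) \<Rightarrow> nat \<Rightarrow> pairs" where "F y = y P" for y
  have R: "rank0 (ZC P ?k) (BC P ?k) \<longrightarrow> rank0 ?Z ?B" "rank1 (ZC P ?k) (BC P ?k) \<longrightarrow> rank1 ?Z ?B"
    by (rule impI, rule rank_transfer[where F = F and G = G and Z' = "ZC P ?k" and B' = "BC P ?k"];
      use ZF_add ZF_ZC G BF_iff in \<open>simp add: F_def plus_fun_def\<close>)+
  show "(\<exists>i. active P (?k - int i) i) \<Longrightarrow> rank1 ?Z ?B"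
    using R(2) rank_C(1) by blast
  show "\<not> (\<exists>i. active P (?k - int i) i) \<Longrightarrow> rank0 ?Z ?B"
    using R(1) rank_C(2) by blast
qed

definition nonzero :: "int \<Rightarrow> int \<Rightarrow> bool"
  where "nonzero p q \<longleftrightarrow> p \<le> 0 \<and> (\<exists>i. active (nat (- p)) (kap q - int i) i)"

lemma rank_page:
  shows "nonzero p q \<Longrightarrow> rank1 (ZF 2 p (p + q)) (BF p (p + q))"
    and "\<not> nonzero p q \<Longrightarrow> rank0 (ZF 2 p (p + q)) (BF p (p + q))"
proof -
  have e: "- int (nat (- p)) = p" "p + q + int (nat (- p)) = q" if "p \<le> 0"
    using that by auto
  show "nonzero p q \<Longrightarrow> rank1 (ZF 2 p (p + q)) (BF p (p + q))"
    using rank_column(1)[of "nat (- p)" "p + q"] e by (simp add: nonzero_def)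
  show "\<not> nonzero p q \<Longrightarrow> rank0 (ZF 2 p (p + q)) (BF p (p + q))"
    using rank_column(2)[of "nat (- p)" "p + q"] e rank_negative_column[of p "p + q"]
    by (cases "p \<le> 0") (simp_all add: nonzero_def)
qed

lemma page_Y: "page Y 2 p q = quot_vs (sub_vs (obj (Tot Y) (p + q)) {x \<in> carrier (obj (Tot Y) (p + q)). cT (p + q) x \<in> ZF 2 p (p + q)})
    {x \<in> carrier (obj (Tot Y) (p + q)). cT (p + q) x \<in> BF p (p + q)}"
proof -
  have e: "int 2 = 2" "(2::int) - 1 = 1" "p + 2 - 1 = p + 1"
    by auto
  show ?thesis
    unfolding page_def filtered_page_def e boundaries_coords unfolding approx_cycles_coords ..
qed

lemma page_rank:
  shows "nonzero p q \<Longrightarrow> page Y 2 p q \<cong>\<^sub>\<bbbK> KK_vs \<and> \<not> trivial_vs (page Y 2 p q)"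
    and "\<not> nonzero p q \<Longrightarrow> trivial_vs (page Y 2 p q)"
proof -
  let ?n = "p + q"
  have sub: "ZF 2 p ?n \<subseteq> TT ?n" "BF p ?n \<subseteq> ZF 2 p ?n" "0 \<in> BF p ?n"
    using FF_TT BF_ZF BF_I[OF ZF_0] by (auto simp: ZF_def[of 2])
  note q = rank_quotient[OF coords_Tot refl refl sub, folded page_Y]
  show "nonzero p q \<Longrightarrow> page Y 2 p q \<cong>\<^sub>\<bbbK> KK_vs \<and> \<not> trivial_vs (page Y 2 p q)"
    by (rule q(2)) (simp_all add: ZF_add BF_add rank_page)
  show "\<not> nonzero p q \<Longrightarrow> trivial_vs (page Y 2 p q)"
    by (rule q(1)) (simp_all add: ZF_add BF_add rank_page)
qed

end

section \<open>The list of nonzero bidegrees\<close>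

context bkp
begin

lemma nonzero_iff: "nonzero p q \<longleftrightarrow>
    (p, q) \<in> {- int s} \<times> {2 * int t ..} \<union> {- 2 * int s .. - int s - 1} \<times> {2 * int t}
      \<union> (case r of
           enat \<rho> \<Rightarrow>
             {- int s - int \<rho>} \<times> {2 * int t + 2 * int \<rho> - 2 ..}
             \<union> {- 2 * int s - int \<rho>} \<times> {2 * int t + int \<rho> - 1}
             \<union> {- 2 * int s - 2 * int \<rho> .. - int s - int \<rho> - 1} \<times> {2 * int t + 2 * int \<rho> - 2}
         | \<infinity> \<Rightarrow> {})"
proof -
  \<comment> \<open>Shared by the sizes c = s and c = s + r, with d their vertex count. The W-degree
    must be \<open>kap q - d\<close>; in column c it may be any natural number, which gives the
    half-line, and in the columns up to 2c only 0, which gives the segment.\<close>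
  have diagonal: "p \<le> 0 \<and> (\<exists>i. kap q - int i = d \<and> (if i = 0 then c \<le> nat (- p) \<and> nat (- p) \<le> 2 * c else nat (- p) = c))
      \<longleftrightarrow> p = - int c \<and> d \<le> kap q \<or> - 2 * int c \<le> p \<and> p \<le> - int c - 1 \<and> kap q = d"
    (is "?L \<longleftrightarrow> ?R") for c d
  proof
    assume ?L
    then obtain i where i: "p \<le> 0" "kap q - int i = d"
      "if i = 0 then c \<le> nat (- p) \<and> nat (- p) \<le> 2 * c else nat (- p) = c"
      by blast
    then show ?R
      by (cases "i = 0") auto
  next
    assume ?R
    then have p: "p \<le> 0" and "0 \<le> kap q - d"
      by auto
    then obtain i where i: "kap q - d = int i"
      using nonneg_int_cases by blast
    have "kap q - int i = d"
      using i by simp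
    moreover have "if i = 0 then c \<le> nat (- p) \<and> nat (- p) \<le> 2 * c else nat (- p) = c"
      using \<open>?R\<close> i by auto
    ultimately show ?L
      using p by blast
  qed
  show ?thesis
  proof (cases r)
    case infinity
    have "active P k i \<longleftrightarrow> k = 2 * int s + 2 \<and> (if i = 0 then s \<le> P \<and> P \<le> 2 * s else P = s)" for P k i
      unfolding active_def unfolding infinity by (simp add: add.commute)
    then have "nonzero p q \<longleftrightarrow> p \<le> 0 \<and> (\<exists>i. kap q - int i = 2 * int s + 2 \<and> (if i = 0 then s \<le> nat (- p) \<and> nat (- p) \<le> 2 * s else nat (- p) = s))"
      by (simp only: nonzero_def)
    then show ?thesis
      unfolding diagonal by (auto simp: infinity kap_def)
  next
    case (enat \<rho>)
    let ?\<beta> = "s + \<rho>"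
    have mixed: "p \<le> 0 \<and> (\<exists>i. kap q - int i = int s + 1 + int ?\<beta> \<and> i = 0 \<and> nat (- p) = s + ?\<beta>)
        \<longleftrightarrow> p = - 2 * int s - int \<rho> \<and> q = 2 * int t + int \<rho> - 1"
      by (auto simp: kap_def)
    have "active P k i \<longleftrightarrow> k = 2 * int s + 2 \<and> (if i = 0 then s \<le> P \<and> P \<le> 2 * s else P = s)
        \<or> k = int s + 1 + int ?\<beta> \<and> i = 0 \<and> P = s + ?\<beta>
        \<or> k = 2 * int ?\<beta> \<and> (if i = 0 then ?\<beta> \<le> P \<and> P \<le> 2 * ?\<beta> else P = ?\<beta>)" for P k i
    proof -
      have beta: "(\<exists>\<beta>. enat s + enat \<rho> = enat \<beta> \<and> R \<beta>) \<longleftrightarrow> R ?\<beta>" for R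
        by simp
      have Suc: "int (Suc s) = int s + 1" "2 * (int s + 1) = 2 * int s + 2"
        by simp_all
      show ?thesis
        unfolding active_def unfolding enat beta Suc ..
    qed
    then have "nonzero p q \<longleftrightarrow>
      (p \<le> 0 \<and> (\<exists>i. kap q - int i = 2 * int s + 2 \<and> (if i = 0 then s \<le> nat (- p) \<and> nat (- p) \<le> 2 * s else nat (- p) = s))) \<or>
      (p \<le> 0 \<and> (\<exists>i. kap q - int i = int s + 1 + int ?\<beta> \<and> i = 0 \<and> nat (- p) = s + ?\<beta>)) \<or>
      (p \<le> 0 \<and> (\<exists>i. kap q - int i = 2 * int ?\<beta> \<and> (if i = 0 then ?\<beta> \<le> nat (- p) \<and> nat (- p) \<le> 2 * ?\<beta> else nat (- p) = ?\<beta>)))"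
      unfolding nonzero_def by (simp only: conj_disj_distribL ex_disj_distrib)
    \<comment> \<open>Back from vertex counts to degrees: two faces with s + 1 vertices each have
      total degree 2t after suspension, two faces with s + \<rho> vertices have total degree 2t +
      2\<rho> - 2.\<close>
    moreover have "2 * int s + 2 \<le> kap q \<longleftrightarrow> 2 * int t \<le> q" "kap q = 2 * int s + 2 \<longleftrightarrow> q = 2 * int t"
      "2 * int ?\<beta> \<le> kap q \<longleftrightarrow> 2 * int t + 2 * int \<rho> - 2 \<le> q" "kap q = 2 * int ?\<beta> \<longleftrightarrow> q = 2 * int t + 2 * int \<rho> - 2"
      "- int ?\<beta> = - int s - int \<rho>" "- 2 * int ?\<beta> = - 2 * int s - 2 * int \<rho>"
      by (auto simp: kap_def)
    ultimately show ?thesis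
      unfolding diagonal mixed enat enat.case
      by (simp only: Un_iff mem_Times_iff fst_conv snd_conv atLeast_iff atLeastAtMost_iff singleton_iff) blast
  qed
qed

end

theorem theorem7p1:
  fixes r :: enat and s t :: nat
  assumes "2 \<le> r"
  shows "(\<forall>p q. trivial_vs (page (\<E> (BK r s t)) 2 p q) \<or> page (\<E> (BK r s t)) 2 p q \<cong>\<^sub>\<bbbK> KK_vs)
    \<and> {(p, q). \<not> trivial_vs (page (\<E> (BK r s t)) 2 p q)} =
        {- int s} \<times> {2 * int t ..}
        \<union> {- 2 * int s .. - int s - 1} \<times> {2 * int t}
        \<union> (case r of
             enat \<rho> \<Rightarrow>
               {- int s - int \<rho>} \<times> {2 * int t + 2 * int \<rho> - 2 ..}
               \<union> {- 2 * int s - int \<rho>} \<times> {2 * int t + int \<rho> - 1}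
               \<union> {- 2 * int s - 2 * int \<rho> .. - int s - int \<rho> - 1} \<times> {2 * int t + 2 * int \<rho> - 2}
           | \<infinity> \<Rightarrow> {})"
  (is "_ \<and> _ = ?S")
proof -
  interpret bkp r s t
    using assms by unfold_locales
  have pairs_set: "{(p, q). (p, q) \<in> S} = S" for S :: "(int \<times> int) set"
    by auto
  have "{(p, q). \<not> trivial_vs (page (\<E> (BK r s t)) 2 p q)} = {(p, q). nonzero p q}"
    using page_rank by blast
  also have "\<dots> = ?S"
    unfolding nonzero_iff by (rule pairs_set)
  finally show ?thesis
    using page_rank by blast
qed

end
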